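(* Let $v$ be a finite place of a number field $K$, lying over the rational prime $p$. Let $\phi\in K[X]$ be a polynomial of degree $d\geq 2$ with leading coefficient $a_d$ such that $\phi(0)\neq 0$. Let $\mu_1,\dots,\mu_r$ be the slopes of the line segments of the Newton polygon of $\phi(X)-X$, viewed as a polynomial over $K_v$. If there is $l\in\{1,\dots,r\}$ with $$\mu_l\notin\frac{\log p}{e_v(K\mid\mathbb{Q})}\mathbb{Z}\quad\text{and}\quad \mu_l\geq-\frac{\log|a_d|_v}{d-1},$$ then $\mathbb{P}^1(K^{nr,v})$ has the strong Bogomolov property relative to $\hat{h}_\phi$.
   Context: $K_v$ is the $v$-adic completion of $K$ and $|\cdot|_v$ is the absolute value on $K_v$ extending the usual $p$-adic absolute value on $\mathbb{Q}_p$ (so $|p|_v=p^{-1}$). $e_v(K\mid\mathbb{Q})$ is the ramification index of $v$ over $p$. For $\psi(X)=\sum_{i=0}^d b_iX^i\in K_v[X]$ with $b_db_0\neq0$, its Newton polygon is the lower boundary of the convex hull of the points $(i,-\log|b_i|_v)$ for $b_i\neq 0$. $K^{nr,v}$ is the maximal algebraic extension of $K$ (inside $\bar{K}$) in which $v$ is unramified. $\hat{h}_\phi:\mathbb{P}^1(\bar K)\to\mathbb{R}$ is the Call–Silverman canonical height of $\phi$, i.e. the unique Weil height for $\mathcal{O}(1)$ with $\hat{h}_\phi\circ\phi=d\,\hat{h}_\phi$. For a field $L\subset\bar K$, $\mathbb{P}^1(L)$ has the strong Bogomolov property relative to $\hat{h}_\phi$ if there is $C>0$ with $\hat{h}_\phi(P)\geq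 C$ for all points $P\in\mathbb{P}^1(L)$ that are not preperiodic under $\phi$, and $\mathbb{P}^1(L)$ contains only finitely many preperiodic points of $\phi$ (a point is preperiodic if its forward orbit under $\phi$ is finite). *)

theory Defs
  imports "HOL-Analysis.Analysis" "HOL-Algebra.Algebraic_Closure_Type"
begin

class number_field = field_char_0 +
  assumes finite_dim_over_rat:
    "\<exists>B::'a set. finite B \<and> (\<forall>x. \<exists>c::'a \<Rightarrow> rat. x = (\<Sum>b\<in>B. of_rat (c b) * b))"

definition is_subfield :: "'a::Fields.field set \<Rightarrow> bool" where
  "is_subfield L \<longleftrightarrow> 0 \<in> L \<and> 1 \<in> L \<and>
     (\<forall>x\<in>L. \<forall>y\<in>L. x - y \<in> L \<and> x * y \<in> L) \<and> (\<forall>x\<in>L. inverse x \<in> L)"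

definition nonarch_abs_on :: "'a::Fields.field set \<Rightarrow> ('a \<Rightarrow> real) \<Rightarrow> bool" where
  "nonarch_abs_on L w \<longleftrightarrow>
     (\<forall>x\<in>L. 0 \<le> w x \<and> (w x = 0 \<longleftrightarrow> x = 0)) \<and>
     (\<forall>x\<in>L. \<forall>y\<in>L. w (x * y) = w x * w y \<and> w (x + y) \<le> max (w x) (w y))"

definition padic_abs :: "nat \<Rightarrow> rat \<Rightarrow> real" where
  "padic_abs p q = (if q = 0 then 0 else
     (case quotient_of q of (a, b) \<Rightarrow>
        real p powi (int (multiplicity (int p) b) - int (multiplicity (int p) a))))"

text \<open>
  A finite place of a subfield \<open>F\<close> over \<open>p\<close> is represented by its unique absolute value
  that extends the \<open>p\<close>-adic one; \<^const>\<open>extensional\<close> makes the function itself unique, so that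
  sums over places count every place once.
\<close>

definition finite_place :: "nat \<Rightarrow> 'a::field_char_0 set \<Rightarrow> ('a \<Rightarrow> real) \<Rightarrow> bool" where
  "finite_place p F w \<longleftrightarrow> Factorial_Ring.prime p \<and> w \<in> extensional F \<and> nonarch_abs_on F w \<and>
     (\<forall>q. w (of_rat q) = padic_abs p q)"

definition value_group :: "'a::Fields.field set \<Rightarrow> ('a \<Rightarrow> real) \<Rightarrow> real set" where
  "value_group L w = w ` (L - {0})"

definition group_index :: "real set \<Rightarrow> real set \<Rightarrow> nat" where
  "group_index G H = card ((\<lambda>g. (\<lambda>h. g * h) ` H) ` G)"

definition ram_index_over_rat :: "nat \<Rightarrow> 'a::field_char_0 set \<Rightarrow> ('a \<Rightarrow> real) \<Rightarrow> nat" where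
  "ram_index_over_rat p F w = group_index (value_group F w) (value_group UNIV (padic_abs p))"

text \<open>
  For \<open>L\<close> inside the algebraic closure of a number field, residue field extensions are separable,
  so unramified means ramification index \<open>1\<close> at every place above \<open>v\<close>.
\<close>

definition unramified_in :: "('k::number_field \<Rightarrow> real) \<Rightarrow> 'k alg_closure set \<Rightarrow> bool" where
  "unramified_in v L \<longleftrightarrow>
     (\<forall>w. nonarch_abs_on L w \<and> (\<forall>x. w (to_ac x) = v x) \<longrightarrow>
        group_index (value_group L w) (value_group UNIV v) = 1)"

text \<open>The largest member of a family of sets is its union.\<close>

definition max_unramified :: "('k::number_field \<Rightarrow> real) \<Rightarrow> 'k alg_closure set" where
  "max_unramified v = \<Union>{L. is_subfield L \<and> range to_ac \<subseteq> L \<and> unramified_in v L}"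

definition newton_polygon :: "('k::Fields.field \<Rightarrow> real) \<Rightarrow> 'k poly \<Rightarrow> (real \<times> real) set" where
  "newton_polygon v \<psi> =
     (let H = convex hull {(real i, - ln (v (poly.coeff \<psi> i))) |i. poly.coeff \<psi> i \<noteq> 0}
      in {(x, y) \<in> H. \<forall>y'. (x, y') \<in> H \<longrightarrow> y \<le> y'})"

definition newton_slopes :: "('k::Fields.field \<Rightarrow> real) \<Rightarrow> 'k poly \<Rightarrow> real set" where
  "newton_slopes v \<psi> =
     {(y2 - y1) / (x2 - x1) |x1 y1 x2 y2.
        x1 < x2 \<and> closed_segment (x1, y1) (x2, y2) \<subseteq> newton_polygon v \<psi>}"

datatype 'a proj_line = Aff 'a | Infty

definition proj_points :: "'a set \<Rightarrow> 'a proj_line set" where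
  "proj_points L = insert Infty (Aff ` L)"

fun poly_proj_map :: "'k::Fields.field poly \<Rightarrow> 'k alg_closure proj_line \<Rightarrow> 'k alg_closure proj_line" where
  "poly_proj_map \<phi> (Aff x) = Aff (poly (map_poly to_ac \<phi>) x)"
| "poly_proj_map \<phi> Infty = Infty"

definition rat_adjoin :: "'a::field_char_0 \<Rightarrow> 'a set" where
  "rat_adjoin x = \<Inter>{L. is_subfield L \<and> x \<in> L}"

definition degree_over_rat :: "'a::field_char_0 set \<Rightarrow> nat" where
  "degree_over_rat F = vector_space.dim (\<lambda>(q::rat) x. of_rat q * x) F"

definition complex_embeddings :: "'a::Fields.field set \<Rightarrow> ('a \<Rightarrow> complex) set" where
  "complex_embeddings F = {\<sigma> \<in> extensional F. \<sigma> 1 = 1 \<and>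
     (\<forall>x\<in>F. \<forall>y\<in>F. \<sigma> (x + y) = \<sigma> x + \<sigma> y \<and> \<sigma> (x * y) = \<sigma> x * \<sigma> y)}"

definition residue_field :: "'a::Fields.field set \<Rightarrow> ('a \<Rightarrow> real) \<Rightarrow> 'a set set" where
  "residue_field F w = (\<lambda>x. {y \<in> F. w (y - x) < 1}) ` {x \<in> F. w x \<le> 1}"

text \<open>
  The local degree at a finite place is the product of the ramification index and the residue
  degree; the latter is the base-\<open>p\<close> logarithm of the size of the residue field.
\<close>

definition local_degree :: "nat \<Rightarrow> 'a::field_char_0 set \<Rightarrow> ('a \<Rightarrow> real) \<Rightarrow> real" where
  "local_degree p F w =
     real (ram_index_over_rat p F w) * log (real p) (real (card (residue_field F w)))"

text \<open>
  Absolute logarithmic height of \<open>[x : 1]\<close> and \<open>[1 : 0]\<close>, computed over \<open>\<rat>(x)\<close>.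
  Summing over complex embeddings gives each archimedean place its local degree.
\<close>

fun std_height :: "'a::field_char_0 proj_line \<Rightarrow> real" where
  "std_height (Aff x) =
     (let F = rat_adjoin x in
       ((\<Sum>\<sigma>\<in>complex_embeddings F. ln (max 1 (cmod (\<sigma> x)))) +
        (\<Sum>\<^sub>\<infinity>(p, w)\<in>{(p, w). finite_place p F w}. local_degree p F w * ln (max 1 (w x))))
       / real (degree_over_rat F))"
| "std_height Infty = 0"

definition weil_height_O1 :: "('a::field_char_0 proj_line \<Rightarrow> real) \<Rightarrow> bool" where
  "weil_height_O1 h \<longleftrightarrow> (\<exists>B. \<forall>P. \<bar>h P - std_height P\<bar> \<le> B)"

definition canonical_height :: "'k::number_field poly \<Rightarrow> 'k alg_closure proj_line \<Rightarrow> real" where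
  "canonical_height \<phi> = (THE h. weil_height_O1 h \<and>
     (\<forall>P. h (poly_proj_map \<phi> P) = real (Polynomial.degree \<phi>) * h P))"

definition preperiodic :: "('p \<Rightarrow> 'p) \<Rightarrow> 'p \<Rightarrow> bool" where
  "preperiodic f P \<longleftrightarrow> finite (range (\<lambda>n. (f ^^ n) P))"

definition strong_bogomolov :: "'k::number_field poly \<Rightarrow> 'k alg_closure set \<Rightarrow> bool" where
  "strong_bogomolov \<phi> L \<longleftrightarrow>
     (\<exists>C>0. \<forall>P\<in>proj_points L. \<not> preperiodic (poly_proj_map \<phi>) P \<longrightarrow> canonical_height \<phi> P \<ge> C) \<and>
     finite {P \<in> proj_points L. preperiodic (poly_proj_map \<phi>) P}"

end

theory Submission
  imports Defs
begin

text \<open>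
  A slope \<open>\<mu>\<close> of \<open>\<phi>(X) - X\<close> yields a fixed point \<open>\<alpha>\<close> with \<open>ln |\<alpha>| = \<mu>\<close> at a place above \<open>v\<close>, whereas
  the values of an extension unramified at \<open>v\<close> lie in \<open>(log p / e) \<int>\<close>; so every nonzero \<open>\<beta>\<close>
  in such an extension satisfies \<open>\<bar>ln |\<beta>| - \<mu>\<bar> \<ge> \<gamma>\<close> for a fixed \<open>\<gamma> > 0\<close>, and the same holds for the
  conjugates of \<open>\<beta>\<close> over \<open>K\<close>.

  Let \<open>\<beta>\<close> have \<open>N\<close> conjugates over \<open>K\<close> and small canonical height. At every place the discriminant of
  the set of conjugates is bounded by interpolation against the basis \<open>X\<^sup>i \<Psi>\<^sup>j\<close>, \<open>\<Psi>\<close> an iterate of \<open>\<phi>\<close>: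
  since \<open>\<Psi>(\<beta>)\<close> has height at most \<open>deg \<Psi>\<close> times that of \<open>\<beta>\<close> up to a constant, the total contribution
  is only a small multiple of \<open>N\<^sup>2\<close>. At \<open>v\<close> one gains a fixed positive multiple of \<open>N\<^sup>2\<close>. If \<open>\<mu>\<close> exceeds
  the capacity \<open>\<lambda> = -log |a\<^sub>d| / (d - 1)\<close>, or many conjugates lie far out, adjoin to the conjugates
  a short arithmetic progression near \<open>\<alpha>\<close>; it has bounded orbit, keeps distance at least \<open>|\<alpha>|\<close> from
  the conjugates, and the bound for the enlarged set then forces a smaller discriminant on the
  conjugates. Otherwise \<open>\<mu> = \<lambda>\<close>, and no conjugate lies on the circle through \<open>\<alpha>\<close>, so most of them lie
  well inside and are too close to each other. The product formula now bounds \<open>N\<close>, and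
  Northcott's theorem leaves finitely many \<open>\<beta>\<close> of small height; a point of positive height among them
  does no harm, and one of height zero is preperiodic.
\<close>

text \<open>All work takes place in one algebraically closed field with one absolute value per
  rational place; other places arise by composing with automorphisms. The height is defined through
  places of the field generated by \<open>x\<close>, weighted by ramification index times residue
  degree, so these weights must first be identified with numbers of conjugates. This is done without
  completions, by counting p-adically separated elements in two ways.

  For \<open>D = deg \<Psi>\<close> the leading coefficient of \<Psi> occurs about
  \<open>N^2 / (2 D)\<close> times in the basis and has logarithm
  \<open>- (D - 1) \<lambda>\<close>. So, up to height terms, the log-discriminant of
  \<open>N\<close> points is at most about \<open>\<lambda> N^2\<close> at each place, and by the
  product formula these main terms cancel. What remains is of order \<open>N^2 / D\<close> or almost
  linear in \<open>N\<close>, and \<open>D\<close> is chosen after the local gain. A progression of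
  \<open>\<tau> N\<close> points costs about \<open>\<tau>^2 N^2\<close> through its own
  discriminant but gains about \<open>\<tau> N^2\<close> in the cross terms, so a small \<tau> wins.
  The gain is present only for automorphisms fixing \<open>K\<close>, a fixed positive proportion of
  all of them.\<close>

hide_const (open) UnivPoly.monom UnivPoly.coeff Polynomials.degree Polynomials.lead_coeff
  Divisibility.prime Divisibility.irreducible Module.smult

section \<open>Field homomorphisms out of an algebraic closure of the rationals\<close>

lemma rat_vector_space:
  "vector_space (\<lambda>(q::rat) (x::'a::field_char_0). of_rat q * x)"
  by unfold_locales (auto simp: algebra_simps of_rat_add of_rat_mult)

text \<open>An algebraic closure of the rationals as a class, so that conjugates, places and heights
  can be treated without mention of the number field \<open>K\<close>.\<close>

class qbar = field_char_0 + alg_closed_field +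
  assumes root_of_int_poly: "\<exists>(c::nat \<Rightarrow> int) n. c n \<noteq> 0 \<and> (\<Sum>i\<le>n. of_int (c i) * x ^ i) = 0"

lemma all_algebraic: "algebraic (x::'a::qbar)"
proof -
  obtain c :: "nat \<Rightarrow> int" and n where c: "c n \<noteq> 0" "(\<Sum>i\<le>n. of_int (c i) * x ^ i) = 0"
    using root_of_int_poly by blast
  let ?p = "\<Sum>i\<le>n. monom (of_int (c i)) i :: 'a poly"
  have co: "coeff ?p j = (if j \<le> n then of_int (c j) else 0)" for j
    by (simp add: coeff_sum)
  show ?thesis
  proof (rule algebraicI)
    show "poly ?p x = 0" using c by (simp add: poly_sum poly_monom)
    have "coeff ?p n \<noteq> 0" using c co by simp
    thus "?p \<noteq> 0" by auto
  qed (auto simp: co)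
qed

text \<open>The powers with exponents up to \<open>card V\<close> either repeat or are too many to
  be independent; each case yields a rational relation for \<open>x\<close>.\<close>

lemma algebraic_of_powers_in_span:
  fixes x :: "'a::field_char_0"
  assumes "finite V" "\<And>i. x ^ i \<in> module.span (\<lambda>(q::rat) x. of_rat q * x) V"
  shows "algebraic x"
proof -
  interpret vector_space "\<lambda>(q::rat) (x::'a). of_rat q * x" by (rule rat_vector_space)
  show ?thesis
  proof (cases "inj_on (\<lambda>i. x ^ i) {..card V}")
    case False
    then obtain i j where ij: "i \<noteq> j" "x ^ i = x ^ j" by (auto simp: inj_on_def)
    show ?thesis
    proof (rule algebraicI)
      show "poly (monom 1 i - monom 1 j) x = 0" using ij by (simp add: poly_monom)
      have "coeff (monom 1 i - monom (1::'a) j) i = 1" using ij by simp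
      thus "monom 1 i - monom (1::'a) j \<noteq> 0" by (metis coeff_0 zero_neq_one)
    qed (auto simp: coeff_monom)
  next
    case True
    let ?S = "(\<lambda>i. x ^ i) ` {..card V}"
    have c: "card ?S = Suc (card V)" using card_image[OF True] by simp
    have "dependent ?S"
    proof (rule ccontr)
      assume "\<not> dependent ?S"
      from independent_span_bound[OF assms(1) this] assms(2) c show False by auto
    qed
    then obtain u where u: "\<exists>v\<in>?S. u v \<noteq> 0" "(\<Sum>v\<in>?S. of_rat (u v) * v) = 0"
      using dependent_finite[of ?S] by auto
    let ?p = "\<Sum>i\<le>card V. monom (of_rat (u (x ^ i))) i :: 'a poly"
    have co: "coeff ?p j = (if j \<le> card V then of_rat (u (x ^ j)) else 0)" for j
      by (simp add: coeff_sum)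
    show ?thesis
    proof (rule algebraicI')
      have "poly ?p x = (\<Sum>i\<le>card V. of_rat (u (x ^ i)) * x ^ i)"
        by (simp add: poly_sum poly_monom)
      also have "\<dots> = (\<Sum>v\<in>?S. of_rat (u v) * v)"
        by (subst sum.reindex[OF True]) simp
      finally show "poly ?p x = 0" using u(2) by simp
      from u(1) obtain i where "i \<le> card V" "u (x ^ i) \<noteq> 0" by auto
      hence "coeff ?p i \<noteq> 0" by (simp add: co)
      thus "?p \<noteq> 0" by auto
    qed (auto simp: co)
  qed
qed

text \<open>Finiteness of \<open>K\<close> over the rationals is combined with a relation
  \<open>P\<close> of \<open>x\<close> over \<open>K\<close>: the products of a spanning set of
  \<open>K\<close> with the powers of \<open>x\<close> below \<open>degree P\<close> span a space
  that multiplication by \<open>x\<close> preserves.\<close>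

lemma number_field_alg_closure_algebraic: "algebraic (x :: 'k::number_field alg_closure)"
proof -
  interpret vector_space "\<lambda>(q::rat) (x::'k alg_closure). of_rat q * x" by (rule rat_vector_space)
  obtain P :: "'k poly" where P: "P \<noteq> 0" "poly (map_poly to_ac P) x = 0"
    by (rule alg_closure_algebraic)
  obtain B :: "'k set" where B: "finite B" "\<And>x. \<exists>c. x = (\<Sum>b\<in>B. of_rat (c b) * b)"
    using finite_dim_over_rat by blast
  define m where "m = degree P"
  define V where "V = (\<lambda>(b,j). to_ac b * x ^ j) ` (B \<times> {..<m})"
  have m: "m > 0"
  proof (rule ccontr)
    assume "\<not> m > 0"
    then obtain c where "P = [:c:]" by (auto simp: m_def elim: degree_eq_zeroE)
    with P show False by (auto simp: map_poly_pCons)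
  qed
  have to_ac_rat: "to_ac (of_rat q) = (of_rat q :: 'k alg_closure)" for q
    by (cases q) (simp add: of_rat_rat)
  have base: "to_ac c * x ^ j \<in> span V" if "j < m" for c j
  proof -
    obtain e where e: "c = (\<Sum>b\<in>B. of_rat (e b) * b)" using B(2) by blast
    have "to_ac c * x ^ j = (\<Sum>b\<in>B. of_rat (e b) * (to_ac b * x ^ j))"
      by (subst e) (simp add: to_ac_sum to_ac_rat sum_distrib_right mult.assoc)
    also have "\<dots> \<in> span V"
      by (intro span_sum span_scale span_base) (use that in \<open>auto simp: V_def\<close>)
    finally show ?thesis .
  qed
  have top: "to_ac c * x ^ m \<in> span V" for c
  proof -
    have lc: "coeff P m \<noteq> 0" using P by (simp add: m_def)
    have "(\<Sum>i\<le>m. to_ac (coeff P i) * x ^ i) = 0"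
      using P(2) by (simp add: poly_altdef m_def coeff_map_poly degree_map_poly)
    hence "to_ac (coeff P m) * x ^ m = - (\<Sum>i<m. to_ac (coeff P i) * x ^ i)"
      by (simp add: lessThan_Suc_atMost[symmetric] eq_neg_iff_add_eq_0 add.commute)
    hence "x ^ m = - (\<Sum>i<m. to_ac (coeff P i) * x ^ i) / to_ac (coeff P m)"
      using lc by (simp add: field_simps)
    hence "to_ac c * x ^ m = (\<Sum>i<m. to_ac (- c * coeff P i / coeff P m) * x ^ i)"
      by (simp add: sum_distrib_left sum_divide_distrib sum_negf algebra_simps)
    also have "\<dots> \<in> span V" by (intro span_sum base) auto
    finally show ?thesis .
  qed
  have mulx: "x * v \<in> span V" if "v \<in> span V" for v
    using that
  proof (induction rule: span_induct_alt)
    case (step c b y)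
    obtain b' j where bj: "b = to_ac b' * x ^ j" "j < m" using step by (auto simp: V_def)
    have "x * b = to_ac b' * x ^ Suc j" by (simp add: bj)
    also have "\<dots> \<in> span V" using base[of "Suc j"] top bj(2)
      by (cases "Suc j = m") (auto simp del: power_Suc)
    finally have "of_rat c * (x * b) + x * y \<in> span V"
      using step by (intro span_add span_scale)
    thus ?case by (simp add: algebra_simps)
  qed (simp add: span_zero)
  show ?thesis
  proof (rule algebraic_of_powers_in_span)
    show "finite V" using B by (simp add: V_def)
    show "x ^ i \<in> span V" for i
    proof (induction i)
      case 0
      show ?case using base[of 0 1] m by simp
    qed (use mulx in simp)
  qed
qed

instance alg_closure :: (number_field) qbar
proof
  fix x :: "'a alg_closure"
  obtain p where p: "p \<noteq> 0" "poly (map_poly of_int p) x = 0"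
    using algebraicE'[OF number_field_alg_closure_algebraic] by metis
  thus "\<exists>c n. c n \<noteq> 0 \<and> (\<Sum>i\<le>n. of_int (c i) * x ^ i) = 0"
    by (intro exI[of _ "coeff p"] exI[of _ "degree p"])
       (auto simp: poly_altdef coeff_map_poly degree_map_poly)
qed

definition field_hom :: "('a::Fields.field \<Rightarrow> 'b::Fields.field) \<Rightarrow> bool" where
  "field_hom f \<longleftrightarrow> f 1 = 1 \<and> (\<forall>x y. f (x + y) = f x + f y \<and> f (x * y) = f x * f y)"

text \<open>A homomorphism from a subring, kept as a relation so that partial homomorphisms are
  ordered by inclusion. Given closure under differences, triviality of the fibre over 0 is
  single-valuedness.\<close>

definition ring_graph :: "('a::Fields.field \<times> 'b::Fields.field) set \<Rightarrow> bool" where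
  "ring_graph R \<longleftrightarrow> (1, 1) \<in> R \<and>
     (\<forall>a b c d. (a, b) \<in> R \<longrightarrow> (c, d) \<in> R \<longrightarrow> (a - c, b - d) \<in> R \<and> (a * c, b * d) \<in> R) \<and>
     (\<forall>b. (0, b) \<in> R \<longrightarrow> b = 0)"

context
  fixes R :: "('a::qbar \<times> 'b::{field_char_0,alg_closed_field}) set"
  assumes R: "ring_graph R"
begin

lemma ring_graph_one: "(1, 1) \<in> R"
  and ring_graph_diff: "(a, b) \<in> R \<Longrightarrow> (c, d) \<in> R \<Longrightarrow> (a - c, b - d) \<in> R"
  and ring_graph_mult: "(a, b) \<in> R \<Longrightarrow> (c, d) \<in> R \<Longrightarrow> (a * c, b * d) \<in> R"
  and ring_graph_inj: "(0, b) \<in> R \<Longrightarrow> b = 0"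
  using R by (auto simp: ring_graph_def)

lemma ring_graph_zero: "(0, 0) \<in> R"
  using ring_graph_diff[OF ring_graph_one ring_graph_one] by simp

lemma ring_graph_add: "(a, b) \<in> R \<Longrightarrow> (c, d) \<in> R \<Longrightarrow> (a + c, b + d) \<in> R"
  using ring_graph_diff[of a b "-c" "-d"] ring_graph_diff[OF ring_graph_zero, of c d] by simp

lemma ring_graph_sum: "finite A \<Longrightarrow> (\<And>i. i \<in> A \<Longrightarrow> (f i, g i) \<in> R) \<Longrightarrow> (sum f A, sum g A) \<in> R"
  by (induction A rule: finite_induct) (auto intro: ring_graph_zero ring_graph_add)

lemma ring_graph_of_nat: "(of_nat n, of_nat n) \<in> R"
  by (induction n) (auto intro: ring_graph_zero ring_graph_one ring_graph_add)

lemma ring_graph_of_int: "(of_int n, of_int n) \<in> R"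
proof (cases n)
  case (nonneg k)
  thus ?thesis using ring_graph_of_nat[of k] by simp
next
  case (neg k)
  thus ?thesis using ring_graph_diff[OF ring_graph_zero ring_graph_of_nat[of "Suc k"]]
    by (simp del: of_nat_Suc)
qed

lemma ring_graph_int_poly:
  "(a, b) \<in> R \<Longrightarrow> (poly (map_poly of_int p) a, poly (map_poly of_int p) b) \<in> R"
  by (induction p) (auto simp: map_poly_pCons intro!: ring_graph_zero ring_graph_add ring_graph_mult ring_graph_of_int)

text \<open>A nonzero algebraic number satisfies an integer equation with nonzero constant term.
  Transported along the graph to the value 0, the equation would say that this constant term
  vanishes.\<close>

lemma ring_graph_inj_right:
  assumes "(a, 0) \<in> R" shows "a = 0"
proof (rule ccontr)
  assume "a \<noteq> 0"
  then obtain p where p: "coeff p 0 \<noteq> 0" "poly (map_poly of_int p) a = 0"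
    using algebraicE'_nonzero[OF all_algebraic] by metis
  from ring_graph_int_poly[OF assms, of p] p
  have "poly (map_poly of_int p) (0::'b) = 0" by (auto dest: ring_graph_inj)
  with p show False by (simp add: poly_0_coeff_0 coeff_map_poly)
qed

lemma ring_graph_zero_iff: "(a, b) \<in> R \<Longrightarrow> a = 0 \<longleftrightarrow> b = 0"
  using ring_graph_inj ring_graph_inj_right by auto

text \<open>Let \<open>m1\<close> be of least degree among the polynomials over the domain of
  \<open>R\<close> that kill \<open>x\<close>, and let \<open>b\<close> be a root of its image
  \<open>m2\<close>; then \<open>x\<close> may be sent to \<open>b\<close>.\<close>

lemma ring_graph_extend:
  "\<exists>b R'. ring_graph R' \<and> R \<subseteq> R' \<and> (x, b) \<in> R'"
proof -
  define PR where "PR = (\<lambda>P Q. \<forall>i. (coeff P i, coeff Q i) \<in> R)"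
  have PR_diff: "PR P Q \<Longrightarrow> PR P' Q' \<Longrightarrow> PR (P - P') (Q - Q')" for P P' Q Q'
    by (auto simp: PR_def intro: ring_graph_diff)
  have PR_mult: "PR P Q \<Longrightarrow> PR P' Q' \<Longrightarrow> PR (P * P') (Q * Q')" for P P' Q Q'
    by (auto simp: PR_def coeff_mult intro!: ring_graph_sum ring_graph_mult)
  have PR_monom: "(a, b) \<in> R \<Longrightarrow> PR (monom a k) (monom b k)" for a b k
    by (auto simp: PR_def coeff_monom intro: ring_graph_zero)
  have PR_zero: "P = 0 \<longleftrightarrow> Q = 0" if "PR P Q" for P Q
    using that unfolding PR_def poly_eq_iff by (metis coeff_0 ring_graph_zero_iff)
  have PR_degree: "degree P = degree Q" if "PR P Q" for P Q
    using that unfolding PR_def degree_def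
    by (intro arg_cong[where f = Least] ext) (metis ring_graph_zero_iff)
  obtain p where "p \<noteq> 0" "poly (map_poly of_int p) x = 0"
    using algebraicE'[OF all_algebraic] by metis
  hence "(\<exists>Q. PR (map_poly of_int p) Q) \<and> map_poly of_int p \<noteq> (0 :: 'a poly) \<and> poly (map_poly of_int p) x = 0"
    by (intro conjI exI[of _ "map_poly of_int p"])
       (auto simp: PR_def coeff_map_poly ring_graph_of_int map_poly_eq_0_iff)
  from ex_has_least_nat[where P = "\<lambda>P. (\<exists>Q. PR P Q) \<and> P \<noteq> 0 \<and> poly P x = 0" and m = degree, OF this]
  obtain m1 where "(\<exists>Q. PR m1 Q) \<and> m1 \<noteq> 0 \<and> poly m1 x = 0"
    and min: "\<And>P. (\<exists>Q. PR P Q) \<and> P \<noteq> 0 \<and> poly P x = 0 \<Longrightarrow> degree m1 \<le> degree P"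
    by blast
  then obtain m2 where m: "PR m1 m2" "m1 \<noteq> 0" "poly m1 x = 0" by auto
  have dm: "degree m1 > 0"
  proof (rule ccontr)
    assume "\<not> degree m1 > 0"
    then obtain c where "m1 = [:c:]" by (auto elim: degree_eq_zeroE)
    with m show False by auto
  qed
  then obtain b where b: "poly m2 b = 0"
    using alg_closed_imp_poly_has_root[of m2] PR_degree[OF m(1)] by auto
  \<comment> \<open>Well-definedness. The coefficients form only a ring, so division by
    \<open>m1\<close> is replaced by pseudo-division: scale by the leading coefficient of
    \<open>m1\<close>, cancel the top term, and recurse on the degree.\<close>
  have key: "poly Q b = 0" if "PR P Q" "poly P x = 0" for P Q
    using that
  proof (induction "degree P" arbitrary: P Q rule: less_induct)
    case less
    show ?case
    proof (cases "P = 0")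
      case True
      thus ?thesis using PR_zero[OF less.prems(1)] by simp
    next
      case False
      define n where "n = degree P"
      define k where "k = n - degree m1"
      have le: "degree m1 \<le> n" using min less.prems False by (auto simp: n_def)
      define P' where "P' = monom (coeff m1 (degree m1)) 0 * P - monom (coeff P n) k * m1"
      define Q' where "Q' = monom (coeff m2 (degree m1)) 0 * Q - monom (coeff Q n) k * m2"
      have PR': "PR P' Q'" unfolding P'_def Q'_def
        using m(1) less.prems(1) by (intro PR_diff PR_mult PR_monom) (auto simp: PR_def)
      have "coeff P' n = 0" using le
        by (simp add: P'_def coeff_monom_mult k_def)
      moreover have "degree P' \<le> n" unfolding P'_def using le
        by (intro degree_diff_le order_trans[OF degree_mult_le] )
           (auto simp: n_def k_def degree_monom_eq monom_0 intro: order_trans[OF add_right_mono[OF degree_monom_le]])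
      ultimately have "degree P' < n"
        using dm le by (metis degree_0 leading_coeff_0_iff le_neq_implies_less less_le_trans)
      moreover have "poly P' x = 0" using m less.prems by (simp add: P'_def)
      ultimately have "poly Q' b = 0" using less.hyps PR' by (auto simp: n_def)
      hence "coeff m2 (degree m1) * poly Q b = 0" using b by (simp add: Q'_def poly_monom)
      moreover have "coeff m2 (degree m1) \<noteq> 0"
        using m(2) m(1) ring_graph_zero_iff unfolding PR_def by (metis leading_coeff_0_iff)
      ultimately show ?thesis by simp
    qed
  qed
  define R' where "R' = {(poly P x, poly Q b) | P Q. PR P Q}"
  have R'I: "PR P Q \<Longrightarrow> (poly P x, poly Q b) \<in> R'" for P Q by (auto simp: R'_def)
  have "R \<subseteq> R'"
  proof
    fix ab assume "ab \<in> R"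
    thus "ab \<in> R'" using R'I[OF PR_monom[of "fst ab" "snd ab" 0]] by (simp add: poly_monom)
  qed
  moreover have "(x, b) \<in> R'"
    using R'I[OF PR_monom[OF ring_graph_one, of 1]] by (simp add: poly_monom)
  moreover have "ring_graph R'"
    unfolding ring_graph_def
  proof (intro conjI allI impI)
    show "(1, 1) \<in> R'" using \<open>R \<subseteq> R'\<close> ring_graph_one by auto
    fix a c d e assume "(a, c) \<in> R'" "(d, e) \<in> R'"
    then obtain P Q P' Q' where "PR P Q" "PR P' Q'"
      "a = poly P x" "c = poly Q b" "d = poly P' x" "e = poly Q' b" by (auto simp: R'_def)
    thus "(a - d, c - e) \<in> R'" "(a * d, c * e) \<in> R'"
      using R'I[OF PR_diff] R'I[OF PR_mult] by fastforce+
  next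
    fix e assume "(0, e) \<in> R'"
    thus "e = 0" using key by (auto simp: R'_def)
  qed
  ultimately show ?thesis by blast
qed

end

text \<open>Zorn's lemma gives a maximal graph; it is total, because any element missing from its
  domain could be adjoined by \<open>ring_graph_extend\<close>.\<close>

lemma field_hom_extending_graph:
  fixes R :: "('a::qbar \<times> 'b::{field_char_0,alg_closed_field}) set"
  assumes "ring_graph R"
  obtains f where "field_hom f" "\<And>a b. (a, b) \<in> R \<Longrightarrow> f a = b"
proof -
  define AA where "AA = {R'. ring_graph R' \<and> R \<subseteq> R'}"
  have "\<exists>M\<in>AA. (\<forall>Y\<in>AA. M \<subseteq> Y \<longrightarrow> Y = M)"
  proof (rule subset_Zorn_nonempty)
    show "AA \<noteq> {}" using assms by (auto simp: AA_def)
    fix C assume C: "C \<noteq> {}" "subset.chain AA C"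
    have CA: "C \<subseteq> AA" using C by (auto simp: subset.chain_def)
    have two: "\<exists>Y\<in>C. u \<in> Y \<and> w \<in> Y" if "u \<in> \<Union>C" "w \<in> \<Union>C" for u w
    proof -
      from that obtain Y Z where "Y \<in> C" "Z \<in> C" "u \<in> Y" "w \<in> Z" by blast
      moreover from this have "Y \<subseteq> Z \<or> Z \<subseteq> Y" using C(2) by (auto simp: subset_chain_def)
      ultimately show ?thesis by blast
    qed
    have "ring_graph (\<Union>C)"
      unfolding ring_graph_def
    proof (intro conjI allI impI)
      show "(1, 1) \<in> \<Union>C" using C CA by (auto simp: AA_def ring_graph_def)
      fix a b c d assume "(a, b) \<in> \<Union>C" "(c, d) \<in> \<Union>C"
      with two obtain Y where Y: "Y \<in> C" "(a, b) \<in> Y" "(c, d) \<in> Y" by metis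
      hence "ring_graph Y" using CA by (auto simp: AA_def)
      hence "(a - c, b - d) \<in> Y" "(a * c, b * d) \<in> Y" using Y unfolding ring_graph_def by blast+
      thus "(a - c, b - d) \<in> \<Union>C" "(a * c, b * d) \<in> \<Union>C" using Y(1) by blast+
    next
      fix b assume "(0, b) \<in> \<Union>C"
      thus "b = 0" using CA by (auto simp: AA_def ring_graph_def)
    qed
    thus "\<Union>C \<in> AA" using C CA by (auto simp: AA_def)
  qed
  then obtain M where M: "ring_graph M" "R \<subseteq> M"
    and max: "\<And>Y. ring_graph Y \<Longrightarrow> R \<subseteq> Y \<Longrightarrow> M \<subseteq> Y \<Longrightarrow> Y = M" by (auto simp: AA_def)
  have total: "\<exists>b. (x, b) \<in> M" for x
  proof -
    obtain b R' where "ring_graph R'" "M \<subseteq> R'" "(x, b) \<in> R'"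
      using ring_graph_extend[OF M(1), of x] by blast
    with max[of R'] M show ?thesis by auto
  qed
  have uniq: "b = c" if "(a, b) \<in> M" "(a, c) \<in> M" for a b c
    using ring_graph_inj[OF M(1)] ring_graph_diff[OF M(1) that] by fastforce
  obtain f where f: "\<And>x. (x, f x) \<in> M" using total by metis
  have "field_hom f" unfolding field_hom_def
  proof (intro conjI allI)
    show "f 1 = 1" using uniq f ring_graph_one[OF M(1)] by blast
    fix x y
    show "f (x + y) = f x + f y" using uniq f ring_graph_add[OF M(1) f f] by blast
    show "f (x * y) = f x * f y" using uniq f ring_graph_mult[OF M(1) f f] by blast
  qed
  moreover have "f a = b" if "(a, b) \<in> R" for a b using uniq f M that by blast
  ultimately show ?thesis by (rule that)
qed

lemma field_hom_1: "field_hom f \<Longrightarrow> f 1 = 1"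
  and field_hom_add: "field_hom f \<Longrightarrow> f (x + y) = f x + f y"
  and field_hom_mult: "field_hom f \<Longrightarrow> f (x * y) = f x * f y"
  by (auto simp: field_hom_def)

lemma field_hom_0: "field_hom f \<Longrightarrow> f 0 = 0"
  using field_hom_add[of f 0 0] by (metis add_0 add_cancel_right_left)

lemma field_hom_uminus: "field_hom f \<Longrightarrow> f (- x) = - f x"
  using field_hom_add[of f "-x" x] by (simp add: field_hom_0 eq_neg_iff_add_eq_0)

lemma field_hom_diff: "field_hom f \<Longrightarrow> f (x - y) = f x - f y"
  using field_hom_add[of f x "-y"] by (simp add: field_hom_uminus)

lemma field_hom_eq_0_iff: "field_hom f \<Longrightarrow> f x = 0 \<longleftrightarrow> x = 0"
  using field_hom_mult[of f x "inverse x"] field_hom_1[of f] field_hom_0[of f] by (cases "x = 0") auto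

lemma field_hom_inj: "field_hom f \<Longrightarrow> inj f"
  by (rule injI) (metis eq_iff_diff_eq_0 field_hom_diff field_hom_eq_0_iff)

lemma field_hom_power: "field_hom f \<Longrightarrow> f (x ^ n) = f x ^ n"
  by (induction n) (auto simp: field_hom_1 field_hom_mult)

lemma field_hom_sum: "field_hom f \<Longrightarrow> f (sum g A) = (\<Sum>i\<in>A. f (g i))"
  by (induction A rule: infinite_finite_induct) (auto simp: field_hom_0 field_hom_add)

lemma field_hom_prod: "field_hom f \<Longrightarrow> f (prod g A) = (\<Prod>i\<in>A. f (g i))"
  by (induction A rule: infinite_finite_induct) (auto simp: field_hom_1 field_hom_mult)

lemma field_hom_of_nat: "field_hom f \<Longrightarrow> f (of_nat n) = of_nat n"
  by (induction n) (auto simp: field_hom_0 field_hom_1 field_hom_add)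

lemma field_hom_of_int: "field_hom f \<Longrightarrow> f (of_int n) = of_int n"
  by (cases n) (auto simp: field_hom_of_nat field_hom_uminus field_hom_diff field_hom_1)

lemma field_hom_inverse:
  assumes "field_hom f" shows "f (inverse x) = inverse (f x)"
proof (cases "x = 0")
  case False
  have "f x * f (inverse x) = 1"
    using field_hom_mult[OF assms, of x "inverse x"] False assms by (simp add: field_hom_1)
  thus ?thesis by (simp add: inverse_unique)
qed (simp add: assms field_hom_0)

lemma field_hom_divide: "field_hom f \<Longrightarrow> f (x / y) = f x / f y"
  by (simp add: field_hom_inverse field_hom_mult field_class.field_divide_inverse)

lemma field_hom_of_rat: "field_hom f \<Longrightarrow> f (of_rat q) = of_rat q"
  by (cases q) (simp add: of_rat_rat field_hom_divide field_hom_of_int)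

lemma field_hom_comp: "field_hom f \<Longrightarrow> field_hom g \<Longrightarrow> field_hom (f \<circ> g)"
  by (auto simp: field_hom_def)

lemma field_hom_poly: "field_hom f \<Longrightarrow> f (poly p x) = poly (map_poly f p) (f x)"
  by (induction p) (auto simp: map_poly_pCons field_hom_0 field_hom_add field_hom_mult)

lemma field_hom_map_poly_add:
  "field_hom f \<Longrightarrow> map_poly f (p + q) = map_poly f p + map_poly f q"
  by (intro poly_eqI) (auto simp: coeff_map_poly field_hom_0 field_hom_add)

lemma field_hom_map_poly_mult:
  "field_hom f \<Longrightarrow> map_poly f (p * q) = map_poly f p * map_poly f q"
  by (intro poly_eqI) (auto simp: coeff_map_poly field_hom_0 field_hom_mult coeff_mult field_hom_sum)

lemma field_hom_map_poly_degree: "field_hom f \<Longrightarrow> degree (map_poly f p) = degree p"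
  by (rule degree_map_poly) (auto simp: field_hom_eq_0_iff)

lemma field_hom_of_rat_hom: "field_hom (of_rat :: rat \<Rightarrow> 'a::field_char_0)"
  by (auto simp: field_hom_def of_rat_add of_rat_mult)

lemma field_hom_to_ac: "field_hom to_ac"
  by (auto simp: field_hom_def)

abbreviation rpoly :: "rat poly \<Rightarrow> 'a::field_char_0 poly" where
  "rpoly \<equiv> map_poly of_rat"

lemma rpoly_simps [simp]:
  "rpoly (p + q) = rpoly p + rpoly q" "rpoly (p * q) = rpoly p * rpoly q"
  "degree (rpoly p) = degree p" "coeff (rpoly p) i = of_rat (coeff p i)" "rpoly 1 = 1"
  by (auto simp: field_hom_map_poly_add[OF field_hom_of_rat_hom]
      field_hom_map_poly_mult[OF field_hom_of_rat_hom] field_hom_map_poly_degree[OF field_hom_of_rat_hom]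
      coeff_map_poly)

lemma rpoly_diff [simp]: "rpoly (p - q) = rpoly p - rpoly q"
  by (intro poly_eqI) (simp add: of_rat_diff)

lemma rpoly_uminus [simp]: "rpoly (- p) = - rpoly p"
  by (intro poly_eqI) (simp add: of_rat_minus)

lemma rpoly_monom [simp]: "rpoly (monom c n) = monom (of_rat c) n"
  by (intro poly_eqI) simp

lemma rpoly_smult [simp]: "rpoly (smult c p) = smult (of_rat c) (rpoly p)"
  by (intro poly_eqI) (simp add: of_rat_mult)

lemma rpoly_eq_0_iff [simp]: "rpoly p = 0 \<longleftrightarrow> p = 0"
  by (simp add: poly_eq_iff)

lemma field_hom_rpoly: "field_hom f \<Longrightarrow> f (poly (rpoly p) x) = poly (rpoly p) (f x)"
  by (simp add: field_hom_poly map_poly_map_poly field_hom_0 field_hom_of_rat o_def)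

lemma rpoly_pderiv: "rpoly (pderiv p) = pderiv (rpoly p)"
  by (intro poly_eqI) (simp add: coeff_pderiv of_rat_mult of_rat_add)

section \<open>Minimal polynomials, automorphisms and conjugates over the rationals\<close>

definition minpoly :: "'a::qbar \<Rightarrow> rat poly" where
  "minpoly x = (SOME q. lead_coeff q = 1 \<and> poly (rpoly q) x = 0 \<and>
     (\<forall>r. r \<noteq> 0 \<longrightarrow> poly (rpoly r) x = 0 \<longrightarrow> degree q \<le> degree r))"

lemma minpoly_props:
  fixes x :: "'a::qbar"
  shows "lead_coeff (minpoly x) = 1" "poly (rpoly (minpoly x)) x = 0"
    "\<And>r. r \<noteq> 0 \<Longrightarrow> poly (rpoly r) x = 0 \<Longrightarrow> degree (minpoly x) \<le> degree r"
proof -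
  obtain p where p: "p \<noteq> 0" "poly (map_poly of_int p) x = 0"
    using algebraicE'[OF all_algebraic] by metis
  have e: "rpoly (map_poly of_int p) = (map_poly of_int p :: 'a poly)"
    by (intro poly_eqI) (simp add: coeff_map_poly)
  have "map_poly of_int p \<noteq> (0 :: rat poly) \<and> poly (rpoly (map_poly of_int p)) x = 0"
    unfolding e using p by (auto simp: poly_eq_iff coeff_map_poly)
  from ex_has_least_nat[where P = "\<lambda>r. r \<noteq> 0 \<and> poly (rpoly r) x = 0" and m = degree, OF this]
  obtain q where q: "q \<noteq> 0 \<and> poly (rpoly q) x = 0"
    and min: "\<And>r. r \<noteq> 0 \<and> poly (rpoly r) x = 0 \<Longrightarrow> degree q \<le> degree r"
    by blast
  let ?q = "smult (inverse (lead_coeff q)) q"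
  have "lead_coeff ?q = 1 \<and> poly (rpoly ?q) x = 0 \<and>
     (\<forall>r. r \<noteq> 0 \<longrightarrow> poly (rpoly r) x = 0 \<longrightarrow> degree ?q \<le> degree r)"
    using q min by auto
  from someI[of "\<lambda>q. lead_coeff q = 1 \<and> poly (rpoly q) x = 0 \<and>
     (\<forall>r. r \<noteq> 0 \<longrightarrow> poly (rpoly r) x = 0 \<longrightarrow> degree q \<le> degree r)", OF this, folded minpoly_def]
  show "lead_coeff (minpoly x) = 1" "poly (rpoly (minpoly x)) x = 0"
    "\<And>r. r \<noteq> 0 \<Longrightarrow> poly (rpoly r) x = 0 \<Longrightarrow> degree (minpoly x) \<le> degree r" by auto
qed

lemma minpoly_nonzero: "minpoly x \<noteq> 0"
  using minpoly_props(1)[of x] by auto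

lemma minpoly_dvd:
  assumes "poly (rpoly r) (x::'a::qbar) = 0" shows "minpoly x dvd r"
proof -
  have "(rpoly r :: 'a poly) = rpoly (r div minpoly x * minpoly x + r mod minpoly x)" by simp
  hence "poly (rpoly (r mod minpoly x)) x = 0"
    using assms minpoly_props(2)[of x] unfolding rpoly_simps by simp
  moreover have "degree (r mod minpoly x) < degree (minpoly x) \<or> r mod minpoly x = 0"
    using degree_mod_less[OF minpoly_nonzero] by auto
  ultimately have "r mod minpoly x = 0" using minpoly_props(3)[of "r mod minpoly x" x] by fastforce
  thus ?thesis by auto
qed

lemma degree_minpoly_pos: "degree (minpoly (x::'a::qbar)) > 0"
proof (rule ccontr)
  assume "\<not> ?thesis"
  then obtain c where "minpoly x = [:c:]" by (auto elim: degree_eq_zeroE)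
  with minpoly_props(1,2)[of x] show False by (auto simp: map_poly_pCons)
qed

text \<open>Field endomorphisms; surjectivity follows from algebraicity, see
  \<open>auts_bij\<close>.\<close>

definition auts :: "('a::qbar \<Rightarrow> 'a) set" where "auts = {g. field_hom g}"

definition conjs :: "'a::qbar \<Rightarrow> 'a set" where "conjs x = (\<lambda>g. g x) ` auts"

lemma auts_id: "id \<in> auts" "(\<lambda>x. x) \<in> auts"
  by (auto simp: auts_def field_hom_def)

lemma auts_comp: "f \<in> auts \<Longrightarrow> g \<in> auts \<Longrightarrow> f \<circ> g \<in> auts"
  by (auto simp: auts_def field_hom_comp)

lemma conjsI: "g \<in> auts \<Longrightarrow> g x \<in> conjs x"
  by (auto simp: conjs_def)

lemma conjs_self: "x \<in> conjs x"
  using auts_id by (force simp: conjs_def)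

text \<open>If \<open>y\<close> is a root of the minimal polynomial of \<open>x\<close>, evaluating
  the same rational polynomial at \<open>x\<close> and at \<open>y\<close> gives pairs that form a
  ring graph, and this graph extends to the whole field.\<close>

lemma conjs_roots: "conjs (x::'a::qbar) = {y. poly (rpoly (minpoly x)) y = 0}"
proof (intro equalityI subsetI)
  fix y assume "y \<in> conjs x"
  then obtain g where g: "field_hom g" "y = g x" by (auto simp: conjs_def auts_def)
  have "poly (rpoly (minpoly x)) y = g (poly (rpoly (minpoly x)) x)"
    using g by (simp add: field_hom_rpoly)
  thus "y \<in> {y. poly (rpoly (minpoly x)) y = 0}"
    using g minpoly_props(2)[of x] by (simp add: field_hom_0)
next
  fix y :: 'a assume "y \<in> {y. poly (rpoly (minpoly x)) y = 0}"
  hence y: "poly (rpoly (minpoly x)) y = 0" by simp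
  define R where "R = {(poly (rpoly p) x, poly (rpoly p) y) | p. True}"
  have RI: "(poly (rpoly p) x, poly (rpoly p) y) \<in> R" for p by (auto simp: R_def)
  have "ring_graph R" unfolding ring_graph_def
  proof (intro conjI allI impI)
    show "(1, 1) \<in> R" using RI[of 1] by simp
    fix a b c d assume "(a, b) \<in> R" "(c, d) \<in> R"
    then obtain p q where "a = poly (rpoly p) x" "b = poly (rpoly p) y"
      "c = poly (rpoly q) x" "d = poly (rpoly q) y" by (auto simp: R_def)
    thus "(a - c, b - d) \<in> R" "(a * c, b * d) \<in> R"
      using RI[of "p - q"] RI[of "p * q"] by simp_all
  next
    fix b assume "(0, b) \<in> R"
    then obtain p where p: "poly (rpoly p) x = 0" "b = poly (rpoly p) y" by (auto simp: R_def)
    then obtain q where "p = minpoly x * q" using minpoly_dvd by blast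
    thus "b = 0" using p y by simp
  qed
  from field_hom_extending_graph[OF this]
  obtain f where f: "field_hom f" "\<And>a b. (a, b) \<in> R \<Longrightarrow> f a = b" by blast
  moreover have "(x, y) \<in> R" using RI[of "monom 1 1"] by (simp add: poly_monom)
  ultimately show "y \<in> conjs x" by (auto simp: conjs_def auts_def image_iff)
qed

lemma finite_conjs: "finite (conjs x)"
  unfolding conjs_roots by (rule poly_roots_finite) (simp add: minpoly_nonzero)

lemma card_conjs_pos: "card (conjs x) > 0"
  using conjs_self finite_conjs by (auto simp: card_gt_0_iff)

text \<open>Separability: a multiple root would also be a root of the derivative, and an
  automorphism would carry this relation of smaller degree back to \<open>x\<close>.\<close>

lemma rpoly_minpoly_eq_prod:
  fixes x :: "'a::qbar"
  shows "rpoly (minpoly x) = (\<Prod>y\<in>conjs x. [:- y, 1:])"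
proof -
  let ?m = "rpoly (minpoly x) :: 'a poly"
  have lc: "lead_coeff ?m = 1" using minpoly_props(1)[of x] by simp
  obtain A where A: "?m = (\<Prod>y\<in>#A. [:- y, 1:])"
    using alg_closed_imp_factorization[of ?m] minpoly_nonzero lc by force
  have "poly ?m y = 0 \<longleftrightarrow> y \<in># A" for y
    unfolding A poly_prod_mset by (auto simp: prod_mset_zero_iff)
  hence sA: "set_mset A = conjs x" by (auto simp: conjs_roots)
  have "count A y = 1" if "y \<in> conjs x" for y
  proof (rule ccontr)
    assume c: "count A y \<noteq> 1"
    have "y \<in># A" using that sA by simp
    hence "count A y > 0" by simp
    hence c2: "count A y \<ge> 2" using c by linarith
    define A' where "A' = A - {#y, y#}"
    have "A = {#y, y#} + A'"
      unfolding A'_def using c2 by (intro multiset_eqI) auto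
    hence eq: "?m = [:- y, 1:] * ([:- y, 1:] * (\<Prod>y\<in>#A'. [:- y, 1:]))" unfolding A by simp
    have "poly (pderiv ?m) y = 0" unfolding eq pderiv_mult by simp
    obtain g where g: "field_hom g" "y = g x" using \<open>y \<in> conjs x\<close> by (auto simp: conjs_def auts_def)
    have "g (poly (rpoly (pderiv (minpoly x))) x) = 0"
      using \<open>poly (pderiv ?m) y = 0\<close> g by (simp add: field_hom_rpoly rpoly_pderiv[symmetric])
    hence "poly (rpoly (pderiv (minpoly x))) x = 0" using g by (simp add: field_hom_eq_0_iff)
    moreover have "pderiv (minpoly x) \<noteq> 0" using degree_minpoly_pos[of x] by (simp add: pderiv_eq_0_iff)
    ultimately have "degree (minpoly x) \<le> degree (pderiv (minpoly x))" by (rule minpoly_props(3)[rotated])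
    thus False using degree_minpoly_pos[of x] by (simp add: degree_pderiv)
  qed
  hence "A = mset_set (conjs x)"
    using sA finite_conjs[of x] by (intro multiset_eqI) (metis count_mset_set(1,3) not_in_iff)
  thus ?thesis using A by (simp add: prod_unfold_prod_mset)
qed

lemma degree_minpoly: "degree (minpoly (x::'a::qbar)) = card (conjs x)"
proof -
  have "degree (minpoly x) = degree (rpoly (minpoly x) :: 'a poly)" by simp
  also have "\<dots> = (\<Sum>y\<in>conjs x. degree [:- y, 1:])"
    unfolding rpoly_minpoly_eq_prod by (rule degree_prod_eq_sum_degree) auto
  finally show ?thesis by simp
qed

text \<open>Every element lies in the finite root set of its minimal polynomial, which an injective
  endomorphism permutes.\<close>

lemma auts_bij:
  assumes "g \<in> auts" shows "bij (g :: 'a::qbar \<Rightarrow> 'a)"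
proof -
  have h: "field_hom g" using assms by (simp add: auts_def)
  have "y \<in> range g" for y
  proof -
    let ?S = "{z. poly (rpoly (minpoly y)) z = 0}"
    have "finite ?S" by (rule poly_roots_finite) (simp add: minpoly_nonzero)
    moreover have "g ` ?S \<subseteq> ?S" using h by (auto simp: field_hom_rpoly[OF h, symmetric] field_hom_0)
    ultimately have "g ` ?S = ?S" using field_hom_inj[OF h]
      by (intro endo_inj_surj) (auto intro: inj_on_subset)
    moreover have "y \<in> ?S" using minpoly_props(2) by simp
    ultimately show ?thesis by auto
  qed
  thus ?thesis using field_hom_inj[OF h] by (auto simp: bij_def)
qed

lemma auts_inv: "g \<in> auts \<Longrightarrow> inv_into UNIV g \<in> auts"
proof -
  assume g: "g \<in> auts"
  have b: "bij g" using g by (rule auts_bij)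
  have h: "field_hom g" using g by (simp add: auts_def)
  have s: "g (inv_into UNIV g x) = x" for x using b by (simp add: bij_is_surj surj_f_inv_f)
  have i: "inv_into UNIV g (g x) = x" for x using b by (simp add: bij_is_inj)
  show ?thesis unfolding auts_def field_hom_def
  proof (intro CollectI conjI allI)
    show "inv_into UNIV g 1 = 1" using i[of 1] h by (simp add: field_hom_1)
    fix x y
    show "inv_into UNIV g (x + y) = inv_into UNIV g x + inv_into UNIV g y" using i[of "inv_into UNIV g x + inv_into UNIV g y"] h by (simp add: field_hom_add s)
    show "inv_into UNIV g (x * y) = inv_into UNIV g x * inv_into UNIV g y" using i[of "inv_into UNIV g x * inv_into UNIV g y"] h by (simp add: field_hom_mult s)
  qed
qed

lemma conjs_aut: "g \<in> auts \<Longrightarrow> conjs (g x) = conjs x"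
proof -
  assume g: "g \<in> auts"
  have 1: "conjs (h y) \<subseteq> conjs y" if h: "h \<in> auts" for h and y :: 'a
  proof
    fix z assume "z \<in> conjs (h y)"
    then obtain f where f: "f \<in> auts" "z = f (h y)" by (auto simp: conjs_def)
    thus "z \<in> conjs y" using conjsI[OF auts_comp[OF f(1) h], of y] by simp
  qed
  have "conjs x = conjs (inv_into UNIV g (g x))" using auts_bij[OF g] by (simp add: bij_is_inj)
  also have "\<dots> \<subseteq> conjs (g x)" by (rule 1[OF auts_inv[OF g]])
  finally show ?thesis using 1[OF g] by blast
qed

section \<open>Orbits of tuples and finite averages over automorphisms\<close>

definition list_orbit :: "'a::qbar list \<Rightarrow> 'a list set" where
  "list_orbit xs = (\<lambda>g. map g xs) ` auts"

lemma finite_list_orbit: "finite (list_orbit xs)"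
proof (rule finite_subset)
  show "list_orbit xs \<subseteq> {ys. set ys \<subseteq> (\<Union>x\<in>set xs. conjs x) \<and> length ys = length xs}"
    using conjsI by (fastforce simp: list_orbit_def)
  show "finite {ys. set ys \<subseteq> (\<Union>x\<in>set xs. conjs x) \<and> length ys = length xs}"
    by (rule finite_lists_length_eq) (auto intro: finite_conjs)
qed

lemma list_orbit_self: "xs \<in> list_orbit xs"
  using auts_id by (force simp: list_orbit_def)

lemma card_list_orbit_pos: "card (list_orbit xs) > 0"
  using list_orbit_self finite_list_orbit by (auto simp: card_gt_0_iff)

lemma list_orbit_singleton: "list_orbit [x] = (\<lambda>y. [y]) ` conjs x"
  by (auto simp: list_orbit_def conjs_def)

text \<open>A finite substitute for Haar measure on the Galois group, valid for all tuples from
  \<open>A\<close> at once: \<Gamma> contains one automorphism for each image of an enumeration of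
  \<open>A\<close>. Composition with an automorphism maps the fibre over one image of
  \<open>ks\<close> injectively into the fibre over another, so all fibres have the same size
  \<open>N ks\<close>.\<close>

lemma galois_average:
  assumes "finite (A :: 'a::qbar set)"
  obtains \<Gamma> where "finite \<Gamma>" "\<Gamma> \<noteq> {}" "\<Gamma> \<subseteq> auts"
    "\<And>ks (\<psi> :: 'a list \<Rightarrow> real). set ks \<subseteq> A \<Longrightarrow>
       (\<Sum>g\<in>\<Gamma>. \<psi> (map g ks)) / card \<Gamma> = (\<Sum>zs\<in>list_orbit ks. \<psi> zs) / card (list_orbit ks)"
proof -
  obtain xs where xs: "set xs = A" using assms finite_list by blast
  have "\<forall>ys\<in>list_orbit xs. \<exists>g. g \<in> auts \<and> map g xs = ys" by (auto simp: list_orbit_def)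
  then obtain h where h: "\<And>ys. ys \<in> list_orbit xs \<Longrightarrow> h ys \<in> auts \<and> map (h ys) xs = ys"
    by metis
  have inj: "inj_on h (list_orbit xs)" using h by (metis inj_onI)
  define \<Gamma> where "\<Gamma> = h ` list_orbit xs"
  show ?thesis
  proof (rule that)
    show "finite \<Gamma>" "\<Gamma> \<noteq> {}" "\<Gamma> \<subseteq> auts"
      using finite_list_orbit list_orbit_self h by (auto simp: \<Gamma>_def)
    fix ks and \<psi> :: "'a list \<Rightarrow> real" assume ks: "set ks \<subseteq> A"
    define N where "N zs = card {ys \<in> list_orbit xs. map (h ys) ks = zs}" for zs
    \<comment> \<open>The representative of \<open>map g ys\<close> need not be \<open>g\<close>
      composed with the representative of \<open>ys\<close>, but the two act alike on
      \<open>A\<close> and hence on \<open>ks\<close>.\<close>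
    have step: "map g ys \<in> list_orbit xs \<and> map (h (map g ys)) ks = map g (map (h ys) ks)"
      if "g \<in> auts" "ys \<in> list_orbit xs" for g ys
    proof -
      have 1: "map g ys \<in> list_orbit xs" using that auts_comp by (force simp: list_orbit_def)
      hence "map (h (map g ys)) xs = map (g \<circ> h ys) xs" using h[OF 1] h[OF that(2)]
        by (metis map_map)
      hence "\<forall>x\<in>A. h (map g ys) x = (g \<circ> h ys) x" using xs by (metis map_eq_conv)
      thus ?thesis using 1 ks by auto
    qed
    have le: "N zs \<le> N (map g zs)" if g: "g \<in> auts" for g zs
      unfolding N_def
    proof (rule card_inj_on_le)
      show "inj_on (map g) {ys \<in> list_orbit xs. map (h ys) ks = zs}"
        using auts_bij[OF g] by (meson bij_is_inj inj_mapI inj_on_subset subset_UNIV)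
      show "map g ` {ys \<in> list_orbit xs. map (h ys) ks = zs}
        \<subseteq> {ys \<in> list_orbit xs. map (h ys) ks = map g zs}" using step[OF g] by auto
    qed (use finite_list_orbit[of xs] in simp)
    have N: "N zs = N ks" if "zs \<in> list_orbit ks" for zs
    proof -
      from that obtain g where g: "g \<in> auts" "zs = map g ks" by (auto simp: list_orbit_def)
      have "map (inv_into UNIV g) zs = ks" using auts_bij[OF g(1)] g(2) by (simp add: bij_is_inj)
      thus ?thesis using le[OF g(1), of ks] le[OF auts_inv[OF g(1)], of zs] g(2) by simp
    qed
    have img: "(\<lambda>ys. map (h ys) ks) ` list_orbit xs \<subseteq> list_orbit ks"
      using h by (auto simp: list_orbit_def)
    have key: "(\<Sum>g\<in>\<Gamma>. f (map g ks)) = N ks * (\<Sum>zs\<in>list_orbit ks. f zs)" for f :: "'a list \<Rightarrow> real"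
    proof -
      have "(\<Sum>g\<in>\<Gamma>. f (map g ks)) = (\<Sum>ys\<in>list_orbit xs. f (map (h ys) ks))"
        unfolding \<Gamma>_def by (subst sum.reindex[OF inj]) simp
      also have "\<dots> = (\<Sum>zs\<in>list_orbit ks. \<Sum>ys\<in>{ys \<in> list_orbit xs. map (h ys) ks = zs}. f (map (h ys) ks))"
        by (rule sum.group[OF finite_list_orbit finite_list_orbit img, symmetric])
      also have "\<dots> = (\<Sum>zs\<in>list_orbit ks. N zs * f zs)"
        by (intro sum.cong) (auto simp: N_def)
      finally show ?thesis using N by (simp add: sum_distrib_left)
    qed
    have "real (card \<Gamma>) = real (N ks * card (list_orbit ks))" using key[of "\<lambda>_. 1"] by simp
    hence c: "card \<Gamma> = N ks * card (list_orbit ks)" by (simp only: of_nat_eq_iff)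
    have "card \<Gamma> > 0" using finite_list_orbit list_orbit_self by (auto simp: \<Gamma>_def card_gt_0_iff)
    thus "(\<Sum>g\<in>\<Gamma>. \<psi> (map g ks)) / card \<Gamma> = (\<Sum>zs\<in>list_orbit ks. \<psi> zs) / card (list_orbit ks)"
      unfolding c key[of \<psi>] by (simp add: field_simps)
  qed
qed

section \<open>The field generated by one element, its degree and its complex embeddings\<close>

lemma rat_adjoin_eq: "rat_adjoin (x::'a::qbar) = range (\<lambda>q. poly (rpoly q) x)"
proof -
  let ?F = "range (\<lambda>q. poly (rpoly q) x)"
  have FI: "poly (rpoly q) x \<in> ?F" for q by blast
  \<comment> \<open>The constant term of the minimal polynomial of a nonzero \<open>u\<close> does
    not vanish; dividing the relation by it exhibits \<open>inverse u\<close> as a polynomial in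
    \<open>u\<close>, hence in \<open>x\<close>.\<close>
  have invs: "inverse u \<in> ?F" if u: "u \<in> ?F" for u
  proof (cases "u = 0")
    case False
    obtain q where q: "u = poly (rpoly q) x" using u by auto
    define m where "m = minpoly u"
    obtain c m' where m': "m = pCons c m'" by (cases m)
    have r: "of_rat c + u * poly (rpoly m') u = 0"
      using minpoly_props(2)[of u] m' by (simp add: m_def map_poly_pCons)
    have "c \<noteq> 0"
    proof
      assume "c = 0"
      hence "poly (rpoly m') u = 0" using r False by simp
      moreover have "m' \<noteq> 0" using m' \<open>c = 0\<close> minpoly_nonzero[of u] by (auto simp: m_def)
      ultimately have "degree m \<le> degree m'" using minpoly_props(3) by (auto simp: m_def)
      thus False using m' \<open>m' \<noteq> 0\<close> by simp
    qed
    hence "inverse u = - poly (rpoly m') u / of_rat c"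
      using r False by (simp add: field_simps eq_neg_iff_add_eq_0)
    also have "\<dots> = poly (rpoly (smult (- 1 / c) (pcompose m' q))) x"
    proof -
      have "poly (rpoly (pcompose m' q)) x = poly (rpoly m') u"
        unfolding q by (induction m') (auto simp: pcompose_pCons map_poly_pCons)
      thus ?thesis by (simp add: of_rat_divide of_rat_minus)
    qed
    finally show ?thesis by blast
  qed (use FI[of 0] in simp)
  have "is_subfield ?F" unfolding is_subfield_def
  proof (intro conjI ballI)
    show "0 \<in> ?F" "1 \<in> ?F" using FI[of 0] FI[of 1] by simp_all
    fix u w assume "u \<in> ?F" "w \<in> ?F"
    then obtain p q where "u = poly (rpoly p) x" "w = poly (rpoly q) x" by auto
    thus "u - w \<in> ?F" "u * w \<in> ?F" using FI[of "p - q"] FI[of "p * q"] by simp_all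
  qed (rule invs)
  moreover have "x \<in> ?F" using FI[of "monom 1 1"] by (simp add: poly_monom)
  moreover have "?F \<subseteq> L" if L: "is_subfield L" "x \<in> L" for L
  proof -
    have d: "u - w \<in> L" and m: "u * w \<in> L" if "u \<in> L" "w \<in> L" for u w
      using L that by (auto simp: is_subfield_def)
    have z: "0 \<in> L" "1 \<in> L" and iv: "u \<in> L \<Longrightarrow> inverse u \<in> L" for u
      using L by (auto simp: is_subfield_def)
    have a: "u + w \<in> L" if "u \<in> L" "w \<in> L" for u w
      using d[OF that(1) d[OF z(1) that(2)]] by simp
    have n: "of_nat k \<in> L" for k by (induction k) (auto intro: z a)
    have i: "of_int k \<in> L" for k
      by (cases k) (use n d[OF z(1) n] in \<open>auto simp del: of_nat_Suc\<close>)
    have r: "of_rat k \<in> L" for k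
      by (cases k) (use m[OF i iv[OF i]] in \<open>auto simp: of_rat_rat field_class.field_divide_inverse\<close>)
    have "poly (rpoly q) x \<in> L" for q
      by (induction q) (auto simp: map_poly_pCons intro!: z a m r L(2))
    thus ?thesis by auto
  qed
  ultimately show ?thesis unfolding rat_adjoin_def by blast
qed

lemma is_subfield_rat_adjoin: "is_subfield (rat_adjoin x)"
  unfolding rat_adjoin_def is_subfield_def by auto

lemma rpoly_low_degree_zero:
  assumes "poly (rpoly q) (x::'a::qbar) = 0" "degree q < card (conjs x)" shows "q = 0"
  using minpoly_props(3)[of q x] assms degree_minpoly[of x] by fastforce

lemma degree_over_rat_adjoin: "degree_over_rat (rat_adjoin (x::'a::qbar)) = card (conjs x)"
proof -
  interpret vector_space "\<lambda>(q::rat) (x::'a). of_rat q * x" by (rule rat_vector_space)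
  define n where "n = card (conjs x)"
  define B where "B = (\<lambda>i. x ^ i) ` {..<n}"
  have e: "poly (rpoly (\<Sum>i<n. monom (c i) i)) x = (\<Sum>i<n. of_rat (c i) * x ^ i)" for c
    by (induction n) (auto simp: poly_monom)
  have z: "c i = 0" if "(\<Sum>i<n. of_rat (c i) * x ^ i) = 0" "i < n" for c i
  proof -
    have "degree (\<Sum>i<n. monom (c i) i) < n"
      using that(2) by (intro degree_sum_less) (auto intro: le_less_trans[OF degree_monom_le])
    hence "(\<Sum>i<n. monom (c i) i) = 0" using rpoly_low_degree_zero[of _ x] e[of c] that by (simp add: n_def)
    hence "coeff (\<Sum>i<n. monom (c i) i) i = 0" by simp
    thus ?thesis using that(2) by (simp add: coeff_sum)
  qed
  have inj: "inj_on (\<lambda>i. x ^ i) {..<n}"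
  proof (rule inj_onI, rule ccontr)
    fix i j assume ij: "i \<in> {..<n}" "j \<in> {..<n}" "x ^ i = x ^ j" "i \<noteq> j"
    let ?c = "\<lambda>k. if k = i then 1 else if k = j then - 1 else (0::rat)"
    have "(\<Sum>k<n. of_rat (?c k) * x ^ k) = (\<Sum>k<n. (if k = i then x ^ i else 0) + (if k = j then - (x ^ j) else 0))"
      using ij(4) by (intro sum.cong) (auto simp: of_rat_minus)
    also have "\<dots> = 0" using ij by (simp add: sum.distrib)
    finally have "?c i = 0" using ij by (intro z) auto
    thus False by simp
  qed
  have "degree_over_rat (rat_adjoin x) = dim (rat_adjoin x)" by (simp add: degree_over_rat_def)
  also have "\<dots> = n"
  proof (rule dim_unique)
    show "B \<subseteq> rat_adjoin x"
    proof
      fix b assume "b \<in> B"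
      then obtain i where "b = poly (rpoly (monom 1 i)) x" by (auto simp: B_def poly_monom)
      thus "b \<in> rat_adjoin x" unfolding rat_adjoin_eq by blast
    qed
    show "rat_adjoin x \<subseteq> span B"
    proof
      fix u assume "u \<in> rat_adjoin x"
      then obtain q where q: "u = poly (rpoly q) x" by (auto simp: rat_adjoin_eq)
      define r where "r = q mod minpoly x"
      have "(rpoly q :: 'a poly) = rpoly (q div minpoly x * minpoly x + r)" by (simp add: r_def)
      hence u: "u = poly (rpoly r) x" using q minpoly_props(2)[of x] unfolding rpoly_simps by simp
      have "degree r < n"
        using degree_mod_less[OF minpoly_nonzero[of x], of q] degree_minpoly[of x] card_conjs_pos[of x]
        by (auto simp: r_def n_def)
      hence "u = (\<Sum>i<n. of_rat (coeff r i) * x ^ i)"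
        unfolding u poly_altdef by (intro sum.mono_neutral_cong_left) (auto simp: coeff_eq_0)
      also have "\<dots> \<in> span B" by (intro span_sum span_scale span_base) (auto simp: B_def)
      finally show "u \<in> span B" .
    qed
    show "independent B"
    proof (rule ccontr)
      assume "\<not> independent B"
      then obtain u where u: "\<exists>v\<in>B. u v \<noteq> 0" "(\<Sum>v\<in>B. of_rat (u v) * v) = 0"
        using dependent_finite[of B] by (auto simp: B_def)
      have "(\<Sum>i<n. of_rat (u (x ^ i)) * x ^ i) = 0"
        using u(2) unfolding B_def by (subst (asm) sum.reindex[OF inj]) simp
      thus False using z[of "\<lambda>i. u (x ^ i)"] u(1) by (auto simp: B_def)
    qed
    show "card B = n" unfolding B_def using card_image[OF inj] by simp
  qed
  finally show ?thesis by (simp add: n_def)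
qed

text \<open>An embedding is determined by its value at \<open>x\<close>, which is a root of the
  minimal polynomial and thus the image under \<iota> of a conjugate. This turns the archimedean
  part of the height into a sum over conjugates for one fixed \<iota>.\<close>

lemma sum_complex_embeddings:
  fixes x :: "'a::qbar"
  assumes \<iota>: "field_hom (\<iota> :: 'a \<Rightarrow> complex)"
  shows "(\<Sum>\<sigma>\<in>complex_embeddings (rat_adjoin x). f (\<sigma> x)) = (\<Sum>y\<in>conjs x. f (\<iota> y))"
proof -
  let ?F = "rat_adjoin x"
  let ?E = "complex_embeddings ?F"
  have x: "x \<in> ?F" by (auto simp: rat_adjoin_def)
  have F0: "0 \<in> ?F" "1 \<in> ?F" and Fd: "u - w \<in> ?F" and Fm: "u * w \<in> ?F" and Fi: "inverse u \<in> ?F"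
    if "u \<in> ?F" "w \<in> ?F" for u w
    using is_subfield_rat_adjoin[of x] that by (auto simp: is_subfield_def)
  have rF: "poly (rpoly q) x \<in> ?F" for q unfolding rat_adjoin_eq by blast
  have ev: "\<sigma> (poly (rpoly q) x) = poly (rpoly q) (\<sigma> x)" if s: "\<sigma> \<in> ?E" for \<sigma> q
  proof -
    have s1: "\<sigma> 1 = 1" and sa: "\<And>u w. u \<in> ?F \<Longrightarrow> w \<in> ?F \<Longrightarrow> \<sigma> (u + w) = \<sigma> u + \<sigma> w"
      and sm: "\<And>u w. u \<in> ?F \<Longrightarrow> w \<in> ?F \<Longrightarrow> \<sigma> (u * w) = \<sigma> u * \<sigma> w"
      using s by (auto simp: complex_embeddings_def)
    have rat: "of_rat r \<in> ?F" for r using rF[of "[:r:]"] by (simp add: map_poly_pCons)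
    have nat: "of_nat k \<in> ?F" for k using rat[of "of_nat k"] by simp
    have int: "of_int k \<in> ?F" for k using rat[of "of_int k"] by simp
    have s0: "\<sigma> 0 = 0" using sa[of 0 0] F0(1)[OF x x] by simp
    have sn: "\<sigma> (of_nat k) = of_nat k" for k
      by (induction k) (auto simp: s0 s1 sa nat F0[OF x x])
    have si: "\<sigma> (of_int k) = of_int k" for k
    proof (cases k)
      case (neg m)
      have "of_int k + of_nat (Suc m) = (0::'a)" using neg by simp
      hence "\<sigma> (of_int k) + of_nat (Suc m) = 0" using sa[OF int nat, of k "Suc m"] by (simp only: sn s0)
      hence "\<sigma> (of_int k) = - of_nat (Suc m)" by (simp only: eq_neg_iff_add_eq_0)
      also have "\<dots> = of_int k" using neg by simp
      finally show ?thesis .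
    qed (use sn in auto)
    have sr: "\<sigma> (of_rat r) = of_rat r" for r
    proof (cases r)
      case (Fract a b)
      have "(of_rat r :: 'a) * of_int b = of_int a" using Fract by (simp add: of_rat_rat)
      hence "\<sigma> (of_rat r) * of_int b = of_int a" by (metis int rat si sm)
      thus ?thesis using Fract by (simp add: of_rat_rat field_simps)
    qed
    show ?thesis
    proof (induction q)
      case (pCons c q)
      have "\<sigma> (poly (rpoly (pCons c q)) x) = \<sigma> (of_rat c + x * poly (rpoly q) x)"
        by (simp add: map_poly_pCons)
      also have "\<dots> = of_rat c + \<sigma> x * poly (rpoly q) (\<sigma> x)"
        by (subst sa) (auto simp: rat Fm x rF sr sm pCons.IH)
      finally show ?case by (simp add: map_poly_pCons)
    qed (simp add: s0)
  qed
  have inj: "inj_on (\<lambda>\<sigma>. \<sigma> x) ?E"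
  proof (rule inj_onI)
    fix \<sigma> \<tau> assume st: "\<sigma> \<in> ?E" "\<tau> \<in> ?E" "\<sigma> x = \<tau> x"
    show "\<sigma> = \<tau>"
    proof (rule extensionalityI[where A = ?F])
      show "\<sigma> \<in> extensional ?F" "\<tau> \<in> extensional ?F" using st by (auto simp: complex_embeddings_def)
      fix u assume "u \<in> ?F"
      then obtain q where "u = poly (rpoly q) x" by (auto simp: rat_adjoin_eq)
      thus "\<sigma> u = \<tau> u" using ev[OF st(1)] ev[OF st(2)] st(3) by simp
    qed
  qed
  have img: "(\<lambda>\<sigma>. \<sigma> x) ` ?E = \<iota> ` conjs x"
  proof (intro equalityI subsetI)
    fix z assume "z \<in> (\<lambda>\<sigma>. \<sigma> x) ` ?E"
    then obtain \<sigma> where s: "\<sigma> \<in> ?E" "z = \<sigma> x" by auto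
    have s0: "\<sigma> 0 = 0" using ev[OF s(1), of 0] by simp
    have "poly (rpoly (minpoly x)) z = \<sigma> (poly (rpoly (minpoly x)) x)" using ev s by simp
    also have "\<dots> = 0" using minpoly_props(2)[of x] s0 by simp
    finally have "poly (rpoly (minpoly x)) z = 0" .
    moreover have "rpoly (minpoly x) = map_poly \<iota> (rpoly (minpoly x))"
      by (intro poly_eqI) (simp add: coeff_map_poly field_hom_0[OF \<iota>] field_hom_of_rat[OF \<iota>])
    moreover have "map_poly \<iota> (\<Prod>y\<in>A. [:- y, 1:]) = (\<Prod>y\<in>A. [:- \<iota> y, 1:])" for A
      by (induction A rule: infinite_finite_induct)
        (auto simp del: mult_pCons_left simp: field_hom_map_poly_mult[OF \<iota>] map_poly_pCons field_hom_0[OF \<iota>] field_hom_1[OF \<iota>] field_hom_uminus[OF \<iota>])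
    ultimately have "(\<Prod>y\<in>conjs x. z - \<iota> y) = 0"
      by (simp add: rpoly_minpoly_eq_prod poly_prod)
    thus "z \<in> \<iota> ` conjs x" using finite_conjs[of x] by (auto simp: prod_zero_iff)
  next
    fix z assume "z \<in> \<iota> ` conjs x"
    then obtain g where g: "g \<in> auts" "z = \<iota> (g x)" by (auto simp: conjs_def)
    have h: "field_hom g" using g by (simp add: auts_def)
    have Fa: "u + w \<in> ?F" if "u \<in> ?F" "w \<in> ?F" for u w
      using Fd[OF that(1) Fd[OF F0(1)[OF x x] that(2)]] that F0(1)[OF x x] by simp
    have "restrict (\<iota> \<circ> g) ?F \<in> ?E" unfolding complex_embeddings_def
      using F0[OF x x] Fa Fm h \<iota>
      by (auto simp: field_hom_1 field_hom_add field_hom_mult)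
    thus "z \<in> (\<lambda>\<sigma>. \<sigma> x) ` ?E" using x g by (intro image_eqI[of _ _ "restrict (\<iota> \<circ> g) ?F"]) auto
  qed
  have "(\<Sum>\<sigma>\<in>?E. f (\<sigma> x)) = (\<Sum>z\<in>\<iota> ` conjs x. f z)"
    unfolding img[symmetric] by (subst sum.reindex[OF inj]) simp
  also have "\<dots> = (\<Sum>y\<in>conjs x. f (\<iota> y))"
    by (subst sum.reindex) (use field_hom_inj[OF \<iota>] in \<open>auto intro: inj_on_subset\<close>)
  finally show ?thesis .
qed

section \<open>Extension of non-archimedean absolute values\<close>

lemma is_subfield_closed:
  assumes "is_subfield F"
  shows "0 \<in> F" "1 \<in> F" "\<And>x y. x \<in> F \<Longrightarrow> y \<in> F \<Longrightarrow> x - y \<in> F"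
    "\<And>x y. x \<in> F \<Longrightarrow> y \<in> F \<Longrightarrow> x + y \<in> F" "\<And>x y. x \<in> F \<Longrightarrow> y \<in> F \<Longrightarrow> x * y \<in> F"
    "\<And>x. x \<in> F \<Longrightarrow> - x \<in> F" "\<And>x. x \<in> F \<Longrightarrow> inverse x \<in> F"
    "\<And>x y. x \<in> F \<Longrightarrow> y \<in> F \<Longrightarrow> x / y \<in> F" "\<And>x n. x \<in> F \<Longrightarrow> x ^ n \<in> F"
proof -
  show d: "0 \<in> F" "1 \<in> F" "\<And>x y. x \<in> F \<Longrightarrow> y \<in> F \<Longrightarrow> x - y \<in> F"
    "\<And>x y. x \<in> F \<Longrightarrow> y \<in> F \<Longrightarrow> x * y \<in> F" "\<And>x. x \<in> F \<Longrightarrow> inverse x \<in> F"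
    using assms by (auto simp: is_subfield_def)
  show "\<And>x. x \<in> F \<Longrightarrow> - x \<in> F" using d(3)[OF d(1)] by simp
  show "\<And>x y. x \<in> F \<Longrightarrow> y \<in> F \<Longrightarrow> x + y \<in> F" using d(3)[OF _ d(3)[OF d(1)]] by simp
  show "\<And>x y. x \<in> F \<Longrightarrow> y \<in> F \<Longrightarrow> x / y \<in> F"
    using d(4,5) by (simp add: field_class.field_divide_inverse)
  show "x ^ n \<in> F" if "x \<in> F" for x n using that by (induction n) (auto intro: d)
qed

lemma is_subfield_of_int:
  assumes "is_subfield (F :: 'a::field_char_0 set)" shows "of_int k \<in> F"
proof -
  have n: "of_nat m \<in> F" for m by (induction m) (auto intro: is_subfield_closed[OF assms])
  show ?thesis
    by (cases k) (use n is_subfield_closed(6)[OF assms n] in \<open>auto simp del: of_nat_Suc\<close>)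
qed

lemma is_subfield_of_rat:
  assumes "is_subfield (F :: 'a::field_char_0 set)" shows "of_rat k \<in> F"
  by (cases k) (auto simp: of_rat_rat intro!: is_subfield_closed(8)[OF assms] is_subfield_of_int[OF assms])

lemma nonarch_abs_onD:
  assumes "nonarch_abs_on F w" "x \<in> F"
  shows "w x \<ge> 0" "w x = 0 \<longleftrightarrow> x = 0" "y \<in> F \<Longrightarrow> w (x * y) = w x * w y"
    "y \<in> F \<Longrightarrow> w (x + y) \<le> max (w x) (w y)" "x \<noteq> 0 \<Longrightarrow> w x > 0"
  using assms by (auto simp: nonarch_abs_on_def order_less_le)

lemma nonarch_abs_on_more:
  assumes w: "nonarch_abs_on F w" and F: "is_subfield F"
  shows "w 0 = 0" "w 1 = 1" "\<And>x. x \<in> F \<Longrightarrow> w (- x) = w x"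
    "\<And>x. x \<in> F \<Longrightarrow> w (inverse x) = inverse (w x)"
    "\<And>x y. x \<in> F \<Longrightarrow> y \<in> F \<Longrightarrow> w (x / y) = w x / w y"
    "\<And>x n. x \<in> F \<Longrightarrow> w (x ^ n) = w x ^ n"
    "\<And>x y. x \<in> F \<Longrightarrow> y \<in> F \<Longrightarrow> w (x - y) \<le> max (w x) (w y)"
    "\<And>x y. x \<in> F \<Longrightarrow> y \<in> F \<Longrightarrow> w x < w y \<Longrightarrow> w (x + y) = w y"
    "\<And>x y. x \<in> F \<Longrightarrow> y \<in> F \<Longrightarrow> w x < w y \<Longrightarrow> w (x - y) = w y"
proof -
  note c = is_subfield_closed[OF F]
  note D = nonarch_abs_onD[OF w]
  show w0: "w 0 = 0" using D(2)[OF c(1)] by simp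
  have "w 1 * w 1 = w 1" using D(3)[OF c(2) c(2)] by simp
  thus w1: "w 1 = 1" using D(2)[OF c(2)] by simp
  have "w (-1) * w (-1) = 1" using D(3)[OF c(6)[OF c(2)] c(6)[OF c(2)]] w1 by simp
  hence "(w (-1))\<^sup>2 = 1" by (simp add: power2_eq_square)
  hence m1: "w (-1) = 1" using D(1)[OF c(6)[OF c(2)]] by (auto simp: power2_eq_1_iff)
  show mn: "w (- x) = w x" if "x \<in> F" for x
    using D(3)[OF c(6)[OF c(2)] that] m1 by simp
  show iv: "w (inverse x) = inverse (w x)" if x: "x \<in> F" for x
  proof (cases "x = 0")
    case False
    have "w x * w (inverse x) = 1" using D(3)[OF x c(7)[OF x]] False w1 by simp
    thus ?thesis by (simp add: inverse_unique)
  qed (simp add: w0)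
  show "w (x / y) = w x / w y" if "x \<in> F" "y \<in> F" for x y
    using D(3)[OF that(1) c(7)[OF that(2)]] iv[OF that(2)] by (simp add: field_class.field_divide_inverse)
  show "w (x ^ n) = w x ^ n" if "x \<in> F" for x n
    using that by (induction n) (auto simp: w1 D(3) c(9))
  show df: "w (x - y) \<le> max (w x) (w y)" if "x \<in> F" "y \<in> F" for x y
    using D(4)[OF that(1) c(6)[OF that(2)]] mn[OF that(2)] by simp
  show ad: "w (x + y) = w y" if xy: "x \<in> F" "y \<in> F" "w x < w y" for x y
    using D(4)[OF xy(1,2)] df[OF c(4)[OF xy(1,2)] xy(1)] xy(3) by simp
  show "w (x - y) = w y" if "x \<in> F" "y \<in> F" "w x < w y" for x y
    using ad[OF that(1) c(6)[OF that(2)]] mn[OF that(2)] that(3) by simp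
qed

text \<open>Leaving out \<open>inverse t\<close> keeps \<open>t\<close> a non-unit. With
  \<open>w t < 1\<close> and \<open>R\<close> the unit ball of \<open>F\<close>, this also prevents
  the ring from meeting \<open>F\<close> outside that ball.\<close>

definition subring_over :: "'a::Fields.field set \<Rightarrow> 'a \<Rightarrow> 'a set \<Rightarrow> bool" where
  "subring_over R t A \<longleftrightarrow> R \<subseteq> A \<and> 1 \<in> A \<and> (\<forall>x\<in>A. \<forall>y\<in>A. x - y \<in> A \<and> x * y \<in> A) \<and> inverse t \<notin> A"

lemma subring_over_maximal:
  assumes "subring_over R t A0"
  obtains A where "subring_over R t A" "\<And>A'. subring_over R t A' \<Longrightarrow> A \<subseteq> A' \<Longrightarrow> A' = A"
proof -
  have "\<exists>M\<in>Collect (subring_over R t). (\<forall>Y\<in>Collect (subring_over R t). M \<subseteq> Y \<longrightarrow> Y = M)"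
  proof (rule subset_Zorn_nonempty)
    show "Collect (subring_over R t) \<noteq> {}" using assms by auto
    fix C assume C: "C \<noteq> {}" "subset.chain (Collect (subring_over R t)) C"
    have CA: "subring_over R t Y" if "Y \<in> C" for Y using C that by (auto simp: subset.chain_def)
    have two: "\<exists>Y\<in>C. u \<in> Y \<and> w \<in> Y" if "u \<in> \<Union>C" "w \<in> \<Union>C" for u w
    proof -
      from that obtain Y Z where "Y \<in> C" "Z \<in> C" "u \<in> Y" "w \<in> Z" by blast
      moreover from this have "Y \<subseteq> Z \<or> Z \<subseteq> Y" using C(2) by (auto simp: subset_chain_def)
      ultimately show ?thesis by blast
    qed
    have "subring_over R t (\<Union>C)" unfolding subring_over_def
    proof (intro conjI ballI)
      show "R \<subseteq> \<Union>C" "1 \<in> \<Union>C" "inverse t \<notin> \<Union>C"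
        using C(1) CA unfolding subring_over_def by blast+
      fix x y assume "x \<in> \<Union>C" "y \<in> \<Union>C"
      then obtain Y where Y: "Y \<in> C" "x \<in> Y" "y \<in> Y" using two by metis
      hence "x - y \<in> Y" "x * y \<in> Y" using CA[OF Y(1)] unfolding subring_over_def by blast+
      thus "x - y \<in> \<Union>C" "x * y \<in> \<Union>C" using Y(1) by blast+
    qed
    thus "\<Union>C \<in> Collect (subring_over R t)" by simp
  qed
  thus ?thesis using that by blast
qed

text \<open>
  A subring maximal among those omitting \<open>inverse t\<close> is a valuation ring: if neither \<open>x\<close> nor
  \<open>inverse x\<close> could be adjoined, the two resulting representations of \<open>inverse t\<close> would shorten
  each other.
\<close>

lemma maximal_subring_valuation:
  assumes A: "subring_over R t A" and max: "\<And>A'. subring_over R t A' \<Longrightarrow> A \<subseteq> A' \<Longrightarrow> A' = A"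
    and t: "t \<in> A" "t \<noteq> 0"
  shows "x \<in> A \<or> inverse x \<in> A"
proof (rule ccontr)
  assume nx: "\<not> (x \<in> A \<or> inverse x \<in> A)"
  have d: "a - b \<in> A" and m: "a * b \<in> A" if "a \<in> A" "b \<in> A" for a b
    using A that by (auto simp: subring_over_def)
  have one: "1 \<in> A" and zero: "0 \<in> A" using A d[of 1 1] by (auto simp: subring_over_def)
  have ad: "a + b \<in> A" if "a \<in> A" "b \<in> A" for a b
    using d[OF that(1) d[OF zero that(2)]] by simp
  have sm: "sum f I \<in> A" if "\<And>i. i \<in> I \<Longrightarrow> f i \<in> A" for f I
    using that by (induction I rule: infinite_finite_induct) (auto intro: zero ad)
  have x0: "x \<noteq> 0" using nx zero by auto
  define P where "P = (\<lambda>x n. \<exists>a. (\<forall>i. a i \<in> A) \<and> 1 = t * (\<Sum>i\<le>n. a i * x ^ i))"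
  have ex: "\<exists>n. P y n" if y: "y \<notin> A" for y
  proof -
    define A' where "A' = {\<Sum>i\<le>degree Q. coeff Q i * y ^ i |Q. \<forall>i. coeff Q i \<in> A}"
    have A'_eq: "A' = {poly Q y |Q. \<forall>i. coeff Q i \<in> A}" by (simp add: A'_def poly_altdef)
    have A'I: "poly Q y \<in> A'" if "\<forall>i. coeff Q i \<in> A" for Q using that by (auto simp: A'_eq)
    have sub: "A \<subseteq> A'"
    proof
      fix a assume "a \<in> A"
      thus "a \<in> A'" using A'I[of "[:a:]"] zero by (auto simp: coeff_pCons split: nat.splits)
    qed
    have "y \<in> A'" using A'I[of "[:0,1:]"] zero one by (auto simp: coeff_pCons split: nat.splits)
    have "\<not> subring_over R t A'" using max[OF _ sub] \<open>y \<in> A'\<close> y by auto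
    moreover have "u - w \<in> A' \<and> u * w \<in> A'" if uw: "u \<in> A'" "w \<in> A'" for u w
    proof -
      from uw obtain P Q where "u = poly P y" "w = poly Q y" "\<forall>i. coeff P i \<in> A" "\<forall>i. coeff Q i \<in> A"
        by (auto simp: A'_eq)
      thus ?thesis using A'I[of "P - Q"] A'I[of "P * Q"]
        by (auto simp: coeff_mult intro!: d m sm)
    qed
    moreover have "R \<subseteq> A'" "1 \<in> A'" using A sub one by (auto simp: subring_over_def)
    ultimately have "inverse t \<in> A'" by (auto simp: subring_over_def)
    then obtain Q where Q: "\<forall>i. coeff Q i \<in> A" "inverse t = (\<Sum>i\<le>degree Q. coeff Q i * y ^ i)"
      by (auto simp: A'_def)
    hence "1 = t * (\<Sum>i\<le>degree Q. coeff Q i * y ^ i)" using t by (metis right_inverse)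
    thus ?thesis using Q(1) unfolding P_def by (intro exI[of _ "degree Q"] exI[of _ "coeff Q"]) auto
  qed
  have P0: "\<not> P y 0" for y
  proof
    assume "P y 0"
    then obtain a where "a \<in> A" "1 = t * a" by (auto simp: P_def)
    thus False using A t by (auto simp: subring_over_def inverse_unique)
  qed
  have mono: "P y n" if "P y k" "k \<le> n" for y k n
  proof -
    from that obtain a where a: "\<forall>i. a i \<in> A" "1 = t * (\<Sum>i\<le>k. a i * y ^ i)" by (auto simp: P_def)
    have "(\<Sum>i\<le>k. a i * y ^ i) = (\<Sum>i\<le>n. (if i \<le> k then a i else 0) * y ^ i)"
      using that(2) by (intro sum.mono_neutral_cong_left) auto
    thus ?thesis unfolding P_def using a zero by (intro exI[of _ "\<lambda>i. if i \<le> k then a i else 0"]) auto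
  qed
  \<comment> \<open>The relation in \<open>inverse y\<close>, multiplied by \<open>y ^ N\<close>,
    expresses \<open>(1 - t * b 0) * y ^ N\<close> through lower powers. Multiplying the relation in
    \<open>y\<close> by \<open>1 - t * b 0\<close> therefore allows its top term to be
    removed.\<close>
  have red: "P y n" if y: "y \<noteq> 0" and p: "P y (Suc n)" "P (inverse y) (Suc n)" for y n
  proof -
    from p(1) obtain a where a: "\<And>i. a i \<in> A" "1 = t * (\<Sum>i\<le>Suc n. a i * y ^ i)" by (auto simp: P_def)
    from p(2) obtain b where b: "\<And>i. b i \<in> A" "1 = t * (\<Sum>i\<le>Suc n. b i * inverse y ^ i)" by (auto simp: P_def)
    define N where "N = Suc n"
    define s where "s = (\<Sum>i\<le>n. a i * y ^ i)"
    define r where "r = (\<Sum>i\<le>n. b (N - i) * y ^ i)"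
    have "y ^ N = t * (\<Sum>i\<le>N. b i * inverse y ^ i) * y ^ N"
      using b(2)[folded N_def] by (metis mult_1_left)
    also have "\<dots> = t * (\<Sum>i\<le>N. b i * (inverse y ^ i * y ^ N))"
      by (simp only: mult.assoc sum_distrib_right)
    also have "(\<Sum>i\<le>N. b i * (inverse y ^ i * y ^ N)) = (\<Sum>i\<le>N. b i * y ^ (N - i))"
      using y by (intro sum.cong) (auto simp: power_diff field_simps)
    also have "\<dots> = (\<Sum>i\<le>N. b (N - i) * y ^ i)"
      using sum.atLeastAtMost_rev[of "\<lambda>i. b i * y ^ (N - i)" 0 N] by (simp add: atLeast0AtMost)
    also have "\<dots> = r + b 0 * y ^ N" by (simp add: N_def r_def)
    finally have e1: "y ^ N = t * (r + b 0 * y ^ N)" .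
    have e2: "1 = t * (s + a N * y ^ N)" using a(2) by (simp add: s_def N_def)
    have "1 = t * (b 0 + (1 - t * b 0) * s + t * a N * r)"
    proof -
      have "(1 - t * b 0) * y ^ N = t * r" using e1 by (simp add: algebra_simps)
      moreover have "(1 - t * b 0) * (t * (s + a N * y ^ N)) = (1 - t * b 0) * (t * s) + t * a N * ((1 - t * b 0) * y ^ N)"
        by (simp add: algebra_simps)
      ultimately have "1 - t * b 0 = (1 - t * b 0) * (t * s) + t * a N * (t * r)"
        by (simp only: e2[symmetric] mult_1_right)
      thus ?thesis by (simp add: algebra_simps)
    qed
    moreover have "b 0 + (1 - t * b 0) * s + t * a N * r
      = (\<Sum>i\<le>n. ((if i = 0 then b 0 else 0) + (1 - t * b 0) * a i + t * a N * b (N - i)) * y ^ i)"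
      by (simp add: s_def r_def sum_distrib_left sum.distrib distrib_right mult.assoc if_distrib[of "\<lambda>z. z * _"] cong: if_cong)
    ultimately show ?thesis unfolding P_def
      using a(1) b(1) t one zero
      by (intro exI[of _ "\<lambda>i. (if i = 0 then b 0 else 0) + (1 - t * b 0) * a i + t * a N * b (N - i)"])
        (auto intro!: ad m d)
  qed
  define n where "n = (LEAST n. P x n)"
  define k where "k = (LEAST n. P (inverse x) n)"
  have Pn: "P x n" using ex[of x] nx unfolding n_def by (auto intro: LeastI_ex)
  have Pk: "P (inverse x) k" using ex[of "inverse x"] nx unfolding k_def by (auto intro: LeastI_ex)
  obtain n' k' where n': "n = Suc n'" and k': "k = Suc k'"
    using Pn Pk P0 by (metis not0_implies_Suc)
  show False
  proof (cases "k \<le> n")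
    case True
    hence "P x n'" using red[OF x0, of n'] mono[OF Pk True] Pn n' by auto
    thus False using n' not_less_Least[of n' "P x"] by (simp add: n_def)
  next
    case False
    hence "P (inverse x) k'" using red[of "inverse x" k'] mono[OF Pn, of k] Pk k' x0 by auto
    thus False using k' not_less_Least[of k' "P (inverse x)"] by (simp add: k_def)
  qed
qed

text \<open>A maximal subring without \<open>inverse t\<close> is a valuation ring \<open>A\<close>
  with unit group \<open>U\<close>. By algebraicity some power \<open>x ^ k\<close> is a unit times
  an element \<open>c\<close> of \<open>F\<close>, and the \<open>k\<close>-th root of
  \<open>w c\<close> is the only possible value at \<open>x\<close>.\<close>

lemma nonarch_abs_extension:
  fixes F :: "'a::qbar set"
  assumes F: "is_subfield F" and w: "nonarch_abs_on F w" and t: "t \<in> F" "t \<noteq> 0" "w t < 1"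
  obtains W where "nonarch_abs_on UNIV W" "\<And>x. x \<in> F \<Longrightarrow> W x = w x"
proof -
  note c = is_subfield_closed[OF F]
  note D = nonarch_abs_onD[OF w]
  note M = nonarch_abs_on_more[OF w F]
  define R where "R = {x \<in> F. w x \<le> 1}"
  have "subring_over R t R" unfolding subring_over_def
  proof (intro conjI ballI)
    show "1 \<in> R" using c M by (auto simp: R_def)
    have "w (inverse t) > 1" using t M(4) D(5) by (simp add: one_less_inverse)
    thus "inverse t \<notin> R" by (auto simp: R_def)
    fix x y assume xy: "x \<in> R" "y \<in> R"
    thus "x - y \<in> R" using c(3) M(7)[of x y] by (auto simp: R_def)
    show "x * y \<in> R" using xy c(5) D(1,3) by (auto simp: R_def mult_le_one)
  qed simp
  then obtain A where A: "subring_over R t A"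
    and max: "\<And>A'. subring_over R t A' \<Longrightarrow> A \<subseteq> A' \<Longrightarrow> A' = A"
    by (rule subring_over_maximal) blast
  have RA: "R \<subseteq> A" and tA: "inverse t \<notin> A" and one: "1 \<in> A" using A by (auto simp: subring_over_def)
  have d: "a - b \<in> A" and m: "a * b \<in> A" if "a \<in> A" "b \<in> A" for a b
    using A that by (auto simp: subring_over_def)
  have zero: "0 \<in> A" using d[OF one one] by simp
  have mi: "- a \<in> A" if "a \<in> A" for a using d[OF zero that] by simp
  have ad: "a + b \<in> A" if "a \<in> A" "b \<in> A" for a b using d[OF that(1) mi[OF that(2)]] by simp
  have pw: "a ^ n \<in> A" if "a \<in> A" for a n using that by (induction n) (auto intro: m one)
  have "t \<in> R" using t by (simp add: R_def)
  have val: "x \<in> A \<or> inverse x \<in> A" for x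
    using maximal_subring_valuation[OF A max] \<open>t \<in> R\<close> RA t(2) by blast
  \<comment> \<open>If \<open>w x > 1\<close>, then \<open>inverse t / x ^ n\<close> lies in the
    unit ball of \<open>F\<close> for large \<open>n\<close>; multiplication by \<open>x ^ n\<close>
    would bring \<open>inverse t\<close> into \<open>A\<close>.\<close>
  have AF: "w x \<le> 1" if x: "x \<in> F" "x \<in> A" for x
  proof (rule ccontr)
    assume "\<not> w x \<le> 1"
    then obtain n where n: "w x ^ n > inverse (w t)" using real_arch_pow[of "w x"] by auto
    have "w (inverse t / x ^ n) = inverse (w t) / w x ^ n"
      by (subst M(5)[OF c(7)[OF t(1)] c(9)[OF x(1)]]) (simp only: M(4)[OF t(1)] M(6)[OF x(1)])
    also have "\<dots> \<le> 1"
    proof -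
      have "inverse (w t) > 0" using D(5)[OF t(1,2)] by simp
      hence "w x ^ n > 0" using n by linarith
      thus ?thesis using n by simp
    qed
    finally have "w (inverse t / x ^ n) \<le> 1" .
    hence "inverse t / x ^ n \<in> A" using RA c t x by (auto simp: R_def)
    hence "inverse t / x ^ n * x ^ n \<in> A" using pw[OF x(2)] by (intro m) auto
    moreover have "x \<noteq> 0" using \<open>\<not> w x \<le> 1\<close> M(1) by auto
    ultimately show False using tA by simp
  qed
  define U where "U = {u. u \<noteq> 0 \<and> u \<in> A \<and> inverse u \<in> A}"
  have U1: "1 \<in> U" using one by (simp add: U_def)
  have Um: "u * z \<in> U" if "u \<in> U" "z \<in> U" for u z using that m by (auto simp: U_def)
  have Ui: "inverse u \<in> U" if "u \<in> U" for u using that by (auto simp: U_def)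
  have Up: "u ^ n \<in> U" if "u \<in> U" for u n using that by (induction n) (auto intro: Um U1)
  have Ud: "u / z \<in> U" if "u \<in> U" "z \<in> U" for u z
    using Um[OF that(1) Ui[OF that(2)]] by (simp add: field_class.field_divide_inverse)
  \<comment> \<open>The ring \<open>A\<close> is local: adding a non-unit to a unit leaves a
    unit.\<close>
  have Usum: "u + a \<in> U" if u: "u \<in> U" and a: "a \<in> A" "a \<notin> U" for u a
  proof (cases "a = 0")
    case False
    hence ia: "inverse a \<notin> A" using a by (auto simp: U_def)
    have s: "u + a \<in> A" using u a by (auto simp: U_def intro: ad)
    have s0: "u + a \<noteq> 0"
    proof
      assume "u + a = 0"
      hence "a = - u" by (simp add: eq_neg_iff_add_eq_0 add.commute)
      thus False using ia u mi by (auto simp: U_def)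
    qed
    have "inverse (u + a) \<in> A"
    proof (rule ccontr)
      assume ns: "inverse (u + a) \<notin> A"
      show False
      proof (cases "(u + a) / a \<in> A")
        case True
        hence "(u + a) / a - 1 \<in> A" using one d by blast
        hence "inverse u * ((u + a) / a - 1) \<in> A" using u m by (auto simp: U_def)
        moreover have "inverse u * ((u + a) / a - 1) = inverse a"
          using False u by (simp add: U_def field_simps)
        ultimately show False using ia by simp
      next
        case False
        hence "a / (u + a) \<in> A" using val[of "(u + a) / a"] by simp
        hence "inverse u * (1 - a / (u + a)) \<in> A" using u one by (auto simp: U_def intro: m d)
        moreover have "inverse u * (1 - a / (u + a)) = inverse (u + a)"
          using s0 u by (simp add: U_def field_simps)
        ultimately show False using ns by simp
      qed
    qed
    thus ?thesis using s s0 by (simp add: U_def)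
  qed (use u in simp)
  \<comment> \<open>No quotient of two terms is a unit, so in terms of the valuation all terms have
    different sizes and the largest one determines the sum up to a unit.\<close>
  have domin: "\<exists>i\<in>I. sum f I / f i \<in> U"
    if "finite I" "I \<noteq> {}" "\<And>i. i \<in> I \<Longrightarrow> f i \<noteq> 0" "\<And>i j. i \<in> I \<Longrightarrow> j \<in> I \<Longrightarrow> i \<noteq> j \<Longrightarrow> f i / f j \<notin> U"
    for I :: "nat set" and f
    using that
  proof (induction I rule: finite_ne_induct)
    case (singleton i)
    thus ?case using U1 by simp
  next
    case (insert j I)
    then obtain i where i: "i \<in> I" "sum f I / f i \<in> U" by auto
    have ij: "i \<noteq> j" "f i \<noteq> 0" "f j \<noteq> 0" using i insert by auto
    have nU: "f i / f j \<notin> U" "f j / f i \<notin> U" using insert.prems(2)[of i j] insert.prems(2)[of j i] i ij by auto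
    show ?case
    proof (cases "f j / f i \<in> A")
      case True
      have "sum f I / f i + f j / f i \<in> U" using Usum[OF i(2) True] nU by simp
      thus ?thesis using i insert.hyps by (intro bexI[of _ i]) (auto simp: add_divide_distrib add.commute)
    next
      case False
      hence "f i / f j \<in> A" using val[of "f j / f i"] by simp
      moreover have "sum f I / f i * (f i / f j) \<notin> U"
        using nU Um[OF Ui[OF i(2)], of "sum f I / f i * (f i / f j)"] i(2) by (auto simp: U_def)
      moreover have "sum f I / f i \<in> A" using i by (simp add: U_def)
      ultimately have "1 + sum f I / f i * (f i / f j) \<in> U" by (intro Usum U1 m)
      thus ?thesis using insert.hyps ij by (intro bexI[of _ j]) (auto simp: add_divide_distrib)
    qed
  qed
  \<comment> \<open>Otherwise the nonzero terms of an integer relation for \<open>x\<close> would be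
    pairwise of different size, and by \<open>domin\<close> their sum could not vanish.\<close>
  have root: "\<exists>k c. k > 0 \<and> c \<in> F \<and> c \<noteq> 0 \<and> x ^ k / c \<in> U" if x0: "x \<noteq> 0" for x
  proof (rule ccontr)
    assume no: "\<not> ?thesis"
    obtain q where q: "q \<noteq> 0" "poly (map_poly of_int q) x = 0"
      using algebraicE'[OF all_algebraic] by metis
    define I where "I = {i. i \<le> degree q \<and> coeff q i \<noteq> 0}"
    define f where "f i = of_int (coeff q i) * x ^ i" for i
    have ne: "f i / f j \<notin> U" if ij: "i \<in> I" "j \<in> I" "i < j" for i j
    proof
      assume "f i / f j \<in> U"
      hence "inverse (f i / f j) \<in> U" by (rule Ui)
      moreover have "inverse (f i / f j) = x ^ (j - i) / (of_int (coeff q i) / of_int (coeff q j))"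
        using ij x0 by (simp add: f_def I_def power_diff field_simps)
      moreover have "of_int (coeff q i) / of_int (coeff q j) \<in> F" by (intro c is_subfield_of_int[OF F])
      moreover have "of_int (coeff q i) / of_int (coeff q j) \<noteq> (0::'a)" "j - i > 0"
        using ij by (auto simp: I_def)
      ultimately show False using no by metis
    qed
    have "\<exists>i\<in>I. sum f I / f i \<in> U"
    proof (rule domin)
      show "finite I" by (simp add: I_def)
      show "I \<noteq> {}" using q(1) by (auto simp: I_def intro!: exI[of _ "degree q"])
      show "f i \<noteq> 0" if "i \<in> I" for i using that x0 by (simp add: f_def I_def)
      show "f i / f j \<notin> U" if "i \<in> I" "j \<in> I" "i \<noteq> j" for i j
        using ne[OF that(1,2)] ne[OF that(2,1)] Ui[of "f i / f j"] that(3) by (cases "i < j") auto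
    qed
    moreover have "sum f I = poly (map_poly of_int q) x"
      unfolding poly_altdef f_def I_def
      by (intro sum.mono_neutral_cong_left) (auto simp: coeff_map_poly degree_map_poly)
    ultimately show False using q by (auto simp: U_def)
  qed
  define rep where "rep x kc \<longleftrightarrow> fst kc > (0::nat) \<and> snd kc \<in> F \<and> snd kc \<noteq> 0 \<and> x ^ fst kc / snd kc \<in> U" for x kc
  define W where "W x = (if x = 0 then 0 else let kc = SOME kc. rep x kc in exp (ln (w (snd kc)) / real (fst kc)))" for x
  \<comment> \<open>Two representations of \<open>x\<close> differ by a unit that lies in
    \<open>F\<close>; \<open>AF\<close>, applied to it and to its inverse, shows that its value is
    1.\<close>
  have uniq: "ln (w c1) / k = ln (w c2) / l"
    if "rep x (k, c1)" "rep x (l, c2)" for x k l c1 c2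
  proof -
    have kc: "k > 0" "l > 0" "c1 \<in> F" "c2 \<in> F" "c1 \<noteq> 0" "c2 \<noteq> 0" "x ^ k / c1 \<in> U" "x ^ l / c2 \<in> U"
      using that by (auto simp: rep_def)
    have "x \<noteq> 0" using kc by (auto simp: U_def)
    have "(x ^ k / c1) ^ l / (x ^ l / c2) ^ k \<in> U" by (intro Ud Up kc)
    moreover have "(x ^ k / c1) ^ l / (x ^ l / c2) ^ k = c2 ^ k / c1 ^ l"
      using \<open>x \<noteq> 0\<close> kc(5,6) by (simp add: power_divide power_mult[symmetric] mult.commute)
    ultimately have u: "c2 ^ k / c1 ^ l \<in> U" by simp
    have f: "c2 ^ k / c1 ^ l \<in> F" "c1 ^ l / c2 ^ k \<in> F" using c kc by auto
    have "w (c2 ^ k / c1 ^ l) \<le> 1" using AF f u by (simp add: U_def)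
    moreover have "w (c1 ^ l / c2 ^ k) \<le> 1" using AF[OF f(2)] u by (simp add: U_def)
    moreover have "w c1 > 0" "w c2 > 0" using D(5) kc by auto
    ultimately have "w c2 ^ k = w c1 ^ l"
      using c kc M(5,6) by (simp add: divide_le_eq_1_pos)
    hence "real k * ln (w c2) = real l * ln (w c1)"
      using \<open>w c1 > 0\<close> \<open>w c2 > 0\<close> by (metis ln_realpow)
    thus ?thesis using kc(1,2) by (simp add: field_simps)
  qed
  have Wrep: "W x = exp (ln (w c1) / k)" if r: "rep x (k, c1)" for x k c1
  proof -
    have "x \<noteq> 0" using r by (auto simp: rep_def U_def zero_power)
    define kc where "kc = (SOME kc. rep x kc)"
    have "rep x kc" unfolding kc_def by (rule someI[of "rep x", OF r])
    hence "ln (w (snd kc)) / fst kc = ln (w c1) / k" using uniq[of x "fst kc" "snd kc"] r by simp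
    thus ?thesis using \<open>x \<noteq> 0\<close> by (simp add: W_def kc_def[symmetric] Let_def)
  qed
  have exrep: "\<exists>k c1. rep x (k, c1)" if "x \<noteq> 0" for x
    using root[OF that] by (auto simp: rep_def)
  have W0: "W 0 = 0" by (simp add: W_def)
  have Wpos: "W x > 0" if "x \<noteq> 0" for x using exrep[OF that] Wrep by fastforce
  have Wm: "W (x * y) = W x * W y" for x y
  proof (cases "x = 0 \<or> y = 0")
    case False
    obtain k c1 l c2 where r: "rep x (k, c1)" "rep y (l, c2)" using exrep False by metis
    hence kc: "k > 0" "l > 0" "c1 \<in> F" "c2 \<in> F" "c1 \<noteq> 0" "c2 \<noteq> 0" "x ^ k / c1 \<in> U" "y ^ l / c2 \<in> U"
      by (auto simp: rep_def)
    have "(x ^ k / c1) ^ l * (y ^ l / c2) ^ k \<in> U" by (intro Um Up kc)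
    moreover have "(x ^ k / c1) ^ l * (y ^ l / c2) ^ k = (x * y) ^ (k * l) / (c1 ^ l * c2 ^ k)"
      by (simp add: power_divide power_mult_distrib power_mult[symmetric] mult.commute)
    ultimately have rp: "rep (x * y) (k * l, c1 ^ l * c2 ^ k)" using kc c by (simp add: rep_def)
    have pos: "w c1 > 0" "w c2 > 0" using D(5) kc by auto
    hence "ln (w (c1 ^ l * c2 ^ k)) = l * ln (w c1) + k * ln (w c2)"
      using kc(3,4) c(9) by (simp add: D(3) M(6) ln_mult ln_realpow)
    hence "W (x * y) = exp ((l * ln (w c1) + k * ln (w c2)) / real (k * l))" using Wrep[OF rp] by simp
    also have "(l * ln (w c1) + k * ln (w c2)) / real (k * l) = ln (w c1) / k + ln (w c2) / l"
      using kc(1,2) by (simp add: add_divide_distrib)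
    finally show ?thesis by (simp only: exp_add Wrep[OF r(1)] Wrep[OF r(2)])
  qed (auto simp: W0)
  \<comment> \<open>That \<open>A\<close> is the unit ball of \<open>W\<close> yields the
    ultrametric inequality, since \<open>A\<close> is closed under addition of 1.\<close>
  have WA: "W x \<le> 1 \<longleftrightarrow> x \<in> A" for x
  proof (cases "x = 0")
    case False
    obtain k c1 where r: "rep x (k, c1)" using exrep False by metis
    hence kc: "k > 0" "c1 \<in> F" "c1 \<noteq> 0" "x ^ k / c1 \<in> A" "inverse (x ^ k / c1) \<in> A"
      by (auto simp: rep_def U_def)
    have "w c1 > 0" using D(5) kc by auto
    have "W x \<le> 1 \<longleftrightarrow> w c1 \<le> 1" using \<open>w c1 > 0\<close> kc(1)
      by (simp add: Wrep[OF r] divide_le_0_iff)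
    also have "\<dots> \<longleftrightarrow> x \<in> A"
    proof
      assume "w c1 \<le> 1"
      hence "c1 \<in> A" using kc RA by (auto simp: R_def)
      hence "x ^ k / c1 * c1 \<in> A" using m kc by blast
      hence xk: "x ^ k \<in> A" using kc by simp
      show "x \<in> A"
      proof (rule ccontr)
        assume "x \<notin> A"
        hence "inverse x \<in> A" using val by blast
        hence "x ^ k * inverse x ^ (k - 1) \<in> A" using xk pw m by blast
        moreover have "x ^ k * inverse x ^ (k - 1) = x" using kc(1) False
          by (cases k) (auto simp: field_simps)
        ultimately show False using \<open>x \<notin> A\<close> by simp
      qed
    next
      assume "x \<in> A"
      hence "inverse (x ^ k / c1) * x ^ k \<in> A" using kc pw m by blast
      hence "c1 \<in> A" using False by simp
      thus "w c1 \<le> 1" using AF kc by blast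
    qed
    finally show ?thesis .
  qed (simp add: W0 zero)
  have Wa1: "W (x + y) \<le> W y" if "W x \<le> W y" for x y
  proof (cases "y = 0")
    case True
    thus ?thesis using that Wpos[of x] W0 by fastforce
  next
    case False
    have "W (x / y) * W y = W x" using Wm[of "x / y" y] False by simp
    hence "W (x / y) \<le> 1" using that Wpos[OF False]
      by (metis mult_le_cancel_right1 mult_le_cancel_right2 not_le)
    hence "x / y + 1 \<in> A" using WA one ad by blast
    hence "W (x / y + 1) \<le> 1" using WA by blast
    moreover have "W (x + y) = W (x / y + 1) * W y" using Wm[of "x / y + 1" y] False by (simp add: distrib_right)
    ultimately show ?thesis using Wpos[OF False] by (simp add: mult_le_cancel_right1)
  qed
  have Wa: "W (x + y) \<le> max (W x) (W y)" for x y
    using Wa1[of x y] Wa1[of y x] by (cases "W x \<le> W y") (auto simp: add.commute)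
  have Wext: "W x = w x" if x: "x \<in> F" for x
  proof (cases "x = 0")
    case False
    have "rep x (1, x)" using False x U1 by (simp add: rep_def)
    thus ?thesis using Wrep[of x 1 x] D(5)[OF x False] by simp
  qed (simp add: W0 M)
  show ?thesis
  proof (rule that[OF _ Wext])
    show "nonarch_abs_on UNIV W" unfolding nonarch_abs_on_def
      using W0 Wpos Wm Wa by (metis less_eq_real_def less_irrefl)
  qed
qed

section \<open>Absolute values and polynomials\<close>

locale absval =
  fixes nv :: "'a::Fields.field \<Rightarrow> real"
  assumes nv_nonneg: "nv x \<ge> 0" and nv_eq_0_iff: "nv x = 0 \<longleftrightarrow> x = 0"
    and nv_mult: "nv (x * y) = nv x * nv y" and nv_triangle: "nv (x + y) \<le> nv x + nv y"
begin

lemma nv_0 [simp]: "nv 0 = 0" by (simp add: nv_eq_0_iff)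

lemma nv_pos: "x \<noteq> 0 \<Longrightarrow> nv x > 0"
  using nv_nonneg[of x] nv_eq_0_iff[of x] by linarith

lemma nv_1 [simp]: "nv 1 = 1"
  using nv_mult[of 1 1] nv_eq_0_iff[of 1] by simp

lemma nv_minus [simp]: "nv (- x) = nv x"
proof -
  have "nv (-1) * nv (-1) = 1" using nv_mult[of "-1" "-1"] by simp
  hence "(nv (-1))\<^sup>2 = 1" by (simp add: power2_eq_square)
  hence "nv (-1) = 1" using nv_nonneg[of "-1"] by (auto simp: power2_eq_1_iff)
  thus ?thesis using nv_mult[of "-1" x] by simp
qed

lemma nv_diff_commute: "nv (x - y) = nv (y - x)"
  using nv_minus[of "x - y"] by simp

lemma nv_power: "nv (x ^ n) = nv x ^ n"
  by (induction n) (auto simp: nv_mult)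

lemma nv_inverse: "nv (inverse x) = inverse (nv x)"
proof (cases "x = 0")
  case False
  have "nv x * nv (inverse x) = 1" using nv_mult[of x "inverse x"] False by simp
  thus ?thesis by (simp add: inverse_unique)
qed simp

lemma nv_divide: "nv (x / y) = nv x / nv y"
  by (simp add: field_class.field_divide_inverse nv_mult nv_inverse)

lemma nv_prod: "nv (prod f A) = (\<Prod>i\<in>A. nv (f i))"
  by (induction A rule: infinite_finite_induct) (auto simp: nv_mult)

lemma nv_sum_le: "nv (sum f A) \<le> (\<Sum>i\<in>A. nv (f i))"
  by (induction A rule: infinite_finite_induct) (auto intro: order_trans[OF nv_triangle])

end

locale ultra_absval = absval +
  assumes nv_ultra: "nv (x + y) \<le> max (nv x) (nv y)"
begin

lemma nv_ultra_diff: "nv (x - y) \<le> max (nv x) (nv y)"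
  using nv_ultra[of x "-y"] by simp

lemma nv_sum_le_bound: "(\<And>i. i \<in> A \<Longrightarrow> nv (f i) \<le> B) \<Longrightarrow> B \<ge> 0 \<Longrightarrow> nv (sum f A) \<le> B"
  by (induction A rule: infinite_finite_induct) (auto intro: order_trans[OF nv_ultra])

lemma nv_sum_less_bound: "(\<And>i. i \<in> A \<Longrightarrow> nv (f i) < B) \<Longrightarrow> B > 0 \<Longrightarrow> nv (sum f A) < B"
  by (induction A rule: infinite_finite_induct) (auto intro: le_less_trans[OF nv_ultra])

lemma nv_add_eq: "nv x < nv y \<Longrightarrow> nv (x + y) = nv y"
  using nv_ultra[of x y] nv_ultra_diff[of "x + y" x] by simp

lemma nv_diff_eq: "nv x < nv y \<Longrightarrow> nv (x - y) = nv y"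
  using nv_add_eq[of x "-y"] by simp

lemma nv_diff_eq_max: "nv x \<noteq> nv y \<Longrightarrow> nv (x - y) = max (nv x) (nv y)"
  using nv_diff_eq[of x y] nv_diff_eq[of y x] nv_diff_commute[of x y] by (cases "nv x < nv y") auto

lemma nv_of_nat_le_1: "nv (of_nat n) \<le> 1"
  by (induction n) (auto intro: order_trans[OF nv_ultra])

lemma nv_of_int_le_1: "nv (of_int n) \<le> 1"
proof (cases n)
  case (neg m)
  have "nv (of_int n) = nv (- of_nat (Suc m))" using neg by simp
  thus ?thesis using nv_of_nat_le_1[of "Suc m"] by (simp del: of_nat_Suc)
qed (use nv_of_nat_le_1 in auto)

end

lemma nonarch_abs_on_UNIV:
  assumes "nonarch_abs_on UNIV w" shows "ultra_absval w"
proof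
  show ge0: "w x \<ge> 0" and "w x = 0 \<longleftrightarrow> x = 0" and "w (x * y) = w x * w y" and u: "w (x + y) \<le> max (w x) (w y)" for x y
    using assms by (auto simp: nonarch_abs_on_def)
  show "w (x + y) \<le> w x + w y" for x y using u[of x y] ge0[of x] ge0[of y] by linarith
qed

lemma degree_prod_linear: "degree (\<Prod>y\<in>A. [:- f y, 1::'a::Fields.field:]) \<le> card A"
  by (induction A rule: infinite_finite_induct) (auto intro: order_trans[OF degree_mult_le] simp del: mult_pCons_left)

section \<open>Interpolation and discriminants of finite sets\<close>

lemma lagrange_interpolation:
  fixes P :: "'a::Fields.field poly"
  assumes S: "finite S" and deg: "degree P < card S"
  shows "P = (\<Sum>x\<in>S. smult (poly P x / (\<Prod>y\<in>S - {x}. x - y)) (\<Prod>y\<in>S - {x}. [:- y, 1:]))" (is "P = ?Q")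
proof -
  have "degree ?Q < card S"
  proof (rule degree_sum_less)
    fix x assume "x \<in> S"
    have "degree (\<Prod>y\<in>S - {x}. [:- y, 1:]) \<le> card (S - {x})" by (rule degree_prod_linear)
    also have "\<dots> < card S" using S \<open>x \<in> S\<close> by (rule card_Diff1_less)
    finally show "degree (smult (poly P x / (\<Prod>y\<in>S - {x}. x - y)) (\<Prod>y\<in>S - {x}. [:- y, 1:])) < card S"
      by (rule le_less_trans[OF degree_smult_le])
  qed (use deg in auto)
  moreover have "poly P z = poly ?Q z" if z: "z \<in> S" for z
  proof -
    have "poly ?Q z = (\<Sum>x\<in>S. if x = z then poly P z else 0)"
      unfolding poly_sum poly_smult poly_prod
    proof (rule sum.cong)
      fix x assume "x \<in> S"
      show "poly P x / (\<Prod>y\<in>S - {x}. x - y) * (\<Prod>y\<in>S - {x}. poly [:- y, 1:] z) = (if x = z then poly P z else 0)"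
        using S z by (auto simp: prod_zero_iff)
    qed simp
    also have "\<dots> = poly P z" using S z by simp
    finally show ?thesis by simp
  qed
  ultimately show ?thesis
    by (intro poly_eqI_degree[of S]) (use deg in auto)
qed

text \<open>The discriminant up to sign. Ordered pairs make it independent of any enumeration and
  compatible with field homomorphisms.\<close>

definition dsc :: "'a::Fields.field set \<Rightarrow> 'a" where
  "dsc S = (\<Prod>x\<in>S. \<Prod>y\<in>S - {x}. x - y)"

lemma dsc_nonzero: "finite S \<Longrightarrow> dsc S \<noteq> 0"
  by (auto simp: dsc_def prod_zero_iff)

lemma dsc_insert:
  assumes "finite S" "x \<notin> S"
  shows "dsc (insert x S) = dsc S * (\<Prod>y\<in>S. x - y) * (\<Prod>y\<in>S. y - x)"
proof -
  have "(\<Prod>y\<in>insert x S - {z}. z - y) = (z - x) * (\<Prod>y\<in>S - {z}. z - y)" if "z \<in> S" for z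
  proof -
    have "insert x S - {z} = insert x (S - {z})" using that assms by auto
    thus ?thesis using assms by simp
  qed
  hence "(\<Prod>z\<in>S. \<Prod>y\<in>insert x S - {z}. z - y) = (\<Prod>z\<in>S. z - x) * dsc S"
    unfolding dsc_def by (simp add: prod.distrib)
  moreover have "insert x S - {x} = S" using assms by auto
  ultimately show ?thesis using assms by (simp add: dsc_def)
qed

lemma dsc_hom: "field_hom g \<Longrightarrow> g (dsc S) = dsc (g ` S)"
proof -
  assume g: "field_hom g"
  have i: "inj_on g A" for A using field_hom_inj[OF g] by (rule inj_on_subset) simp
  have "g ` S - {g x} = g ` (S - {x})" for x using field_hom_inj[OF g] by (auto dest: injD)
  thus ?thesis unfolding dsc_def
    by (simp add: field_hom_prod[OF g] field_hom_diff[OF g] prod.reindex[OF i])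
qed

context absval
begin

text \<open>Read off from the Lagrange formula; the point is that \<open>C\<close> depends on the
  nodes alone and serves all polynomials of degree below \<open>card S\<close>.\<close>

lemma coeff_bound_by_values:
  fixes S :: "'a set"
  assumes "finite S"
  obtains C where "C > 0"
    "\<And>P B i. degree P < card S \<Longrightarrow> (\<And>x. x \<in> S \<Longrightarrow> nv (poly P x) \<le> B) \<Longrightarrow> nv (coeff P i) \<le> C * B"
proof -
  define L where "L x = (\<Prod>y\<in>S - {x}. [:- y, 1:])" for x
  define e where "e x = (\<Prod>y\<in>S - {x}. x - y)" for x
  define C where "C = 1 + (\<Sum>i\<le>card S. \<Sum>x\<in>S. nv (coeff (L x) i) / nv (e x))"
  have "nv (coeff P i) \<le> C * B" if P: "degree P < card S" "\<And>x. x \<in> S \<Longrightarrow> nv (poly P x) \<le> B" for P B i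
  proof -
    have "S \<noteq> {}" using P(1) by auto
    hence B: "B \<ge> 0" using P(2) nv_nonneg order_trans by blast
    have C0: "C \<ge> 0" unfolding C_def by (intro add_nonneg_nonneg sum_nonneg divide_nonneg_nonneg nv_nonneg) auto
    show ?thesis
    proof (cases "i \<le> card S")
      case True
      have "coeff P i = (\<Sum>x\<in>S. poly P x / e x * coeff (L x) i)"
        by (subst lagrange_interpolation[OF assms P(1)]) (simp add: coeff_sum L_def e_def)
      hence "nv (coeff P i) \<le> (\<Sum>x\<in>S. nv (poly P x) * (nv (coeff (L x) i) / nv (e x)))"
        using nv_sum_le[of "\<lambda>x. poly P x / e x * coeff (L x) i" S] by (simp add: nv_mult nv_divide)
      also have "\<dots> \<le> (\<Sum>x\<in>S. B * (nv (coeff (L x) i) / nv (e x)))"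
        using P(2) by (intro sum_mono mult_right_mono) (auto intro: divide_nonneg_nonneg nv_nonneg)
      also have "\<dots> = (\<Sum>x\<in>S. nv (coeff (L x) i) / nv (e x)) * B" by (simp add: sum_distrib_left mult.commute)
      also have "\<dots> \<le> C * B"
      proof (rule mult_right_mono[OF _ B])
        define E where "E j = (\<Sum>x\<in>S. nv (coeff (L x) j) / nv (e x))" for j
        have "E i \<le> sum E {..card S}"
          using True by (intro member_le_sum) (auto simp: E_def intro!: sum_nonneg divide_nonneg_nonneg nv_nonneg)
        thus "(\<Sum>x\<in>S. nv (coeff (L x) i) / nv (e x)) \<le> C" by (simp add: C_def E_def)
      qed
      finally show ?thesis .
    next
      case False
      thus ?thesis using P(1) B C0 by (simp add: coeff_eq_0)
    qed
  qed
  moreover have "C > 0" unfolding C_def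
    by (intro add_pos_nonneg sum_nonneg divide_nonneg_nonneg nv_nonneg) auto
  ultimately show ?thesis using that by blast
qed

text \<open>Lagrange interpolation writes the coefficient in degree \<open>n\<close> as the sum of
  the quotients \<open>P(x) / (product of the x - y)\<close>. At least one summand must be as large
  as the sum divided by \<open>k\<close>, where \<open>k\<close> is the constant of the triangle
  inequality for \<open>n + 1\<close> terms.\<close>

lemma dsc_step:
  assumes S: "finite S" "card S = Suc n" and P: "degree P \<le> n"
    and k: "\<And>f B. (\<And>x. x \<in> S \<Longrightarrow> nv (f x) \<le> B) \<Longrightarrow> B \<ge> 0 \<Longrightarrow> nv (sum f S) \<le> k * B" "k > 0"
    and u: "\<And>x. x \<in> S \<Longrightarrow> nv (poly P x) \<le> u x"
  shows "\<exists>x\<in>S. nv (coeff P n) * (\<Prod>y\<in>S - {x}. nv (x - y)) \<le> k * u x"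
proof -
  define e where "e x = (\<Prod>y\<in>S - {x}. x - y)" for x
  have e0: "e x \<noteq> 0" for x using S by (auto simp: e_def prod_zero_iff)
  have lc: "coeff (\<Prod>y\<in>S - {x}. [:- y, 1:]) n = 1" if "x \<in> S" for x
  proof -
    have "degree (\<Prod>y\<in>S - {x}. [:- y, 1::'a:]) = (\<Sum>y\<in>S - {x}. degree [:- y, 1::'a:])"
      by (rule degree_prod_eq_sum_degree) auto
    hence "degree (\<Prod>y\<in>S - {x}. [:- y, 1::'a:]) = n" using S that by simp
    moreover have "lead_coeff (\<Prod>y\<in>S - {x}. [:- y, 1::'a:]) = 1"
      by (simp add: lead_coeff_prod)
    ultimately show ?thesis by simp
  qed
  have eq: "coeff P n = (\<Sum>x\<in>S. poly P x / e x)"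
    using S P lc by (subst lagrange_interpolation[of S P]) (auto simp: coeff_sum e_def intro!: sum.cong)
  show ?thesis
  proof (rule ccontr)
    assume no: "\<not> ?thesis"
    have lt: "nv (poly P x / e x) < nv (coeff P n) / k" if x: "x \<in> S" for x
    proof -
      have "k * u x < nv (coeff P n) * nv (e x)"
        using no x by (force simp: e_def nv_prod not_le)
      hence "k * nv (poly P x) < nv (coeff P n) * nv (e x)" using u[OF x] k(2)
        by (meson le_less_trans mult_left_mono less_imp_le)
      thus ?thesis using nv_pos[OF e0[of x]] k(2) by (simp add: nv_divide field_simps)
    qed
    define B where "B = Max ((\<lambda>x. nv (poly P x / e x)) ` S)"
    have ne: "S \<noteq> {}" using S by auto
    have "B < nv (coeff P n) / k" unfolding B_def using S ne lt by (subst Max_less_iff) auto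
    moreover have "nv (coeff P n) \<le> k * B" unfolding eq
    proof (rule k(1))
      show "nv (poly P x / e x) \<le> B" if "x \<in> S" for x using that S by (auto simp: B_def)
      thus "B \<ge> 0" using ne nv_nonneg order_trans by blast
    qed
    ultimately show False using k(2) by (simp add: field_simps)
  qed
qed

text \<open>Takes the place of Hadamard's inequality for the matrix of the values
  \<open>P m (x)\<close>. The node supplied by \<open>dsc_step\<close> is split off and the rest
  treated by induction. Because \<open>u x\<close> bounds all \<open>P m\<close> at
  \<open>x\<close>, the order in which nodes are removed leaves no trace in the result.\<close>

lemma dsc_bound_gen:
  assumes S: "finite S" "card S = N"
    and deg: "\<And>m. degree (P m) \<le> m"
    and u: "\<And>m x. m < N \<Longrightarrow> x \<in> S \<Longrightarrow> nv (poly (P m) x) \<le> u x"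
    and k: "\<And>(S' :: 'a set) f B. finite S' \<Longrightarrow> (\<And>x. x \<in> S' \<Longrightarrow> nv (f x) \<le> B) \<Longrightarrow> B \<ge> 0 \<Longrightarrow> nv (sum f S') \<le> k (card S') * B"
      "\<And>m. k (Suc m) > 0"
  shows "(\<Prod>m<N. nv (coeff (P m) m))\<^sup>2 * nv (dsc S) \<le> (\<Prod>m<N. k (Suc m))\<^sup>2 * (\<Prod>x\<in>S. u x)\<^sup>2"
  using S u
proof (induction N arbitrary: S)
  case 0
  thus ?case by (simp add: dsc_def)
next
  case (Suc n)
  have "\<exists>x\<in>S. nv (coeff (P n) n) * (\<Prod>y\<in>S - {x}. nv (x - y)) \<le> k (Suc n) * u x"
  proof (rule dsc_step[OF Suc.prems(1,2) deg])
    show "nv (sum f S) \<le> k (Suc n) * B" if "\<And>x. x \<in> S \<Longrightarrow> nv (f x) \<le> B" "B \<ge> 0" for f B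
      using k(1)[OF Suc.prems(1) that] Suc.prems(2) by simp
  qed (use k(2) Suc.prems(3) in auto)
  then obtain x where x: "x \<in> S" "nv (coeff (P n) n) * (\<Prod>y\<in>S - {x}. nv (x - y)) \<le> k (Suc n) * u x"
    by blast
  define T where "T = S - {x}"
  have T: "finite T" "card T = n" "x \<notin> T" "S = insert x T" using Suc.prems x by (auto simp: T_def)
  have IH: "(\<Prod>m<n. nv (coeff (P m) m))\<^sup>2 * nv (dsc T) \<le> (\<Prod>m<n. k (Suc m))\<^sup>2 * (\<Prod>x\<in>T. u x)\<^sup>2"
    using Suc.prems T by (intro Suc.IH) auto
  have a: "(nv (coeff (P n) n) * (\<Prod>y\<in>T. nv (x - y)))\<^sup>2 \<le> (k (Suc n) * u x)\<^sup>2"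
    using x(2) unfolding T_def[symmetric]
    by (intro power_mono mult_nonneg_nonneg prod_nonneg nv_nonneg) (auto intro: nv_nonneg)
  have "nv (dsc S) = nv (dsc T) * (\<Prod>y\<in>T. nv (x - y))\<^sup>2"
    using T by (simp add: dsc_insert nv_mult nv_prod power2_eq_square nv_diff_commute[of _ x])
  hence "(\<Prod>m<Suc n. nv (coeff (P m) m))\<^sup>2 * nv (dsc S)
     = ((\<Prod>m<n. nv (coeff (P m) m))\<^sup>2 * nv (dsc T)) * (nv (coeff (P n) n) * (\<Prod>y\<in>T. nv (x - y)))\<^sup>2"
    by (simp add: power_mult_distrib mult_ac)
  also have "\<dots> \<le> ((\<Prod>m<n. k (Suc m))\<^sup>2 * (\<Prod>x\<in>T. u x)\<^sup>2) * (k (Suc n) * u x)\<^sup>2"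
    by (intro mult_mono IH a mult_nonneg_nonneg) (auto intro: nv_nonneg)
  also have "\<dots> = (\<Prod>m<Suc n. k (Suc m))\<^sup>2 * (\<Prod>x\<in>S. u x)\<^sup>2"
    using T by (simp add: power_mult_distrib mult_ac)
  finally show ?case .
qed

lemma dsc_bound:
  assumes "finite S" "card S = N" "\<And>m. degree (P m) \<le> m"
    "\<And>m x. m < N \<Longrightarrow> x \<in> S \<Longrightarrow> nv (poly (P m) x) \<le> u x"
  shows "(\<Prod>m<N. nv (coeff (P m) m))\<^sup>2 * nv (dsc S) \<le> (fact N)\<^sup>2 * (\<Prod>x\<in>S. u x)\<^sup>2"
proof -
  have "nv (sum f S') \<le> real (card S') * B" if "\<And>x. x \<in> S' \<Longrightarrow> nv (f x) \<le> B" for S' :: "'a set" and f B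
    using nv_sum_le[of f S'] sum_bounded_above[of S' "\<lambda>x. nv (f x)" B] that by force
  hence "(\<Prod>m<N. nv (coeff (P m) m))\<^sup>2 * nv (dsc S) \<le> (\<Prod>m<N. real (Suc m))\<^sup>2 * (\<Prod>x\<in>S. u x)\<^sup>2"
    using assms by (intro dsc_bound_gen) auto
  also have "(\<Prod>m<N. real (Suc m)) = fact N" by (induction N) auto
  finally show ?thesis .
qed

end

context ultra_absval
begin

lemma dsc_bound_ultra:
  assumes "finite S" "card S = N" "\<And>m. degree (P m) \<le> m"
    "\<And>m x. m < N \<Longrightarrow> x \<in> S \<Longrightarrow> nv (poly (P m) x) \<le> u x"
  shows "(\<Prod>m<N. nv (coeff (P m) m))\<^sup>2 * nv (dsc S) \<le> (\<Prod>x\<in>S. u x)\<^sup>2"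
proof -
  have "(\<Prod>m<N. nv (coeff (P m) m))\<^sup>2 * nv (dsc S) \<le> (\<Prod>m<N. 1)\<^sup>2 * (\<Prod>x\<in>S. u x)\<^sup>2"
    by (rule dsc_bound_gen[OF assms, where k = "\<lambda>_. 1"]) (simp_all add: nv_sum_le_bound)
  thus ?thesis by simp
qed

section \<open>Gauss norms\<close>

definition gauss_norm :: "'a poly \<Rightarrow> real" where
  "gauss_norm P = Max ((\<lambda>i. nv (coeff P i)) ` {..degree P})"

lemma coeff_le_gauss_norm: "nv (coeff P i) \<le> gauss_norm P"
proof (cases "i \<le> degree P")
  case False
  have "0 \<le> nv (coeff P 0)" by (rule nv_nonneg)
  also have "\<dots> \<le> gauss_norm P" unfolding gauss_norm_def by (rule Max_ge) auto
  finally show ?thesis using False by (simp add: coeff_eq_0)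
qed (auto simp: gauss_norm_def)

lemma gauss_norm_attained: obtains i where "nv (coeff P i) = gauss_norm P"
proof -
  have "gauss_norm P \<in> (\<lambda>i. nv (coeff P i)) ` {..degree P}" unfolding gauss_norm_def by (rule Max_in) auto
  thus ?thesis using that by auto
qed

lemma gauss_norm_pos: "P \<noteq> 0 \<Longrightarrow> gauss_norm P > 0"
  using coeff_le_gauss_norm[of P "degree P"] nv_pos[of "lead_coeff P"] by simp

lemma gauss_norm_leI: "(\<And>i. nv (coeff P i) \<le> B) \<Longrightarrow> gauss_norm P \<le> B"
  by (metis gauss_norm_attained)

text \<open>Gauss's lemma: with \<open>i\<close> and \<open>j\<close> the first indices at which the
  norms are attained, one product strictly dominates all others in the coefficient of index
  \<open>i + j\<close>.\<close>

lemma gauss_norm_mult: "gauss_norm (P * Q) = gauss_norm P * gauss_norm Q"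
proof (cases "P = 0 \<or> Q = 0")
  case False
  let ?p = "gauss_norm P" let ?q = "gauss_norm Q"
  define i where "i = (LEAST i. nv (coeff P i) = ?p)"
  define j where "j = (LEAST j. nv (coeff Q j) = ?q)"
  have i: "nv (coeff P i) = ?p" unfolding i_def by (metis (mono_tags) LeastI gauss_norm_attained)
  have j: "nv (coeff Q j) = ?q" unfolding j_def by (metis (mono_tags) LeastI gauss_norm_attained)
  have li: "nv (coeff P l) < ?p" if "l < i" for l
    using not_less_Least[of l "\<lambda>i. nv (coeff P i) = ?p"] that coeff_le_gauss_norm[of P l] by (simp add: i_def)
  have lj: "nv (coeff Q l) < ?q" if "l < j" for l
    using not_less_Least[of l "\<lambda>i. nv (coeff Q i) = ?q"] that coeff_le_gauss_norm[of Q l] by (simp add: j_def)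
  have pq: "?p > 0" "?q > 0" using gauss_norm_pos False by auto
  have "coeff (P * Q) (i + j) = coeff P i * coeff Q j + (\<Sum>l\<in>{..i + j} - {i}. coeff P l * coeff Q (i + j - l))"
    unfolding coeff_mult by (subst sum.remove[of _ i]) auto
  moreover have "nv (\<Sum>l\<in>{..i + j} - {i}. coeff P l * coeff Q (i + j - l)) < ?p * ?q"
  proof (rule nv_sum_less_bound)
    fix l assume l: "l \<in> {..i + j} - {i}"
    show "nv (coeff P l * coeff Q (i + j - l)) < ?p * ?q"
    proof (cases "l < i")
      case True
      have "nv (coeff P l) * nv (coeff Q (i + j - l)) \<le> nv (coeff P l) * ?q"
        by (intro mult_left_mono coeff_le_gauss_norm nv_nonneg)
      also have "\<dots> < ?p * ?q" using li[OF True] pq by simp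
      finally show ?thesis by (simp add: nv_mult)
    next
      case False
      hence "i + j - l < j" using l by auto
      have "nv (coeff P l) * nv (coeff Q (i + j - l)) \<le> ?p * nv (coeff Q (i + j - l))"
        by (intro mult_right_mono coeff_le_gauss_norm nv_nonneg)
      also have "\<dots> < ?p * ?q" using lj[OF \<open>i + j - l < j\<close>] pq by simp
      finally show ?thesis by (simp add: nv_mult)
    qed
  qed (use pq in simp)
  ultimately have "nv (coeff (P * Q) (i + j)) = ?p * ?q"
    using nv_add_eq[of "\<Sum>l\<in>{..i + j} - {i}. coeff P l * coeff Q (i + j - l)" "coeff P i * coeff Q j"] i j
    by (simp add: nv_mult add.commute)
  moreover have "gauss_norm (P * Q) \<le> ?p * ?q"
  proof (rule gauss_norm_leI)
    fix m show "nv (coeff (P * Q) m) \<le> ?p * ?q" unfolding coeff_mult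
      using pq by (intro nv_sum_le_bound) (auto simp: nv_mult intro!: mult_mono coeff_le_gauss_norm nv_nonneg)
  qed
  ultimately show ?thesis using coeff_le_gauss_norm[of "P * Q" "i + j"] by simp
qed (auto simp: gauss_norm_def)

lemma gauss_norm_linear: "gauss_norm [:- y, 1:] = max 1 (nv y)"
proof (rule antisym)
  show "gauss_norm [:- y, 1:] \<le> max 1 (nv y)"
    by (rule gauss_norm_leI) (auto simp: coeff_pCons split: nat.splits)
  show "max 1 (nv y) \<le> gauss_norm [:- y, 1:]"
    using coeff_le_gauss_norm[of "[:- y, 1:]" 0] coeff_le_gauss_norm[of "[:- y, 1:]" 1] by simp
qed

lemma gauss_norm_prod_linear: "gauss_norm (\<Prod>i\<in>A. [:- f i, 1:]) = (\<Prod>i\<in>A. max 1 (nv (f i)))"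
proof (induction A rule: infinite_finite_induct)
  case (insert x F)
  thus ?case by (simp add: gauss_norm_mult gauss_norm_linear del: mult_pCons_left)
qed (auto simp: gauss_norm_def)

text \<open>This is the step from Newton slopes to roots.\<close>

lemma dominating_term:
  assumes r: "r > 0" and A: "\<And>a. a \<in># A \<Longrightarrow> nv a \<noteq> r"
  shows "\<exists>i0. coeff (\<Prod>a\<in>#A. [:- a, 1:]) i0 \<noteq> 0 \<and> (\<forall>i. i \<noteq> i0 \<longrightarrow>
     nv (coeff (\<Prod>a\<in>#A. [:- a, 1:]) i) * r ^ i < nv (coeff (\<Prod>a\<in>#A. [:- a, 1:]) i0) * r ^ i0)"
  using A
proof (induction A)
  case empty
  show ?case by (intro exI[of _ 0]) (auto simp: coeff_eq_0)
next
  case (add a A)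
  define b where "b = coeff (\<Prod>a\<in>#A. [:- a, 1:])"
  define c where "c = coeff (\<Prod>a\<in>#add_mset a A. [:- a, 1:])"
  obtain k where k: "b k \<noteq> 0" "\<And>i. i \<noteq> k \<Longrightarrow> nv (b i) * r ^ i < nv (b k) * r ^ k"
    using add by (auto simp: b_def)
  define M where "M = nv (b k) * r ^ k"
  have M: "M > 0" using k(1) r nv_pos by (simp add: M_def)
  have le: "nv (b i) * r ^ i \<le> M" for i using k(2)[of i] by (cases "i = k") (auto simp: M_def)
  have c0: "c 0 = - (a * b 0)" by (simp add: b_def c_def)
  have cS: "c (Suc i) = b i - a * b (Suc i)" for i by (simp add: b_def c_def)
  have ar: "nv a < r \<or> nv a > r" using add.prems[of a] by auto
  hence "\<exists>i0. c i0 \<noteq> 0 \<and> (\<forall>i. i \<noteq> i0 \<longrightarrow> nv (c i) * r ^ i < nv (c i0) * r ^ i0)"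
  proof
    \<comment> \<open>The factor \<open>X\<close> outweighs the constant \<open>- a\<close> at
      radius \<open>r\<close>, so the dominating index moves up by one.\<close>
    assume a: "nv a < r"
    have "nv (a * b (Suc k)) < nv (b k)"
    proof -
      have "nv a * (nv (b (Suc k)) * r ^ Suc k) \<le> nv a * M" by (intro mult_left_mono le nv_nonneg)
      also have "\<dots> < r * M" using a M by simp
      finally have "nv (a * b (Suc k)) * r ^ Suc k < nv (b k) * r ^ Suc k"
        by (simp add: M_def nv_mult mult_ac)
      thus ?thesis using r by simp
    qed
    hence e: "nv (c (Suc k)) = nv (b k)" unfolding cS
      by (subst nv_diff_commute) (rule nv_diff_eq)
    have eM: "nv (c (Suc k)) * r ^ Suc k = r * M" by (simp add: e M_def)
    show ?thesis
    proof (intro exI[of _ "Suc k"] conjI allI impI)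
      show "c (Suc k) \<noteq> 0" using e k(1) nv_eq_0_iff by metis
      fix i assume i: "i \<noteq> Suc k"
      have 1: "nv (a * b i) * r ^ i < r * M"
      proof -
        have "nv a * (nv (b i) * r ^ i) \<le> nv a * M" by (intro mult_left_mono le nv_nonneg)
        also have "\<dots> < r * M" using a M by simp
        finally show ?thesis by (simp add: nv_mult mult_ac)
      qed
      show "nv (c i) * r ^ i < nv (c (Suc k)) * r ^ Suc k"
      proof (cases i)
        case 0
        thus ?thesis using 1 unfolding eM by (simp add: nv_mult c0)
      next
        case (Suc j)
        have 2: "nv (b j) * r ^ i < r * M" using k(2)[of j] i Suc r by (simp add: M_def)
        have "nv (c i) * r ^ i \<le> max (nv (b j)) (nv (a * b i)) * r ^ i"
          unfolding Suc cS using r by (intro mult_right_mono nv_ultra_diff) auto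
        also have "\<dots> < r * M" using 1 2 by (auto simp: max_def)
        finally show ?thesis unfolding eM .
      qed
    qed
  next
    \<comment> \<open>Here the constant \<open>- a\<close> outweighs \<open>X\<close>, so the
      dominating index stays and its weight is multiplied by \<open>nv a\<close>.\<close>
    assume a: "nv a > r"
    have aM: "r * M < nv a * M" using a M by simp
    have e: "nv (c k) * r ^ k = nv a * M"
    proof (cases k)
      case 0
      thus ?thesis by (simp add: M_def nv_mult c0)
    next
      case (Suc j)
      have "nv (b j) * r ^ k \<le> r * M" using le[of j] r Suc by simp
      also have "\<dots> < nv (a * b k) * r ^ k" using aM by (simp add: M_def nv_mult mult_ac)
      finally have "nv (b j) < nv (a * b k)" using r by simp
      hence "nv (c k) = nv (a * b k)" unfolding Suc cS by (rule nv_diff_eq)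
      thus ?thesis by (simp add: M_def nv_mult)
    qed
    show ?thesis
    proof (intro exI[of _ k] conjI allI impI)
      show "c k \<noteq> 0" using e M a r nv_nonneg[of a] by (metis mult_pos_pos less_trans nv_0 mult_zero_left less_irrefl)
      fix i assume i: "i \<noteq> k"
      have 1: "nv (a * b i) * r ^ i < nv a * M"
        using k(2)[OF i] a r by (simp add: M_def nv_mult)
      show "nv (c i) * r ^ i < nv (c k) * r ^ k"
      proof (cases i)
        case 0
        thus ?thesis using 1 unfolding e by (simp add: nv_mult c0)
      next
        case (Suc j)
        have 2: "nv (b j) * r ^ i < nv a * M" 
        proof -
          have "nv (b j) * r ^ i = r * (nv (b j) * r ^ j)" using Suc by simp
          also have "\<dots> \<le> r * M" using le r by (intro mult_left_mono) auto
          finally show ?thesis using aM by linarith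
        qed
        have "nv (c i) * r ^ i \<le> max (nv (b j)) (nv (a * b i)) * r ^ i"
          unfolding Suc cS using r by (intro mult_right_mono nv_ultra_diff) auto
        also have "\<dots> < nv a * M" using 1 2 by (auto simp: max_def)
        finally show ?thesis unfolding e .
      qed
    qed
  qed
  thus ?case by (simp only: c_def)
qed

end

section \<open>Places of a number field above a prime\<close>

locale padic_absval = ultra_absval nv for nv :: "'a::field_char_0 \<Rightarrow> real" +
  fixes p :: nat
  assumes p_prime: "prime p" and nv_of_rat: "nv (of_rat q) = padic_abs p q"
begin

lemma p_gt_1: "real p > 1" using prime_gt_1_nat[OF p_prime] by simp

lemma nv_of_int_mult: "c \<noteq> 0 \<Longrightarrow> nv (of_int c) = real p powi (- int (multiplicity (int p) c))"
  using nv_of_rat[of "of_int c"] by (simp add: padic_abs_def quotient_of_int)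

lemma nv_of_int_unit: "\<not> int p dvd c \<Longrightarrow> nv (of_int c) = 1"
  by (subst nv_of_int_mult) (auto simp: not_dvd_imp_multiplicity_0)

lemma nv_p: "nv (of_nat p) = 1 / p"
proof -
  have "multiplicity (int p) (int p) = 1" using p_prime by (intro multiplicity_self) auto
  thus ?thesis using nv_of_int_mult[of "int p"] p_gt_1 by (simp add: power_int_minus inverse_eq_divide)
qed

lemma nv_p_power: "nv (of_nat p ^ k) = 1 / real p ^ k"
  by (simp add: nv_power nv_p power_one_over)

lemma nv_of_int_dvd: "int p ^ b dvd c \<Longrightarrow> nv (of_int c) \<le> 1 / real p ^ b"
proof -
  assume "int p ^ b dvd c"
  then obtain c' where "c = int p ^ b * c'" by auto
  hence "nv (of_int c) = nv (of_nat p ^ b) * nv (of_int c')" by (simp add: nv_mult)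
  also have "\<dots> \<le> nv (of_nat p ^ b) * 1" by (intro mult_left_mono nv_of_int_le_1 nv_nonneg)
  finally show ?thesis by (simp add: nv_p_power)
qed

lemma nv_of_int_lower:
  assumes "c \<noteq> 0" "\<bar>c\<bar> < int p ^ b" shows "nv (of_int c) > 1 / real p ^ b"
proof -
  let ?m = "multiplicity (int p) c"
  have "int p ^ ?m dvd c" by (rule multiplicity_dvd)
  hence "int p ^ ?m \<le> \<bar>c\<bar>" using assms(1) by (intro zdvd_imp_le) auto
  hence "int p ^ ?m < int p ^ b" using assms(2) by linarith
  hence "?m < b" using prime_gt_1_nat[OF p_prime] by (metis power_less_imp_less_exp of_nat_1 of_nat_less_iff)
  hence "real p ^ ?m < real p ^ b" using p_gt_1 by simp
  moreover have "real p ^ ?m > 0" using p_gt_1 by simp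
  ultimately show ?thesis using assms(1)
    by (simp add: nv_of_int_mult power_int_minus frac_less2 inverse_eq_divide)
qed

lemma nv_of_rat_value:
  assumes "q \<noteq> 0" shows "\<exists>k::int. nv (of_rat q) = real p powi k"
  using assms by (auto simp: nv_of_rat padic_abs_def split: prod.splits)

text \<open>The denominator is prime to \<open>p\<close>, so it can be inverted modulo
  \<open>p ^ b\<close> by Bezout. This leaves \<open>p ^ b\<close> classes for each rational
  coordinate in the count of separated elements.\<close>

lemma nv_of_rat_approx:
  assumes "nv (of_rat q) \<le> 1"
  obtains k :: nat where "k < p ^ b" "nv (of_rat q - of_nat k) \<le> 1 / real p ^ b"
proof -
  obtain a d where ad: "quotient_of q = (a, d)" by fastforce
  have d: "d > 0" "coprime a d" "q = of_int a / of_int d"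
    using ad quotient_of_denom_pos quotient_of_coprime quotient_of_div by blast+
  have q: "of_rat q = (of_int a / of_int d :: 'a)" by (simp add: d(3) of_rat_divide)
  have pd: "\<not> int p dvd d"
  proof
    assume pd: "int p dvd d"
    hence "\<not> int p dvd a" using d(2) p_prime
      by (metis coprime_common_divisor not_prime_unit prime_nat_int_transfer)
    hence "nv (of_int a) = 1" by (rule nv_of_int_unit)
    moreover have "nv (of_int d) \<le> 1 / real p ^ 1" using pd by (intro nv_of_int_dvd) simp
    moreover have "1 / real p < 1" using p_gt_1 by simp
    moreover have "nv (of_int d) > 0" using d(1) by (intro nv_pos) simp
    ultimately have "nv (of_rat q) > 1" unfolding q nv_divide by simp
    thus False using assms by simp
  qed
  have "coprime d (int p ^ b)"
    using pd p_prime by (metis coprime_commute coprime_power_right_iff prime_imp_coprime prime_nat_int_transfer)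
  then obtain u v where uv: "u * d + v * int p ^ b = 1" using bezout_int[of d "int p ^ b"] by (auto simp: coprime_iff_gcd_eq_1)
  define k where "k = nat ((a * u) mod int p ^ b)"
  have pp: "int p ^ b > 0" using p_prime by (simp add: prime_gt_0_nat)
  have k: "int k = (a * u) mod int p ^ b" using pp by (simp add: k_def)
  have "int p ^ b dvd a - int k * d"
  proof -
    have "a - int k * d = a * (u * d + v * int p ^ b) - int k * d" using uv by simp
    also have "\<dots> = (a * u - (a * u) mod int p ^ b) * d + a * v * int p ^ b" by (simp add: k algebra_simps)
    finally show ?thesis by (simp add: minus_mod_eq_mult_div)
  qed
  hence "nv (of_int (a - int k * d)) \<le> 1 / real p ^ b" by (rule nv_of_int_dvd)
  moreover have "of_rat q - of_nat k = (of_int (a - int k * d) / of_int d :: 'a)"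
    using d(1) by (simp add: q field_simps)
  moreover have "nv (of_int d) = 1" by (rule nv_of_int_unit[OF pd])
  ultimately have "nv (of_rat q - of_nat k) \<le> 1 / real p ^ b" by (simp add: nv_divide)
  moreover have "int k < int (p ^ b)" using k pp by simp
  hence "k < p ^ b" by (simp only: of_nat_less_iff)
  ultimately show ?thesis using that by blast
qed

end

section \<open>Counting elements separated by an ultrametric absolute value\<close>

context ultra_absval
begin

lemma nv_sum_distinct:
  assumes "finite I" "I \<noteq> {}" "inj_on (\<lambda>i. nv (f i)) I"
  shows "\<exists>i\<in>I. nv (sum f I) = nv (f i)"
  using assms
proof (induction I rule: finite_ne_induct)
  case (insert j I)
  have "inj_on (\<lambda>i. nv (f i)) I" using insert.prems by (rule inj_on_subset) auto
  with insert.IH obtain i where i: "i \<in> I" "nv (sum f I) = nv (f i)" by auto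
  have "nv (f i) \<noteq> nv (f j)" using inj_onD[OF insert.prems, of i j] insert.hyps i(1) by auto
  hence "nv (f j + sum f I) = nv (f j) \<or> nv (f j + sum f I) = nv (f i)"
    using nv_add_eq[of "f j" "sum f I"] nv_add_eq[of "sum f I" "f j"] i(2)
    by (cases "nv (f i) < nv (f j)") (auto simp: add.commute)
  thus ?case using i insert.hyps by auto
qed simp

text \<open>Digit expansions with positions \<open>Ts\<close> and digits \<open>Z\<close>. Distinct
  digits differ by a unit, so in a difference of two expansions the surviving terms have the
  distinct sizes of their positions, and one of these is the size of the whole difference.\<close>

lemma digit_sums:
  assumes F: "is_subfield F" and s: "s \<ge> 0"
    and P: "finite Ts" "Ts \<subseteq> F" "inj_on nv Ts" "\<And>t. t \<in> Ts \<Longrightarrow> s < nv t \<and> nv t \<le> 1"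
    and Z: "finite Z" "Z \<subseteq> F" "\<And>z. z \<in> Z \<Longrightarrow> nv z \<le> 1" "\<And>z z'. z \<in> Z \<Longrightarrow> z' \<in> Z \<Longrightarrow> z \<noteq> z' \<Longrightarrow> nv (z - z') = 1"
  obtains Y where "finite Y" "Y \<subseteq> F" "card Y = card Z ^ card Ts" "\<And>y. y \<in> Y \<Longrightarrow> nv y \<le> 1"
    "\<And>y y'. y \<in> Y \<Longrightarrow> y' \<in> Y \<Longrightarrow> y \<noteq> y' \<Longrightarrow> nv (y - y') > s"
proof -
  define D where "D = Ts \<rightarrow>\<^sub>E Z"
  define val where "val d = (\<Sum>t\<in>Ts. d t * t)" for d
  have key: "nv (val d - val d') > s \<and> val d \<noteq> val d'" if d: "d \<in> D" "d' \<in> D" "d \<noteq> d'" for d d'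
  proof -
    define I where "I = {t \<in> Ts. d t \<noteq> d' t}"
    have "I \<noteq> {}"
    proof
      assume "I = {}"
      hence "d = d'" using d unfolding D_def by (intro PiE_ext) (auto simp: I_def)
      thus False using d by simp
    qed
    have eq: "val d - val d' = (\<Sum>t\<in>I. (d t - d' t) * t)"
      unfolding val_def sum_subtractf[symmetric] left_diff_distrib[symmetric]
      by (intro sum.mono_neutral_right) (auto simp: I_def P(1))
    have n1: "nv ((d t - d' t) * t) = nv t" if t: "t \<in> I" for t
    proof -
      have "d t \<in> Z" "d' t \<in> Z" "d t \<noteq> d' t" using t d by (auto simp: I_def D_def)
      thus ?thesis using Z(4) by (simp add: nv_mult)
    qed
    have "\<exists>t\<in>I. nv (\<Sum>t\<in>I. (d t - d' t) * t) = nv ((d t - d' t) * t)"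
    proof (rule nv_sum_distinct)
      have "inj_on nv I" using P(3) by (rule inj_on_subset) (auto simp: I_def)
      thus "inj_on (\<lambda>t. nv ((d t - d' t) * t)) I" by (subst inj_on_cong[OF n1]) 
    qed (use P(1) \<open>I \<noteq> {}\<close> in \<open>auto simp: I_def\<close>)
    then obtain t where "t \<in> I" "nv (val d - val d') = nv t" using n1 eq by auto
    hence "s < nv (val d - val d')" using P(4)[of t] by (simp add: I_def)
    moreover from this have "val d \<noteq> val d'" using s by auto
    ultimately show ?thesis by blast
  qed
  have inj: "inj_on val D" using key by (meson inj_onI)
  show ?thesis
  proof (rule that)
    show "finite (val ` D)" using P Z by (auto simp: D_def intro: finite_PiE)
    show "val ` D \<subseteq> F"
    proof
      fix y assume "y \<in> val ` D"
      then obtain d where d: "d \<in> D" "y = val d" by auto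
      have "(\<Sum>t\<in>A. d t * t) \<in> F" if "A \<subseteq> Ts" for A
        using finite_subset[OF that P(1)] that
      proof (induction A rule: finite_induct)
        case (insert t A)
        have "d t \<in> F" "t \<in> F" using insert.prems d(1) Z(2) P(2) by (auto simp: D_def)
        thus ?case using insert by (auto intro!: is_subfield_closed[OF F])
      qed (simp add: is_subfield_closed[OF F])
      thus "y \<in> F" using d by (simp add: val_def)
    qed
    show "card (val ` D) = card Z ^ card Ts"
      using card_image[OF inj] P(1) by (simp add: D_def card_PiE)
    show "nv y \<le> 1" if "y \<in> val ` D" for y
    proof -
      from that obtain d where d: "d \<in> D" "y = val d" by auto
      show ?thesis unfolding d(2) val_def
      proof (rule nv_sum_le_bound)
        fix t assume t: "t \<in> Ts"
        have "nv (d t) \<le> 1" using d t Z(3) by (auto simp: D_def)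
        thus "nv (d t * t) \<le> 1" using P(4)[OF t] nv_nonneg by (auto simp: nv_mult intro: mult_le_one)
      qed simp
    qed
    show "nv (y - y') > s" if "y \<in> val ` D" "y' \<in> val ` D" "y \<noteq> y'" for y y'
      using that key by auto
  qed
qed

text \<open>Induction on the set of possible distances. A maximal subset with all mutual distances
  equal to the largest one, \<open>t\<close>, becomes after rescaling a set with distances 1 and so
  has at most \<open>q\<close> elements. Every point is closer than \<open>t\<close> to one of them,
  and inside such a ball only smaller distances occur.\<close>

lemma separated_card_le:
  assumes F: "is_subfield F"
    and Q: "\<And>Z. finite Z \<Longrightarrow> Z \<subseteq> F \<Longrightarrow> (\<forall>z\<in>Z. nv z \<le> 1) \<Longrightarrow>
      (\<forall>z\<in>Z. \<forall>z'\<in>Z. z \<noteq> z' \<longrightarrow> nv (z - z') = 1) \<Longrightarrow> card Z \<le> q"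
    and q: "q \<ge> 1"
    and U: "finite U" "\<And>u. u \<in> U \<Longrightarrow> u > 0" and Y: "finite Y" "Y \<subseteq> F" "\<And>y y'. y \<in> Y \<Longrightarrow> y' \<in> Y \<Longrightarrow> y \<noteq> y' \<Longrightarrow> nv (y - y') \<in> U"
  shows "card Y \<le> q ^ card U"
  using U Y
proof (induction "card U" arbitrary: U Y)
  case 0
  hence "U = {}" by simp
  hence "\<forall>y\<in>Y. \<forall>y'\<in>Y. y = y'" using "0.prems" by blast
  hence "card Y \<le> 1" using "0.prems"(3) by (simp add: card_le_Suc0_iff_eq)
  thus ?case using \<open>U = {}\<close> by simp
next
  case (Suc n)
  have ne: "U \<noteq> {}" using Suc.hyps(2) by auto
  define t where "t = Max U"
  have t: "t \<in> U" "\<And>u. u \<in> U \<Longrightarrow> u \<le> t" using Suc.prems(1) ne by (auto simp: t_def)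
  define good where "good Z \<longleftrightarrow> Z \<subseteq> Y \<and> (\<forall>z\<in>Z. \<forall>z'\<in>Z. z \<noteq> z' \<longrightarrow> nv (z - z') = t)" for Z
  have "\<exists>Z. good Z \<and> (\<forall>Z'. good Z' \<longrightarrow> card Z' \<le> card Z)"
  proof -
    have "finite {Z. good Z}" by (rule finite_subset[of _ "Pow Y"]) (use Suc.prems in \<open>auto simp: good_def\<close>)
    moreover have "{Z. good Z} \<noteq> {}" by (auto simp: good_def intro!: exI[of _ "{}"])
    ultimately have "Max (card ` {Z. good Z}) \<in> card ` {Z. good Z}" by (intro Max_in) auto
    then obtain Z where "good Z" "card Z = Max (card ` {Z. good Z})" by auto
    thus ?thesis using \<open>finite {Z. good Z}\<close> by (intro exI[of _ Z]) (auto intro: Max_ge)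
  qed
  then obtain Z where Z: "good Z" and Zmax: "\<And>Z'. good Z' \<Longrightarrow> card Z' \<le> card Z" by blast
  have fZ: "finite Z" "Z \<subseteq> Y" using Z Suc.prems by (auto simp: good_def intro: finite_subset)
  have cov: "Y \<subseteq> (\<Union>z\<in>Z. {y \<in> Y. nv (y - z) < t})"
  proof
    fix y assume y: "y \<in> Y"
    show "y \<in> (\<Union>z\<in>Z. {y \<in> Y. nv (y - z) < t})"
    proof (rule ccontr)
      assume no: "y \<notin> (\<Union>z\<in>Z. {y \<in> Y. nv (y - z) < t})"
      have "z \<noteq> y \<Longrightarrow> nv (y - z) = t" if "z \<in> Z" for z
        using no y that t(2)[of "nv (y - z)"] Suc.prems(5)[of y z] fZ by force
      moreover have "y \<notin> Z" using no y Suc.prems(2)[OF t(1)] by force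
      ultimately have "good (insert y Z)" using Z y nv_diff_commute by (auto simp: good_def)
      from Zmax[OF this] fZ \<open>y \<notin> Z\<close> show False by simp
    qed
  qed
  have cls: "card {y \<in> Y. nv (y - z) < t} \<le> q ^ n" if "z \<in> Z" for z
  proof -
    have "card {y \<in> Y. nv (y - z) < t} \<le> q ^ card (U - {t})"
    proof (rule Suc.hyps(1))
      show "n = card (U - {t})" using Suc.hyps(2) Suc.prems(1) t(1) by simp
      show "nv (y - y') \<in> U - {t}" if y: "y \<in> {y \<in> Y. nv (y - z) < t}" "y' \<in> {y \<in> Y. nv (y - z) < t}" "y \<noteq> y'" for y y'
      proof -
        have "nv (y - y') \<le> max (nv (y - z)) (nv (y' - z))" using nv_ultra_diff[of "y - z" "y' - z"] by simp
        also have "\<dots> < t" using y by simp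
        finally show ?thesis using y Suc.prems(5)[of y y'] by auto
      qed
    qed (use Suc.prems in auto)
    moreover have "card (U - {t}) = n" using Suc.hyps(2)[symmetric] Suc.prems(1) t(1) by simp
    ultimately show ?thesis by simp
  qed
  have "card Z \<le> q"
  proof (cases "card Z \<le> 1")
    case False
    then obtain z0 z1 where z: "z0 \<in> Z" "z1 \<in> Z" "z1 \<noteq> z0"
      using card_le_Suc0_iff_eq[OF fZ(1)] by auto
    have nz: "nv (z1 - z0) = t" "z1 - z0 \<noteq> 0" using z Z by (auto simp: good_def)
    have tp: "t > 0" using Suc.prems(2) t(1) by blast
    let ?f = "\<lambda>z. (z - z0) / (z1 - z0)"
    have df: "?f z - ?f z' = (z - z') / (z1 - z0)" for z z' by (simp add: diff_divide_distrib)
    have inj: "inj_on ?f Z" using nz(2) by (intro inj_onI) simp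
    have "card (?f ` Z) \<le> q"
    proof (rule Q)
      have "Z \<subseteq> F" using fZ Suc.prems by auto
      thus "?f ` Z \<subseteq> F" using z by (auto intro!: is_subfield_closed(3,8)[OF F])
      show "\<forall>a\<in>?f ` Z. nv a \<le> 1"
      proof
        fix a assume "a \<in> ?f ` Z"
        then obtain z' where z': "z' \<in> Z" "a = ?f z'" by auto
        have "nv (z' - z0) \<le> t" using Z z'(1) z(1) tp by (cases "z' = z0") (auto simp: good_def)
        thus "nv a \<le> 1" using tp z'(2) nz(1) by (simp add: nv_divide)
      qed
      show "\<forall>a\<in>?f ` Z. \<forall>b\<in>?f ` Z. a \<noteq> b \<longrightarrow> nv (a - b) = 1"
      proof (intro ballI impI)
        fix a b assume "a \<in> ?f ` Z" "b \<in> ?f ` Z" "a \<noteq> b"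
        then obtain z' z'' where zz: "z' \<in> Z" "z'' \<in> Z" "z' \<noteq> z''" "a = ?f z'" "b = ?f z''" by auto
        have "nv (z' - z'') = t" using Z zz by (auto simp: good_def)
        thus "nv (a - b) = 1" using tp nz(1) unfolding zz(4,5) df by (simp add: nv_divide)
      qed
    qed (use fZ in simp)
    thus ?thesis using card_image[OF inj] by simp
  qed (use q in simp)
  have "card Y \<le> card (\<Union>z\<in>Z. {y \<in> Y. nv (y - z) < t})"
    using cov fZ Suc.prems(3) by (intro card_mono) auto
  also have "\<dots> \<le> (\<Sum>z\<in>Z. card {y \<in> Y. nv (y - z) < t})" by (rule card_UN_le[OF fZ(1)])
  also have "\<dots> \<le> (\<Sum>z\<in>Z. q ^ n)" by (rule sum_mono) (rule cls)
  also have "\<dots> \<le> q * q ^ n" using \<open>card Z \<le> q\<close> by simp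
  finally show ?case using Suc.hyps(2) by (metis power_Suc)
qed

text \<open>A separated subset of greatest cardinality is already a net: a point far from all its
  members could be added.\<close>

lemma separated_covering:
  assumes s: "s \<ge> 0"
    and bd: "\<And>Y. finite Y \<Longrightarrow> Y \<subseteq> B \<Longrightarrow> (\<forall>y\<in>Y. \<forall>y'\<in>Y. y \<noteq> y' \<longrightarrow> nv (y - y') > s) \<Longrightarrow> card Y \<le> N"
  obtains Z where "finite Z" "card Z \<le> N" "\<And>y. y \<in> B \<Longrightarrow> \<exists>z\<in>Z. nv (y - z) \<le> s"
proof -
  define good where "good Y \<longleftrightarrow> finite Y \<and> Y \<subseteq> B \<and> (\<forall>y\<in>Y. \<forall>y'\<in>Y. y \<noteq> y' \<longrightarrow> nv (y - y') > s)" for Y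
  have "good {}" by (simp add: good_def)
  moreover have "\<forall>Y. good Y \<longrightarrow> card Y < Suc N" using bd by (simp add: good_def less_Suc_eq_le)
  ultimately obtain Z where Z: "good Z" "\<And>Y. good Y \<Longrightarrow> card Y \<le> card Z"
    using ex_has_greatest_nat[of good "{}" card "Suc N"] by blast
  have "\<exists>z\<in>Z. nv (y - z) \<le> s" if y: "y \<in> B" for y
  proof (rule ccontr)
    assume no: "\<not> ?thesis"
    have "y \<notin> Z" using no s by force
    moreover from this have "good (insert y Z)" using Z(1) no y by (auto simp: good_def not_le nv_diff_commute[of _ y])
    ultimately show False using Z(2)[of "insert y Z"] Z(1) by (simp add: good_def)
  qed
  moreover have "card Z \<le> N" using bd[of Z] Z(1) by (auto simp: good_def)
  ultimately show ?thesis using that[of Z] Z(1) by (auto simp: good_def)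
qed

end

section \<open>Value groups and residue fields of subfields, relative to \<open>p\<close>\<close>

context padic_absval
begin

lemma padic_value_group: "value_group UNIV (padic_abs p) = range (\<lambda>k::int. real p powi k)"
proof (intro equalityI subsetI)
  fix v assume "v \<in> value_group UNIV (padic_abs p)"
  then obtain q where "q \<noteq> 0" "v = padic_abs p q" by (auto simp: value_group_def)
  thus "v \<in> range (\<lambda>k::int. real p powi k)" using nv_of_rat_value[of q] nv_of_rat[of q] by auto
next
  fix v assume "v \<in> range (\<lambda>k::int. real p powi k)"
  then obtain k :: int where k: "v = real p powi k" by auto
  have p0: "p \<noteq> 0" using p_prime by auto
  have "nv (of_rat (of_nat p powi (- k))) = real p powi k"
  proof (cases "k \<ge> 0")
    case True
    have "of_rat (of_nat p powi (- k)) = (inverse (of_nat p ^ nat k) :: 'a)"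
      using True by (simp add: power_int_def of_rat_inverse of_rat_power power_inverse)
    thus ?thesis using True by (simp add: nv_inverse nv_p_power power_int_def)
  next
    case False
    have "of_rat (of_nat p powi (- k)) = (of_nat p ^ nat (- k) :: 'a)"
      using False by (simp add: power_int_def of_rat_power)
    thus ?thesis using False by (simp add: nv_p_power power_int_def power_inverse divide_inverse)
  qed
  hence "v = padic_abs p (of_nat p powi (- k))" using k nv_of_rat by simp
  moreover have "(of_nat p :: rat) powi (- k) \<noteq> 0" using p0 by simp
  ultimately show "v \<in> value_group UNIV (padic_abs p)" unfolding value_group_def by blast
qed

definition coset :: "real \<Rightarrow> real set" where
  "coset v = (\<lambda>h. v * h) ` value_group UNIV (padic_abs p)"

lemma ram_index_eq: "ram_index_over_rat p F nv = card (coset ` value_group F nv)"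
  by (simp add: ram_index_over_rat_def group_index_def coset_def)

lemma coset_eqD:
  assumes "coset v = coset v'" shows "\<exists>k::int. v' = v * real p powi k"
proof -
  have "v' * real p powi 0 \<in> coset v'" unfolding coset_def padic_value_group by blast
  thus ?thesis using assms unfolding coset_def padic_value_group by auto
qed

lemma coset_scale: "coset (v * real p powi k) = coset v"
proof -
  have p0: "real p \<noteq> 0" using p_gt_1 by simp
  have "coset (v * real p powi k) \<subseteq> coset v" for v k
    unfolding coset_def padic_value_group using p0
    by (auto simp: mult.assoc power_int_add[symmetric])
  moreover have "v = (v * real p powi k) * real p powi (- k)"
    using p0 by (simp add: power_int_minus)
  ultimately show ?thesis by (metis subset_antisym)
qed

text \<open>Two values in one coset differ by a power of \<open>p\<close>, and a half-open interval
  with end points in ratio \<open>p\<close> has no room for both. So each such interval contains at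
  most as many values as the ramification index.\<close>

lemma inj_on_coset: "(a::real) > 0 \<Longrightarrow> inj_on coset (value_group F nv \<inter> {a<..a * p})"
proof (rule inj_onI)
  fix v v' :: real assume a: "a > 0" and v: "v \<in> value_group F nv \<inter> {a<..a * p}" "v' \<in> value_group F nv \<inter> {a<..a * p}"
    and c: "coset v = coset v'"
  have no: False if "u' = u * real p powi k" "k \<ge> 1" "a < u" "u' \<le> a * p" for u u' :: real and k :: int
  proof -
    have "real p powi 1 \<le> real p powi k" using that p_gt_1 by (intro power_int_increasing) auto
    hence "u * p \<le> u'" using that a by (simp add: mult_left_mono)
    moreover have "a * p < u * p" using that p_gt_1 by simp
    ultimately show False using that by linarith
  qed
  obtain k :: int where k: "v' = v * real p powi k" using coset_eqD[OF c] by auto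
  hence l: "v = v' * real p powi (- k)" using p_gt_1 by (simp add: power_int_minus)
  consider "k \<ge> 1" | "- k \<ge> 1" | "k = 0" by linarith
  thus "v = v'" using no[OF k] no[OF l] v k by cases auto
qed

lemma card_values_le:
  assumes "finite (coset ` value_group F nv)" "s > 0"
  shows "finite (value_group F nv \<inter> {s<..s * real p ^ J}) \<and>
    card (value_group F nv \<inter> {s<..s * real p ^ J}) \<le> ram_index_over_rat p F nv * J"
proof (induction J)
  case (Suc J)
  let ?V = "value_group F nv"
  let ?a = "s * real p ^ J"
  have a: "?a > 0" using assms p_gt_1 by simp
  have img: "coset ` (?V \<inter> {?a<..?a * p}) \<subseteq> coset ` ?V" by blast
  have f2: "finite (?V \<inter> {?a<..?a * p})"
    using finite_subset[OF img assms(1)] inj_on_coset[OF a] by (rule finite_imageD)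
  have c2: "card (?V \<inter> {?a<..?a * p}) \<le> ram_index_over_rat p F nv"
    unfolding ram_index_eq using inj_on_coset[OF a] img assms(1) by (rule card_inj_on_le)
  have "s \<le> ?a" using assms(2) p_gt_1 by (simp add: one_le_power)
  moreover have "?a * 1 \<le> ?a * p" using a p_gt_1 by (intro mult_left_mono) auto
  ultimately have eq: "?V \<inter> {s<..s * real p ^ Suc J} = (?V \<inter> {s<..?a}) \<union> (?V \<inter> {?a<..?a * p})"
    by (auto simp: mult_ac)
  have "card (?V \<inter> {s<..s * real p ^ Suc J}) \<le> card (?V \<inter> {s<..?a}) + card (?V \<inter> {?a<..?a * p})"
    unfolding eq by (rule card_Un_le)
  thus ?case using Suc c2 f2 eq by auto
qed auto

lemma normalize_value:
  assumes "v > 0" obtains k :: int where "1 / p < v * real p powi k" "v * real p powi k \<le> 1"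
proof -
  define k where "k = - \<lceil>log p v\<rceil>"
  have e: "v * real p powi k = real p powr (log p v + of_int k)"
    using assms p_gt_1 by (simp add: powr_add powr_real_of_int')
  have "v * real p powi k \<le> real p powr 0" unfolding e
    using p_gt_1 by (intro powr_mono) (auto simp: k_def)
  moreover have "v * real p powi k > real p powr (-1)" unfolding e
    using p_gt_1 ceiling_correct[of "log p v"] by (intro powr_less_mono) (auto simp: k_def)
  ultimately show ?thesis using that[of k] p_gt_1 by (simp add: powr_minus_divide)
qed

text \<open>Each coset in \<open>C\<close> has a representative with value above
  \<open>1 / p\<close> and at most 1; multiplying it by the first \<open>j\<close> powers of
  \<open>p\<close> gives the positions for the digit sums.\<close>

lemma value_representatives:
  assumes F: "is_subfield F" and C: "finite C" "C \<subseteq> coset ` value_group F nv"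
  obtains Ts where "finite Ts" "Ts \<subseteq> F" "inj_on nv Ts" "card Ts = card C * j"
    "\<And>t. t \<in> Ts \<Longrightarrow> 1 / real p ^ j < nv t \<and> nv t \<le> 1"
proof -
  have ex: "\<exists>t. t \<in> F \<and> coset (nv t) = c \<and> 1 / p < nv t \<and> nv t \<le> 1" if c: "c \<in> C" for c
  proof -
    from c C obtain t where t: "t \<in> F" "t \<noteq> 0" "coset (nv t) = c" by (auto simp: value_group_def)
    obtain k :: int where k: "1 / p < nv t * real p powi k" "nv t * real p powi k \<le> 1"
      using normalize_value[OF nv_pos[OF t(2)]] by blast
    have "real p powi k \<in> value_group UNIV (padic_abs p)" unfolding padic_value_group by blast
    then obtain q where q: "nv (of_rat q) = real p powi k"
      unfolding value_group_def nv_of_rat by (metis imageE)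
    have "nv (t * of_rat q) = nv t * real p powi k" by (simp add: nv_mult q)
    moreover have "t * of_rat q \<in> F" using t by (intro is_subfield_closed[OF F] is_subfield_of_rat[OF F])
    ultimately show ?thesis using k t coset_scale by metis
  qed
  then obtain r where r: "\<And>c. c \<in> C \<Longrightarrow> r c \<in> F \<and> coset (nv (r c)) = c \<and> 1 / p < nv (r c) \<and> nv (r c) \<le> 1"
    by metis
  define g where "g = (\<lambda>(c, i). r c * of_nat p ^ i)"
  have ng: "nv (g (c, i)) = nv (r c) / real p ^ i" for c i by (simp add: g_def nv_mult nv_p_power)
  have cg: "coset (nv (g (c, i))) = c" if "c \<in> C" for c i
    using coset_scale[of "nv (r c)" "- int i"] r[OF that] by (simp add: ng power_int_minus divide_inverse)
  have inj: "inj_on (nv \<circ> g) (C \<times> {..<j})"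
  proof (rule inj_onI)
    fix a b assume ab: "a \<in> C \<times> {..<j}" "b \<in> C \<times> {..<j}" "(nv \<circ> g) a = (nv \<circ> g) b"
    obtain c i d l where cd: "a = (c, i)" "b = (d, l)" by fastforce
    hence "c = d" using ab cg[of c i] cg[of d l] by auto
    moreover have "nv (r c) > 0" using r[of c] ab cd p_gt_1 by (auto intro: less_trans[of 0 "1 / p"])
    ultimately have "real p ^ i = real p ^ l" using ab cd by (simp add: ng)
    hence "i = l" using p_gt_1 by simp
    thus "a = b" using cd \<open>c = d\<close> by simp
  qed
  show ?thesis
  proof (rule that)
    show "finite (g ` (C \<times> {..<j}))" using C by simp
    show "g ` (C \<times> {..<j}) \<subseteq> F"
    proof
      fix y assume "y \<in> g ` (C \<times> {..<j})"
      then obtain c i where "c \<in> C" "y = r c * of_rat (of_nat p ^ i)" by (auto simp: g_def of_rat_power)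
      thus "y \<in> F" using r by (auto intro!: is_subfield_closed(5)[OF F] is_subfield_of_rat[OF F])
    qed
    show "inj_on nv (g ` (C \<times> {..<j}))" using inj by (rule inj_on_imageI)
    show "card (g ` (C \<times> {..<j})) = card C * j"
      using card_image[OF inj_on_imageI2[OF inj]] by (simp add: card_cartesian_product)
    fix t assume "t \<in> g ` (C \<times> {..<j})"
    then obtain c i where ci: "c \<in> C" "i < j" "t = g (c, i)" by auto
    have "1 / real p ^ j \<le> 1 / real p ^ Suc i" using ci p_gt_1 by (intro divide_left_mono power_increasing) auto
    also have "\<dots> < nv (r c) / real p ^ i" using r[OF ci(1)] p_gt_1 by (simp add: field_simps)
    finally have "1 / real p ^ j < nv t" using ci ng by simp
    moreover have "nv (r c) / real p ^ i \<le> nv (r c) / 1"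
      using p_gt_1 nv_nonneg by (intro divide_left_mono) (auto simp: one_le_power)
    hence "nv t \<le> 1" using r[OF ci(1)] ci ng by simp
    ultimately show "1 / real p ^ j < nv t \<and> nv t \<le> 1" by simp
  qed
qed

lemma residue_class_eq_iff:
  assumes F: "is_subfield F" and "z \<in> F" "z' \<in> F"
  shows "{y \<in> F. nv (y - z) < 1} = {y \<in> F. nv (y - z') < 1} \<longleftrightarrow> nv (z - z') < 1"
proof
  assume "{y \<in> F. nv (y - z) < 1} = {y \<in> F. nv (y - z') < 1}"
  moreover have "z \<in> {y \<in> F. nv (y - z) < 1}" using assms by simp
  ultimately show "nv (z - z') < 1" by blast
next
  assume l: "nv (z - z') < 1"
  have "nv (y - z) < 1 \<longleftrightarrow> nv (y - z') < 1" for y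
    using nv_ultra[of "y - z" "z - z'"] nv_ultra_diff[of "y - z'" "z - z'"] l by auto
  thus "{y \<in> F. nv (y - z) < 1} = {y \<in> F. nv (y - z') < 1}" by auto
qed

lemma separated_residues_card:
  assumes F: "is_subfield F" and fin: "finite (residue_field F nv)"
    and Z: "Z \<subseteq> F" "\<forall>z\<in>Z. nv z \<le> 1" "\<forall>z\<in>Z. \<forall>z'\<in>Z. z \<noteq> z' \<longrightarrow> nv (z - z') = 1"
  shows "card Z \<le> card (residue_field F nv)"
proof (rule card_inj_on_le)
  show "inj_on (\<lambda>x. {y \<in> F. nv (y - x) < 1}) Z"
  proof (rule inj_onI, rule ccontr)
    fix z z' assume z: "z \<in> Z" "z' \<in> Z" "{y \<in> F. nv (y - z) < 1} = {y \<in> F. nv (y - z') < 1}" "z \<noteq> z'"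
    hence "nv (z - z') < 1" using residue_class_eq_iff[OF F, of z z'] Z(1) by blast
    thus False using Z(3) z by auto
  qed
  show "(\<lambda>x. {y \<in> F. nv (y - x) < 1}) ` Z \<subseteq> residue_field F nv"
    using Z by (auto simp: residue_field_def)
qed (rule fin)

lemma residue_representatives:
  assumes F: "is_subfield F" and R: "finite R" "R \<subseteq> residue_field F nv"
  obtains Z where "finite Z" "Z \<subseteq> F" "card Z = card R" "\<And>z. z \<in> Z \<Longrightarrow> nv z \<le> 1"
    "\<And>z z'. z \<in> Z \<Longrightarrow> z' \<in> Z \<Longrightarrow> z \<noteq> z' \<Longrightarrow> nv (z - z') = 1"
proof -
  have "\<forall>c\<in>R. \<exists>z. z \<in> F \<and> nv z \<le> 1 \<and> c = {y \<in> F. nv (y - z) < 1}"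
    using R by (auto simp: residue_field_def)
  then obtain r where r: "\<And>c. c \<in> R \<Longrightarrow> r c \<in> F \<and> nv (r c) \<le> 1 \<and> c = {y \<in> F. nv (y - r c) < 1}"
    by metis
  have inj: "inj_on r R"
  proof (rule inj_onI)
    fix c d assume cd: "c \<in> R" "d \<in> R" "r c = r d"
    have "c = {y \<in> F. nv (y - r c) < 1}" using r cd by blast
    also have "\<dots> = d" using r[of d] cd by simp
    finally show "c = d" .
  qed
  show ?thesis
  proof (rule that)
    show "finite (r ` R)" "r ` R \<subseteq> F" "card (r ` R) = card R"
      using R r card_image[OF inj] by auto
    show "nv z \<le> 1" if "z \<in> r ` R" for z using that r by auto
    fix z z' assume z: "z \<in> r ` R" "z' \<in> r ` R" "z \<noteq> z'"
    then obtain c d where cd: "c \<in> R" "d \<in> R" "z = r c" "z' = r d" by auto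
    have zF: "z \<in> F" "z' \<in> F" using cd r by auto
    have ce: "c = {y \<in> F. nv (y - z) < 1}" "d = {y \<in> F. nv (y - z') < 1}" using r cd by blast+
    have "nv (z - z') \<le> 1" using nv_ultra_diff[of z z'] r cd by (meson max.bounded_iff order_trans)
    moreover have "\<not> nv (z - z') < 1"
    proof
      assume "nv (z - z') < 1"
      hence "c = d" using residue_class_eq_iff[OF F zF] ce by simp
      thus False using z cd by simp
    qed
    ultimately show "nv (z - z') = 1" by simp
  qed
qed

lemma prime_subfield_residues:
  assumes F: "is_subfield F"
  obtains R where "finite R" "R \<subseteq> residue_field F nv" "card R = p"
proof -
  let ?c = "\<lambda>z. {y \<in> F. nv (y - z) < 1}"
  have inF: "of_nat i \<in> F" for i using is_subfield_of_int[OF F, of "int i"] by simp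
  have ne: "?c (of_nat i) \<noteq> ?c (of_nat k)" if ik: "i < k" "k < p" for i k
  proof
    assume "?c (of_nat i) = ?c (of_nat k)"
    hence "nv (of_nat i - of_nat k) < 1" using residue_class_eq_iff[OF F inF inF] by blast
    moreover have "nv (of_int (int k - int i)) = 1"
      using ik by (intro nv_of_int_unit) (auto dest: zdvd_imp_le)
    ultimately show False using nv_diff_commute[of "of_nat i" "of_nat k"] by simp
  qed
  have inj: "inj_on (\<lambda>i. ?c (of_nat i)) {..<p}"
  proof (rule inj_onI, rule ccontr)
    fix i k assume "i \<in> {..<p}" "k \<in> {..<p}" "?c (of_nat i) = ?c (of_nat k)" "i \<noteq> k"
    thus False using ne[of i k] ne[of k i] by (cases "i < k") auto
  qed
  show ?thesis
  proof (rule that)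
    show "finite ((\<lambda>i. ?c (of_nat i)) ` {..<p})" by simp
    show "(\<lambda>i. ?c (of_nat i)) ` {..<p} \<subseteq> residue_field F nv"
      using inF nv_of_nat_le_1 by (auto simp: residue_field_def)
    show "card ((\<lambda>i. ?c (of_nat i)) ` {..<p}) = p" using card_image[OF inj] by simp
  qed
qed

text \<open>The lower half of the double count: \<open>card C * j\<close> positions, each with one
  digit per residue class in \<open>R\<close>.\<close>

lemma separated_family:
  assumes F: "is_subfield F" and C: "finite C" "C \<subseteq> coset ` value_group F nv"
    and R: "finite R" "R \<subseteq> residue_field F nv"
  obtains Y where "finite Y" "Y \<subseteq> F" "card Y = card R ^ (card C * j)" "\<And>y. y \<in> Y \<Longrightarrow> nv y \<le> 1"
    "\<And>y y'. y \<in> Y \<Longrightarrow> y' \<in> Y \<Longrightarrow> y \<noteq> y' \<Longrightarrow> nv (y - y') > 1 / real p ^ j"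
proof -
  obtain Ts where T: "finite Ts" "Ts \<subseteq> F" "inj_on nv Ts" "card Ts = card C * j"
    "\<And>t. t \<in> Ts \<Longrightarrow> 1 / real p ^ j < nv t \<and> nv t \<le> 1"
    using value_representatives[OF F C, of j] by blast
  obtain Z where Z: "finite Z" "Z \<subseteq> F" "card Z = card R" "\<And>z. z \<in> Z \<Longrightarrow> nv z \<le> 1"
    "\<And>z z'. z \<in> Z \<Longrightarrow> z' \<in> Z \<Longrightarrow> z \<noteq> z' \<Longrightarrow> nv (z - z') = 1"
    using residue_representatives[OF F R] by blast
  have "(0::real) \<le> 1 / real p ^ j" by simp
  from digit_sums[OF F this T(1,2,3,5) Z(1,2,4,5)]
  obtain Y where Y: "finite Y" "Y \<subseteq> F" "card Y = card Z ^ card Ts" "\<And>y. y \<in> Y \<Longrightarrow> nv y \<le> 1"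
    "\<And>y y'. y \<in> Y \<Longrightarrow> y' \<in> Y \<Longrightarrow> y \<noteq> y' \<Longrightarrow> nv (y - y') > 1 / real p ^ j" by blast
  show ?thesis by (rule that[OF Y(1,2) _ Y(4,5)]) (simp_all add: Y(3) Z(3) T(4))
qed

text \<open>The upper half of the double count. Distances between \<open>s\<close>-separated points
  of the ball are values in an interval with end points in ratio \<open>p ^ J\<close>, hence at most
  \<open>e * J\<close> in number, and \<open>separated_card_le\<close> applies.\<close>

lemma ball_covering:
  assumes F: "is_subfield F" and fin: "finite (coset ` value_group F nv)" "finite (residue_field F nv)"
    and s: "s > 0"
  obtains Z where "finite Z" "card Z \<le> card (residue_field F nv) ^ (ram_index_over_rat p F nv * J)"
    "\<And>y. y \<in> F \<Longrightarrow> nv y \<le> s * real p ^ J \<Longrightarrow> \<exists>z\<in>Z. nv (y - z) \<le> s"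
proof -
  let ?q = "card (residue_field F nv)" let ?e = "ram_index_over_rat p F nv"
  let ?U = "value_group F nv \<inter> {s<..s * real p ^ J}"
  obtain R where R: "finite R" "R \<subseteq> residue_field F nv" "card R = p" by (rule prime_subfield_residues[OF F])
  have q: "?q \<ge> 1" using card_mono[OF fin(2) R(2)] R(3) p_gt_1 by simp
  have bd: "card Y \<le> ?q ^ (?e * J)"
    if Y: "finite Y" "Y \<subseteq> {y \<in> F. nv y \<le> s * real p ^ J}" "\<forall>y\<in>Y. \<forall>y'\<in>Y. y \<noteq> y' \<longrightarrow> nv (y - y') > s" for Y
  proof -
    have "card Y \<le> ?q ^ card ?U"
    proof (rule separated_card_le[OF F _ q])
      show "finite ?U" using card_values_le[OF fin(1) s] by blast
      show "u > 0" if "u \<in> ?U" for u using that s by auto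
      show "nv (y - y') \<in> ?U" if y: "y \<in> Y" "y' \<in> Y" "y \<noteq> y'" for y y'
      proof -
        have "y \<in> F" "y' \<in> F" "nv y \<le> s * real p ^ J" "nv y' \<le> s * real p ^ J" using y Y(2) by auto
        moreover from this have "y - y' \<in> F" using is_subfield_closed(3)[OF F] by blast
        ultimately show ?thesis using y Y(3) nv_ultra_diff[of y y'] by (auto simp: value_group_def)
      qed
    qed (use Y separated_residues_card[OF F fin(2)] in auto)
    also have "\<dots> \<le> ?q ^ (?e * J)" using q card_values_le[OF fin(1) s, of J] by (intro power_increasing) auto
    finally show ?thesis .
  qed
  have "s \<ge> 0" using s by simp
  from separated_covering[OF this bd] obtain Z where Z: "finite Z" "card Z \<le> ?q ^ (?e * J)"
    "\<And>y. y \<in> {y \<in> F. nv y \<le> s * real p ^ J} \<Longrightarrow> \<exists>z\<in>Z. nv (y - z) \<le> s" by blast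
  show ?thesis by (rule that[OF Z(1,2)]) (use Z(3) in auto)
qed

end

section \<open>Independence of the places above \<open>p\<close> and weak approximation\<close>

lemma padic_place_separation:
  assumes W: "padic_absval W p" "padic_absval W' p" and F: "is_subfield F"
    and u: "u \<in> F" "W u \<noteq> W' u"
  obtains z where "z \<in> F" "W z < 1" "W' z > 1"
proof -
  interpret W: padic_absval W p by fact
  interpret W': padic_absval W' p by fact
  have p1: "real p > 1" by (rule W.p_gt_1)
  have "\<exists>u\<in>F. 0 < W u \<and> W u < W' u"
  proof (cases "W u < W' u")
    case True
    have "u \<noteq> 0" using u by auto
    thus ?thesis using True u W.nv_pos by blast
  next
    case False
    have u0: "u \<noteq> 0" using u by auto
    have "W (inverse u) < W' (inverse u)"
      using False u(2) W'.nv_pos[OF u0] W.nv_pos[OF u0] by (simp add: W.nv_inverse W'.nv_inverse)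
    thus ?thesis using is_subfield_closed(7)[OF F u(1)] W.nv_pos u0 by (metis inverse_nonzero_iff_nonzero)
  qed
  then obtain y where y: "y \<in> F" "0 < W y" "W y < W' y" by blast
  have "W' y / W y > 1" using y by simp
  \<comment> \<open>Both absolute values agree on rational numbers. Once their ratio exceeds
    \<open>p ^ 2\<close>, a power of \<open>p\<close> can move the smaller value into the range
    above \<open>1 / p ^ 2\<close> and up to \<open>1 / p\<close>, which pushes the larger one
    beyond 1.\<close>
  then obtain k where k: "(real p)\<^sup>2 < (W' y / W y) ^ k" using real_arch_pow by blast
  have Wk: "W (y ^ k) > 0" using y by (simp add: W.nv_power)
  obtain l :: int where l: "1 / p < W (y ^ k) * real p powi l" "W (y ^ k) * real p powi l \<le> 1"
    using W.normalize_value[OF Wk] by blast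
  define m where "m = l - 1"
  have pm: "real p powi m * p = real p powi l" using p1 by (simp add: m_def power_int_diff)
  have pmp: "real p powi m > 0" using p1 by simp
  have "real p powi m \<in> value_group UNIV (padic_abs p)" unfolding W.padic_value_group by blast
  then obtain q where q: "padic_abs p q = real p powi m"
    unfolding value_group_def by (metis imageE)
  define z where "z = y ^ k * of_rat q"
  have Wz: "W z = W (y ^ k) * real p powi m" by (simp add: z_def W.nv_mult W.nv_of_rat q)
  have W'z: "W' z = W' (y ^ k) * real p powi m" by (simp add: z_def W'.nv_mult W'.nv_of_rat q)
  have "W z * p \<le> 1" using l(2) unfolding Wz pm[symmetric] by (simp add: mult.assoc)
  moreover have Wz0: "W z > 0" using Wk pmp by (simp add: Wz)
  ultimately have "W z < 1" using mult_strict_left_mono[OF p1, of "W z"] by linarith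
  moreover have "W' z > 1"
  proof -
    have "1 / p < W z * p" using l(1) unfolding Wz pm[symmetric] by (simp add: mult.assoc)
    hence "1 < W z * (real p)\<^sup>2" using p1 by (simp add: field_simps power2_eq_square)
    also have "\<dots> < W z * (W' y / W y) ^ k" using k Wz0 by simp
    also have "\<dots> = W' z" using y by (simp add: Wz W'z W.nv_power W'.nv_power power_divide)
    finally show ?thesis .
  qed
  moreover have "z \<in> F" unfolding z_def
    by (intro is_subfield_closed[OF F] is_subfield_of_rat[OF F] y)
  ultimately show ?thesis using that by blast
qed

lemma eventually_power_less:
  fixes a b e :: real
  assumes "0 \<le> a" "a < 1" "e > 0"
  shows "\<forall>\<^sub>F k in sequentially. a ^ k * b < e"
proof -
  have "(\<lambda>k. a ^ k * b) \<longlonglongrightarrow> 0 * b" by (intro tendsto_intros LIMSEQ_realpow_zero assms)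
  thus ?thesis using assms(3) by (intro order_tendstoD(2)) auto
qed

text \<open>Induction over the places to be avoided. If the new place does not see \<open>z\<close>
  as large, a high power of \<open>z\<close> times a separating \<open>y\<close> works. Otherwise
  \<open>z ^ k / (1 + z ^ k)\<close> replaces the power: it has size 1 wherever \<open>z\<close> is
  large and is as small as \<open>z ^ k\<close> elsewhere.\<close>

lemma padic_place_isolation:
  assumes F: "is_subfield F" and W0: "padic_absval W0 p" and I: "finite I" "\<And>W. W \<in> I \<Longrightarrow> padic_absval W p"
    and ne: "\<And>W. W \<in> I \<Longrightarrow> \<exists>u\<in>F. W u \<noteq> W0 u"
  shows "\<exists>z\<in>F. W0 z > 1 \<and> (\<forall>W\<in>I. W z < 1)"
  using I ne
proof (induction I rule: finite_induct)
  case empty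
  interpret W0: padic_absval W0 p by fact
  have "inverse (of_nat p) \<in> F" using is_subfield_closed(7)[OF F is_subfield_of_int[OF F, of "int p"]] by simp
  moreover have "W0 (inverse (of_nat p)) > 1" using W0.p_gt_1 by (simp add: W0.nv_inverse W0.nv_p)
  ultimately show ?case by blast
next
  case (insert W1 I)
  interpret W0: padic_absval W0 p by fact
  interpret W1: padic_absval W1 p using insert by auto
  note c = is_subfield_closed[OF F]
  obtain z where z: "z \<in> F" "W0 z > 1" "\<And>W. W \<in> I \<Longrightarrow> W z < 1" using insert by auto
  obtain u where u: "u \<in> F" "W1 u \<noteq> W0 u" using insert.prems by blast
  obtain y where y: "y \<in> F" "W1 y < 1" "W0 y > 1"
    by (rule padic_place_separation[OF W1.padic_absval_axioms W0 F u])
  have small: "\<forall>\<^sub>F k in sequentially. \<forall>W\<in>I. W z ^ k * W y < 1"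
  proof (intro eventually_ball_finite ballI)
    fix W assume W: "W \<in> I"
    interpret W: padic_absval W p using insert W by auto
    show "\<forall>\<^sub>F k in sequentially. W z ^ k * W y < 1"
      using z(3)[OF W] W.nv_nonneg by (intro eventually_power_less) auto
  qed (use insert in auto)
  have "\<forall>\<^sub>F k in sequentially. k \<ge> 1 \<and> (\<forall>W\<in>I. W z ^ k * W y < 1)"
    using small eventually_ge_at_top[of "1::nat"] by eventually_elim auto
  then obtain k where k: "k \<ge> 1" "\<And>W. W \<in> I \<Longrightarrow> W z ^ k * W y < 1"
    by (auto simp: eventually_sequentially)
  have W0k: "W0 z ^ k > 1" using z(2) k(1) by (simp add: one_less_power)
  show ?case
  proof (cases "W1 z \<le> 1")
    case True
    have "W0 (z ^ k * y) > 1" using W0k y(3) by (simp add: W0.nv_mult W0.nv_power less_1_mult)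
    moreover have "W1 (z ^ k * y) < 1"
    proof -
      have "W1 z ^ k \<le> 1" using True W1.nv_nonneg by (simp add: power_le_one)
      hence "W1 z ^ k * W1 y \<le> 1 * W1 y" using W1.nv_nonneg by (rule mult_right_mono)
      thus ?thesis using y(2) by (simp add: W1.nv_mult W1.nv_power)
    qed
    moreover have "W (z ^ k * y) < 1" if W: "W \<in> I" for W
    proof -
      interpret W: padic_absval W p using insert W by auto
      show ?thesis using k(2)[OF W] by (simp add: W.nv_mult W.nv_power)
    qed
    moreover have "z ^ k * y \<in> F" by (intro c z y)
    ultimately show ?thesis by blast
  next
    case False
    define t where "t = z ^ k / (1 + z ^ k)"
    have big: "W t = 1" if W: "padic_absval W p" "W z > 1" for W
    proof -
      interpret W: padic_absval W p by fact
      have zk: "W (z ^ k) > 1" using W(2) k(1) by (simp add: W.nv_power one_less_power)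
      hence "W (1 + z ^ k) = W (z ^ k)" by (intro W.nv_add_eq) simp
      thus ?thesis using zk by (simp add: t_def W.nv_divide)
    qed
    have "W0 (t * y) > 1" using big[OF W0 z(2)] y(3) by (simp add: W0.nv_mult)
    moreover have "W1 (t * y) < 1" using big[OF W1.padic_absval_axioms] False y(2) by (simp add: W1.nv_mult)
    moreover have "W (t * y) < 1" if W: "W \<in> I" for W
    proof -
      interpret W: padic_absval W p using insert W by auto
      have "W (z ^ k) < 1" using z(3)[OF W] W.nv_nonneg[of z] k(1) by (simp add: W.nv_power power_less_one_iff)
      hence "W (1 + z ^ k) = 1" using W.nv_add_eq[of "z ^ k" 1] by (simp add: add.commute)
      thus ?thesis using k(2)[OF W] by (simp add: t_def W.nv_mult W.nv_divide W.nv_power)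
    qed
    moreover have "t * y \<in> F" unfolding t_def by (intro c z y)
    ultimately show ?thesis by blast
  qed
qed

text \<open>For an isolating \<open>z\<close> the quotients \<open>z ^ k / (1 + z ^ k)\<close> tend
  to 1 at \<open>W0\<close>, where \<open>z\<close> is large, and to 0 at the places of
  \<open>I\<close>, where it is small.\<close>

lemma weak_approximation:
  assumes F: "is_subfield F" and W0: "padic_absval W0 p" and I: "finite I" "\<And>W. W \<in> I \<Longrightarrow> padic_absval W p"
    and ne: "\<And>W. W \<in> I \<Longrightarrow> \<exists>u\<in>F. W u \<noteq> W0 u" and e: "e > 0"
  shows "\<exists>z\<in>F. W0 (z - 1) < e \<and> (\<forall>W\<in>I. W z < e)"
proof -
  interpret W0: padic_absval W0 p by fact
  note c = is_subfield_closed[OF F]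
  obtain z where z: "z \<in> F" "W0 z > 1" "\<And>W. W \<in> I \<Longrightarrow> W z < 1"
    using padic_place_isolation[OF F W0 I ne] by blast
  have "\<forall>\<^sub>F k in sequentially. \<forall>W\<in>I. W z ^ k * 1 < e"
  proof (intro eventually_ball_finite ballI)
    fix W assume W: "W \<in> I"
    interpret W: padic_absval W p using I W by auto
    show "\<forall>\<^sub>F k in sequentially. W z ^ k * 1 < e"
      using z(3)[OF W] W.nv_nonneg e by (intro eventually_power_less) auto
  qed (use I in auto)
  moreover have "\<forall>\<^sub>F k in sequentially. inverse (W0 z) ^ k * 1 < e"
    using z(2) e by (intro eventually_power_less) (auto simp: inverse_less_1_iff)
  ultimately have "\<forall>\<^sub>F k in sequentially. k \<ge> 1 \<and> (\<forall>W\<in>I. W z ^ k * 1 < e) \<and> inverse (W0 z) ^ k * 1 < e"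
    using eventually_ge_at_top[of "1::nat"] by eventually_elim auto
  then obtain k where k: "k \<ge> 1" "\<And>W. W \<in> I \<Longrightarrow> W z ^ k < e" "inverse (W0 z) ^ k < e"
    by (auto simp: eventually_sequentially)
  define t where "t = z ^ k / (1 + z ^ k)"
  have zk: "W0 (z ^ k) > 1" using z(2) k(1) by (simp add: W0.nv_power one_less_power)
  hence s: "W0 (1 + z ^ k) = W0 (z ^ k)" by (intro W0.nv_add_eq) simp
  hence nz: "1 + z ^ k \<noteq> 0" using zk by auto
  have "t - 1 = - inverse (1 + z ^ k)" using nz by (simp add: t_def field_simps)
  hence "W0 (t - 1) = inverse (W0 z) ^ k" by (simp add: s W0.nv_inverse W0.nv_power power_inverse)
  hence "W0 (t - 1) < e" using k by simp
  moreover have "W t < e" if W: "W \<in> I" for W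
  proof -
    interpret W: padic_absval W p using I W by auto
    have "W (z ^ k) < 1" using z(3)[OF W] W.nv_nonneg[of z] k(1) by (simp add: W.nv_power power_less_one_iff)
    hence "W (1 + z ^ k) = 1" using W.nv_add_eq[of "z ^ k" 1] by (simp add: add.commute)
    thus ?thesis using k(2)[OF W] by (simp add: t_def W.nv_divide W.nv_power)
  qed
  moreover have "t \<in> F" unfolding t_def by (intro c z)
  ultimately show ?thesis by blast
qed

section \<open>Places of the field generated by one element\<close>

lemma finite_place_extension:
  fixes F :: "'a::qbar set"
  assumes F: "is_subfield F" and w: "finite_place p F w"
  obtains W where "padic_absval W p" "\<And>u. u \<in> F \<Longrightarrow> W u = w u"
proof -
  have pr: "prime p" and nw: "nonarch_abs_on F w" and wq: "\<And>q. w (of_rat q) = padic_abs p q"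
    using w by (auto simp: finite_place_def)
  have "multiplicity (int p) (int p) = 1" using pr by (intro multiplicity_self) auto
  hence "padic_abs p (of_int (int p)) = inverse (real p)"
    using pr unfolding padic_abs_def quotient_of_int by (simp add: power_int_minus)
  hence "w (of_nat p) = inverse (real p)" using wq[of "of_int (int p)"] by simp
  moreover have "inverse (real p) < 1" using prime_gt_1_nat[OF pr] by (simp add: inverse_less_1_iff)
  moreover have "of_nat p \<in> F" using is_subfield_of_int[OF F, of "int p"] by simp
  moreover have "of_nat p \<noteq> (0::'a)" using pr by (simp add: prime_gt_0_nat)
  ultimately obtain W where W: "nonarch_abs_on UNIV W" "\<And>u. u \<in> F \<Longrightarrow> W u = w u"
    using nonarch_abs_extension[OF F nw, of "of_nat p"] by metis
  interpret ultra_absval W by (rule nonarch_abs_on_UNIV[OF W(1)])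
  have "padic_absval W p"
    by unfold_locales (use pr W(2) wq is_subfield_of_rat[OF F] in auto)
  thus ?thesis using W(2) that by blast
qed

lemma value_group_cong: "(\<And>u. u \<in> F \<Longrightarrow> W u = w u) \<Longrightarrow> value_group F W = value_group F w"
  unfolding value_group_def by (rule image_cong) auto

lemma residue_field_cong:
  assumes "is_subfield F" "\<And>u. u \<in> F \<Longrightarrow> W u = w u"
  shows "residue_field F W = residue_field F w"
proof -
  have "{y \<in> F. W (y - z) < 1} = {y \<in> F. w (y - z) < 1}" if "z \<in> F" for z
    using assms is_subfield_closed(3)[OF assms(1) _ that] by auto
  moreover have "{z \<in> F. W z \<le> 1} = {z \<in> F. w z \<le> 1}" using assms(2) by auto
  ultimately show ?thesis unfolding residue_field_def by (intro image_cong) auto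
qed

lemma local_degree_cong:
  assumes "is_subfield F" "\<And>u. u \<in> F \<Longrightarrow> W u = w u"
  shows "local_degree p F W = local_degree p F w"
  using residue_field_cong[OF assms] value_group_cong[of F W w] assms(2)
  by (simp add: local_degree_def ram_index_over_rat_def)

lemma rat_adjoin_low_degree:
  assumes "u \<in> rat_adjoin (x::'a::qbar)"
  obtains c where "degree c < card (conjs x)" "u = poly (rpoly c) x"
proof -
  from assms obtain q where q: "u = poly (rpoly q) x" by (auto simp: rat_adjoin_eq)
  define r where "r = q mod minpoly x"
  have "(rpoly q :: 'a poly) = rpoly (q div minpoly x * minpoly x + r)" by (simp add: r_def)
  hence "u = poly (rpoly r) x" using q minpoly_props(2)[of x] unfolding rpoly_simps by simp
  moreover have "degree r < card (conjs x)"
    using degree_mod_less[OF minpoly_nonzero[of x], of q] degree_minpoly[of x] card_conjs_pos[of x]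
    by (auto simp: r_def)
  ultimately show ?thesis using that by blast
qed

locale padic_qbar = padic_absval nv p for nv :: "'a::qbar \<Rightarrow> real" and p +
  fixes x :: 'a
begin

abbreviation "F \<equiv> rat_adjoin x"
abbreviation "n \<equiv> card (conjs x)"

lemma F_subfield: "is_subfield F" by (rule is_subfield_rat_adjoin)

lemma x_in_F: "x \<in> F" by (auto simp: rat_adjoin_def)

definition plc :: "('a \<Rightarrow> 'a) \<Rightarrow> 'a \<Rightarrow> real" where
  "plc g = restrict (nv \<circ> g) F"

lemma auts_agree_on_F:
  assumes "g \<in> auts" "g' \<in> auts" "g x = g' x" "u \<in> F" shows "g u = g' u"
proof -
  obtain q where "u = poly (rpoly q) x" using assms(4) by (auto simp: rat_adjoin_eq)
  thus ?thesis using assms(1-3) by (simp add: auts_def field_hom_rpoly)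
qed

lemma padic_absval_aut: "g \<in> auts \<Longrightarrow> padic_absval (nv \<circ> g) p"
proof -
  assume "g \<in> auts"
  hence g: "field_hom g" by (simp add: auts_def)
  show ?thesis
    by unfold_locales
      (auto simp: nv_nonneg nv_eq_0_iff field_hom_eq_0_iff[OF g] field_hom_mult[OF g] nv_mult
        field_hom_add[OF g] nv_triangle nv_ultra p_prime field_hom_of_rat[OF g] nv_of_rat)
qed

lemma finite_place_restrict:
  assumes "padic_absval W p" shows "finite_place p F (restrict W F)"
proof -
  interpret W: padic_absval W p by fact
  show ?thesis unfolding finite_place_def nonarch_abs_on_def
    using is_subfield_closed[OF F_subfield] is_subfield_of_rat[OF F_subfield] p_prime
    by (auto simp: W.nv_nonneg W.nv_eq_0_iff W.nv_mult W.nv_of_rat intro: W.nv_ultra)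
qed

text \<open>The places that automorphisms induce from the fixed absolute value. That every finite
  place above \<open>p\<close> arises in this way is the conclusion of the double count, see
  \<open>all_places\<close>.\<close>

definition places :: "('a \<Rightarrow> real) set" where "places = plc ` auts"

lemma finite_places: "finite places"
proof -
  have "\<forall>y\<in>conjs x. \<exists>g. g \<in> auts \<and> g x = y" by (auto simp: conjs_def)
  from bchoice[OF this] obtain h where h: "\<And>y. y \<in> conjs x \<Longrightarrow> h y \<in> auts \<and> h y x = y" by blast
  have "places \<subseteq> (\<lambda>y. plc (h y)) ` conjs x"
  proof
    fix w assume "w \<in> places"
    then obtain g where g: "g \<in> auts" "w = plc g" by (auto simp: places_def)
    have gx: "g x \<in> conjs x" by (rule conjsI[OF g(1)])
    have "plc g = plc (h (g x))" unfolding plc_def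
      using auts_agree_on_F[OF g(1), of "h (g x)"] h[OF gx] by (intro restrict_ext) simp
    thus "w \<in> (\<lambda>y. plc (h y)) ` conjs x" using g gx by blast
  qed
  thus ?thesis using finite_conjs finite_surj by blast
qed

lemma places_finite_place: "w \<in> places \<Longrightarrow> finite_place p F w"
  unfolding places_def plc_def using finite_place_restrict[OF padic_absval_aut] by auto

text \<open>An extension to the whole field, chosen so that the results on absolute values apply to
  an arbitrary place of \<open>F\<close>.\<close>

definition ext :: "('a \<Rightarrow> real) \<Rightarrow> 'a \<Rightarrow> real" where
  "ext w = (SOME W. padic_absval W p \<and> (\<forall>u\<in>F. W u = w u))"

lemma ext_props: assumes "finite_place p F w"
  shows "padic_absval (ext w) p" "\<And>u. u \<in> F \<Longrightarrow> ext w u = w u"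
proof -
  have "\<exists>W. padic_absval W p \<and> (\<forall>u\<in>F. W u = w u)"
    using finite_place_extension[OF F_subfield assms] by metis
  hence "padic_absval (ext w) p \<and> (\<forall>u\<in>F. ext w u = w u)" unfolding ext_def by (rule someI_ex)
  thus "padic_absval (ext w) p" "\<And>u. u \<in> F \<Longrightarrow> ext w u = w u" by auto
qed

lemma ext_differ:
  assumes "finite_place p F w" "finite_place p F w'" "w \<noteq> w'"
  shows "\<exists>u\<in>F. ext w u \<noteq> ext w' u"
proof (rule ccontr)
  assume "\<not> ?thesis"
  hence "\<And>u. u \<in> F \<Longrightarrow> w u = w' u" using ext_props(2)[OF assms(1)] ext_props(2)[OF assms(2)] by simp
  hence "w = w'" using assms(1,2) by (intro extensionalityI[where A = F]) (auto simp: finite_place_def)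
  thus False using assms(3) by simp
qed

text \<open>Separated families are built at each place of \<open>S\<close> separately, and weak
  approximation glues each tuple of their members into a single element of \<open>F\<close>. The
  sizes therefore multiply.\<close>

lemma separated_tuples:
  assumes S: "finite S" "\<And>w. w \<in> S \<Longrightarrow> finite_place p F w"
    and C: "\<And>w. w \<in> S \<Longrightarrow> finite (C w) \<and> C w \<subseteq> coset ` value_group F (ext w)"
    and R: "\<And>w. w \<in> S \<Longrightarrow> finite (R w) \<and> R w \<subseteq> residue_field F (ext w)"
  shows "\<exists>U. finite U \<and> U \<subseteq> F \<and> card U = (\<Prod>w\<in>S. card (R w) ^ (card (C w) * j)) \<and>
    (\<forall>u\<in>U. \<forall>w\<in>S. ext w u \<le> 1) \<and>
    (\<forall>u\<in>U. \<forall>u'\<in>U. u \<noteq> u' \<longrightarrow> (\<exists>w\<in>S. ext w (u - u') > 1 / real p ^ j))"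
proof -
  note cl = is_subfield_closed[OF F_subfield]
  have exY: "\<exists>Y. finite Y \<and> Y \<subseteq> F \<and> card Y = card (R w) ^ (card (C w) * j) \<and> (\<forall>y\<in>Y. ext w y \<le> 1) \<and>
    (\<forall>y\<in>Y. \<forall>y'\<in>Y. y \<noteq> y' \<longrightarrow> ext w (y - y') > 1 / real p ^ j)" if w: "w \<in> S" for w
  proof -
    interpret W: padic_absval "ext w" p by (rule ext_props[OF S(2)[OF w]])
    show ?thesis using W.separated_family[OF F_subfield, of "C w" "R w" j] C[OF w] R[OF w] by metis
  qed
  obtain Y where Y': "\<forall>w\<in>S. finite (Y w) \<and> Y w \<subseteq> F \<and> card (Y w) = card (R w) ^ (card (C w) * j) \<and> (\<forall>y\<in>Y w. ext w y \<le> 1) \<and>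
    (\<forall>y\<in>Y w. \<forall>y'\<in>Y w. y \<noteq> y' \<longrightarrow> ext w (y - y') > 1 / real p ^ j)"
    using bchoice[OF ballI[OF exY]] by (rule exE)
  have Y: "\<And>w. w \<in> S \<Longrightarrow> finite (Y w)" "\<And>w. w \<in> S \<Longrightarrow> Y w \<subseteq> F"
    "\<And>w. w \<in> S \<Longrightarrow> card (Y w) = card (R w) ^ (card (C w) * j)"
    "\<And>w y. w \<in> S \<Longrightarrow> y \<in> Y w \<Longrightarrow> ext w y \<le> 1"
    "\<And>w y y'. w \<in> S \<Longrightarrow> y \<in> Y w \<Longrightarrow> y' \<in> Y w \<Longrightarrow> y \<noteq> y' \<Longrightarrow> ext w (y - y') > 1 / real p ^ j"
    using Y' by auto
  have nn: "ext w y \<ge> 0" if "w \<in> S" for w y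
  proof -
    interpret W: padic_absval "ext w" p by (rule ext_props[OF S(2)[OF that]])
    show ?thesis by (rule W.nv_nonneg)
  qed
  define Mx where "Mx = 1 + (\<Sum>w\<in>S. \<Sum>w'\<in>S. \<Sum>y\<in>Y w'. ext w y)"
  have Mx: "ext w y \<le> Mx" if "w \<in> S" "w' \<in> S" "y \<in> Y w'" for w w' y
  proof -
    have "ext w y \<le> (\<Sum>y\<in>Y w'. ext w y)" using that Y(1) nn by (intro member_le_sum) auto
    also have "\<dots> \<le> (\<Sum>w'\<in>S. \<Sum>y\<in>Y w'. ext w y)"
      using that S(1) nn by (intro member_le_sum[of w' S "\<lambda>w'. \<Sum>y\<in>Y w'. ext w y"] sum_nonneg) auto
    also have "\<dots> \<le> (\<Sum>w\<in>S. \<Sum>w'\<in>S. \<Sum>y\<in>Y w'. ext w y)"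
      using that S(1) nn by (intro member_le_sum[of w S "\<lambda>w. \<Sum>w'\<in>S. \<Sum>y\<in>Y w'. ext w y"] sum_nonneg) auto
    finally show ?thesis by (simp add: Mx_def)
  qed
  have Mx1: "Mx > 0" unfolding Mx_def using nn by (intro add_pos_nonneg sum_nonneg) auto
  \<comment> \<open>\<open>Mx\<close> bounds all chosen digits at all places, so an approximation
    error \<open>e\<close> grows to at most \<open>1 / p ^ j\<close> after multiplication, which the
    strict separation of the families tolerates.\<close>
  define e where "e = 1 / real p ^ j / Mx"
  have e: "e > 0" using Mx1 p_gt_1 by (simp add: e_def)
  have "\<exists>z. z \<in> F \<and> ext w (z - 1) < e \<and> (\<forall>w'\<in>S - {w}. ext w' z < e)" if w: "w \<in> S" for w
  proof -
    have "\<exists>z\<in>F. ext w (z - 1) < e \<and> (\<forall>W\<in>ext ` (S - {w}). W z < e)"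
    proof (rule weak_approximation[OF F_subfield])
      fix W assume "W \<in> ext ` (S - {w})"
      then obtain w' where w': "w' \<in> S" "w' \<noteq> w" "W = ext w'" by auto
      show "padic_absval W p" using ext_props(1)[OF S(2)[OF w'(1)]] w' by simp
      show "\<exists>u\<in>F. W u \<noteq> ext w u" using ext_differ[of w' w] S(2) w w' by simp
    qed (use ext_props(1)[OF S(2)[OF w]] S e in auto)
    thus ?thesis by auto
  qed
  then obtain z where z: "\<And>w. w \<in> S \<Longrightarrow> z w \<in> F" "\<And>w. w \<in> S \<Longrightarrow> ext w (z w - 1) < e"
    "\<And>w w'. w \<in> S \<Longrightarrow> w' \<in> S \<Longrightarrow> w' \<noteq> w \<Longrightarrow> ext w' (z w) < e"
    by (metis Diff_iff singletonD)
  define u where "u f = (\<Sum>w\<in>S. f w * z w)" for f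
  have near: "ext w (u f - f w) \<le> 1 / real p ^ j" if f: "f \<in> Pi\<^sub>E S Y" and w: "w \<in> S" for f w
  proof -
    interpret W: padic_absval "ext w" p by (rule ext_props[OF S(2)[OF w]])
    have fin: "f w' \<in> Y w'" if "w' \<in> S" for w' using f that by auto
    have eM: "Mx * e = 1 / real p ^ j" using Mx1 by (simp add: e_def)
    have "u f - f w = f w * (z w - 1) + (\<Sum>w'\<in>S - {w}. f w' * z w')"
      unfolding u_def using S(1) w by (subst sum.remove[of S w]) (auto simp: algebra_simps)
    moreover have "ext w (f w * (z w - 1)) \<le> 1 / real p ^ j"
      unfolding eM[symmetric] W.nv_mult using Mx[OF w w fin[OF w]] z(2)[OF w] W.nv_nonneg Mx1
      by (intro mult_mono) auto
    moreover have "ext w (\<Sum>w'\<in>S - {w}. f w' * z w') \<le> 1 / real p ^ j"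
    proof (rule W.nv_sum_le_bound)
      fix w' assume w': "w' \<in> S - {w}"
      show "ext w (f w' * z w') \<le> 1 / real p ^ j"
        unfolding eM[symmetric] W.nv_mult using Mx[OF w _ fin] z(3)[of w' w] w w' W.nv_nonneg Mx1
        by (intro mult_mono) auto
    qed simp
    ultimately show ?thesis using W.nv_ultra[of "f w * (z w - 1)" "\<Sum>w'\<in>S - {w}. f w' * z w'"] by simp
  qed
  have sep: "\<exists>w\<in>S. ext w (u f - u f') > 1 / real p ^ j" if f: "f \<in> Pi\<^sub>E S Y" "f' \<in> Pi\<^sub>E S Y" "f \<noteq> f'" for f f'
  proof -
    obtain w where w: "w \<in> S" "f w \<noteq> f' w" using f by (meson PiE_ext)
    interpret W: padic_absval "ext w" p by (rule ext_props[OF S(2)[OF w(1)]])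
    have 1: "ext w (f w - f' w) > 1 / real p ^ j" using Y(5)[OF w(1)] f w by (auto simp: PiE_mem)
    have "ext w (f w - f' w) \<le> max (ext w (f w - u f)) (max (ext w (u f - u f')) (ext w (u f' - f' w)))"
      using W.nv_ultra[of "f w - u f" "(u f - u f') + (u f' - f' w)"] W.nv_ultra[of "u f - u f'" "u f' - f' w"] by simp
    thus ?thesis using 1 near[OF f(1) w(1)] near[OF f(2) w(1)] w(1) W.nv_diff_commute[of "f w" "u f"]
      by (intro bexI[of _ w]) auto
  qed
  have p0: "1 / real p ^ j > 0" using p_gt_1 by simp
  have inj: "inj_on u (Pi\<^sub>E S Y)"
  proof (rule inj_onI, rule ccontr)
    fix f f' assume "f \<in> Pi\<^sub>E S Y" "f' \<in> Pi\<^sub>E S Y" "u f = u f'" "f \<noteq> f'"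
    from sep[OF this(1,2,4)] obtain w where w: "w \<in> S" "ext w (u f - u f') > 1 / real p ^ j" by blast
    interpret W: padic_absval "ext w" p by (rule ext_props[OF S(2)[OF w(1)]])
    show False using w(2) \<open>u f = u f'\<close> p0 by simp
  qed
  show ?thesis
  proof (intro exI[of _ "u ` Pi\<^sub>E S Y"] conjI ballI impI)
    show "finite (u ` Pi\<^sub>E S Y)" using S(1) Y(1) by (auto intro: finite_PiE)
    show "u ` Pi\<^sub>E S Y \<subseteq> F"
    proof
      fix v assume "v \<in> u ` Pi\<^sub>E S Y"
      then obtain f where f: "f \<in> Pi\<^sub>E S Y" "v = u f" by auto
      have "(\<Sum>w\<in>T. f w * z w) \<in> F" if "T \<subseteq> S" for T
        using finite_subset[OF that S(1)] that
      proof (induction T rule: finite_induct)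
        case (insert w T)
        have "f w \<in> F" "z w \<in> F" using insert.prems f(1) Y(2) z(1) by (auto simp: PiE_mem)
        thus ?case using insert by (auto intro!: cl)
      qed (simp add: cl)
      thus "v \<in> F" using f by (simp add: u_def)
    qed
    show "card (u ` Pi\<^sub>E S Y) = (\<Prod>w\<in>S. card (R w) ^ (card (C w) * j))"
      using card_image[OF inj] S(1) Y(3) by (simp add: card_PiE)
    show "ext w v \<le> 1" if v: "v \<in> u ` Pi\<^sub>E S Y" "w \<in> S" for v w
    proof -
      from v obtain f where f: "f \<in> Pi\<^sub>E S Y" "v = u f" by auto
      interpret W: padic_absval "ext w" p by (rule ext_props[OF S(2)[OF v(2)]])
      have "1 / real p ^ j \<le> 1" using p_gt_1 by (simp add: one_le_power)
      moreover have "ext w (f w) \<le> 1" using Y(4) f v(2) by (auto simp: PiE_mem)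
      ultimately show ?thesis using near[OF f(1) v(2)] W.nv_ultra[of "u f - f w" "f w"] f(2) by auto
    qed
    show "\<exists>w\<in>S. ext w (v - v') > 1 / real p ^ j" if "v \<in> u ` Pi\<^sub>E S Y" "v' \<in> u ` Pi\<^sub>E S Y" "v \<noteq> v'" for v v'
      using that sep by auto
  qed
qed

section \<open>First half of the fundamental identity: the local degrees sum to at most
  \<open>n\<close>\<close>

lemma integral_coeff_bound:
  assumes S: "places \<subseteq> S" "\<And>w. w \<in> S \<Longrightarrow> finite_place p F w"
  obtains a where "\<And>c i. degree c < n \<Longrightarrow> (\<And>w. w \<in> S \<Longrightarrow> ext w (poly (rpoly c) x) \<le> 1) \<Longrightarrow>
    nv (of_rat (coeff c i)) \<le> real p ^ a"
proof -
  obtain C where C: "C > 0" "\<And>P B i. degree P < card (conjs x) \<Longrightarrow>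
      (\<And>y. y \<in> conjs x \<Longrightarrow> nv (poly P y) \<le> B) \<Longrightarrow> nv (coeff P i) \<le> C * B"
    using coeff_bound_by_values[OF finite_conjs[of x]] by blast
  obtain a where a: "C < real p ^ a" using real_arch_pow[OF p_gt_1] by blast
  have "nv (of_rat (coeff c i)) \<le> real p ^ a"
    if c: "degree c < n" "\<And>w. w \<in> S \<Longrightarrow> ext w (poly (rpoly c) x) \<le> 1" for c i
  proof -
    have "nv (coeff (rpoly c :: 'a poly) i) \<le> C * 1"
    proof (rule C(2))
      fix y assume "y \<in> conjs x"
      then obtain g where g: "g \<in> auts" "y = g x" by (auto simp: conjs_def)
      \<comment> \<open>The value of \<open>nv\<close> at a conjugate is the value of an induced
        place at the original element. Integrality at \<open>S\<close>, which contains
        \<open>places\<close>, thus bounds the polynomial at all nodes.\<close>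
      have w: "plc g \<in> S" using S(1) g by (auto simp: places_def)
      have uF: "poly (rpoly c) x \<in> F" unfolding rat_adjoin_eq by blast
      have "nv (poly (rpoly c) y) = nv (g (poly (rpoly c) x))" using g by (simp add: auts_def field_hom_rpoly)
      also have "\<dots> = ext (plc g) (poly (rpoly c) x)" using ext_props(2)[OF S(2)[OF w] uF] uF by (simp add: plc_def)
      also have "\<dots> \<le> 1" by (rule c(2)[OF w])
      finally show "nv (poly (rpoly c) y) \<le> 1" .
    qed (use c in simp)
    thus ?thesis using a by simp
  qed
  thus ?thesis using that by blast
qed

text \<open>A box count in the power basis of \<open>x\<close>: elements whose rational coordinates
  agree to sufficient p-adic precision are close at every place of \<open>S\<close>. The constant
  \<open>c\<close> does not depend on \<open>j\<close>, so it disappears in the limit of large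
  \<open>j\<close>.\<close>

lemma separated_elements_bound:
  assumes S: "finite S" "places \<subseteq> S" "\<And>w. w \<in> S \<Longrightarrow> finite_place p F w"
  shows "\<exists>c. \<forall>j U. finite U \<longrightarrow> U \<subseteq> F \<longrightarrow> (\<forall>u\<in>U. \<forall>w\<in>S. ext w u \<le> 1) \<longrightarrow>
    (\<forall>u\<in>U. \<forall>u'\<in>U. u \<noteq> u' \<longrightarrow> (\<exists>w\<in>S. ext w (u - u') > 1 / real p ^ j)) \<longrightarrow>
    card U \<le> p ^ (n * (c + j))"
proof -
  obtain a where a: "\<And>c i. degree c < n \<Longrightarrow> (\<And>w. w \<in> S \<Longrightarrow> ext w (poly (rpoly c) x) \<le> 1) \<Longrightarrow>
    nv (of_rat (coeff c i)) \<le> real p ^ a" using integral_coeff_bound[OF S(2,3)] by blast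
  have nn: "ext w y \<ge> 0" if "w \<in> S" for w y
  proof -
    interpret W: padic_absval "ext w" p by (rule ext_props[OF S(3)[OF that]])
    show ?thesis by (rule W.nv_nonneg)
  qed
  obtain b where b: "(\<Sum>w\<in>S. \<Sum>i<n. ext w x ^ i) < real p ^ b" using real_arch_pow[OF p_gt_1] by blast
  have b': "ext w x ^ i \<le> real p ^ b" if "w \<in> S" "i < n" for w i
  proof -
    have "ext w x ^ i \<le> (\<Sum>i<n. ext w x ^ i)" using that nn by (intro member_le_sum) auto
    also have "\<dots> \<le> (\<Sum>w\<in>S. \<Sum>i<n. ext w x ^ i)"
      using that S(1) nn by (intro member_le_sum[of w S "\<lambda>w. \<Sum>i<n. ext w x ^ i"] sum_nonneg) auto
    finally show ?thesis using b by simp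
  qed
  have bd: "card U \<le> p ^ (n * ((a + b) + j))"
    if U: "finite U" "U \<subseteq> F" "\<And>u w. u \<in> U \<Longrightarrow> w \<in> S \<Longrightarrow> ext w u \<le> 1"
      "\<And>u u'. u \<in> U \<Longrightarrow> u' \<in> U \<Longrightarrow> u \<noteq> u' \<Longrightarrow> \<exists>w\<in>S. ext w (u - u') > 1 / real p ^ j" for j U
  proof -
    \<comment> \<open>Digits of precision: \<open>a\<close> for the denominators of the coordinates,
      \<open>b\<close> for the size of the powers of \<open>x\<close>, and \<open>j\<close> for the
      required closeness.\<close>
    define N where "N = a + b + j"
    have "\<forall>u\<in>U. \<exists>c. degree c < n \<and> u = poly (rpoly c) x" using U(2) rat_adjoin_low_degree by (metis subsetD)
    then obtain c where c: "\<And>u. u \<in> U \<Longrightarrow> degree (c u) < n" "\<And>u. u \<in> U \<Longrightarrow> u = poly (rpoly (c u)) x" by metis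
    have "\<exists>k<p ^ N. nv (of_rat (of_nat p ^ a * coeff (c u) i) - of_nat k) \<le> 1 / real p ^ N" if u: "u \<in> U" for u i
    proof -
      have "nv (of_rat (coeff (c u) i)) \<le> real p ^ a" using a[OF c(1)[OF u]] U(3)[OF u] c(2)[OF u] by metis
      hence "nv (of_rat (of_nat p ^ a * coeff (c u) i)) \<le> 1"
        using p_gt_1 by (simp add: of_rat_mult of_rat_power nv_mult nv_p_power field_simps)
      from nv_of_rat_approx[OF this, of N] show ?thesis by blast
    qed
    then obtain k where k: "\<And>u i. u \<in> U \<Longrightarrow> k u i < p ^ N"
      "\<And>u i. u \<in> U \<Longrightarrow> nv (of_rat (of_nat p ^ a * coeff (c u) i) - of_nat (k u i)) \<le> 1 / real p ^ N" by metis
    have inj: "inj_on (\<lambda>u. restrict (k u) {..<n}) U"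
    proof (rule inj_onI, rule ccontr)
      fix u u' assume u: "u \<in> U" "u' \<in> U" "restrict (k u) {..<n} = restrict (k u') {..<n}" "u \<noteq> u'"
      obtain w where w: "w \<in> S" "ext w (u - u') > 1 / real p ^ j" using U(4)[OF u(1,2,4)] by blast
      interpret W: padic_absval "ext w" p by (rule ext_props[OF S(3)[OF w(1)]])
      define r where "r = c u - c u'"
      have dr: "degree r < n" unfolding r_def using c(1) u by (intro degree_diff_less) auto
      have cr: "ext w (of_rat (coeff r i)) * real p ^ b \<le> 1 / real p ^ j" if i: "i < n" for i
      proof -
        let ?P = "of_nat p ^ a :: rat"
        have ki: "k u i = k u' i" using u(3) i by (metis lessThan_iff restrict_apply')
        have "(of_rat (?P * coeff r i) :: 'a) = (of_rat (?P * coeff (c u) i) - of_nat (k u i)) - (of_rat (?P * coeff (c u') i) - of_nat (k u' i))"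
          by (simp add: ki r_def of_rat_diff algebra_simps)
        hence "nv (of_rat (?P * coeff r i)) \<le> 1 / real p ^ N"
          using nv_ultra_diff[of "of_rat (?P * coeff (c u) i) - of_nat (k u i)" "of_rat (?P * coeff (c u') i) - of_nat (k u' i)"]
            k(2)[OF u(1), of i] k(2)[OF u(2), of i] by simp
        hence "nv (of_rat (coeff r i)) / real p ^ a \<le> 1 / real p ^ N"
          by (simp add: of_rat_mult of_rat_power nv_mult nv_p_power)
        hence "nv (of_rat (coeff r i)) * real p ^ b \<le> 1 / real p ^ j"
          using p_gt_1 by (simp add: N_def power_add field_simps)
        thus ?thesis by (simp add: nv_of_rat W.nv_of_rat)
      qed
      have "u - u' = poly (rpoly r) x" using c(2)[OF u(1)] c(2)[OF u(2)] by (simp add: r_def)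
      also have "\<dots> = (\<Sum>i<n. of_rat (coeff r i) * x ^ i)"
        unfolding poly_altdef using dr by (intro sum.mono_neutral_cong_left) (auto simp: coeff_eq_0)
      finally have "ext w (u - u') = ext w (\<Sum>i<n. of_rat (coeff r i) * x ^ i)" by simp
      also have "\<dots> \<le> 1 / real p ^ j"
      proof (rule W.nv_sum_le_bound)
        fix i assume i: "i \<in> {..<n}"
        have "ext w (of_rat (coeff r i) * x ^ i) \<le> ext w (of_rat (coeff r i)) * real p ^ b"
          unfolding W.nv_mult W.nv_power using b'[OF w(1)] i W.nv_nonneg by (intro mult_left_mono) auto
        thus "ext w (of_rat (coeff r i) * x ^ i) \<le> 1 / real p ^ j" using cr i by force
      qed simp
      finally show False using w(2) by simp
    qed
    have "(\<lambda>u. restrict (k u) {..<n}) ` U \<subseteq> Pi\<^sub>E {..<n} (\<lambda>_. {..<p ^ N})"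
    proof (rule image_subsetI)
      fix u assume "u \<in> U"
      thus "restrict (k u) {..<n} \<in> Pi\<^sub>E {..<n} (\<lambda>_. {..<p ^ N})"
        unfolding restrict_PiE_iff using k(1) by auto
    qed
    hence "card U \<le> card (Pi\<^sub>E {..<n} (\<lambda>_. {..<p ^ N}))"
      by (rule card_inj_on_le[OF inj]) (auto intro!: finite_PiE)
    also have "\<dots> = p ^ (n * N)" by (simp add: card_PiE power_mult[symmetric] mult.commute)
    finally show ?thesis by (simp add: N_def)
  qed
  show ?thesis
  proof (intro exI[of _ "a + b"] allI impI)
    fix j U assume h: "finite U" "U \<subseteq> F" "\<forall>u\<in>U. \<forall>w\<in>S. ext w u \<le> 1"
      "\<forall>u\<in>U. \<forall>u'\<in>U. u \<noteq> u' \<longrightarrow> (\<exists>w\<in>S. ext w (u - u') > 1 / real p ^ j)"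
    show "card U \<le> p ^ (n * (a + b + j))" using h(3,4) by (intro bd[OF h(1,2)]) auto
  qed
qed

text \<open>Comparing the number of separated tuples with the box count gives \<open>j\<close> times
  the sum at most \<open>n * (c + j)\<close> for all \<open>j\<close>. Finite sets
  \<open>C w\<close> and \<open>R w\<close> stand for the value group and the residue field, since
  it is from this bound that their finiteness is derived.\<close>

lemma sum_local_bound:
  assumes S: "finite S" "places \<subseteq> S" "\<And>w. w \<in> S \<Longrightarrow> finite_place p F w"
    and C: "\<And>w. w \<in> S \<Longrightarrow> finite (C w) \<and> C w \<subseteq> coset ` value_group F (ext w)"
    and R: "\<And>w. w \<in> S \<Longrightarrow> finite (R w) \<and> R w \<subseteq> residue_field F (ext w)" "\<And>w. w \<in> S \<Longrightarrow> card (R w) > 0"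
  shows "(\<Sum>w\<in>S. real (card (C w)) * log p (card (R w))) \<le> n"
proof -
  obtain c where c: "\<forall>j U. finite U \<longrightarrow> U \<subseteq> F \<longrightarrow> (\<forall>u\<in>U. \<forall>w\<in>S. ext w u \<le> 1) \<longrightarrow>
    (\<forall>u\<in>U. \<forall>u'\<in>U. u \<noteq> u' \<longrightarrow> (\<exists>w\<in>S. ext w (u - u') > 1 / real p ^ j)) \<longrightarrow>
    card U \<le> p ^ (n * (c + j))" using separated_elements_bound[OF S] by blast
  let ?s = "\<Sum>w\<in>S. real (card (C w)) * log p (card (R w))"
  have j: "real j * ?s \<le> real n * (real c + real j)" for j
  proof -
    obtain U where U: "finite U" "U \<subseteq> F" "card U = (\<Prod>w\<in>S. card (R w) ^ (card (C w) * j))"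
      "\<forall>u\<in>U. \<forall>w\<in>S. ext w u \<le> 1"
      "\<forall>u\<in>U. \<forall>u'\<in>U. u \<noteq> u' \<longrightarrow> (\<exists>w\<in>S. ext w (u - u') > 1 / real p ^ j)"
      using separated_tuples[OF S(1,3) C R(1), of j] by auto
    have "card U \<le> p ^ (n * (c + j))" using c U(1,2,4,5) by blast
    hence "real (\<Prod>w\<in>S. card (R w) ^ (card (C w) * j)) \<le> real (p ^ (n * (c + j)))"
      unfolding U(3)[symmetric] by (simp only: of_nat_le_iff)
    hence le: "(\<Prod>w\<in>S. real (card (R w)) ^ (card (C w) * j)) \<le> real p ^ (n * (c + j))" by simp
    have pos: "(\<Prod>w\<in>S. real (card (R w)) ^ (card (C w) * j)) > 0" using R(2) by (intro prod_pos) auto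
    have "log p (\<Prod>w\<in>S. real (card (R w)) ^ (card (C w) * j)) \<le> log p (real p ^ (n * (c + j)))"
      using le pos p_gt_1 by (subst log_le_cancel_iff) auto
    also have "\<dots> = n * (c + j)" using p_gt_1 by (simp add: log_nat_power)
    also have "log p (\<Prod>w\<in>S. real (card (R w)) ^ (card (C w) * j)) = (\<Sum>w\<in>S. log p (real (card (R w)) ^ (card (C w) * j)))"
      using R(2) S(1) p_gt_1 by (subst log_def) (simp add: ln_prod log_def sum_divide_distrib)
    also have "\<dots> = real j * ?s"
      using R(2) by (simp add: log_nat_power sum_distrib_left mult_ac)
    finally show ?thesis by simp
  qed
  show ?thesis
  proof (rule ccontr)
    assume "\<not> ?s \<le> n"
    hence d: "?s - n > 0" by simp
    then obtain j where "real j * (?s - n) > real n * real c" using reals_Archimedean3 by blast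
    thus False using j[of j] by (simp add: algebra_simps)
  qed
qed

end

context padic_qbar
begin

lemma one_coset: "padic_absval W p \<Longrightarrow> coset 1 \<in> coset ` value_group F W"
proof -
  assume "padic_absval W p"
  then interpret W: padic_absval W p .
  have "1 \<in> value_group F W" unfolding value_group_def
    using is_subfield_closed(2)[OF F_subfield] W.nv_1 by force
  thus ?thesis by blast
qed

text \<open>If there were infinitely many cosets or residues, a finite selection at the single place
  \<open>w\<close> would already exceed \<open>n\<close> in \<open>sum_local_bound\<close>:
  \<open>n + 1\<close> cosets with \<open>p\<close> residues, or one coset with
  \<open>p ^ (n + 1)\<close> residues.\<close>

lemma place_finite:
  assumes w: "finite_place p F w"
  shows "finite (coset ` value_group F (ext w))" "finite (residue_field F (ext w))"
proof -
  define S where "S = insert w places"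
  have S: "finite S" "places \<subseteq> S" "\<And>w. w \<in> S \<Longrightarrow> finite_place p F w"
    using finite_places places_finite_place w by (auto simp: S_def)
  have "\<exists>R. finite R \<and> R \<subseteq> residue_field F (ext w') \<and> card R = p" if "w' \<in> S" for w'
  proof -
    interpret W: padic_absval "ext w'" p by (rule ext_props[OF S(3)[OF that]])
    show ?thesis using W.prime_subfield_residues[OF F_subfield] by metis
  qed
  hence "\<forall>w'\<in>S. \<exists>R. finite R \<and> R \<subseteq> residue_field F (ext w') \<and> card R = p" by blast
  from bchoice[OF this] obtain R0 where
    R0: "\<forall>w'\<in>S. finite (R0 w') \<and> R0 w' \<subseteq> residue_field F (ext w') \<and> card (R0 w') = p" by (rule exE)
  have p0: "p > 0" "log p p = 1" using p_prime p_gt_1 by (auto simp: prime_gt_0_nat)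
  have c0: "finite {coset 1} \<and> {coset 1} \<subseteq> coset ` value_group F (ext w')" if "w' \<in> S" for w'
    using one_coset[OF ext_props(1)[OF S(3)[OF that]]] by simp
  have wS: "w \<in> S" by (simp add: S_def)
  show "finite (coset ` value_group F (ext w))"
  proof (rule ccontr)
    assume "infinite (coset ` value_group F (ext w))"
    then obtain C1 where C1: "finite C1" "card C1 = Suc n" "C1 \<subseteq> coset ` value_group F (ext w)"
      using infinite_arbitrarily_large by blast
    define C where "C = (\<lambda>w'. if w' = w then C1 else {coset 1})"
    have "(\<Sum>w'\<in>S. real (card (C w')) * log p (card (R0 w'))) \<le> n"
      by (rule sum_local_bound[OF S]) (use C1 c0 R0 p0 in \<open>auto simp: C_def\<close>)
    moreover have "real (card (C w)) * log p (card (R0 w)) \<le> (\<Sum>w'\<in>S. real (card (C w')) * log p (card (R0 w')))"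
      using R0 p0 wS S(1) by (intro member_le_sum) auto
    ultimately show False using C1 R0 p0 wS by (simp add: C_def)
  qed
  show "finite (residue_field F (ext w))"
  proof (rule ccontr)
    assume "infinite (residue_field F (ext w))"
    then obtain R1 where R1: "finite R1" "card R1 = p ^ Suc n" "R1 \<subseteq> residue_field F (ext w)"
      using infinite_arbitrarily_large by blast
    define R where "R = (\<lambda>w'. if w' = w then R1 else R0 w')"
    have cR: "card (R w') \<ge> 1" if "w' \<in> S" for w' using R1(2) R0 p0 that by (auto simp: R_def)
    have "(\<Sum>w'\<in>S. real (card {coset 1}) * log p (card (R w'))) \<le> n"
      by (rule sum_local_bound[OF S]) (use R1 c0 R0 p0 in \<open>auto simp: R_def\<close>)
    moreover have "log p (card (R w)) \<le> (\<Sum>w'\<in>S. log p (card (R w')))"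
    proof (rule member_le_sum[OF wS _ S(1)])
      fix w' assume "w' \<in> S - {w}"
      thus "log p (card (R w')) \<ge> 0" using cR[of w'] p_gt_1 by (subst zero_le_log_cancel_iff) auto
    qed
    moreover have "log p (card (R w)) = real (Suc n)"
      using R1(2) p_gt_1 by (simp add: R_def log_nat_power del: power_Suc)
    ultimately show False by simp
  qed
qed

lemma local_degree_eq:
  assumes "finite_place p F w"
  shows "local_degree p F w = real (card (coset ` value_group F (ext w))) * log p (card (residue_field F (ext w)))"
proof -
  interpret W: padic_absval "ext w" p by (rule ext_props[OF assms])
  have "local_degree p F w = local_degree p F (ext w)"
    by (rule local_degree_cong[OF F_subfield, symmetric]) (rule ext_props(2)[OF assms])
  thus ?thesis by (simp add: local_degree_def W.ram_index_eq)
qed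

lemma residue_field_card_ge:
  assumes "finite_place p F w" shows "card (residue_field F (ext w)) \<ge> p"
proof -
  interpret W: padic_absval "ext w" p by (rule ext_props[OF assms])
  obtain R where "finite R" "R \<subseteq> residue_field F (ext w)" "card R = p"
    by (rule W.prime_subfield_residues[OF F_subfield])
  thus ?thesis using card_mono[OF place_finite(2)[OF assms]] by blast
qed

lemma local_degree_ge_1:
  assumes "finite_place p F w" shows "local_degree p F w \<ge> 1"
proof -
  have "coset ` value_group F (ext w) \<noteq> {}" using one_coset[OF ext_props(1)[OF assms]] by blast
  hence "card (coset ` value_group F (ext w)) \<ge> 1"
    using place_finite(1)[OF assms] by (simp add: Suc_le_eq card_gt_0_iff)
  moreover have "log p p \<le> log p (card (residue_field F (ext w)))"
    using residue_field_card_ge[OF assms] p_gt_1 by (subst log_le_cancel_iff) auto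
  hence "log p (card (residue_field F (ext w))) \<ge> 1" using p_gt_1 by simp
  ultimately show ?thesis unfolding local_degree_eq[OF assms] using mult_mono[of 1 "real (card (coset ` value_group F (ext w)))" 1] by simp
qed

lemma sum_local_degree_le:
  assumes S: "finite S" "places \<subseteq> S" "\<And>w. w \<in> S \<Longrightarrow> finite_place p F w"
  shows "(\<Sum>w\<in>S. local_degree p F w) \<le> n"
proof -
  have "(\<Sum>w\<in>S. local_degree p F w) = (\<Sum>w\<in>S. real (card (coset ` value_group F (ext w))) * log p (card (residue_field F (ext w))))"
    by (intro sum.cong refl local_degree_eq S)
  also have "\<dots> \<le> n"
  proof (rule sum_local_bound[OF S])
    show "card (residue_field F (ext w)) > 0" if "w \<in> S" for w
      using residue_field_card_ge[OF S(3)[OF that]] p_gt_1 by linarith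
  qed (use place_finite S in auto)
  finally show ?thesis .
qed

text \<open>
  The elements \<open>\<Sum>j<k. c\<^sub>j z ^ (n + j)\<close> with digits \<open>c\<^sub>j\<close> below the Gauss norm of the minimal polynomial
  are pairwise far apart at some place above \<open>p\<close>; counting them against the number of balls that
  cover them compares the Gauss norm with the local degrees.
\<close>

lemma power_basis_separated:
  assumes z: "z \<in> F" "card (conjs z) = n"
    and A: "(\<Prod>y\<in>conjs z. max 1 (nv y)) = real p ^ A"
    and C: "C > 0" "\<And>P B i. degree P < card (conjs z) \<Longrightarrow>
      (\<And>y. y \<in> conjs z \<Longrightarrow> nv (poly P y) \<le> B) \<Longrightarrow> nv (coeff P i) \<le> C * B"
    and c: "c \<in> Pi\<^sub>E {..<k} (\<lambda>_. {..<p ^ A})" "c' \<in> Pi\<^sub>E {..<k} (\<lambda>_. {..<p ^ A})" "c \<noteq> c'"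
  shows "\<exists>w\<in>places. w ((\<Sum>j<k. of_nat (c j) * z ^ (n + j)) - (\<Sum>j<k. of_nat (c' j) * z ^ (n + j))) > 1 / C"
    (is "\<exists>w\<in>places. w ?d > _")
proof (rule ccontr)
  assume "\<not> ?thesis"
  hence small: "w ?d \<le> 1 / C" if "w \<in> places" for w using that by force
  define m where "m = minpoly z"
  define \<delta> where "\<delta> j = int (c j) - int (c' j)" for j
  \<comment> \<open>The exponents start at \<open>n\<close>, so subtracting the remainder
    \<open>r\<close>, which has degree below \<open>n\<close>, leaves the leading coefficient of
    \<open>Q\<close> unchanged.\<close>
  define Q :: "rat poly" where "Q = (\<Sum>j<k. monom (of_int (\<delta> j)) (n + j))"
  have coQ: "coeff Q i = (if n \<le> i \<and> i < n + k then of_int (\<delta> (i - n)) else 0)" for i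
  proof -
    have "coeff Q i = (\<Sum>j<k. if n + j = i then of_int (\<delta> j) else 0)" by (simp add: Q_def coeff_sum)
    also have "\<dots> = (\<Sum>j<k. if j = i - n then (if n \<le> i then of_int (\<delta> j) else 0) else 0)"
      by (intro sum.cong) auto
    also have "\<dots> = (if n \<le> i \<and> i < n + k then of_int (\<delta> (i - n)) else 0)" by auto
    finally show ?thesis .
  qed
  have Qz: "poly (rpoly Q) z = ?d"
  proof -
    have "rpoly (\<Sum>j<l. monom (of_int (\<delta> j)) (n + j)) = (\<Sum>j<l. monom (of_int (\<delta> j)) (n + j) :: 'a poly)" for l
      by (induction l) auto
    thus ?thesis by (simp add: Q_def poly_sum poly_monom \<delta>_def sum_subtractf left_diff_distrib)
  qed
  obtain J where J: "J < k" "c J \<noteq> c' J" using c by (metis PiE_ext lessThan_iff)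
  have "coeff Q (n + J) \<noteq> 0" using J by (simp add: coQ \<delta>_def)
  hence Q0: "Q \<noteq> 0" and dQ: "degree Q \<ge> n" using le_degree[of Q "n + J"] by auto
  define r where "r = Q mod m"
  define s where "s = Q div m"
  have m1: "lead_coeff m = 1" "m \<noteq> 0" "degree m = n"
    using minpoly_props(1)[of z] minpoly_nonzero[of z] degree_minpoly[of z] z(2) by (auto simp: m_def)
  have n0: "n > 0" by (rule card_conjs_pos)
  have dr: "degree r < n" using degree_mod_less[OF m1(2), of Q] m1(3) n0 by (auto simp: r_def)
  have Qrs: "Q - r = m * s" by (simp add: r_def s_def minus_mod_eq_mult_div)
  have rz: "poly (rpoly r) z = ?d"
  proof -
    have "poly (rpoly (Q - r)) z = 0" unfolding Qrs using minpoly_props(2)[of z] by (simp add: m_def)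
    thus ?thesis using Qz by simp
  qed
  \<comment> \<open>The remainder \<open>r\<close> takes the value \<open>?d\<close> at
    \<open>z\<close>. This is at most \<open>1 / C\<close> at every induced place, so
    \<open>r\<close> is that small at all conjugates of \<open>z\<close> and interpolation bounds
    its coefficients.\<close>
  have cr: "nv (of_rat (coeff r i)) \<le> 1" for i
  proof -
    have "nv (coeff (rpoly r :: 'a poly) i) \<le> C * (1 / C)"
    proof (rule C(2))
      fix y assume "y \<in> conjs z"
      then obtain g where g: "g \<in> auts" "y = g z" by (auto simp: conjs_def)
      have dF: "?d \<in> F"
      proof -
        obtain a where "z = poly (rpoly a) x" using z(1) by (auto simp: rat_adjoin_eq)
        have "poly (rpoly r) z \<in> F" 
        proof -
          have "poly (rpoly q) z \<in> F" for q
            by (induction q) (auto simp: map_poly_pCons intro!: is_subfield_closed[OF F_subfield] is_subfield_of_rat[OF F_subfield] z(1))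
          thus ?thesis .
        qed
        thus ?thesis by (simp add: rz)
      qed
      have "nv (poly (rpoly r) y) = nv (g ?d)" using g rz field_hom_rpoly[of g r z] by (simp add: auts_def)
      also have "\<dots> = plc g ?d" using dF by (simp add: plc_def)
      also have "\<dots> \<le> 1 / C" using g by (intro small) (auto simp: places_def)
      finally show "nv (poly (rpoly r) y) \<le> 1 / C" .
    qed (use dr z(2) in simp)
    thus ?thesis using C(1) by simp
  qed
  \<comment> \<open>The contradiction: \<open>Q - r\<close> has Gauss norm at most 1, yet it is the
    product of the minimal polynomial, of norm \<open>p ^ A\<close>, with \<open>s\<close>, of norm
    above \<open>1 / p ^ A\<close>.\<close>
  have "gauss_norm (rpoly (Q - r) :: 'a poly) \<le> 1"
  proof (rule gauss_norm_leI)
    fix i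
    have "nv (of_rat (coeff Q i)) \<le> 1" by (simp add: coQ nv_of_int_le_1)
    thus "nv (coeff (rpoly (Q - r) :: 'a poly) i) \<le> 1"
      using cr[of i] nv_ultra_diff[of "of_rat (coeff Q i)" "of_rat (coeff r i)"] by (simp add: of_rat_diff)
  qed
  moreover have "gauss_norm (rpoly (Q - r) :: 'a poly) = real p ^ A * gauss_norm (rpoly s :: 'a poly)"
    unfolding Qrs rpoly_simps gauss_norm_mult m_def rpoly_minpoly_eq_prod gauss_norm_prod_linear A ..
  \<comment> \<open>As the minimal polynomial is monic, the leading coefficient of \<open>s\<close>
    is the highest nonzero digit difference; being smaller than \<open>p ^ A\<close> in modulus, it
    is not divisible by \<open>p ^ A\<close>.\<close>
  moreover have "gauss_norm (rpoly s :: 'a poly) > 1 / real p ^ A"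
  proof -
    have drQ: "degree r < degree Q" using dr dQ by linarith
    hence "degree (Q - r) = degree Q" using degree_add_eq_left[of "- r" Q] by simp
    hence "lead_coeff (Q - r) = lead_coeff Q" using drQ by (simp add: coeff_eq_0)
    hence ls: "lead_coeff s = lead_coeff Q" unfolding Qrs lead_coeff_mult using m1 by simp
    have lQ: "lead_coeff Q \<noteq> 0" using Q0 by simp
    hence rng: "n \<le> degree Q" "degree Q < n + k" by (auto simp: coQ split: if_splits)
    define l where "l = degree Q - n"
    have l: "lead_coeff Q = of_int (\<delta> l)" "l < k" using rng by (auto simp: coQ l_def)
    have "c l < p ^ A" "c' l < p ^ A" using c l(2) by (auto simp: PiE_mem)
    hence "int (c l) < int p ^ A" "int (c' l) < int p ^ A" by (metis of_nat_less_iff of_nat_power)+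
    moreover have "int (c l) \<ge> 0" "int (c' l) \<ge> 0" by simp_all
    ultimately have "\<bar>\<delta> l\<bar> < int p ^ A" unfolding \<delta>_def abs_less_iff by linarith
    moreover have "\<delta> l \<noteq> 0" using l lQ by auto
    ultimately have "nv (of_int (\<delta> l)) > 1 / real p ^ A" by (intro nv_of_int_lower)
    hence "nv (coeff (rpoly s :: 'a poly) (degree s)) > 1 / real p ^ A" using ls l by simp
    thus ?thesis using coeff_le_gauss_norm[of "rpoly s" "degree s"] by linarith
  qed
  moreover have "real p ^ A > 0" using p_gt_1 by simp
  ultimately show False by (simp add: field_simps)
qed

text \<open>There are \<open>p ^ (A * k)\<close> digit sums, and each is determined by the balls of
  radius \<open>s\<close> that contain it at the various places. At \<open>w\<close> about
  \<open>D w * (n + k) * log p (max 1 (w z))\<close> is the exponent of the number of balls, so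
  comparing the growth in \<open>k\<close> proves the claim.\<close>

lemma gauss_norm_le_local_degrees:
  assumes z: "z \<in> F" "card (conjs z) = n"
  shows "(\<Sum>y\<in>conjs z. log p (max 1 (nv y))) \<le> (\<Sum>w\<in>places. local_degree p F w * log p (max 1 (w z)))"
proof -
  let ?G = "\<Prod>y\<in>conjs z. max 1 (nv y)"
  have G: "gauss_norm (rpoly (minpoly z) :: 'a poly) = ?G"
    by (simp add: rpoly_minpoly_eq_prod gauss_norm_prod_linear)
  have G1: "?G \<ge> 1" by (intro prod_ge_1) auto
  obtain A where A: "?G = real p ^ A"
  proof -
    obtain i where i: "nv (of_rat (coeff (minpoly z) i)) = ?G"
      using gauss_norm_attained[of "rpoly (minpoly z)"] G by auto
    have "coeff (minpoly z) i \<noteq> 0" using i G1 by auto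
    then obtain k :: int where k: "?G = real p powi k" using nv_of_rat_value i by metis
    have "k \<ge> 0"
    proof (rule ccontr)
      assume "\<not> k \<ge> 0"
      hence "real p powi k < real p powi 0" using p_gt_1 by (intro power_int_strict_increasing) auto
      thus False using k G1 by simp
    qed
    thus ?thesis using that[of "nat k"] k by (simp add: power_int_def)
  qed
  obtain C0 where C0: "C0 > 0" "\<And>P B i. degree P < card (conjs z) \<Longrightarrow>
      (\<And>y. y \<in> conjs z \<Longrightarrow> nv (poly P y) \<le> B) \<Longrightarrow> nv (coeff P i) \<le> C0 * B"
    using coeff_bound_by_values[OF finite_conjs[of z]] by blast
  \<comment> \<open>A radius \<open>1 / C\<close> of at most 1 makes
    \<open>Rw w ^ (n + k) / s\<close> at least 1, so the number \<open>J w\<close> of scales comes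
    from a nonnegative logarithm.\<close>
  define C where "C = max C0 1"
  have C: "C > 0" "C \<ge> 1" by (auto simp: C_def)
  have C2: "nv (coeff P i) \<le> C * B" if P: "degree P < card (conjs z)" "\<And>y. y \<in> conjs z \<Longrightarrow> nv (poly P y) \<le> B" for P B i
  proof -
    have "B \<ge> 0" using P(2)[OF conjs_self] nv_nonneg order_trans by blast
    hence "C0 * B \<le> C * B" by (intro mult_right_mono) (auto simp: C_def)
    thus ?thesis using C0(2)[OF P, of i] by linarith
  qed
  define s where "s = 1 / C"
  have s: "s > 0" "1 / s \<ge> 1" using C by (auto simp: s_def)
  define Rw where "Rw w = max 1 (w z)" for w :: "'a \<Rightarrow> real"
  define D where "D w = local_degree p F w" for w
  have fp: "finite_place p F w" if "w \<in> places" for w by (rule places_finite_place[OF that])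
  have zpF: "z ^ i \<in> F" for i using is_subfield_closed(9)[OF F_subfield z(1)] .
  have D0: "D w \<ge> 0" if "w \<in> places" for w using local_degree_ge_1[OF fp[OF that]] by (simp add: D_def)
  have step: "real A * real k \<le> (\<Sum>w\<in>places. D w * (real (n + k) * log p (Rw w) + log p (1 / s) + 1))" for k
  proof -
    define E where "E = Pi\<^sub>E {..<k} (\<lambda>_. {..<p ^ A})"
    define el where "el c = (\<Sum>j<k. of_nat (c j) * z ^ (n + j))" for c :: "nat \<Rightarrow> nat"
    have elF: "el c \<in> F" for c
    proof -
      have "(\<Sum>j<l. of_nat (c j) * z ^ (n + j)) \<in> F" for l
      proof (induction l)
        case (Suc l)
        have "of_nat (c l) \<in> F" using is_subfield_of_int[OF F_subfield, of "int (c l)"] by simp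
        thus ?case using Suc zpF by (auto intro!: is_subfield_closed(4,5)[OF F_subfield])
      qed (simp add: is_subfield_closed[OF F_subfield])
      thus ?thesis by (simp add: el_def)
    qed
    define J where "J w = nat \<lceil>log p (Rw w ^ (n + k) / s)\<rceil>" for w
    have R1: "Rw w ^ (n + k) \<ge> 1" for w by (simp add: Rw_def one_le_power)
    have Rs: "Rw w ^ (n + k) / s \<ge> 1" for w
      using mult_mono[OF R1 s(2)] R1[of w] by simp
    have JR: "Rw w ^ (n + k) \<le> s * real p ^ J w" for w
    proof -
      have "log p (Rw w ^ (n + k) / s) \<le> real (J w)"
        unfolding J_def by (metis real_nat_ceiling_ge)
      hence "Rw w ^ (n + k) / s \<le> real p powr real (J w)"
        using p_gt_1 Rs[of w] by (subst (asm) log_le_iff) auto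
      thus ?thesis using s(1) p_gt_1 by (simp add: powr_realpow field_simps)
    qed
    have JL: "real (J w) \<le> real (n + k) * log p (Rw w) + log p (1 / s) + 1" for w
    proof -
      have "log p (Rw w ^ (n + k) / s) \<ge> 0" using Rs[of w] p_gt_1 by simp
      hence "real (J w) \<le> log p (Rw w ^ (n + k) / s) + 1" unfolding J_def
        by (simp add: of_nat_nat)
      also have "log p (Rw w ^ (n + k) / s) = log p (Rw w ^ (n + k)) + log p (1 / s)"
      proof -
        have Rp: "Rw w ^ (n + k) > 0" using R1[of w] by linarith
        have "ln (Rw w ^ (n + k) / s) = ln (Rw w ^ (n + k)) - ln s"
          using Rp s(1) ln_div[of "Rw w ^ (n + k)" s] by (metis less_irrefl)
        moreover have "ln (1 / s) = - ln s" using s(1) by (simp add: ln_div)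
        ultimately show ?thesis by (simp add: log_def diff_divide_distrib)
      qed
      also have "log p (Rw w ^ (n + k)) = real (n + k) * log p (Rw w)"
        by (rule log_nat_power) (simp add: Rw_def)
      finally show ?thesis by simp
    qed
    have "\<exists>Z. finite Z \<and> real (card Z) \<le> real p powr (D w * real (J w)) \<and> (\<forall>c. \<exists>t\<in>Z. ext w (el c - t) \<le> s)"
      if w: "w \<in> places" for w
    proof -
      interpret W: padic_absval "ext w" p by (rule ext_props[OF fp[OF w]])
      let ?q = "card (residue_field F (ext w))"
      obtain Z where Z: "finite Z" "card Z \<le> ?q ^ (ram_index_over_rat p F (ext w) * J w)"
        "\<And>y. y \<in> F \<Longrightarrow> ext w y \<le> s * real p ^ J w \<Longrightarrow> \<exists>t\<in>Z. ext w (y - t) \<le> s"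
        using W.ball_covering[OF F_subfield place_finite[OF fp[OF w]] s(1), of "J w"] by metis
      have q1: "real ?q > 0" using residue_field_card_ge[OF fp[OF w]] p_gt_1 by linarith
      have "real (card Z) \<le> real (?q ^ (ram_index_over_rat p F (ext w) * J w))" using Z(2) by (simp only: of_nat_le_iff)
      also have "\<dots> = real p powr (D w * real (J w))"
      proof -
        have "real ?q = real p powr log p (real ?q)" using q1 p_gt_1 by simp
        hence "real ?q ^ (ram_index_over_rat p F (ext w) * J w) = real p powr (log p ?q * real (ram_index_over_rat p F (ext w) * J w))"
          by (metis p_gt_1 powr_powr powr_realpow q1)
        moreover have "D w = real (ram_index_over_rat p F (ext w)) * log p ?q"
          using local_degree_eq[OF fp[OF w]] by (simp add: D_def W.ram_index_eq)
        ultimately show ?thesis by (simp add: mult_ac)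
      qed
      finally have cZ: "real (card Z) \<le> real p powr (D w * real (J w))" .
      have "ext w (el c) \<le> s * real p ^ J w" for c
      proof -
        have "ext w (el c) \<le> Rw w ^ (n + k)" unfolding el_def
        proof (rule W.nv_sum_le_bound)
          fix j assume j: "j \<in> {..<k}"
          have "ext w (of_nat (c j) * z ^ (n + j)) \<le> 1 * ext w z ^ (n + j)"
            unfolding W.nv_mult W.nv_power by (intro mult_right_mono W.nv_of_nat_le_1 zero_le_power W.nv_nonneg)
          also have "\<dots> \<le> Rw w ^ (n + j)"
            using ext_props(2)[OF fp[OF w] z(1)] W.nv_nonneg[of z] by (auto simp: Rw_def intro!: power_mono)
          also have "\<dots> \<le> Rw w ^ (n + k)" using j by (intro power_increasing) (auto simp: Rw_def)
          finally show "ext w (of_nat (c j) * z ^ (n + j)) \<le> Rw w ^ (n + k)" .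
        qed (use R1[of w] in linarith)
        thus ?thesis using JR[of w] by linarith
      qed
      thus ?thesis using Z(1,3) cZ elF by blast
    qed
    hence "\<forall>w\<in>places. \<exists>Z. finite Z \<and> real (card Z) \<le> real p powr (D w * real (J w)) \<and> (\<forall>c. \<exists>t\<in>Z. ext w (el c - t) \<le> s)"
      by blast
    from bchoice[OF this] obtain Z where Z: "\<forall>w\<in>places. finite (Z w) \<and> real (card (Z w)) \<le> real p powr (D w * real (J w)) \<and> (\<forall>c. \<exists>t\<in>Z w. ext w (el c - t) \<le> s)"
      by (rule exE)
    hence "\<exists>t. t \<in> Z w \<and> ext w (el c - t) \<le> s" if "w \<in> places" for w c using that by blast
    then obtain t where t: "\<And>w c. w \<in> places \<Longrightarrow> t w c \<in> Z w" "\<And>w c. w \<in> places \<Longrightarrow> ext w (el c - t w c) \<le> s"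
      by metis
    have inj: "inj_on (\<lambda>c. restrict (\<lambda>w. t w c) places) E"
    proof (rule inj_onI, rule ccontr)
      fix c c' assume c: "c \<in> E" "c' \<in> E" "restrict (\<lambda>w. t w c) places = restrict (\<lambda>w. t w c') places" "c \<noteq> c'"
      obtain w where w: "w \<in> places" "w (el c - el c') > 1 / C"
        using power_basis_separated[OF z A C(1) C2 c(1)[unfolded E_def] c(2)[unfolded E_def] c(4)]
        unfolding el_def by blast
      interpret W: padic_absval "ext w" p by (rule ext_props[OF fp[OF w(1)]])
      have "t w c = t w c'" using c(3) w(1) by (metis restrict_apply')
      hence "ext w (el c - el c') \<le> max (ext w (el c - t w c)) (ext w (el c' - t w c'))"
        using W.nv_ultra_diff[of "el c - t w c" "el c' - t w c'"] by simp
      also have "\<dots> \<le> s" using t(2) w(1) by simp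
      finally show False using w ext_props(2)[OF fp[OF w(1)] is_subfield_closed(3)[OF F_subfield elF elF]] by (simp add: s_def)
    qed
    have sub: "(\<lambda>c. restrict (\<lambda>w. t w c) places) ` E \<subseteq> Pi\<^sub>E places Z"
    proof (rule image_subsetI)
      fix c show "restrict (\<lambda>w. t w c) places \<in> Pi\<^sub>E places Z" unfolding restrict_PiE_iff using t(1) by auto
    qed
    have "card E \<le> card (Pi\<^sub>E places Z)"
      using inj sub by (rule card_inj_on_le) (use Z finite_places in \<open>auto intro!: finite_PiE\<close>)
    also have "\<dots> = (\<Prod>w\<in>places. card (Z w))" using finite_places by (simp add: card_PiE)
    finally have "real (card E) \<le> (\<Prod>w\<in>places. real (card (Z w)))" by (metis of_nat_le_iff of_nat_prod)
    also have "\<dots> \<le> (\<Prod>w\<in>places. real p powr (D w * real (J w)))" using Z by (intro prod_mono) auto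
    also have "\<dots> = real p powr (\<Sum>w\<in>places. D w * real (J w))"
      using p_gt_1 by (simp add: powr_sum)
    finally have "real p ^ (A * k) \<le> real p powr (\<Sum>w\<in>places. D w * real (J w))"
      by (simp add: E_def card_PiE power_mult)
    hence "real p powr (real (A * k)) \<le> real p powr (\<Sum>w\<in>places. D w * real (J w))"
      using p_gt_1 by (simp add: powr_realpow del: of_nat_mult)
    hence "real (A * k) \<le> (\<Sum>w\<in>places. D w * real (J w))" using p_gt_1 by simp
    also have "\<dots> \<le> (\<Sum>w\<in>places. D w * (real (n + k) * log p (Rw w) + log p (1 / s) + 1))"
      by (intro sum_mono mult_left_mono JL D0)
    finally show ?thesis by simp
  qed
  let ?L = "\<Sum>w\<in>places. D w * log p (Rw w)"
  define K where "K = (\<Sum>w\<in>places. D w * (real n * log p (Rw w) + log p (1 / s) + 1))"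
  have eq: "(\<Sum>w\<in>places. D w * (real (n + k) * log p (Rw w) + log p (1 / s) + 1)) = K + real k * ?L" for k
    unfolding K_def sum_distrib_left sum.distrib[symmetric] by (intro sum.cong) (auto simp: algebra_simps)
  \<comment> \<open>Both sides of \<open>step\<close> are affine in \<open>k\<close>, so the slopes
    must satisfy the same inequality.\<close>
  have "real A \<le> ?L"
  proof (rule ccontr)
    assume "\<not> real A \<le> ?L"
    hence "real A - ?L > 0" by simp
    then obtain k where "real k * (real A - ?L) > K" using reals_Archimedean3 by blast
    thus False using step[of k] eq[of k] by (simp add: algebra_simps)
  qed
  moreover have "(\<Sum>y\<in>conjs z. log p (max 1 (nv y))) = real A"
  proof -
    have "(\<Sum>y\<in>conjs z. log p (max 1 (nv y))) = log p ?G"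
      unfolding log_def
      by (subst ln_prod) (auto simp: sum_divide_distrib finite_conjs less_max_iff_disj)
    thus ?thesis unfolding A using p_gt_1 by (simp add: log_nat_power)
  qed
  ultimately show ?thesis by (simp add: D_def Rw_def)
qed

section \<open>Second half of the fundamental identity: local degrees as numbers of
  conjugates\<close>

definition emb :: "'a \<Rightarrow> 'a \<Rightarrow> 'a" where
  "emb y = (SOME g. g \<in> auts \<and> g x = y)"

lemma emb: assumes "y \<in> conjs x" shows "emb y \<in> auts" "emb y x = y"
proof -
  have "\<exists>g. g \<in> auts \<and> g x = y" using assms by (auto simp: conjs_def)
  hence "emb y \<in> auts \<and> emb y x = y" unfolding emb_def by (rule someI_ex)
  thus "emb y \<in> auts" "emb y x = y" by auto
qed

lemma plc_emb: "g \<in> auts \<Longrightarrow> plc g = plc (emb (g x))"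
  unfolding plc_def using auts_agree_on_F[of g "emb (g x)"] emb[OF conjsI[of g x]]
  by (intro restrict_ext) simp

lemma places_eq: "places = (\<lambda>y. plc (emb y)) ` conjs x"
proof (intro equalityI subsetI)
  fix w assume "w \<in> places"
  then obtain g where "g \<in> auts" "w = plc g" by (auto simp: places_def)
  thus "w \<in> (\<lambda>y. plc (emb y)) ` conjs x" using plc_emb conjsI by blast
qed (auto simp: places_def emb)

lemma conjs_of_F: assumes "z \<in> F" shows "conjs z = (\<lambda>y. emb y z) ` conjs x"
proof (intro equalityI subsetI)
  fix u assume "u \<in> conjs z"
  then obtain g where g: "g \<in> auts" "u = g z" by (auto simp: conjs_def)
  have "g z = emb (g x) z" using auts_agree_on_F[OF g(1) emb(1)[OF conjsI[OF g(1)]] _ assms] emb(2)[OF conjsI[OF g(1)]] by simp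
  thus "u \<in> (\<lambda>y. emb y z) ` conjs x" using g conjsI by blast
qed (auto intro: conjsI emb)

text \<open>\<open>gauss_norm_le_local_degrees\<close> requires an element of full degree. Adding
  \<open>p ^ j * x\<close> achieves this at small p-adic cost, because each pair of conjugates of
  \<open>x\<close> excludes at most one exponent \<open>j\<close>.\<close>

lemma generator_near:
  assumes "z0 \<in> F"
  obtains j where "j \<ge> J" "card (conjs (z0 + of_nat p ^ j * x)) = n"
proof -
  define bad where "bad = (\<Union>(y, y')\<in>conjs x \<times> conjs x. {j. y \<noteq> y' \<and> of_nat p ^ j = (emb y' z0 - emb y z0) / (y - y')})"
  have p1: "p > 1" using prime_gt_1_nat[OF p_prime] .
  have "finite {j. y \<noteq> y' \<and> of_nat p ^ j = (r::'a)}" for y y' :: 'a and r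
  proof (cases "\<exists>j0. of_nat p ^ j0 = r")
    case True
    then obtain j0 where j0: "of_nat p ^ j0 = r" by blast
    have "j = j0" if "of_nat p ^ j = r" for j
    proof -
      have "(of_nat (p ^ j) :: 'a) = of_nat (p ^ j0)" using that j0 by simp
      hence "p ^ j = p ^ j0" by (simp only: of_nat_eq_iff)
      thus ?thesis using p1 by simp
    qed
    hence "{j. y \<noteq> y' \<and> of_nat p ^ j = r} \<subseteq> {j0}" by auto
    thus ?thesis using finite_subset by blast
  qed auto
  hence "finite bad" unfolding bad_def by (intro finite_UN_I) (auto simp: finite_conjs)
  hence "infinite ({J..} - bad)" by (simp add: Diff_infinite_finite infinite_Ici)
  hence "{J..} - bad \<noteq> {}" by (rule infinite_imp_nonempty)
  then obtain j where j: "j \<ge> J" "j \<notin> bad" by auto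
  let ?z = "z0 + of_nat p ^ j * x"
  have zF: "?z \<in> F"
  proof -
    have "of_nat p ^ j \<in> F" using is_subfield_of_int[OF F_subfield, of "int p ^ j"] by simp
    thus ?thesis using assms x_in_F by (intro is_subfield_closed(4,5)[OF F_subfield])
  qed
  have ez: "emb y ?z = emb y z0 + of_nat p ^ j * y" if "y \<in> conjs x" for y
  proof -
    have h: "field_hom (emb y)" using emb(1)[OF that] by (simp add: auts_def)
    show ?thesis using emb(2)[OF that]
      by (simp add: field_hom_add[OF h] field_hom_mult[OF h] field_hom_power[OF h] field_hom_of_nat[OF h])
  qed
  have inj: "inj_on (\<lambda>y. emb y ?z) (conjs x)"
  proof (rule inj_onI, rule ccontr)
    fix y y' assume y: "y \<in> conjs x" "y' \<in> conjs x" "emb y ?z = emb y' ?z" "y \<noteq> y'"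
    hence "emb y z0 + of_nat p ^ j * y = emb y' z0 + of_nat p ^ j * y'"
      using ez[OF y(1)] ez[OF y(2)] by simp
    hence "of_nat p ^ j * (y - y') = emb y' z0 - emb y z0" by (simp add: algebra_simps)
    hence "of_nat p ^ j = (emb y' z0 - emb y z0) / (y - y')" using y(4) by (simp add: nonzero_eq_divide_eq)
    hence "j \<in> bad" unfolding bad_def using y by blast
    thus False using j(2) by simp
  qed
  have "card (conjs ?z) = n" unfolding conjs_of_F[OF zF] by (rule card_image[OF inj])
  thus ?thesis using that j(1) by blast
qed

text \<open>Applied to a generator \<open>z\<close> that is large at \<open>w0\<close> and integral
  at all other induced places, \<open>gauss_norm_le_local_degrees\<close> keeps only the terms of
  \<open>w0\<close>; the common factor \<open>log p (w0 z)\<close> cancels.\<close>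

lemma card_fibre_le_local_degree:
  assumes w0: "w0 \<in> places"
  shows "real (card {y \<in> conjs x. plc (emb y) = w0}) \<le> local_degree p F w0"
proof -
  have fp: "finite_place p F w" if "w \<in> places" for w by (rule places_finite_place[OF that])
  have "\<exists>z\<in>F. ext w0 z > 1 \<and> (\<forall>W\<in>ext ` (places - {w0}). W z < 1)"
  proof (rule padic_place_isolation[OF F_subfield])
    fix W assume "W \<in> ext ` (places - {w0})"
    then obtain w where w: "w \<in> places" "w \<noteq> w0" "W = ext w" by auto
    show "padic_absval W p" using ext_props(1)[OF fp[OF w(1)]] w by simp
    show "\<exists>u\<in>F. W u \<noteq> ext w0 u" using ext_differ[OF fp[OF w(1)] fp[OF w0]] w by simp
  qed (use ext_props(1)[OF fp[OF w0]] finite_places in auto)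
  then obtain z0 where z0: "z0 \<in> F" "ext w0 z0 > 1" "\<And>w. w \<in> places \<Longrightarrow> w \<noteq> w0 \<Longrightarrow> ext w z0 < 1" by auto
  obtain J where J: "(\<Sum>w\<in>places. ext w x) < real p ^ J" using real_arch_pow[OF p_gt_1] by blast
  obtain j where j: "j \<ge> J" "card (conjs (z0 + of_nat p ^ j * x)) = n" by (rule generator_near[OF z0(1)])
  define z where "z = z0 + of_nat p ^ j * x"
  have zF: "z \<in> F"
  proof -
    have "of_nat p ^ j \<in> F" using is_subfield_of_int[OF F_subfield, of "int p ^ j"] by simp
    thus ?thesis unfolding z_def using z0 x_in_F by (intro is_subfield_closed(4,5)[OF F_subfield])
  qed
  have small: "ext w (of_nat p ^ j * x) < 1" if w: "w \<in> places" for w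
  proof -
    interpret W: padic_absval "ext w" p by (rule ext_props[OF fp[OF w]])
    have nn: "ext w' x \<ge> 0" if "w' \<in> places" for w'
    proof -
      interpret W': padic_absval "ext w'" p by (rule ext_props[OF fp[OF that]])
      show ?thesis by (rule W'.nv_nonneg)
    qed
    have "ext w x \<le> (\<Sum>w\<in>places. ext w x)" using w finite_places nn by (intro member_le_sum) auto
    also have "\<dots> < real p ^ J" by (rule J)
    also have "\<dots> \<le> real p ^ j" using j(1) p_gt_1 by (intro power_increasing) auto
    finally show ?thesis using p_gt_1 by (simp add: W.nv_mult W.nv_p_power field_simps)
  qed
  have wz0: "w0 z > 1"
  proof -
    interpret W: padic_absval "ext w0" p by (rule ext_props[OF fp[OF w0]])
    have "ext w0 z = ext w0 z0" unfolding z_def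
      using W.nv_add_eq[of "of_nat p ^ j * x" z0] small[OF w0] z0(2) by (simp add: add.commute)
    thus ?thesis using z0(2) ext_props(2)[OF fp[OF w0] zF] by simp
  qed
  have wz: "w z \<le> 1" if w: "w \<in> places" "w \<noteq> w0" for w
  proof -
    interpret W: padic_absval "ext w" p by (rule ext_props[OF fp[OF w(1)]])
    have "ext w z \<le> 1" unfolding z_def
      using W.nv_ultra[of z0 "of_nat p ^ j * x"] small[OF w(1)] z0(3)[OF w] by simp
    thus ?thesis using ext_props(2)[OF fp[OF w(1)] zF] by simp
  qed
  have lz: "log p (w0 z) > 0" using wz0 p_gt_1 by simp
  have inj: "inj_on (\<lambda>y. emb y z) (conjs x)"
    using j(2) conjs_of_F[OF zF] finite_conjs[of x] by (intro eq_card_imp_inj_on) (simp_all add: z_def[symmetric])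
  have "(\<Sum>y\<in>conjs z. log p (max 1 (nv y))) = (\<Sum>y\<in>conjs x. log p (max 1 (plc (emb y) z)))"
    unfolding conjs_of_F[OF zF] by (subst sum.reindex[OF inj]) (simp add: plc_def zF)
  also have "\<dots> = (\<Sum>y\<in>conjs x. if plc (emb y) = w0 then log p (w0 z) else 0)"
  proof (rule sum.cong)
    fix y assume y: "y \<in> conjs x"
    have "plc (emb y) \<in> places" using y by (auto simp: places_eq)
    thus "log p (max 1 (plc (emb y) z)) = (if plc (emb y) = w0 then log p (w0 z) else 0)"
      using wz0 wz[of "plc (emb y)"] by (auto simp: max_def)
  qed simp
  also have "\<dots> = real (card {y \<in> conjs x. plc (emb y) = w0}) * log p (w0 z)"
    using finite_conjs[of x] by (simp add: sum.If_cases Int_def)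
  finally have L: "(\<Sum>y\<in>conjs z. log p (max 1 (nv y))) = real (card {y \<in> conjs x. plc (emb y) = w0}) * log p (w0 z)" .
  have "(\<Sum>w\<in>places. local_degree p F w * log p (max 1 (w z))) = (\<Sum>w\<in>places. if w = w0 then local_degree p F w0 * log p (w0 z) else 0)"
  proof (rule sum.cong)
    fix w assume w: "w \<in> places"
    show "local_degree p F w * log p (max 1 (w z)) = (if w = w0 then local_degree p F w0 * log p (w0 z) else 0)"
      using wz0 wz[OF w] by (cases "w = w0") (auto simp: max_absorb1 max_absorb2)
  qed simp
  also have "\<dots> = local_degree p F w0 * log p (w0 z)" using finite_places w0 by simp
  finally have "real (card {y \<in> conjs x. plc (emb y) = w0}) * log p (w0 z) \<le> local_degree p F w0 * log p (w0 z)"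
    using gauss_norm_le_local_degrees[OF zF] j(2) L by (simp add: z_def)
  thus ?thesis using lz by (simp add: mult_le_cancel_right)
qed

lemma sum_card_fibres: "(\<Sum>w\<in>places. card {y \<in> conjs x. plc (emb y) = w}) = n"
proof -
  have "(\<Sum>w\<in>places. \<Sum>y\<in>{y \<in> conjs x. plc (emb y) = w}. 1) = (\<Sum>y\<in>conjs x. 1::nat)"
    by (rule sum.group[OF finite_conjs finite_places]) (simp add: places_eq)
  thus ?thesis by simp
qed

text \<open>The fibres already account for all \<open>n\<close> conjugates and are bounded by the
  local degrees, whose sum is at most \<open>n\<close>; a further place would add at least
  1.\<close>

lemma all_places: "{w. finite_place p F w} = places"
proof (intro equalityI subsetI)
  fix w assume "w \<in> {w. finite_place p F w}"
  hence w: "finite_place p F w" by simp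
  show "w \<in> places"
  proof (rule ccontr)
    assume nw: "w \<notin> places"
    have "(\<Sum>w\<in>insert w places. local_degree p F w) \<le> n"
      using finite_places places_finite_place w by (intro sum_local_degree_le) auto
    hence "local_degree p F w + (\<Sum>w\<in>places. local_degree p F w) \<le> n" using nw finite_places by simp
    moreover have "(\<Sum>w\<in>places. real (card {y \<in> conjs x. plc (emb y) = w})) \<le> (\<Sum>w\<in>places. local_degree p F w)"
      by (intro sum_mono card_fibre_le_local_degree)
    moreover have "(\<Sum>w\<in>places. real (card {y \<in> conjs x. plc (emb y) = w})) = n"
      using arg_cong[OF sum_card_fibres, of real] by (simp only: of_nat_sum)
    ultimately show False using local_degree_ge_1[OF w] by linarith
  qed
qed (use places_finite_place in auto)

text \<open>The inequality holds at each place and both totals are \<open>n\<close>, so no single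
  place can be strict.\<close>

lemma local_degree_eq_card_fibre:
  assumes w: "w \<in> places"
  shows "local_degree p F w = real (card {y \<in> conjs x. plc (emb y) = w})"
proof (rule ccontr)
  assume "\<not> ?thesis"
  hence "real (card {y \<in> conjs x. plc (emb y) = w}) < local_degree p F w"
    using card_fibre_le_local_degree[OF w] by simp
  hence "(\<Sum>w\<in>places. real (card {y \<in> conjs x. plc (emb y) = w})) < (\<Sum>w\<in>places. local_degree p F w)"
    using w finite_places card_fibre_le_local_degree by (intro sum_strict_mono_ex1) auto
  moreover have "(\<Sum>w\<in>places. real (card {y \<in> conjs x. plc (emb y) = w})) = n"
    using arg_cong[OF sum_card_fibres, of real] by (simp only: of_nat_sum)
  moreover have "(\<Sum>w\<in>places. local_degree p F w) \<le> n"
    using finite_places places_finite_place by (intro sum_local_degree_le) auto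
  ultimately show False by simp
qed

text \<open>The bridge between the two descriptions of the height: each place, counted with its
  local degree, is replaced by the conjugates of \<open>x\<close> that induce it.\<close>

theorem sum_over_places:
  "finite {w. finite_place p F w}"
  "(\<Sum>w | finite_place p F w. local_degree p F w * f (w x)) = (\<Sum>y\<in>conjs x. f (nv y))"
proof -
  show "finite {w. finite_place p F w}" unfolding all_places by (rule finite_places)
  have "(\<Sum>y\<in>conjs x. f (nv y)) = (\<Sum>y\<in>conjs x. f (plc (emb y) x))"
    using emb x_in_F by (intro sum.cong) (auto simp: plc_def)
  also have "\<dots> = (\<Sum>w\<in>places. \<Sum>y\<in>{y \<in> conjs x. plc (emb y) = w}. f (plc (emb y) x))"
    by (rule sum.group[OF finite_conjs finite_places, symmetric]) (simp add: places_eq)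
  also have "\<dots> = (\<Sum>w\<in>places. local_degree p F w * f (w x))"
    by (intro sum.cong) (auto simp: local_degree_eq_card_fibre)
  finally show "(\<Sum>w | finite_place p F w. local_degree p F w * f (w x)) = (\<Sum>y\<in>conjs x. f (nv y))"
    unfolding all_places ..
qed

end

section \<open>The height as an average over conjugates\<close>

context ultra_absval
begin

lemma root_of_integral_le_1:
  assumes P: "\<And>i. nv (coeff P i) \<le> 1" "nv (lead_coeff P) = 1" "poly P z = 0"
  shows "nv z \<le> 1"
proof (rule ccontr)
  assume "\<not> nv z \<le> 1"
  hence z: "nv z > 1" by simp
  define d where "d = degree P"
  have d0: "d > 0"
  proof (rule ccontr)
    assume "\<not> d > 0"
    then obtain c where "P = [:c:]" by (auto simp: d_def elim: degree_eq_zeroE)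
    thus False using P by auto
  qed
  have "(\<Sum>i<d. coeff P i * z ^ i) + coeff P d * z ^ d = 0"
    using P(3) by (simp add: poly_altdef d_def lessThan_Suc_atMost[symmetric])
  hence "nv (coeff P d * z ^ d) = nv (\<Sum>i<d. coeff P i * z ^ i)"
    by (metis add_eq_0_iff nv_minus)
  also have "\<dots> < nv z ^ d"
  proof (rule nv_sum_less_bound)
    fix i assume i: "i \<in> {..<d}"
    have "nv (coeff P i) * nv z ^ i \<le> 1 * nv z ^ i" using P(1) z by (intro mult_right_mono) auto
    also have "\<dots> < nv z ^ d" using i z by simp
    finally show "nv (coeff P i * z ^ i) < nv z ^ d" by (simp add: nv_mult nv_power)
  qed (use z in auto)
  finally show False using P(2) by (simp add: nv_mult nv_power d_def)
qed

end

context absval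
begin

lemma coeff_prod_linear_le:
  "finite A \<Longrightarrow> nv (coeff (\<Prod>y\<in>A. [:- y, 1:]) i) \<le> 2 ^ card A * (\<Prod>y\<in>A. max 1 (nv y))"
proof (induction A arbitrary: i rule: finite_induct)
  case (insert y A)
  let ?P = "\<Prod>y\<in>A. [:- y, 1:]"
  let ?B = "2 ^ card A * (\<Prod>y\<in>A. max 1 (nv y))"
  have B0: "?B \<ge> 0" by (intro mult_nonneg_nonneg prod_nonneg) auto
  have "coeff ([:- y, 1:] * ?P) i = (case i of 0 \<Rightarrow> 0 | Suc j \<Rightarrow> coeff ?P j) - y * coeff ?P i"
    by (cases i) auto
  hence "nv (coeff ([:- y, 1:] * ?P) i) \<le> nv (case i of 0 \<Rightarrow> 0 | Suc j \<Rightarrow> coeff ?P j) + nv (y * coeff ?P i)"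
    using nv_triangle[of _ "- (y * coeff ?P i)"] by simp
  also have "\<dots> \<le> ?B + nv y * ?B"
  proof (rule add_mono)
    show "nv (case i of 0 \<Rightarrow> 0 | Suc j \<Rightarrow> coeff ?P j) \<le> ?B"
      using insert.IH B0 by (cases i) auto
    show "nv (y * coeff ?P i) \<le> nv y * ?B"
      unfolding nv_mult by (intro mult_left_mono insert.IH nv_nonneg)
  qed
  also have "\<dots> \<le> 2 * max 1 (nv y) * ?B"
  proof -
    have "1 + nv y \<le> 2 * max 1 (nv y)" by simp
    from mult_right_mono[OF this B0] show ?thesis by (simp add: algebra_simps)
  qed
  finally show ?case using insert.hyps by (simp add: mult_ac del: mult_pCons_left)
qed simp

end

section \<open>Rational places and the product formula\<close>

definition lnp :: "real \<Rightarrow> real" where "lnp t = ln (max 1 t)"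

lemma lnp_nonneg: "lnp t \<ge> 0" by (simp add: lnp_def)

lemma lnp_ge_ln: "t > 0 \<Longrightarrow> ln t \<le> lnp t" by (simp add: lnp_def)

text \<open>Labels of the places of the rationals; \<open>0\<close> stands for the archimedean
  one.\<close>

definition Pl :: "nat set" where "Pl = insert 0 {q. prime q}"

text \<open>One absolute value of the closure above each rational place. The others above the same
  place are obtained from it by automorphisms and therefore enter as sums over conjugates.\<close>

locale global_places =
  fixes av :: "nat \<Rightarrow> 'a::qbar \<Rightarrow> real" and \<iota> :: "'a \<Rightarrow> complex"
  assumes iota: "field_hom \<iota>" and av_0: "av 0 x = cmod (\<iota> x)"
    and av_prime: "prime q \<Longrightarrow> padic_absval (av q) q"
begin

lemma av_absval: "v \<in> Pl \<Longrightarrow> absval (av v)"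
proof -
  assume "v \<in> Pl"
  then consider "v = 0" | "prime v" by (auto simp: Pl_def)
  thus ?thesis
  proof cases
    case 1
    show ?thesis unfolding 1
      by unfold_locales (auto simp: av_0 field_hom_eq_0_iff[OF iota] field_hom_mult[OF iota]
        field_hom_add[OF iota] norm_mult norm_triangle_ineq)
  next
    case 2
    interpret padic_absval "av v" v by (rule av_prime[OF 2])
    show ?thesis by unfold_locales
  qed
qed

lemma av_nonneg: "v \<in> Pl \<Longrightarrow> av v x \<ge> 0"
  using absval.nv_nonneg[OF av_absval] .

lemma av_pos: "v \<in> Pl \<Longrightarrow> x \<noteq> 0 \<Longrightarrow> av v x > 0"
  using absval.nv_pos[OF av_absval] .

lemma finite_primes_dvd: "c \<noteq> 0 \<Longrightarrow> finite {q::nat. prime q \<and> int q dvd c}"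
proof (rule finite_subset)
  assume c: "c \<noteq> 0"
  show "{q. prime q \<and> int q dvd c} \<subseteq> {..nat \<bar>c\<bar>}"
    using c by (auto dest: dvd_imp_le_int)
qed simp

text \<open>At a prime dividing neither the leading nor the constant coefficient of an integer
  equation for \<open>z\<close>, both \<open>z\<close> and \<open>inverse z\<close> are integral;
  the reflected polynomial serves for the inverse.\<close>

lemma finite_nontrivial: "z \<noteq> 0 \<Longrightarrow> finite {v \<in> Pl. av v z \<noteq> 1}"
proof -
  assume z: "z \<noteq> 0"
  obtain P where P: "P \<noteq> 0" "coeff P 0 \<noteq> 0" "poly (map_poly of_int P) z = 0"
    using algebraicE'_nonzero[OF all_algebraic z] by metis
  let ?P = "map_poly of_int P :: 'a poly"
  have dP: "degree ?P = degree P" by (rule degree_map_poly) auto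
  have "{v \<in> Pl. av v z \<noteq> 1} \<subseteq> insert 0 ({q. prime q \<and> int q dvd coeff P 0} \<union> {q. prime q \<and> int q dvd lead_coeff P})"
  proof
    fix v assume v: "v \<in> {v \<in> Pl. av v z \<noteq> 1}"
    show "v \<in> insert 0 ({q. prime q \<and> int q dvd coeff P 0} \<union> {q. prime q \<and> int q dvd lead_coeff P})"
    proof (rule ccontr)
      assume n: "\<not> ?thesis"
      hence pv: "prime v" and nd: "\<not> int v dvd coeff P 0" "\<not> int v dvd lead_coeff P"
        using v by (auto simp: Pl_def)
      interpret padic_absval "av v" v by (rule av_prime[OF pv])
      have "av v z \<le> 1"
      proof (rule root_of_integral_le_1)
        show "av v (coeff ?P i) \<le> 1" for i by (simp add: coeff_map_poly nv_of_int_le_1)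
        show "av v (lead_coeff ?P) = 1" using nv_of_int_unit[OF nd(2)] by (simp add: coeff_map_poly dP)
      qed (rule P(3))
      moreover have "av v (inverse z) \<le> 1"
      proof (rule root_of_integral_le_1)
        have c0: "coeff ?P 0 \<noteq> 0" using P(2) by (simp add: coeff_map_poly)
        show "av v (coeff (reflect_poly ?P) i) \<le> 1" for i
          by (simp add: coeff_reflect_poly coeff_map_poly nv_of_int_le_1)
        show "av v (lead_coeff (reflect_poly ?P)) = 1"
          using nv_of_int_unit[OF nd(1)] c0 by (simp add: coeff_reflect_poly coeff_map_poly)
        show "poly (reflect_poly ?P) (inverse z) = 0"
          using poly_reflect_poly_nz[of "inverse z" ?P] z P(3) by simp
      qed
      moreover have "av v z > 0" by (rule nv_pos[OF z])
      ultimately have "av v z = 1" unfolding nv_inverse inverse_le_1_iff by linarith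
      thus False using v by simp
    qed
  qed
  thus ?thesis using finite_primes_dvd[OF P(2)] finite_primes_dvd[of "lead_coeff P"] P(1)
    by (meson finite.insertI finite_UnI finite_subset leading_coeff_0_iff)
qed

lemma product_formula_int:
  assumes a: "a \<noteq> 0" and V: "finite V" "0 \<in> V" "V \<subseteq> Pl" "\<And>q. prime q \<Longrightarrow> int q dvd a \<Longrightarrow> q \<in> V"
  shows "(\<Sum>v\<in>V. ln (av v (of_int a))) = 0"
proof -
  define m where "m = nat \<bar>a\<bar>"
  have m0: "m > 0" using a by (simp add: m_def)
  have mult: "multiplicity (int q) a = multiplicity q m" if q: "prime q" for q
  proof -
    have "multiplicity (int q) a = multiplicity (int q) \<bar>a\<bar>"
      using multiplicity_normalize_right[of "int q" a] by simp
    also have "\<bar>a\<bar> = int m" by (simp add: m_def)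
    also have "multiplicity (int q) (int m) = multiplicity q m"
    proof (rule multiplicity_eqI)
      show "int q ^ multiplicity q m dvd int m" using multiplicity_dvd[of q m] by (metis of_nat_dvd_iff of_nat_power)
      have "\<not> q ^ Suc (multiplicity q m) dvd m"
        using m0 q by (subst power_dvd_iff_le_multiplicity) (auto simp: not_prime_unit)
      thus "\<not> int q ^ Suc (multiplicity q m) dvd int m" by (metis of_nat_dvd_iff of_nat_power)
    qed
    finally show ?thesis .
  qed
  have 0: "ln (av 0 (of_int a)) = ln (real m)"
    by (simp add: av_0 field_hom_of_int[OF iota] m_def)
  have q: "ln (av q (of_int a)) = - real (multiplicity q m) * ln (real q)" if "prime q" for q
  proof -
    interpret padic_absval "av q" q by (rule av_prime[OF that])
    have "av q (of_int a) = inverse (real q ^ multiplicity q m)"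
      using nv_of_int_mult[OF a] by (simp add: mult[OF that] power_int_minus)
    thus ?thesis using p_gt_1 by (simp add: ln_inverse ln_realpow)
  qed
  have sub: "prime_factors m \<subseteq> V - {0}"
  proof
    fix q assume "q \<in> prime_factors m"
    hence "prime q" "q dvd m" by auto
    moreover from this have "int q dvd a" by (metis m_def dvd_abs_iff int_dvd_int_iff nat_0_le abs_ge_zero)
    ultimately show "q \<in> V - {0}" using V(4) by auto
  qed
  have "ln (real m) = ln (real (\<Prod>q\<in>prime_factors m. q ^ multiplicity q m))"
    using prod_prime_factors[of m] m0 by simp
  also have "\<dots> = (\<Sum>q\<in>prime_factors m. ln (real q ^ multiplicity q m))"
    unfolding of_nat_prod by (subst ln_prod) (auto simp: prime_factors_gt_0_nat)
  also have "\<dots> = (\<Sum>q\<in>prime_factors m. real (multiplicity q m) * ln (real q))"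
    by (intro sum.cong) (auto simp: ln_realpow prime_factors_gt_0_nat)
  also have "\<dots> = (\<Sum>q\<in>V - {0}. real (multiplicity q m) * ln (real q))"
  proof (rule sum.mono_neutral_left)
    show "\<forall>q\<in>V - {0} - prime_factors m. real (multiplicity q m) * ln (real q) = 0"
    proof
      fix q assume q: "q \<in> V - {0} - prime_factors m"
      hence "prime q" using V(3) by (auto simp: Pl_def)
      hence "multiplicity q m = 0" using q m0 by (auto simp: prime_factors_multiplicity)
      thus "real (multiplicity q m) * ln (real q) = 0" by simp
    qed
  qed (use V sub in auto)
  finally have "ln (real m) = (\<Sum>q\<in>V - {0}. real (multiplicity q m) * ln (real q))" .
  moreover have "(\<Sum>v\<in>V. ln (av v (of_int a))) = ln (real m) + (\<Sum>q\<in>V - {0}. - real (multiplicity q m) * ln (real q))"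
    using V q by (subst sum.remove[of _ 0]) (auto simp: 0 Pl_def intro!: sum.cong)
  ultimately show ?thesis by (simp add: sum_negf)
qed

lemma product_formula_rat:
  assumes c: "c \<noteq> 0" and V: "finite V" "V \<subseteq> Pl" "{v \<in> Pl. av v (of_rat c) \<noteq> 1} \<subseteq> V"
  shows "(\<Sum>v\<in>V. ln (av v (of_rat c))) = 0"
proof -
  obtain a b where ab: "quotient_of c = (a, b)" by fastforce
  have b: "b > 0" "c = of_int a / of_int b" using ab quotient_of_denom_pos quotient_of_div by blast+
  have a: "a \<noteq> 0" using b c by auto
  define W where "W = V \<union> insert 0 ({q. prime q \<and> int q dvd a} \<union> {q. prime q \<and> int q dvd b})"
  have W: "finite W" "0 \<in> W" "W \<subseteq> Pl" using V finite_primes_dvd[OF a] finite_primes_dvd[of b] b(1)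
    by (auto simp: W_def Pl_def)
  have "(\<Sum>v\<in>V. ln (av v (of_rat c))) = (\<Sum>v\<in>W. ln (av v (of_rat c)))"
  proof (rule sum.mono_neutral_left)
    show "\<forall>i\<in>W - V. ln (av i (of_rat c)) = 0" using V(3) W(3) by auto
  qed (use W in \<open>auto simp: W_def\<close>)
  also have "\<dots> = (\<Sum>v\<in>W. ln (av v (of_int a)) - ln (av v (of_int b)))"
  proof (rule sum.cong)
    fix v assume "v \<in> W"
    hence v: "v \<in> Pl" using W by auto
    interpret absval "av v" by (rule av_absval[OF v])
    have "of_rat c = (of_int a / of_int b :: 'a)" by (simp add: b(2) of_rat_divide)
    moreover have "av v (of_int a) > 0" "av v (of_int b) > 0" using a b(1) nv_pos by auto
    ultimately show "ln (av v (of_rat c)) = ln (av v (of_int a)) - ln (av v (of_int b))"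
      by (simp add: nv_divide ln_div)
  qed simp
  also have "\<dots> = 0"
    unfolding sum_subtractf using product_formula_int[OF a W] product_formula_int[OF _ W, of b] b(1)
    by (auto simp: W_def)
  finally show ?thesis .
qed

lemma prod_conjs_rat: "\<exists>c. (\<Prod>y\<in>conjs (z::'a). y) = of_rat c"
proof -
  have "poly (rpoly (minpoly z)) (0::'a) = (\<Prod>y\<in>conjs z. - y)"
    by (simp add: rpoly_minpoly_eq_prod poly_prod)
  also have "\<dots> = (-1) ^ card (conjs z) * (\<Prod>y\<in>conjs z. y)" by (rule prod_uminus)
  finally have "(\<Prod>y\<in>conjs z. y) = (-1) ^ card (conjs z) * poly (rpoly (minpoly z)) (0::'a)"
    by (simp add: mult.assoc[symmetric] power_mult_distrib[symmetric])
  also have "\<dots> = of_rat ((-1) ^ card (conjs z) * coeff (minpoly z) 0)"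
    by (simp add: of_rat_mult of_rat_power of_rat_minus poly_0_coeff_0)
  finally show ?thesis by blast
qed

text \<open>The product of the conjugates of \<open>z\<close> is rational, being the constant term
  of the minimal polynomial up to sign, so the formula over the rationals suffices.\<close>

theorem product_formula:
  assumes z: "z \<noteq> 0" and V: "finite V" "V \<subseteq> Pl" "\<And>y v. y \<in> conjs z \<Longrightarrow> v \<in> Pl \<Longrightarrow> av v y \<noteq> 1 \<Longrightarrow> v \<in> V"
  shows "(\<Sum>v\<in>V. \<Sum>y\<in>conjs z. ln (av v y)) = 0"
proof -
  have nz: "y \<noteq> 0" if "y \<in> conjs z" for y
    using that z by (auto simp: conjs_def auts_def field_hom_eq_0_iff)
  obtain c where c: "(\<Prod>y\<in>conjs z. y) = of_rat c" using prod_conjs_rat by blast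
  have "(of_rat c :: 'a) \<noteq> 0" unfolding c[symmetric] using nz finite_conjs[of z] by (auto simp: prod_zero_iff)
  hence c0: "c \<noteq> 0" by auto
  have pr: "av v (of_rat c) = (\<Prod>y\<in>conjs z. av v y)" if "v \<in> Pl" for v
    unfolding c[symmetric] by (rule absval.nv_prod[OF av_absval[OF that]])
  have "(\<Sum>v\<in>V. \<Sum>y\<in>conjs z. ln (av v y)) = (\<Sum>v\<in>V. ln (av v (of_rat c)))"
  proof (rule sum.cong)
    fix v assume "v \<in> V"
    hence v: "v \<in> Pl" using V by auto
    show "(\<Sum>y\<in>conjs z. ln (av v y)) = ln (av v (of_rat c))"
    proof -
      have "av v y \<noteq> 0" if "y \<in> conjs z" for y using av_pos[OF v nz[OF that]] by simp
      thus ?thesis unfolding pr[OF v] using finite_conjs av_nonneg[OF v]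
        by (subst ln_prod) (auto simp: order_less_le)
    qed
  qed simp
  also have "\<dots> = 0"
  proof (rule product_formula_rat[OF c0 V(1,2)])
    show "{v \<in> Pl. av v (of_rat c) \<noteq> 1} \<subseteq> V"
    proof
      fix v assume v: "v \<in> {v \<in> Pl. av v (of_rat c) \<noteq> 1}"
      hence "\<exists>y\<in>conjs z. av v y \<noteq> 1" using pr[of v] by (metis (mono_tags, lifting) mem_Collect_eq prod.neutral)
      thus "v \<in> V" using V(3) v by auto
    qed
  qed
  finally show ?thesis .
qed

section \<open>Heights and Northcott's theorem\<close>

definition tot :: "'a \<Rightarrow> real" where
  "tot y = (\<Sum>v\<in>{v \<in> Pl. av v y > 1}. lnp (av v y))"

lemma finite_large: "finite {v \<in> Pl. av v y > 1}"
proof (cases "y = 0")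
  case True
  have "av v 0 = 0" if "v \<in> Pl" for v using absval.nv_0[OF av_absval[OF that]] .
  hence "{v \<in> Pl. av v y > 1} = {}" using True by force
  thus ?thesis by (metis finite.emptyI)
next
  case False
  show ?thesis by (rule finite_subset[OF _ finite_nontrivial[OF False]]) auto
qed

lemma tot_eq:
  assumes "finite V" "V \<subseteq> Pl" "{v \<in> Pl. av v y > 1} \<subseteq> V"
  shows "tot y = (\<Sum>v\<in>V. lnp (av v y))"
  unfolding tot_def
proof (rule sum.mono_neutral_left)
  show "\<forall>i\<in>V - {v \<in> Pl. av v y > 1}. lnp (av i y) = 0"
    using assms(2) by (auto simp: lnp_def max_def)
qed (use assms in auto)

lemma tot_nonneg: "tot y \<ge> 0" unfolding tot_def by (intro sum_nonneg lnp_nonneg)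

text \<open>The absolute logarithmic Weil height in the form used from here on: an average over
  conjugates in place of a weighted sum over places.\<close>

definition hgt :: "'a \<Rightarrow> real" where
  "hgt x = (\<Sum>y\<in>conjs x. tot y) / card (conjs x)"

lemma hgt_nonneg: "hgt x \<ge> 0"
  unfolding hgt_def by (intro divide_nonneg_nonneg sum_nonneg tot_nonneg) simp

lemma hgt_aut: "g \<in> auts \<Longrightarrow> hgt (g x) = hgt x" by (simp add: hgt_def conjs_aut)

text \<open>Only the finitely many primes in \<open>Q\<close>, where some conjugate is not integral,
  contribute to the infinite sum. At each of them \<open>sum_over_places\<close> turns places into
  conjugates, and complex embeddings are handled by \<open>sum_complex_embeddings\<close>.\<close>

lemma std_height_eq: "std_height (Aff x) = hgt x"
proof -
  let ?F = "rat_adjoin x"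
  define Q where "Q = {q. prime q \<and> (\<exists>y\<in>conjs x. av q y > 1)}"
  have fQ: "finite Q"
  proof (rule finite_subset)
    show "Q \<subseteq> (\<Union>y\<in>conjs x. {v \<in> Pl. av v y > 1})" by (auto simp: Q_def Pl_def)
  qed (auto intro: finite_conjs finite_large)
  have pq: "padic_qbar (av q) q" if "prime q" for q
    using av_prime[OF that] by (simp add: padic_qbar_def)
  have fin: "finite {w. finite_place q ?F w}"
    and sm: "(\<Sum>w | finite_place q ?F w. local_degree q ?F w * lnp (w x)) = (\<Sum>y\<in>conjs x. lnp (av q y))"
    if "prime q" for q
    using padic_qbar.sum_over_places(1)[OF pq[OF that], where x = x]
      padic_qbar.sum_over_places(2)[OF pq[OF that], where x = x and f = lnp] by auto
  have zero: "lnp (w x) = 0" if w: "finite_place q ?F w" "q \<notin> Q" for q w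
  proof -
    have q: "prime q" using w by (simp add: finite_place_def)
    interpret padic_qbar "av q" q x by (rule pq[OF q])
    have "w \<in> places" using w all_places by auto
    then obtain y where y: "y \<in> conjs x" "w = plc (emb y)" by (auto simp: places_eq)
    hence "w x = av q y" using emb[OF y(1)] x_in_F by (simp add: plc_def)
    moreover have "av q y \<le> 1" using w(2) q y(1) by (force simp: Q_def)
    ultimately show ?thesis by (simp add: lnp_def max_def)
  qed
  define T where "T = Sigma Q (\<lambda>q. {w. finite_place q ?F w})"
  have pQ: "prime q" if "q \<in> Q" for q using that by (simp add: Q_def)
  have "(\<Sum>\<^sub>\<infinity>(q, w)\<in>{(q, w). finite_place q ?F w}. local_degree q ?F w * ln (max 1 (w x)))
      = (\<Sum>\<^sub>\<infinity>(q, w)\<in>T. local_degree q ?F w * lnp (w x))"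
    by (rule infsum_cong_neutral) (auto simp: T_def lnp_def[symmetric], use zero in blast)
  also have "\<dots> = (\<Sum>(q, w)\<in>T. local_degree q ?F w * lnp (w x))"
    using fQ fin pQ by (intro infsum_finite) (auto simp: T_def)
  also have "\<dots> = (\<Sum>q\<in>Q. \<Sum>w | finite_place q ?F w. local_degree q ?F w * lnp (w x))"
    unfolding T_def using fQ fin pQ by (subst sum.Sigma) auto
  also have "\<dots> = (\<Sum>q\<in>Q. \<Sum>y\<in>conjs x. lnp (av q y))"
    using sm pQ by (intro sum.cong) auto
  finally have fp: "(\<Sum>\<^sub>\<infinity>(q, w)\<in>{(q, w). finite_place q ?F w}. local_degree q ?F w * ln (max 1 (w x)))
      = (\<Sum>q\<in>Q. \<Sum>y\<in>conjs x. lnp (av q y))" .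
  have arch: "(\<Sum>\<sigma>\<in>complex_embeddings ?F. ln (max 1 (cmod (\<sigma> x)))) = (\<Sum>y\<in>conjs x. lnp (av 0 y))"
    using sum_complex_embeddings[OF iota, of "\<lambda>t. ln (max 1 (cmod t))" x] by (simp add: lnp_def av_0)
  have "(\<Sum>y\<in>conjs x. tot y) = (\<Sum>y\<in>conjs x. \<Sum>v\<in>insert 0 Q. lnp (av v y))"
  proof (rule sum.cong)
    fix y assume "y \<in> conjs x"
    thus "tot y = (\<Sum>v\<in>insert 0 Q. lnp (av v y))"
      using fQ by (intro tot_eq) (auto simp: Pl_def Q_def)
  qed simp
  also have "\<dots> = (\<Sum>y\<in>conjs x. lnp (av 0 y)) + (\<Sum>q\<in>Q. \<Sum>y\<in>conjs x. lnp (av q y))"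
  proof -
    have "0 \<notin> Q" by (auto simp: Q_def)
    thus ?thesis using fQ sum.swap[of "\<lambda>y q. lnp (av q y)" Q "conjs x"] by (simp add: sum.distrib)
  qed
  finally show ?thesis
    using fp arch by (simp add: hgt_def Let_def degree_over_rat_adjoin)
qed

text \<open>The two test functions that are needed: functions of one entry, which express heights,
  and the indicator of a tuple, which measures the share of automorphisms fixing it.\<close>

lemma galois_average_single:
  assumes "finite (A :: 'a set)"
  obtains \<Gamma> where "finite \<Gamma>" "\<Gamma> \<noteq> {}" "\<Gamma> \<subseteq> auts"
    "\<And>x (f :: 'a \<Rightarrow> real). x \<in> A \<Longrightarrow> (\<Sum>g\<in>\<Gamma>. f (g x)) / card \<Gamma> = (\<Sum>y\<in>conjs x. f y) / card (conjs x)"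
    "\<And>ks. set ks \<subseteq> A \<Longrightarrow> real (card {g \<in> \<Gamma>. map g ks = ks}) / card \<Gamma> = 1 / card (list_orbit ks)"
proof -
  obtain \<Gamma> where G: "finite \<Gamma>" "\<Gamma> \<noteq> {}" "\<Gamma> \<subseteq> auts"
    "\<And>ks (\<psi> :: 'a list \<Rightarrow> real). set ks \<subseteq> A \<Longrightarrow>
       (\<Sum>g\<in>\<Gamma>. \<psi> (map g ks)) / card \<Gamma> = (\<Sum>zs\<in>list_orbit ks. \<psi> zs) / card (list_orbit ks)"
    by (rule galois_average[OF assms]) blast
  show ?thesis
  proof (rule that[OF G(1,2,3)])
    fix x and f :: "'a \<Rightarrow> real" assume "x \<in> A"
    hence "(\<Sum>g\<in>\<Gamma>. f (hd (map g [x]))) / card \<Gamma> = (\<Sum>zs\<in>list_orbit [x]. f (hd zs)) / card (list_orbit [x])"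
      using G(4)[of "[x]" "\<lambda>zs. f (hd zs)"] by simp
    moreover have i: "inj_on (\<lambda>y. [y]) (conjs x)" by (rule inj_onI) simp
    ultimately show "(\<Sum>g\<in>\<Gamma>. f (g x)) / card \<Gamma> = (\<Sum>y\<in>conjs x. f y) / card (conjs x)"
      unfolding list_orbit_singleton by (simp add: sum.reindex[OF i] card_image[OF i])
  next
    fix ks assume "set ks \<subseteq> A"
    hence "(\<Sum>g\<in>\<Gamma>. if map g ks = ks then 1 else 0) / card \<Gamma> = (\<Sum>zs\<in>list_orbit ks. if zs = ks then 1 else 0) / card (list_orbit ks)"
      using G(4)[of ks "\<lambda>zs. if zs = ks then 1 else (0::real)"] by simp
    thus "real (card {g \<in> \<Gamma>. map g ks = ks}) / card \<Gamma> = 1 / card (list_orbit ks)"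
      using G(1) finite_list_orbit[of ks] list_orbit_self[of ks] by (simp add: sum.If_cases Int_def)
  qed
qed

text \<open>The archimedean term bounds the absolute value. At the primes dividing the denominator
  \<open>b\<close> the numerator is a unit, so by the product formula \<open>ln b\<close> is at most
  the sum of the finite terms.\<close>

lemma finite_rat_tot_le: "finite {c::rat. tot (of_rat c) \<le> B}"
proof -
  define N where "N = \<lceil>exp B\<rceil>"
  have "{c::rat. tot (of_rat c) \<le> B} \<subseteq> (\<lambda>(a, b). of_int a / of_int b) ` ({- (N * N)..N * N} \<times> {1..N})"
  proof
    fix c :: rat assume "c \<in> {c. tot (of_rat c) \<le> B}"
    hence cB: "tot (of_rat c) \<le> B" by simp
    obtain a b where ab: "quotient_of c = (a, b)" by fastforce
    have b: "b > 0" "c = of_int a / of_int b" "coprime a b"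
      using ab quotient_of_denom_pos quotient_of_div quotient_of_coprime by blast+
    have ce: "of_rat c = (of_int a / of_int b :: 'a)" by (simp add: b(2) of_rat_divide)
    define V where "V = insert 0 ({q. prime q \<and> int q dvd b} \<union> {v \<in> Pl. av v (of_rat c) > 1})"
    have V: "finite V" "0 \<in> V" "V \<subseteq> Pl" using finite_primes_dvd[of b] finite_large b(1) by (auto simp: V_def Pl_def)
    have t: "tot (of_rat c) = (\<Sum>v\<in>V. lnp (av v (of_rat c)))" using V by (intro tot_eq) (auto simp: V_def)
    have "lnp (av 0 (of_rat c)) \<le> tot (of_rat c)" unfolding t
      using V by (intro member_le_sum lnp_nonneg) auto
    moreover have "(of_rat c :: complex) = of_real (of_rat c)" by (cases c) (simp add: of_rat_rat)
    hence "cmod (of_rat c) = \<bar>of_rat c :: real\<bar>" by (simp only: norm_of_real)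
    ultimately have "ln (max 1 \<bar>of_rat c :: real\<bar>) \<le> B"
      using cB by (simp add: lnp_def av_0 field_hom_of_rat[OF iota])
    hence "exp (ln (max 1 \<bar>of_rat c :: real\<bar>)) \<le> exp B" by (simp only: exp_le_cancel_iff)
    moreover have "exp (ln (max 1 \<bar>of_rat c :: real\<bar>)) = max 1 \<bar>of_rat c :: real\<bar>" by (rule exp_ln) (simp add: less_max_iff_disj)
    ultimately have c1: "\<bar>of_rat c :: real\<bar> \<le> exp B" by simp
    have ge: "- ln (av q (of_int b)) \<le> lnp (av q (of_rat c))" if q: "q \<in> V - {0}" for q
    proof -
      have pr: "prime q" using q V by (auto simp: Pl_def)
      interpret padic_absval "av q" q by (rule av_prime[OF pr])
      show ?thesis
      proof (cases "int q dvd b")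
        case True
        hence "\<not> int q dvd a" using b(3) pr by (meson coprime_common_divisor not_prime_unit prime_nat_int_transfer)
        hence "av q (of_rat c) = 1 / av q (of_int b)" unfolding ce by (simp add: nv_divide nv_of_int_unit)
        moreover have "av q (of_int b) > 0" using b(1) by (intro nv_pos) simp
        ultimately show ?thesis using lnp_ge_ln[of "1 / av q (of_int b)"] by (simp add: ln_div)
      next
        case False
        thus ?thesis using lnp_nonneg by (simp add: nv_of_int_unit)
      qed
    qed
    have "ln (av 0 (of_int b)) + (\<Sum>q\<in>V - {0}. ln (av q (of_int b))) = 0"
      using product_formula_int[of b V] V b(1) sum.remove[of V 0 "\<lambda>v. ln (av v (of_int b))"] by (auto simp: V_def)
    hence "ln (real_of_int b) = (\<Sum>q\<in>V - {0}. - ln (av q (of_int b)))"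
      using b(1) by (simp add: av_0 field_hom_of_int[OF iota] sum_negf)
    also have "\<dots> \<le> (\<Sum>q\<in>V - {0}. lnp (av q (of_rat c)))" by (intro sum_mono ge)
    also have "\<dots> \<le> tot (of_rat c)" unfolding t using V lnp_nonneg by (intro sum_mono2) auto
    finally have "ln (real_of_int b) \<le> B" using cB by simp
    hence b1: "real_of_int b \<le> exp B" using b(1) by (metis exp_le_cancel_iff exp_ln of_int_0_less_iff)
    have bN: "b \<le> N" using b1 unfolding N_def by linarith
    have N0: "N \<ge> 0" using bN b(1) by linarith
    have "(of_rat c :: real) = of_int a / of_int b" by (simp add: b(2) of_rat_divide)
    hence "\<bar>real_of_int a\<bar> = \<bar>of_rat c :: real\<bar> * real_of_int b" using b(1) by (simp add: abs_mult)
    also have "\<dots> \<le> exp B * exp B" using c1 b1 b(1) by (intro mult_mono) auto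
    also have "\<dots> \<le> real_of_int N * real_of_int N"
    proof -
      have "exp B \<le> real_of_int N" unfolding N_def by (rule le_of_int_ceiling)
      thus ?thesis using N0 by (intro mult_mono) auto
    qed
    finally have "\<bar>a\<bar> \<le> N * N" by (metis of_int_abs of_int_le_iff of_int_mult)
    hence "(a, b) \<in> {- (N * N)..N * N} \<times> {1..N}" using bN b(1) by auto
    thus "c \<in> (\<lambda>(a, b). of_int a / of_int b) ` ({- (N * N)..N * N} \<times> {1..N})" using b(2) by force
  qed
  thus ?thesis using finite_subset by blast
qed

text \<open>The coefficients of the minimal polynomial are controlled by the conjugates: through
  Gauss norms at primes and up to a factor 2 per conjugate at the archimedean place. So only
  finitely many minimal polynomials occur.\<close>

theorem northcott: "finite {x::'a. card (conjs x) \<le> D \<and> hgt x \<le> B}"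
proof -
  \<comment> \<open>The term with \<open>ln 2\<close> comes from the archimedean factor
    \<open>2 ^ n\<close>. The modulus of \<open>B\<close> keeps
    \<open>real D * \<bar>B\<bar>\<close> an upper bound for \<open>n * hgt x\<close> whatever the
    sign of \<open>B\<close>.\<close>
  define B' where "B' = real D * ln 2 + real D * \<bar>B\<bar>"
  define Q where "Q = {c::rat. tot (of_rat c) \<le> B'}"
  define PP where "PP = {p :: rat poly. degree p \<le> D \<and> (\<forall>i. coeff p i \<in> insert 0 Q)}"
  have fQ: "finite (insert 0 Q)" using finite_rat_tot_le by (simp add: Q_def)
  have fPP: "finite PP"
  proof (rule finite_imageD)
    show "inj_on (\<lambda>p. restrict (coeff p) {..D}) PP"
    proof (rule inj_onI)
      fix p q assume pq: "p \<in> PP" "q \<in> PP" "restrict (coeff p) {..D} = restrict (coeff q) {..D}"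
      show "p = q"
      proof (rule poly_eqI)
        fix i show "coeff p i = coeff q i"
        proof (cases "i \<le> D")
          case True
          thus ?thesis using fun_cong[OF pq(3), of i] by simp
        next
          case False
          thus ?thesis using pq by (simp add: PP_def coeff_eq_0)
        qed
      qed
    qed
    show "finite ((\<lambda>p. restrict (coeff p) {..D}) ` PP)"
    proof (rule finite_subset)
      show "(\<lambda>p. restrict (coeff p) {..D}) ` PP \<subseteq> Pi\<^sub>E {..D} (\<lambda>_. insert 0 Q)"
      proof (rule image_subsetI)
        fix p assume "p \<in> PP"
        thus "restrict (coeff p) {..D} \<in> Pi\<^sub>E {..D} (\<lambda>_. insert 0 Q)"
          unfolding restrict_PiE_iff PP_def by blast
      qed
      show "finite (Pi\<^sub>E {..D} (\<lambda>_. insert 0 Q))" using fQ by (intro finite_PiE) auto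
    qed
  qed
  have "minpoly x \<in> PP" if x: "card (conjs x) \<le> D" "hgt x \<le> B" for x :: 'a
  proof -
    have "coeff (minpoly x) i \<in> Q" for i
    proof -
      let ?c = "of_rat (coeff (minpoly x) i) :: 'a"
      have c: "?c = coeff (\<Prod>y\<in>conjs x. [:- y, 1:]) i"
        by (simp add: rpoly_minpoly_eq_prod[symmetric])
      define V where "V = insert 0 ({v \<in> Pl. av v ?c > 1} \<union> (\<Union>y\<in>conjs x. {v \<in> Pl. av v y > 1}))"
      have V: "finite V" "V \<subseteq> Pl" "0 \<in> V" using finite_large finite_conjs by (auto simp: V_def Pl_def)
      let ?n = "card (conjs x)"
      have loc: "lnp (av v ?c) \<le> (if v = 0 then ?n * ln 2 else 0) + (\<Sum>y\<in>conjs x. lnp (av v y))" if v: "v \<in> V" for v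
      proof -
        have pos: "(\<Prod>y\<in>conjs x. max 1 (av v y)) \<ge> 1" by (intro prod_ge_1) auto
        have lnpr: "ln (\<Prod>y\<in>conjs x. max 1 (av v y)) = (\<Sum>y\<in>conjs x. lnp (av v y))"
          unfolding lnp_def using finite_conjs by (subst ln_prod) (auto simp: less_max_iff_disj)
        show ?thesis
        proof (cases "v = 0")
          case True
          interpret absval "av v" using V v by (intro av_absval) auto
          have "av v ?c \<le> 2 ^ ?n * (\<Prod>y\<in>conjs x. max 1 (av v y))" unfolding c by (rule coeff_prod_linear_le[OF finite_conjs])
          moreover have "1 * 1 \<le> 2 ^ ?n * (\<Prod>y\<in>conjs x. max 1 (av v y))" using pos by (intro mult_mono) auto
          ultimately have "lnp (av v ?c) \<le> ln (2 ^ ?n * (\<Prod>y\<in>conjs x. max 1 (av v y)))"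
            unfolding lnp_def by (subst ln_le_cancel_iff) auto
          also have "\<dots> = ?n * ln 2 + (\<Sum>y\<in>conjs x. lnp (av v y))"
            using pos lnpr by (subst ln_mult_pos) (auto simp: ln_realpow)
          finally show ?thesis using True by simp
        next
          case False
          hence "prime v" using V v by (auto simp: Pl_def)
          then interpret padic_absval "av v" v by (rule av_prime)
          have "av v ?c \<le> (\<Prod>y\<in>conjs x. max 1 (av v y))"
            unfolding c using coeff_le_gauss_norm[of "\<Prod>y\<in>conjs x. [:- y, 1:]" i] by (simp add: gauss_norm_prod_linear)
          hence "lnp (av v ?c) \<le> ln (\<Prod>y\<in>conjs x. max 1 (av v y))"
            unfolding lnp_def using pos by (subst ln_le_cancel_iff) auto
          thus ?thesis using lnpr False by simp
        qed
      qed
      have "tot ?c = (\<Sum>v\<in>V. lnp (av v ?c))" using V by (intro tot_eq) (auto simp: V_def)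
      also have "\<dots> \<le> (\<Sum>v\<in>V. (if v = 0 then ?n * ln 2 else 0) + (\<Sum>y\<in>conjs x. lnp (av v y)))" by (intro sum_mono loc)
      also have "\<dots> = ?n * ln 2 + (\<Sum>y\<in>conjs x. \<Sum>v\<in>V. lnp (av v y))"
        using V sum.swap[of "\<lambda>v y. lnp (av v y)" "conjs x" V] by (simp add: sum.distrib)
      also have "(\<Sum>y\<in>conjs x. \<Sum>v\<in>V. lnp (av v y)) = (\<Sum>y\<in>conjs x. tot y)"
        using V by (intro sum.cong tot_eq[symmetric]) (auto simp: V_def)
      also have "\<dots> = ?n * hgt x" using card_conjs_pos[of x] by (simp add: hgt_def)
      also have "?n * ln 2 + ?n * hgt x \<le> D * ln 2 + D * \<bar>B\<bar>"
        using x hgt_nonneg[of x] by (intro add_mono mult_mono) auto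
      finally show ?thesis by (simp add: Q_def B'_def)
    qed
    thus ?thesis using x by (simp add: PP_def degree_minpoly)
  qed
  hence sub: "{x::'a. card (conjs x) \<le> D \<and> hgt x \<le> B} \<subseteq> (\<Union>p\<in>PP - {0}. {x. poly (rpoly p) x = 0})"
    using minpoly_props(2) minpoly_nonzero by blast
  have "finite (\<Union>p\<in>PP - {0}. {x::'a. poly (rpoly p) x = 0})"
    using fPP by (intro finite_UN_I) (auto intro: poly_roots_finite)
  with sub show ?thesis by (rule finite_subset)
qed

end

section \<open>The canonical height\<close>

lemma lnp_mono: "s \<le> t \<Longrightarrow> lnp s \<le> lnp t"
  unfolding lnp_def by (subst ln_le_cancel_iff) (auto simp: less_max_iff_disj)

lemma lnp_le_1: "t \<le> 1 \<Longrightarrow> lnp t = 0" by (simp add: lnp_def max_absorb1)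

lemma lnp_ge_1: "t \<ge> 1 \<Longrightarrow> lnp t = ln t" by (simp add: lnp_def max_absorb2)

context absval
begin

lemma poly_lnp_upper:
  obtains c where "c \<ge> 0" "\<And>x. lnp (nv (poly f x)) \<le> real (degree f) * lnp (nv x) + c"
proof -
  define S where "S = (\<Sum>i\<le>degree f. nv (coeff f i))"
  have S0: "S \<ge> 0" unfolding S_def by (intro sum_nonneg nv_nonneg)
  have "lnp (nv (poly f x)) \<le> real (degree f) * lnp (nv x) + lnp S" for x
  proof -
    let ?M = "max 1 (nv x)"
    have "nv (poly f x) \<le> (\<Sum>i\<le>degree f. nv (coeff f i * x ^ i))" unfolding poly_altdef by (rule nv_sum_le)
    also have "\<dots> \<le> (\<Sum>i\<le>degree f. nv (coeff f i) * ?M ^ degree f)"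
    proof (rule sum_mono)
      fix i assume i: "i \<in> {..degree f}"
      have "nv x ^ i \<le> ?M ^ i" using nv_nonneg by (intro power_mono) auto
      also have "\<dots> \<le> ?M ^ degree f" using i by (intro power_increasing) auto
      finally show "nv (coeff f i * x ^ i) \<le> nv (coeff f i) * ?M ^ degree f"
        unfolding nv_mult nv_power by (intro mult_left_mono nv_nonneg)
    qed
    also have "\<dots> = S * ?M ^ degree f" by (simp add: S_def sum_distrib_right)
    also have "\<dots> \<le> max 1 S * ?M ^ degree f" by (intro mult_right_mono) auto
    finally have "nv (poly f x) \<le> max 1 S * ?M ^ degree f" .
    moreover have "1 * 1 \<le> max 1 S * ?M ^ degree f" by (intro mult_mono) (auto simp: one_le_power)
    ultimately have "lnp (nv (poly f x)) \<le> ln (max 1 S * ?M ^ degree f)"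
      unfolding lnp_def by (subst ln_le_cancel_iff) auto
    also have "\<dots> = ln (max 1 S) + ln (?M ^ degree f)"
      by (rule ln_mult_pos) (auto simp: less_max_iff_disj)
    also have "ln (?M ^ degree f) = real (degree f) * ln ?M" by (rule ln_realpow)
    finally show ?thesis by (simp add: lnp_def)
  qed
  thus ?thesis using that[of "lnp S"] lnp_nonneg by blast
qed

lemma poly_lnp_lower:
  assumes d: "degree f \<ge> 1"
  obtains c where "c \<ge> 0" "\<And>x. real (degree f) * lnp (nv x) \<le> lnp (nv (poly f x)) + c"
proof -
  define S where "S = (\<Sum>i<degree f. nv (coeff f i))"
  define a where "a = nv (lead_coeff f)"
  have a: "a > 0" unfolding a_def using d by (intro nv_pos) auto
  have S0: "S \<ge> 0" unfolding S_def by (intro sum_nonneg nv_nonneg)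
  \<comment> \<open>Beyond this radius the lower terms of \<open>f\<close> sum to at most half of
    the leading term.\<close>
  define R where "R = max 1 (2 * S / a)"
  have "real (degree f) * lnp (nv x) \<le> lnp (nv (poly f x)) + (real (degree f) * ln R + lnp (2 / a))" for x
  proof (cases "nv x \<ge> R")
    case True
    define d where "d = degree f"
    have x1: "nv x \<ge> 1" using True by (simp add: R_def)
    obtain d' where d': "d = Suc d'" using assms by (cases d) (auto simp: d_def)
    have pf: "poly f x = (\<Sum>i<d. coeff f i * x ^ i) + lead_coeff f * x ^ d"
      by (simp add: poly_altdef d_def lessThan_Suc_atMost[symmetric])
    have "nv (\<Sum>i<d. coeff f i * x ^ i) \<le> (\<Sum>i<d. nv (coeff f i * x ^ i))" by (rule nv_sum_le)
    also have "\<dots> \<le> (\<Sum>i<d. nv (coeff f i) * nv x ^ d')"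
    proof (rule sum_mono)
      fix i assume "i \<in> {..<d}"
      hence "nv x ^ i \<le> nv x ^ d'" using x1 d' by (intro power_increasing) auto
      thus "nv (coeff f i * x ^ i) \<le> nv (coeff f i) * nv x ^ d'"
        unfolding nv_mult nv_power by (intro mult_left_mono nv_nonneg)
    qed
    also have "\<dots> = S * nv x ^ d'" by (simp add: S_def d_def sum_distrib_right)
    also have "\<dots> \<le> (a * nv x / 2) * nv x ^ d'"
    proof (rule mult_right_mono)
      have "2 * S / a \<le> nv x" using True by (simp add: R_def)
      thus "S \<le> a * nv x / 2" using a by (simp add: field_simps)
    qed (use nv_nonneg in auto)
    finally have r: "nv (\<Sum>i<d. coeff f i * x ^ i) \<le> a * nv x ^ d / 2" by (simp add: d' mult_ac)
    have "a * nv x ^ d = nv (poly f x - (\<Sum>i<d. coeff f i * x ^ i))" by (simp add: pf a_def nv_mult nv_power)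
    also have "\<dots> \<le> nv (poly f x) + nv (\<Sum>i<d. coeff f i * x ^ i)"
      using nv_triangle[of "poly f x" "- (\<Sum>i<d. coeff f i * x ^ i)"] by simp
    finally have ge: "nv x ^ d \<le> nv (poly f x) * (2 / a)" using r a by (simp add: field_simps)
    have x0: "nv x ^ d > 0" using x1 by simp
    have fx: "nv (poly f x) > 0" using ge x0 a by (metis less_le_trans nv_nonneg mult_zero_left less_irrefl order_less_le)
    have "real d * lnp (nv x) = ln (nv x ^ d)" using x1 by (simp add: lnp_ge_1 ln_realpow)
    also have "\<dots> \<le> ln (nv (poly f x) * (2 / a))" using ge x0 by (subst ln_le_cancel_iff) auto
    also have "\<dots> = ln (nv (poly f x)) + ln (2 / a)" using fx a by (intro ln_mult_pos) auto
    also have "\<dots> \<le> lnp (nv (poly f x)) + lnp (2 / a)" using fx a by (intro add_mono lnp_ge_ln) auto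
    finally have "real (degree f) * lnp (nv x) \<le> lnp (nv (poly f x)) + lnp (2 / a)" by (simp add: d_def)
    moreover have "real (degree f) * ln R \<ge> 0" by (intro mult_nonneg_nonneg) (auto simp: R_def)
    ultimately show ?thesis by linarith
  next
    case False
    hence "lnp (nv x) \<le> lnp R" by (intro lnp_mono) simp
    moreover have "lnp R = ln R" by (rule lnp_ge_1) (simp add: R_def)
    ultimately have "lnp (nv x) \<le> ln R" by simp
    hence "real (degree f) * lnp (nv x) \<le> real (degree f) * ln R" by (intro mult_left_mono) auto
    thus ?thesis using lnp_nonneg[of "nv (poly f x)"] lnp_nonneg[of "2 / a"] by linarith
  qed
  moreover have "real (degree f) * ln R + lnp (2 / a) \<ge> 0"
    using lnp_nonneg[of "2 / a"] by (intro add_nonneg_nonneg mult_nonneg_nonneg) (auto simp: R_def)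
  ultimately show ?thesis using that by blast
qed

end

lemma (in ultra_absval) poly_lnp_good:
  assumes d: "degree f \<ge> 1" and f: "\<And>i. nv (coeff f i) \<le> 1" "nv (lead_coeff f) = 1"
  shows "lnp (nv (poly f x)) = real (degree f) * lnp (nv x)"
proof (cases "nv x \<le> 1")
  case True
  have "nv (poly f x) \<le> 1" unfolding poly_altdef
    using f(1) True nv_nonneg by (intro nv_sum_le_bound) (auto simp: nv_mult nv_power intro!: mult_le_one power_le_one)
  thus ?thesis using True by (simp add: lnp_le_1)
next
  case False
  define d where "d = degree f"
  have pf: "poly f x = (\<Sum>i<d. coeff f i * x ^ i) + lead_coeff f * x ^ d"
    by (simp add: poly_altdef d_def lessThan_Suc_atMost[symmetric])
  have "nv (\<Sum>i<d. coeff f i * x ^ i) < nv x ^ d"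
  proof (rule nv_sum_less_bound)
    fix i assume i: "i \<in> {..<d}"
    have "nv (coeff f i) * nv x ^ i \<le> 1 * nv x ^ i" using f(1) nv_nonneg by (intro mult_right_mono) auto
    also have "\<dots> < nv x ^ d" using i False by simp
    finally show "nv (coeff f i * x ^ i) < nv x ^ d" by (simp add: nv_mult nv_power)
  qed (use False in auto)
  hence "nv (poly f x) = nv x ^ d" unfolding pf using f(2)
    by (subst nv_add_eq) (auto simp: nv_mult nv_power)
  thus ?thesis using False by (simp add: lnp_ge_1 ln_realpow d_def one_le_power)
qed

lemma geometric_cauchy_limit:
  fixes a :: "nat \<Rightarrow> real" and d :: real
  assumes d: "d \<ge> 2" and B: "B \<ge> 0" and a: "\<And>n. \<bar>a (Suc n) - a n\<bar> \<le> B / d ^ Suc n"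
  shows "convergent a" "\<bar>lim a - a 0\<bar> \<le> B"
proof -
  define f where "f n = a (Suc n) - a n" for n
  have g: "(\<lambda>n. B / d ^ Suc n) sums (B / d * (1 / (1 - 1 / d)))"
  proof -
    have "(\<lambda>n. B / d * (1 / d) ^ n) sums (B / d * (1 / (1 - 1 / d)))"
      using d by (intro sums_mult geometric_sums) auto
    thus ?thesis by (simp add: power_one_over)
  qed
  have sf: "summable (\<lambda>n. \<bar>f n\<bar>)"
    by (rule summable_comparison_test'[OF sums_summable[OF g], of 0]) (use a in \<open>simp add: f_def\<close>)
  have an: "a m = a 0 + (\<Sum>n<m. f n)" for m unfolding f_def sum_lessThan_telescope by simp
  have L: "a \<longlonglongrightarrow> a 0 + suminf f"
    using tendsto_add[OF tendsto_const[of "a 0"] summable_LIMSEQ[OF summable_rabs_cancel[OF sf]]] by (simp add: an[symmetric])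
  thus "convergent a" by (auto simp: convergent_def)
  have "\<bar>lim a - a 0\<bar> = \<bar>suminf f\<bar>" using limI[OF L] by simp
  also have "\<dots> \<le> (\<Sum>n. \<bar>f n\<bar>)" by (rule summable_rabs[OF sf])
  also have "\<dots> \<le> (\<Sum>n. B / d ^ Suc n)" by (rule suminf_le[OF _ sf sums_summable[OF g]]) (use a in \<open>simp add: f_def\<close>)
  also have "\<dots> = B / (d - 1)" using sums_unique[OF g] d by (simp add: field_simps)
  also have "\<dots> \<le> B" using d B by (simp add: divide_le_eq mult_le_cancel_left1)
  finally show "\<bar>lim a - a 0\<bar> \<le> B" .
qed

locale poly_dynamics = global_places av \<iota>
  for av :: "nat \<Rightarrow> 'k::number_field alg_closure \<Rightarrow> real" and \<iota> +
  fixes \<phi> :: "'k poly"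
  assumes deg: "degree \<phi> \<ge> 2"
begin

abbreviation "d \<equiv> degree \<phi>"

definition P :: "'k alg_closure poly" where "P = map_poly to_ac \<phi>"

lemma degree_P: "degree P = d"
  unfolding P_def by (rule field_hom_map_poly_degree[OF field_hom_to_ac])

text \<open>A finite list spanning \<open>K\<close> over the rationals. An automorphism is the
  identity on \<open>K\<close> once it fixes this list, which makes a condition on all of
  \<open>K\<close> accessible to averages over tuples.\<close>

definition basis :: "'k alg_closure list" where
  "basis = (SOME bs. \<exists>B::'k set. (\<forall>x. \<exists>c::'k \<Rightarrow> rat. x = (\<Sum>b\<in>B. of_rat (c b) * b)) \<and> set bs = to_ac ` B \<and> finite B)"

lemma basis: "\<exists>B::'k set. (\<forall>x. \<exists>c::'k \<Rightarrow> rat. x = (\<Sum>b\<in>B. of_rat (c b) * b)) \<and> set basis = to_ac ` B \<and> finite B"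
proof -
  obtain B :: "'k set" where B: "finite B" "\<forall>x. \<exists>c::'k \<Rightarrow> rat. x = (\<Sum>b\<in>B. of_rat (c b) * b)"
    using finite_dim_over_rat by blast
  obtain bs where "set bs = to_ac ` B" using finite_list[of "to_ac ` B"] B(1) by auto
  hence "\<exists>bs. \<exists>B::'k set. (\<forall>x. \<exists>c::'k \<Rightarrow> rat. x = (\<Sum>b\<in>B. of_rat (c b) * b)) \<and> set bs = to_ac ` B \<and> finite B"
    using B by blast
  thus ?thesis unfolding basis_def by (rule someI_ex)
qed

lemma auts_agree_on_K:
  assumes g: "g \<in> auts" "h \<in> auts" "map g basis = map h basis" shows "g (to_ac c) = h (to_ac c)"
proof -
  obtain B :: "'k set" where B: "\<And>x. \<exists>c::'k \<Rightarrow> rat. x = (\<Sum>b\<in>B. of_rat (c b) * b)" "set basis = to_ac ` B" "finite B"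
    using basis by auto
  have gh: "field_hom g" "field_hom h" using g by (auto simp: auts_def)
  obtain e :: "'k \<Rightarrow> rat" where e: "c = (\<Sum>b\<in>B. of_rat (e b) * b)" using B(1) by blast
  have eq: "g (to_ac b) = h (to_ac b)" if "b \<in> B" for b using g(3) B(2) that by auto
  show ?thesis unfolding e
    by (simp add: to_ac_sum field_hom_sum[OF gh(1)] field_hom_sum[OF gh(2)] field_hom_mult[OF gh(1)] field_hom_mult[OF gh(2)]
        field_hom_of_rat[OF field_hom_to_ac] field_hom_of_rat[OF gh(1)] field_hom_of_rat[OF gh(2)] eq)
qed

lemma aut_fixes_K: "g \<in> auts \<Longrightarrow> map g basis = basis \<Longrightarrow> g (to_ac c) = to_ac c"
  using auts_agree_on_K[of g id] auts_id by simp

text \<open>Automorphisms move the coefficients of \<phi>, but only through their action on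
  \<open>basis\<close>. Finiteness of the set of conjugate polynomials is what makes the local
  constants uniform in the automorphism.\<close>

lemma finite_conj_polys: "finite ((\<lambda>g. map_poly g P) ` auts)"
proof -
  have "\<forall>bs\<in>list_orbit basis. \<exists>g. g \<in> auts \<and> map g basis = bs" by (auto simp: list_orbit_def)
  from bchoice[OF this] obtain h where h: "\<And>bs. bs \<in> list_orbit basis \<Longrightarrow> h bs \<in> auts \<and> map (h bs) basis = bs" by blast
  have "(\<lambda>g. map_poly g P) ` auts \<subseteq> (\<lambda>bs. map_poly (h bs) P) ` list_orbit basis"
  proof
    fix f assume "f \<in> (\<lambda>g. map_poly g P) ` auts"
    then obtain g where g: "g \<in> auts" "f = map_poly g P" by auto
    have o: "map g basis \<in> list_orbit basis" using g by (auto simp: list_orbit_def)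
    have eq: "g (to_ac c) = h (map g basis) (to_ac c)" for c
      using auts_agree_on_K[OF g(1), of "h (map g basis)"] h[OF o] by simp
    have "map_poly g P = map_poly (h (map g basis)) P"
    proof (rule poly_eqI)
      fix i
      have gh: "field_hom g" "field_hom (h (map g basis))" using g h[OF o] by (auto simp: auts_def)
      show "coeff (map_poly g P) i = coeff (map_poly (h (map g basis)) P) i"
        using eq by (simp add: coeff_map_poly field_hom_0[OF gh(1)] field_hom_0[OF gh(2)] P_def)
    qed
    thus "f \<in> (\<lambda>bs. map_poly (h bs) P) ` list_orbit basis" using g o by blast
  qed
  thus ?thesis using finite_list_orbit finite_surj by blast
qed

lemma conj_poly:
  assumes "g \<in> auts"
  shows "degree (map_poly g P) = d" "g (poly P x) = poly (map_poly g P) (g x)"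
  using assms by (auto simp: auts_def field_hom_map_poly_degree degree_P field_hom_poly)

text \<open>At a prime where all nonzero coefficients of all conjugate polynomials are units the
  defect is zero. The finitely many other places receive the sum of the constants of the conjugate
  polynomials.\<close>

lemma local_constants:
  obtains cv where "\<And>v. v \<in> Pl \<Longrightarrow> cv v \<ge> 0" "finite {v \<in> Pl. cv v \<noteq> 0}"
    "\<And>v g x. v \<in> Pl \<Longrightarrow> g \<in> auts \<Longrightarrow> \<bar>lnp (av v (poly (map_poly g P) x)) - real d * lnp (av v x)\<bar> \<le> cv v"
proof -
  define FP where "FP = (\<lambda>g. map_poly g P) ` auts"
  have fFP: "finite FP" unfolding FP_def by (rule finite_conj_polys)
  have dFP: "degree f = d" if "f \<in> FP" for f using that conj_poly by (auto simp: FP_def)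
  define good where "good v f \<longleftrightarrow> prime v \<and> (\<forall>i. av v (coeff f i) \<le> 1) \<and> av v (lead_coeff f) = 1" for v f
  have ex: "\<exists>c. c \<ge> 0 \<and> (good v f \<longrightarrow> c = 0) \<and> (\<forall>x. \<bar>lnp (av v (poly f x)) - real d * lnp (av v x)\<bar> \<le> c)"
    if v: "v \<in> Pl" and f: "f \<in> FP" for v f
  proof (cases "good v f")
    case True
    then interpret padic_absval "av v" v by (intro av_prime) (simp add: good_def)
    have "lnp (av v (poly f x)) = real d * lnp (av v x)" for x
      using poly_lnp_good[of f x] True deg dFP[OF f] by (auto simp: good_def)
    thus ?thesis by (intro exI[of _ 0]) auto
  next
    case False
    interpret absval "av v" by (rule av_absval[OF v])
    obtain c1 where c1: "c1 \<ge> 0" "\<And>x. lnp (av v (poly f x)) \<le> real (degree f) * lnp (av v x) + c1"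
      using poly_lnp_upper[of f] by blast
    obtain c2 where c2: "c2 \<ge> 0" "\<And>x. real (degree f) * lnp (av v x) \<le> lnp (av v (poly f x)) + c2"
      using poly_lnp_lower[of f] deg dFP[OF f] by auto
    have "\<bar>lnp (av v (poly f x)) - real d * lnp (av v x)\<bar> \<le> c1 + c2" for x
      using c1(1) c2(1) c1(2)[of x, unfolded dFP[OF f]] c2(2)[of x, unfolded dFP[OF f]] by linarith
    thus ?thesis using False c1(1) c2(1) by (intro exI[of _ "c1 + c2"]) auto
  qed
  define c0 where "c0 v f = (SOME c. c \<ge> 0 \<and> (good v f \<longrightarrow> c = 0) \<and> (\<forall>x. \<bar>lnp (av v (poly f x)) - real d * lnp (av v x)\<bar> \<le> c))" for v f
  have c0: "c0 v f \<ge> 0" "good v f \<Longrightarrow> c0 v f = 0" "\<bar>lnp (av v (poly f x)) - real d * lnp (av v x)\<bar> \<le> c0 v f"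
    if "v \<in> Pl" "f \<in> FP" for v f x
    using someI_ex[OF ex[OF that]] by (auto simp: c0_def)
  define cv where "cv v = (\<Sum>f\<in>FP. c0 v f)" for v
  show ?thesis
  proof (rule that)
    show "cv v \<ge> 0" if "v \<in> Pl" for v unfolding cv_def using c0(1)[OF that] by (intro sum_nonneg) auto
    show "\<bar>lnp (av v (poly (map_poly g P) x)) - real d * lnp (av v x)\<bar> \<le> cv v" if "v \<in> Pl" "g \<in> auts" for v g x
    proof -
      have f: "map_poly g P \<in> FP" using that by (auto simp: FP_def)
      have "c0 v (map_poly g P) \<le> cv v" unfolding cv_def using c0(1)[OF that(1)] fFP f by (intro member_le_sum) auto
      thus ?thesis using c0(3)[OF that(1) f, of x] by linarith
    qed
    define bad where "bad = insert 0 (\<Union>f\<in>FP. \<Union>i\<in>{i. i \<le> d \<and> coeff f i \<noteq> 0}. {v \<in> Pl. av v (coeff f i) \<noteq> 1})"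
    have "finite bad" unfolding bad_def using fFP by (auto intro!: finite_nontrivial)
    moreover have "{v \<in> Pl. cv v \<noteq> 0} \<subseteq> bad"
    proof
      fix v assume v: "v \<in> {v \<in> Pl. cv v \<noteq> 0}"
      show "v \<in> bad"
      proof (rule ccontr)
        assume nb: "v \<notin> bad"
        have "c0 v f = 0" if f: "f \<in> FP" for f
        proof (rule c0(2)[OF _ f])
          have "prime v" using v nb by (auto simp: bad_def Pl_def)
          have co: "av v (coeff f i) = 1" if "coeff f i \<noteq> 0" for i
          proof -
            have "i \<le> d" using that dFP[OF f] le_degree by metis
            thus ?thesis using nb f that v by (auto simp: bad_def)
          qed
          have "av v 0 = 0" using v absval.nv_0[OF av_absval] by auto
          moreover have "f \<noteq> 0" using dFP[OF f] deg by auto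
          hence "lead_coeff f \<noteq> 0" by (metis leading_coeff_0_iff)
          ultimately show "good v f" unfolding good_def using \<open>prime v\<close> co by (metis order_refl zero_le_one)
        qed (use v in auto)
        thus False using v by (simp add: cv_def)
      qed
    qed
    ultimately show "finite {v \<in> Pl. cv v \<noteq> 0}" by (rule finite_subset[rotated])
  qed
qed

lemma hgt_functorial: obtains B where "B \<ge> 0" "\<And>x. \<bar>hgt (poly P x) - real d * hgt x\<bar> \<le> B"
proof -
  obtain cv where cv: "\<And>v. v \<in> Pl \<Longrightarrow> cv v \<ge> 0" "finite {v \<in> Pl. cv v \<noteq> 0}"
    "\<And>v g x. v \<in> Pl \<Longrightarrow> g \<in> auts \<Longrightarrow> \<bar>lnp (av v (poly (map_poly g P) x)) - real d * lnp (av v x)\<bar> \<le> cv v"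
    using local_constants by blast
  define B where "B = (\<Sum>v\<in>{v \<in> Pl. cv v \<noteq> 0}. cv v)"
  have "\<bar>hgt (poly P x) - real d * hgt x\<bar> \<le> B" for x
  proof -
    obtain \<Gamma> where G: "finite \<Gamma>" "\<Gamma> \<noteq> {}" "\<Gamma> \<subseteq> auts"
      "\<And>y (f :: 'k alg_closure \<Rightarrow> real). y \<in> {x, poly P x} \<Longrightarrow> (\<Sum>g\<in>\<Gamma>. f (g y)) / card \<Gamma> = (\<Sum>z\<in>conjs y. f z) / card (conjs y)"
    proof (rule galois_average_single[of "{x, poly P x}"])
      show "finite {x, poly P x}" by simp
    qed (rule that)
    have one: "\<bar>tot (g (poly P x)) - real d * tot (g x)\<bar> \<le> B" if g: "g \<in> auts" for g
    proof -
      let ?y = "g x" let ?z = "g (poly P x)"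
      define V where "V = {v \<in> Pl. cv v \<noteq> 0} \<union> {v \<in> Pl. av v ?y > 1} \<union> {v \<in> Pl. av v ?z > 1}"
      have V: "finite V" "V \<subseteq> Pl" using cv(2) finite_large by (auto simp: V_def)
      have "tot ?z - real d * tot ?y = (\<Sum>v\<in>V. lnp (av v ?z) - real d * lnp (av v ?y))"
      proof -
        have "tot ?y = (\<Sum>v\<in>V. lnp (av v ?y))" by (rule tot_eq[OF V]) (auto simp: V_def)
        moreover have "tot ?z = (\<Sum>v\<in>V. lnp (av v ?z))" by (rule tot_eq[OF V]) (auto simp: V_def)
        ultimately show ?thesis by (simp add: sum_subtractf sum_distrib_left)
      qed
      also have "\<bar>\<dots>\<bar> \<le> (\<Sum>v\<in>V. cv v)"
        using cv(3)[OF _ g] V(2) conj_poly(2)[OF g] by (intro order_trans[OF sum_abs] sum_mono) auto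
      also have "\<dots> = B" unfolding B_def using V by (intro sum.mono_neutral_right) (auto simp: V_def)
      finally show ?thesis .
    qed
    have h: "hgt (poly P x) = (\<Sum>g\<in>\<Gamma>. tot (g (poly P x))) / card \<Gamma>" "hgt x = (\<Sum>g\<in>\<Gamma>. tot (g x)) / card \<Gamma>"
      using G(4)[of _ tot] by (auto simp: hgt_def)
    have c: "real (card \<Gamma>) > 0" using G by (simp add: card_gt_0_iff)
    have "\<bar>(\<Sum>g\<in>\<Gamma>. tot (g (poly P x)) - real d * tot (g x))\<bar> \<le> (\<Sum>g\<in>\<Gamma>. B)"
      using one G(3) by (intro order_trans[OF sum_abs] sum_mono) auto
    hence "\<bar>(\<Sum>g\<in>\<Gamma>. tot (g (poly P x))) - real d * (\<Sum>g\<in>\<Gamma>. tot (g x))\<bar> \<le> card \<Gamma> * B"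
      by (simp add: sum_subtractf sum_distrib_left)
    moreover have "hgt (poly P x) - real d * hgt x = ((\<Sum>g\<in>\<Gamma>. tot (g (poly P x))) - real d * (\<Sum>g\<in>\<Gamma>. tot (g x))) / card \<Gamma>"
      unfolding h by (simp add: diff_divide_distrib)
    ultimately show ?thesis using c by (simp add: abs_divide divide_le_eq mult.commute)
  qed
  moreover have "B \<ge> 0" unfolding B_def using cv(1) by (intro sum_nonneg) auto
  ultimately show ?thesis using that by blast
qed

text \<open>Tate's limit on affine points; infinity is fixed by a polynomial and gets the value
  0.\<close>

definition hh :: "'k alg_closure proj_line \<Rightarrow> real" where
  "hh Q = (case Q of Infty \<Rightarrow> 0 | Aff x \<Rightarrow> lim (\<lambda>n. hgt ((poly P ^^ n) x) / real d ^ n))"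

lemma hh_props:
  obtains B where "B \<ge> 0" "\<And>x. \<bar>hh (Aff x) - hgt x\<bar> \<le> B"
    "\<And>Q. hh (poly_proj_map \<phi> Q) = real d * hh Q" "\<And>Q. hh Q \<ge> 0"
proof -
  obtain B where B: "B \<ge> 0" "\<And>x. \<bar>hgt (poly P x) - real d * hgt x\<bar> \<le> B"
    using hgt_functorial by blast
  define a where "a x n = hgt ((poly P ^^ n) x) / real d ^ n" for x n
  have d2: "real d \<ge> 2" using deg by simp
  have st: "\<bar>a x (Suc n) - a x n\<bar> \<le> B / real d ^ Suc n" for x n
  proof -
    have "a x (Suc n) - a x n = (hgt (poly P ((poly P ^^ n) x)) - real d * hgt ((poly P ^^ n) x)) / real d ^ Suc n"
      using d2 by (simp add: a_def diff_divide_distrib)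
    hence "\<bar>a x (Suc n) - a x n\<bar> = \<bar>hgt (poly P ((poly P ^^ n) x)) - real d * hgt ((poly P ^^ n) x)\<bar> / real d ^ Suc n"
      by (simp add: abs_divide)
    also have "\<dots> \<le> B / real d ^ Suc n" by (intro divide_right_mono B) simp
    finally show ?thesis .
  qed
  have conv: "convergent (a x)" and near: "\<bar>lim (a x) - a x 0\<bar> \<le> B" for x
    using geometric_cauchy_limit[of "real d" B "a x", OF d2 B(1) st] by auto
  have hA: "hh (Aff x) = lim (a x)" for x
  proof -
    have "a x = (\<lambda>n. hgt ((poly P ^^ n) x) / real d ^ n)" by (rule HOL.ext) (simp add: a_def)
    thus ?thesis by (simp add: hh_def)
  qed
  have L: "a x \<longlonglongrightarrow> hh (Aff x)" for x unfolding hA using conv convergent_LIMSEQ_iff by blast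
  have f: "hh (Aff (poly P x)) = real d * hh (Aff x)" for x
  proof -
    have "a (poly P x) = (\<lambda>n. real d * a x (Suc n))"
      using d2 by (intro HOL.ext) (simp add: a_def funpow_swap1)
    hence "(\<lambda>n. real d * a x (Suc n)) \<longlonglongrightarrow> hh (Aff (poly P x))" using L[of "poly P x"] by simp
    moreover have "(\<lambda>n. real d * a x (Suc n)) \<longlonglongrightarrow> real d * hh (Aff x)"
      by (intro tendsto_mult_left LIMSEQ_Suc L)
    ultimately show ?thesis by (rule LIMSEQ_unique)
  qed
  show ?thesis
  proof (rule that[OF B(1)])
    show "\<bar>hh (Aff x) - hgt x\<bar> \<le> B" for x using near[of x] by (simp add: hA a_def)
    show "hh (poly_proj_map \<phi> Q) = real d * hh Q" for Q
      by (cases Q) (auto simp: f P_def[symmetric] hh_def[of Infty])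
    show "hh Q \<ge> 0" for Q
    proof (cases Q)
      case (Aff x)
      have "a x n \<ge> 0" for n unfolding a_def using hgt_nonneg by simp
      thus ?thesis using LIMSEQ_le_const[OF L[of x]] Aff by auto
    qed (simp add: hh_def)
  qed
qed

text \<open>Uniqueness: two candidates differ by a bounded function that the map multiplies by
  \<open>d\<close>, so their difference vanishes.\<close>

theorem canonical_height_eq: "canonical_height \<phi> = hh"
proof -
  obtain B where B: "B \<ge> 0" "\<And>x. \<bar>hh (Aff x) - hgt x\<bar> \<le> B"
    "\<And>Q. hh (poly_proj_map \<phi> Q) = real d * hh Q" "\<And>Q. hh Q \<ge> 0" using hh_props by blast
  have d2: "real d \<ge> 2" using deg by simp
  have near: "\<bar>hh Q - std_height Q\<bar> \<le> B" for Q
    using B(1,2) by (cases Q) (auto simp: std_height_eq hh_def[of Infty] simp del: std_height.simps(1))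
  show ?thesis unfolding canonical_height_def
  proof (rule the_equality)
    show "weil_height_O1 hh \<and> (\<forall>Q. hh (poly_proj_map \<phi> Q) = real d * hh Q)"
      using near B(3) by (auto simp: weil_height_O1_def)
    fix h assume h: "weil_height_O1 h \<and> (\<forall>Q. h (poly_proj_map \<phi> Q) = real d * h Q)"
    then obtain B' where B': "\<And>Q. \<bar>h Q - std_height Q\<bar> \<le> B'" by (auto simp: weil_height_O1_def)
    show "h = hh"
    proof (rule HOL.ext, rule ccontr)
      fix Q assume ne: "h Q \<noteq> hh Q"
      define e where "e = \<bar>h Q - hh Q\<bar>"
      have e: "e > 0" using ne by (simp add: e_def)
      have it: "h ((poly_proj_map \<phi> ^^ n) Q) - hh ((poly_proj_map \<phi> ^^ n) Q) = real d ^ n * (h Q - hh Q)" for n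
      proof (induction n)
        case (Suc n)
        let ?R = "(poly_proj_map \<phi> ^^ n) Q"
        have "h (poly_proj_map \<phi> ?R) - hh (poly_proj_map \<phi> ?R) = real d * (h ?R - hh ?R)"
          using h B(3) by (simp add: right_diff_distrib)
        thus ?case using Suc by simp
      qed simp
      have "real d ^ n * e \<le> B + B'" for n
      proof -
        let ?R = "(poly_proj_map \<phi> ^^ n) Q"
        have "real d ^ n * e = \<bar>h ?R - hh ?R\<bar>" by (simp add: it e_def abs_mult)
        also have "\<dots> \<le> B + B'" using B'[of ?R] near[of ?R] by linarith
        finally show ?thesis .
      qed
      moreover obtain n where "(B + B') / e < real d ^ n" using real_arch_pow[of "real d"] d2 by auto
      ultimately show False using e by (metis divide_less_eq not_less mult.commute)
    qed
  qed
qed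

end

section \<open>Discriminant bounds\<close>

fun iter_poly :: "'a::Fields.field poly \<Rightarrow> nat \<Rightarrow> 'a poly" where
  "iter_poly f 0 = [:0, 1:]"
| "iter_poly f (Suc k) = pcompose f (iter_poly f k)"

lemma poly_iter_poly: "poly (iter_poly f k) x = (poly f ^^ k) x"
  by (induction k) (auto simp: poly_pcompose)

lemma degree_iter_poly: "degree (iter_poly f k) = degree f ^ k"
  by (induction k) (auto simp: degree_pcompose)

lemma lead_coeff_iter_poly:
  "degree f > 0 \<Longrightarrow> lead_coeff (iter_poly f (Suc k)) = lead_coeff f * lead_coeff (iter_poly f k) ^ degree f"
  by (simp add: lead_coeff_comp degree_iter_poly del: iter_poly.simps(1))

lemma map_iter_poly: "field_hom g \<Longrightarrow> map_poly g (iter_poly f k) = iter_poly (map_poly g f) k"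
proof (induction k)
  case 0
  thus ?case by (simp add: map_poly_pCons field_hom_0 field_hom_1)
next
  case (Suc k)
  have "map_poly g (pcompose p q) = pcompose (map_poly g p) (map_poly g q)" for p q
    using Suc.prems
    by (induction p) (auto simp: pcompose_pCons map_poly_pCons field_hom_0 field_hom_map_poly_add field_hom_map_poly_mult)
  thus ?case using Suc by simp
qed

text \<open>The total exponent with which the leading coefficient of \<Psi> enters the basis
  polynomials of degrees below \<open>N\<close>; it is about \<open>N^2 / (2 D)\<close>.\<close>

definition floor_sum :: "nat \<Rightarrow> nat \<Rightarrow> nat" where
  "floor_sum D N = (\<Sum>m<N. m div D)"

lemma floor_sum_bounds:
  assumes D: "D \<ge> 1"
  shows "2 * real D * real (floor_sum D N) \<le> real N ^ 2"
    "2 * real D * real (floor_sum D N) \<ge> real N ^ 2 - 3 * real D * real N"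
proof -
  have "(\<Sum>m<N. m) = D * floor_sum D N + (\<Sum>m<N. m mod D)"
    unfolding floor_sum_def sum_distrib_left sum.distrib[symmetric] by simp
  from arg_cong[OF this, of real]
  have "(\<Sum>m<N. real m) = real D * real (floor_sum D N) + (\<Sum>m<N. real (m mod D))"
    by (simp only: of_nat_sum of_nat_add of_nat_mult)
  hence eq: "2 * (\<Sum>m<N. real m) = 2 * real D * real (floor_sum D N) + 2 * (\<Sum>m<N. real (m mod D))" by simp
  have g: "2 * (\<Sum>m<N. real m) = real N ^ 2 - real N"
    by (induction N) (auto simp: power2_eq_square algebra_simps)
  have "(\<Sum>m<N. real (m mod D)) \<le> (\<Sum>m<N. real D)" using D by (intro sum_mono) (simp add: less_imp_le)
  hence m: "(\<Sum>m<N. real (m mod D)) \<le> real D * real N" by (simp add: mult.commute)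
  have m0: "(\<Sum>m<N. real (m mod D)) \<ge> 0" by (intro sum_nonneg) auto
  show "2 * real D * real (floor_sum D N) \<le> real N ^ 2" using eq g m0 by simp
  have "real N \<le> real D * real N" using D mult_right_mono[of 1 "real D" "real N"] by simp
  thus "2 * real D * real (floor_sum D N) \<ge> real N ^ 2 - 3 * real D * real N" using eq g m by simp
qed

text \<open>Used with \<open>t\<close> the logarithmic capacity: the leading coefficient of an
  iterate of degree \<open>D\<close> has logarithm \<open>- (D - 1) * t\<close>, so its total
  contribution is \<open>- t * N^2\<close> up to an error linear in \<open>N\<close> and one of
  order \<open>N^2 / D\<close>.\<close>

lemma floor_sum_scaled:
  assumes D: "D \<ge> 1"
  shows "\<bar>2 * (real D - 1) * t * real (floor_sum D N) - t * real N ^ 2\<bar> \<le> \<bar>t\<bar> * (3 * real D * real N + real N ^ 2 / real D)"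
proof -
  let ?E = "real (floor_sum D N)"
  note b = floor_sum_bounds[OF D, of N]
  have "2 * ?E \<le> real N ^ 2 / real D" using b(1) D by (simp add: field_simps)
  hence "\<bar>2 * (real D - 1) * ?E - real N ^ 2\<bar> \<le> 3 * real D * real N + real N ^ 2 / real D"
    using b by (simp add: abs_le_iff algebra_simps)
  hence "\<bar>t\<bar> * \<bar>2 * (real D - 1) * ?E - real N ^ 2\<bar> \<le> \<bar>t\<bar> * (3 * real D * real N + real N ^ 2 / real D)"
    by (intro mult_left_mono) auto
  thus ?thesis by (simp add: abs_mult[symmetric] algebra_simps)
qed

context absval
begin

text \<open>Division with remainder in the exponent gives one polynomial in each degree. The last
  bound is uniform in \<open>m\<close>, in the form that the argument \<open>u\<close> of
  \<open>dsc_bound\<close> requires.\<close>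

lemma basis_poly:
  fixes \<Psi> :: "'a poly"
  assumes D: "degree \<Psi> = D" "D \<ge> 1"
  defines "B \<equiv> (\<lambda>m. monom 1 (m mod D) * \<Psi> ^ (m div D))"
  shows "degree (B m) \<le> m" "coeff (B m) m = lead_coeff \<Psi> ^ (m div D)"
    "m < N \<Longrightarrow> nv (poly (B m) x) \<le> max 1 (nv x) ^ D * max 1 (nv (poly \<Psi> x)) ^ (N div D)"
proof -
  have P0: "\<Psi> \<noteq> 0" using D by auto
  have dB: "degree (B m) = m"
    unfolding B_def using P0 D by (subst degree_mult_eq) (auto simp: degree_power_eq degree_monom_eq mult.commute)
  show "degree (B m) \<le> m" using dB by simp
  have "coeff (B m) m = lead_coeff (B m)" using dB by simp
  also have "\<dots> = lead_coeff \<Psi> ^ (m div D)" unfolding B_def lead_coeff_mult lead_coeff_power by (simp add: degree_monom_eq)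
  finally show "coeff (B m) m = lead_coeff \<Psi> ^ (m div D)" .
  assume m: "m < N"
  have "nv (poly (B m) x) = nv x ^ (m mod D) * nv (poly \<Psi> x) ^ (m div D)"
    by (simp add: B_def poly_monom nv_mult nv_power)
  also have "\<dots> \<le> max 1 (nv x) ^ D * max 1 (nv (poly \<Psi> x)) ^ (N div D)"
  proof (rule mult_mono)
    have "nv x ^ (m mod D) \<le> max 1 (nv x) ^ (m mod D)" using nv_nonneg by (intro power_mono) auto
    also have "\<dots> \<le> max 1 (nv x) ^ D" using D(2) by (intro power_increasing) (auto simp: less_imp_le)
    finally show "nv x ^ (m mod D) \<le> max 1 (nv x) ^ D" .
    have "nv (poly \<Psi> x) ^ (m div D) \<le> max 1 (nv (poly \<Psi> x)) ^ (m div D)" using nv_nonneg by (intro power_mono) auto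
    also have "\<dots> \<le> max 1 (nv (poly \<Psi> x)) ^ (N div D)" using m by (intro power_increasing) (auto intro: div_le_mono)
    finally show "nv (poly \<Psi> x) ^ (m div D) \<le> max 1 (nv (poly \<Psi> x)) ^ (N div D)" .
  qed (use nv_nonneg in auto)
  finally show "nv (poly (B m) x) \<le> max 1 (nv x) ^ D * max 1 (nv (poly \<Psi> x)) ^ (N div D)" .
qed

text \<open>The logarithmic form common to both cases: \<open>K\<close> is \<open>fact N\<close> for
  a general absolute value and 1 for an ultrametric one.\<close>

lemma ln_dsc_bound_gen:
  fixes \<Psi> :: "'a poly"
  assumes D: "degree \<Psi> = D" "D \<ge> 1" and S: "finite S" "card S = N"
    and K: "K > 0" "(\<Prod>m<N. nv (lead_coeff \<Psi> ^ (m div D)))\<^sup>2 * nv (dsc S) \<le>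
      K\<^sup>2 * (\<Prod>x\<in>S. max 1 (nv x) ^ D * max 1 (nv (poly \<Psi> x)) ^ (N div D))\<^sup>2"
  shows "2 * real (floor_sum D N) * ln (nv (lead_coeff \<Psi>)) + ln (nv (dsc S)) \<le>
    2 * ln K + 2 * real D * (\<Sum>x\<in>S. lnp (nv x)) + 2 * (real N / real D) * (\<Sum>x\<in>S. lnp (nv (poly \<Psi> x)))"
proof -
  let ?l = "nv (lead_coeff \<Psi>)"
  have l0: "?l > 0" using D by (intro nv_pos) auto
  have d0: "nv (dsc S) > 0" using dsc_nonzero[OF S(1)] by (rule nv_pos)
  have pr: "(\<Prod>m<N. nv (lead_coeff \<Psi> ^ (m div D))) = ?l ^ floor_sum D N"
    unfolding floor_sum_def by (simp add: nv_power power_sum)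
  have q0: "max 1 (nv x) ^ D * max 1 (nv (poly \<Psi> x)) ^ (N div D) > 0" for x
    by (intro mult_pos_pos zero_less_power) (auto simp: less_max_iff_disj)
  let ?R = "\<Prod>x\<in>S. max 1 (nv x) ^ D * max 1 (nv (poly \<Psi> x)) ^ (N div D)"
  have R0: "?R > 0" using q0 by (intro prod_pos) auto
  have "ln ((?l ^ floor_sum D N)\<^sup>2 * nv (dsc S)) \<le> ln (K\<^sup>2 * ?R\<^sup>2)"
    using K(2) l0 d0 K(1) R0 unfolding pr by (subst ln_le_cancel_iff) auto
  also have "ln (K\<^sup>2 * ?R\<^sup>2) = 2 * ln K + 2 * ln ?R"
    using K(1) R0 by (subst ln_mult_pos) (auto simp: ln_realpow)
  also have "ln ?R = (\<Sum>x\<in>S. real D * lnp (nv x) + real (N div D) * lnp (nv (poly \<Psi> x)))"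
  proof -
    have "ln ?R = (\<Sum>x\<in>S. ln (max 1 (nv x) ^ D * max 1 (nv (poly \<Psi> x)) ^ (N div D)))"
      using S(1) q0 by (subst ln_prod) (auto simp: order_less_imp_not_eq2)
    also have "\<dots> = (\<Sum>x\<in>S. real D * lnp (nv x) + real (N div D) * lnp (nv (poly \<Psi> x)))"
    proof (rule sum.cong)
      fix x
      have "ln (max 1 (nv x) ^ D * max 1 (nv (poly \<Psi> x)) ^ (N div D)) = ln (max 1 (nv x) ^ D) + ln (max 1 (nv (poly \<Psi> x)) ^ (N div D))"
        by (intro ln_mult_pos zero_less_power) (auto simp: less_max_iff_disj)
      thus "ln (max 1 (nv x) ^ D * max 1 (nv (poly \<Psi> x)) ^ (N div D)) = real D * lnp (nv x) + real (N div D) * lnp (nv (poly \<Psi> x))"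
        by (simp only: ln_realpow lnp_def)
    qed simp
    finally show ?thesis .
  qed
  also have "\<dots> = real D * (\<Sum>x\<in>S. lnp (nv x)) + real (N div D) * (\<Sum>x\<in>S. lnp (nv (poly \<Psi> x)))"
    by (simp add: sum.distrib sum_distrib_left)
  also have "ln ((?l ^ floor_sum D N)\<^sup>2 * nv (dsc S)) = 2 * (real (floor_sum D N) * ln ?l) + ln (nv (dsc S))"
    using l0 d0 by (subst ln_mult_pos) (auto simp: ln_realpow)
  finally have 1: "2 * (real (floor_sum D N) * ln ?l) + ln (nv (dsc S)) \<le>
    2 * ln K + 2 * (real D * (\<Sum>x\<in>S. lnp (nv x)) + real (N div D) * (\<Sum>x\<in>S. lnp (nv (poly \<Psi> x))))" .
  have "real (N div D) \<le> real N / real D" by (rule of_nat_div_le_of_nat)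
  hence "real (N div D) * (\<Sum>x\<in>S. lnp (nv (poly \<Psi> x))) \<le> (real N / real D) * (\<Sum>x\<in>S. lnp (nv (poly \<Psi> x)))"
    by (intro mult_right_mono sum_nonneg lnp_nonneg)
  thus ?thesis using 1 by (simp only: mult.assoc distrib_left)
qed

lemma ln_dsc_bound:
  fixes \<Psi> :: "'a poly"
  assumes D: "degree \<Psi> = D" "D \<ge> 1" and S: "finite S" "card S = N"
  shows "2 * real (floor_sum D N) * ln (nv (lead_coeff \<Psi>)) + ln (nv (dsc S)) \<le>
    2 * ln (fact N) + 2 * real D * (\<Sum>x\<in>S. lnp (nv x)) + 2 * (real N / real D) * (\<Sum>x\<in>S. lnp (nv (poly \<Psi> x)))"
proof (rule ln_dsc_bound_gen[OF assms])
  have "(\<Prod>m<N. nv (coeff (monom 1 (m mod D) * \<Psi> ^ (m div D)) m))\<^sup>2 * nv (dsc S) \<le>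
      (fact N)\<^sup>2 * (\<Prod>x\<in>S. max 1 (nv x) ^ D * max 1 (nv (poly \<Psi> x)) ^ (N div D))\<^sup>2"
    by (rule dsc_bound[OF S]) (use basis_poly[OF D] in auto)
  thus "(\<Prod>m<N. nv (lead_coeff \<Psi> ^ (m div D)))\<^sup>2 * nv (dsc S) \<le>
      (fact N)\<^sup>2 * (\<Prod>x\<in>S. max 1 (nv x) ^ D * max 1 (nv (poly \<Psi> x)) ^ (N div D))\<^sup>2"
    by (simp only: basis_poly(2)[OF D])
qed simp

end

lemma (in ultra_absval) ln_dsc_bound_ultra:
  fixes \<Psi> :: "'a poly"
  assumes D: "degree \<Psi> = D" "D \<ge> 1" and S: "finite S" "card S = N"
  shows "2 * real (floor_sum D N) * ln (nv (lead_coeff \<Psi>)) + ln (nv (dsc S)) \<le>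
    2 * real D * (\<Sum>x\<in>S. lnp (nv x)) + 2 * (real N / real D) * (\<Sum>x\<in>S. lnp (nv (poly \<Psi> x)))"
proof -
  have "(\<Prod>m<N. nv (coeff (monom 1 (m mod D) * \<Psi> ^ (m div D)) m))\<^sup>2 * nv (dsc S) \<le>
      (\<Prod>x\<in>S. max 1 (nv x) ^ D * max 1 (nv (poly \<Psi> x)) ^ (N div D))\<^sup>2"
    by (rule dsc_bound_ultra[OF S]) (use basis_poly[OF D] in auto)
  hence "(\<Prod>m<N. nv (lead_coeff \<Psi> ^ (m div D)))\<^sup>2 * nv (dsc S) \<le>
      1\<^sup>2 * (\<Prod>x\<in>S. max 1 (nv x) ^ D * max 1 (nv (poly \<Psi> x)) ^ (N div D))\<^sup>2"
    by (simp only: basis_poly(2)[OF D] power_one mult_1_left)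
  from ln_dsc_bound_gen[OF D S _ this] show ?thesis by simp
qed

lemma dsc_union:
  assumes "finite T" "finite S" "S \<inter> T = {}"
  shows "dsc (S \<union> T) = dsc S * dsc T * (\<Prod>t\<in>T. \<Prod>x\<in>S. (t - x) * (x - t))"
  using assms
proof (induction T rule: finite_induct)
  case empty
  show ?case by (simp add: dsc_def)
next
  case (insert t T)
  have "S \<union> insert t T = insert t (S \<union> T)" by auto
  moreover have "t \<notin> S \<union> T" using insert by auto
  ultimately have "dsc (S \<union> insert t T) = dsc (S \<union> T) * (\<Prod>y\<in>S \<union> T. t - y) * (\<Prod>y\<in>S \<union> T. y - t)"
    using insert by (simp add: dsc_insert)
  also have "(\<Prod>y\<in>S \<union> T. t - y) = (\<Prod>y\<in>S. t - y) * (\<Prod>y\<in>T. t - y)"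
    using insert by (intro prod.union_disjoint) auto
  also have "(\<Prod>y\<in>S \<union> T. y - t) = (\<Prod>y\<in>S. y - t) * (\<Prod>y\<in>T. y - t)"
    using insert by (intro prod.union_disjoint) auto
  also have "dsc (S \<union> T) = dsc S * dsc T * (\<Prod>t\<in>T. \<Prod>x\<in>S. (t - x) * (x - t))" using insert by auto
  finally show ?case using insert by (simp add: dsc_insert prod.distrib mult_ac)
qed

section \<open>The local saving at a place with a ramified fixed point\<close>

lemma (in absval) ln_dsc_pos: "finite S \<Longrightarrow> nv (dsc S) > 0"
  using dsc_nonzero nv_pos by blast

context padic_absval
begin

text \<open>Legendre's recursion with \<open>k = n div p\<close>: the multiples of \<open>p\<close>
  contribute \<open>k\<close> factors \<open>p\<close> and the factorial of \<open>k\<close>, which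
  by induction gives at most \<open>2 * k\<close> factors, and \<open>2 * k\<close> is at most
  \<open>n\<close>.\<close>

lemma nv_fact_ge: "nv (of_nat (fact n)) \<ge> 1 / real p ^ n"
proof (induction n rule: less_induct)
  case (less n)
  show ?case
  proof (cases "n = 0")
    case False
    let ?k = "n div p"
    have p2: "p \<ge> 2" using prime_ge_2_nat[OF p_prime] .
    have k: "?k < n" "2 * ?k \<le> n"
    proof -
      show "?k < n" using False p2 by (intro div_less_dividend) auto
      have "2 * ?k \<le> p * ?k" using p2 by (rule mult_le_mono1)
      also have "\<dots> \<le> n" by (rule times_div_less_eq_dividend)
      finally show "2 * ?k \<le> n" .
    qed
    have "nv (of_nat (fact n)) = (\<Prod>j\<in>{1..n}. nv (of_nat j))"
      unfolding fact_prod by (simp add: nv_prod)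
    also have "\<dots> = (\<Prod>j\<in>{j\<in>{1..n}. p dvd j}. nv (of_nat j))"
    proof (rule prod.mono_neutral_right)
      show "\<forall>i\<in>{1..n} - {j \<in> {1..n}. p dvd j}. nv (of_nat i) = 1"
      proof
        fix i assume "i \<in> {1..n} - {j \<in> {1..n}. p dvd j}"
        hence "\<not> int p dvd int i" by auto
        from nv_of_int_unit[OF this] show "nv (of_nat i) = 1" by simp
      qed
    qed auto
    also have "{j\<in>{1..n}. p dvd j} = (\<lambda>i. p * i) ` {1..?k}"
    proof (intro equalityI subsetI)
      fix j assume "j \<in> {j\<in>{1..n}. p dvd j}"
      then obtain i where i: "j = p * i" "1 \<le> j" "j \<le> n" by auto
      hence "i \<ge> 1" by (cases i) auto
      moreover have "i \<le> ?k" using i p2 by (simp add: less_eq_div_iff_mult_less_eq mult.commute)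
      ultimately show "j \<in> (\<lambda>i. p * i) ` {1..?k}" using i by auto
    next
      fix j assume "j \<in> (\<lambda>i. p * i) ` {1..?k}"
      then obtain i where "j = p * i" "i \<in> {1..?k}" by (rule imageE)
      hence i: "j = p * i" "1 \<le> i" "i \<le> ?k" by simp_all
      hence "p * i \<le> n" using p2 by (simp add: less_eq_div_iff_mult_less_eq mult.commute)
      thus "j \<in> {j\<in>{1..n}. p dvd j}" using i p2 by auto
    qed
    also have "(\<Prod>j\<in>(\<lambda>i. p * i) ` {1..?k}. nv (of_nat j)) = (\<Prod>i\<in>{1..?k}. nv (of_nat (p * i)))"
      using p2 by (subst prod.reindex) (auto simp: inj_on_def)
    also have "\<dots> = (\<Prod>i\<in>{1..?k}. 1 / real p * nv (of_nat i))" by (simp add: nv_mult nv_p)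
    also have "\<dots> = (1 / real p) ^ ?k * nv (of_nat (fact ?k))"
      unfolding prod.distrib fact_prod by (simp add: nv_prod)
    also have "\<dots> \<ge> (1 / real p) ^ ?k * (1 / real p ^ ?k)" by (intro mult_left_mono less.IH k) auto
    finally have "nv (of_nat (fact n)) \<ge> 1 / real p ^ (2 * ?k)"
      by (simp add: power_one_over power_add[symmetric] mult_2)
    moreover have "1 / real p ^ n \<le> 1 / real p ^ (2 * ?k)"
      using p_gt_1 k by (intro divide_left_mono power_increasing) auto
    ultimately show ?thesis by linarith
  qed simp
qed

text \<open>Differences are a fixed power of \<open>p\<close> times integers, so the discriminant is
  built from factorials, and \<open>nv_fact_ge\<close> keeps its logarithm above a multiple of
  \<open>- M^2\<close> that depends on \<open>s\<close> only.\<close>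

lemma arithmetic_progression:
  defines "T \<equiv> (\<lambda>a s M. (\<lambda>j. a + of_nat p ^ s * of_nat j) ` {..<M})"
  shows "finite (T a s M)" "card (T a s M) = M"
    "ln (nv (dsc (T a s M))) \<ge> - ((real s + 1) * ln (real p)) * (real M)\<^sup>2"
proof -
  have p0: "(of_nat p :: 'a) ^ s \<noteq> 0" using p_prime by (simp add: prime_gt_0_nat)
  have inj: "inj_on (\<lambda>j. a + of_nat p ^ s * of_nat j) A" for A :: "nat set"
    using p0 by (auto simp: inj_on_def)
  show fT: "finite (T a s M)" for M by (simp add: T_def)
  show "card (T a s M) = M" unfolding T_def using card_image[OF inj] by simp
  let ?c = "(real s + 1) * ln (real p)"
  have c0: "?c \<ge> 0" using p_gt_1 by simp
  show "ln (nv (dsc (T a s M))) \<ge> - ?c * (real M)\<^sup>2"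
  proof (induction M)
    case 0
    show ?case by (simp add: T_def dsc_def)
  next
    case (Suc M)
    let ?t = "a + of_nat p ^ s * of_nat M"
    have nT: "?t \<notin> T a s M" using p0 by (auto simp: T_def)
    have TS: "T a s (Suc M) = insert ?t (T a s M)" by (auto simp: T_def lessThan_Suc)
    have pr: "(\<Prod>y\<in>T a s M. ?t - y) = (of_nat p ^ s) ^ M * of_nat (fact M)"
    proof -
      have "(\<Prod>y\<in>T a s M. ?t - y) = (\<Prod>j<M. of_nat p ^ s * of_nat (M - j))"
        unfolding T_def by (subst prod.reindex[OF inj]) (auto simp: of_nat_diff algebra_simps intro!: prod.cong)
      also have "\<dots> = (of_nat p ^ s) ^ M * of_nat (\<Prod>j<M. M - j)" by (simp add: prod.distrib)
      also have "(\<Prod>j<M. M - j) = fact M" by (simp add: fact_prod_rev atLeast0LessThan)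
      finally show ?thesis .
    qed
    define r where "r = nv (\<Prod>y\<in>T a s M. ?t - y)"
    have re: "r = (1 / real p ^ s) ^ M * nv (of_nat (fact M))"
      unfolding r_def pr nv_mult nv_power[of "of_nat p ^ s"] nv_p_power ..
    have r0: "r > 0" unfolding re using p_gt_1 by (intro mult_pos_pos zero_less_power nv_pos) auto
    have "ln r \<ge> - real M * ?c"
    proof -
      have "(1 / real p ^ s) ^ M * (1 / real p ^ M) \<le> r" unfolding re using nv_fact_ge by (intro mult_left_mono) auto
      moreover have "(1 / real p ^ s) ^ M * (1 / real p ^ M) = 1 / real p ^ ((s + 1) * M)"
        by (simp add: power_one_over power_mult[symmetric] power_add add_mult_distrib)
      ultimately have "1 / real p ^ ((s + 1) * M) \<le> r" by simp
      hence "ln (1 / real p ^ ((s + 1) * M)) \<le> ln r" using p_gt_1 r0 by (subst ln_le_cancel_iff) auto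
      moreover have "ln (1 / real p ^ ((s + 1) * M)) = - real M * ?c"
        using p_gt_1 by (simp add: ln_div ln_realpow algebra_simps)
      ultimately show ?thesis by simp
    qed
    moreover have "nv (dsc (T a s (Suc M))) = nv (dsc (T a s M)) * r\<^sup>2"
    proof -
      have "nv (\<Prod>y\<in>T a s M. y - ?t) = r" unfolding r_def nv_prod by (intro prod.cong nv_diff_commute) simp
      thus ?thesis unfolding TS dsc_insert[OF fT nT] nv_mult by (simp add: r_def power2_eq_square)
    qed
    moreover have "ln (nv (dsc (T a s M)) * r\<^sup>2) = ln (nv (dsc (T a s M))) + 2 * ln r"
      using r0 ln_dsc_pos[OF fT] by (subst ln_mult_pos) (auto simp: ln_realpow)
    ultimately have "ln (nv (dsc (T a s (Suc M)))) \<ge> - ?c * (real M)\<^sup>2 - 2 * (real M * ?c)" using Suc by simp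
    also have "- ?c * (real M)\<^sup>2 - 2 * (real M * ?c) = - ?c * (real (Suc M))\<^sup>2 + ?c"
      by (simp add: power2_eq_square algebra_simps)
    finally show ?case using c0 by linarith
  qed
qed

end

context ultra_absval
begin

lemma poly_continuous_at_fixed_point:
  assumes fp: "poly P \<alpha> = \<alpha>" and e: "e > 0"
  shows "\<exists>\<delta>>0. \<forall>t. nv (t - \<alpha>) \<le> \<delta> \<longrightarrow> nv (poly P t - \<alpha>) \<le> e"
proof -
  define Q where "Q = synthetic_div P \<alpha>"
  have PQ: "poly P t - \<alpha> = (t - \<alpha>) * poly Q t" for t
  proof -
    have "poly ([:- \<alpha>, 1:] * Q + [:poly P \<alpha>:]) t = poly P t" unfolding Q_def synthetic_div_correct' ..
    thus ?thesis using fp by (simp add: algebra_simps)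
  qed
  define C where "C = 1 + (\<Sum>i\<le>degree Q. nv (coeff Q i) * (nv \<alpha> + 1) ^ i)"
  have C: "C > 0" unfolding C_def
    by (intro add_pos_nonneg sum_nonneg mult_nonneg_nonneg zero_le_power) (auto simp: nv_nonneg)
  have "nv (poly P t - \<alpha>) \<le> e" if t: "nv (t - \<alpha>) \<le> min 1 (e / C)" for t
  proof -
    have "nv t \<le> nv \<alpha> + 1" using nv_triangle[of "t - \<alpha>" \<alpha>] t by simp
    have "nv (poly Q t) \<le> (\<Sum>i\<le>degree Q. nv (coeff Q i * t ^ i))" unfolding poly_altdef by (rule nv_sum_le)
    also have "\<dots> \<le> (\<Sum>i\<le>degree Q. nv (coeff Q i) * (nv \<alpha> + 1) ^ i)"
      unfolding nv_mult nv_power using \<open>nv t \<le> nv \<alpha> + 1\<close> by (intro sum_mono mult_left_mono power_mono nv_nonneg)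
    also have "\<dots> \<le> C" by (simp add: C_def)
    finally have "nv (poly Q t) \<le> C" .
    hence "nv (t - \<alpha>) * nv (poly Q t) \<le> (e / C) * C" using t C e by (intro mult_mono nv_nonneg) auto
    thus ?thesis using C by (simp add: PQ nv_mult)
  qed
  thus ?thesis using C e by (intro exI[of _ "min 1 (e / C)"]) auto
qed

lemma iterate_continuous_at_fixed_point:
  assumes fp: "poly P \<alpha> = \<alpha>"
  shows "e > 0 \<Longrightarrow> \<exists>\<delta>>0. \<forall>t. nv (t - \<alpha>) \<le> \<delta> \<longrightarrow> nv ((poly P ^^ k) t - \<alpha>) \<le> e"
proof (induction k arbitrary: e)
  case (Suc k)
  obtain \<delta>1 where d1: "\<delta>1 > 0" "\<forall>t. nv (t - \<alpha>) \<le> \<delta>1 \<longrightarrow> nv (poly P t - \<alpha>) \<le> e"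
    using poly_continuous_at_fixed_point[OF fp Suc.prems] by blast
  obtain \<delta> where "\<delta> > 0" "\<forall>t. nv (t - \<alpha>) \<le> \<delta> \<longrightarrow> nv ((poly P ^^ k) t - \<alpha>) \<le> \<delta>1"
    using Suc.IH[OF d1(1)] by blast
  thus ?case using d1(2) by auto
qed auto

lemma lnp_iterate_le:
  assumes d: "degree P \<ge> 2" and c: "c \<ge> 0" "\<And>x. lnp (nv (poly P x)) \<le> real (degree P) * lnp (nv x) + c"
  shows "lnp (nv ((poly P ^^ j) y)) \<le> real (degree P) ^ j * (lnp (nv y) + c) - c"
proof (induction j)
  case (Suc j)
  let ?d = "real (degree P)"
  have "lnp (nv ((poly P ^^ Suc j) y)) \<le> ?d * lnp (nv ((poly P ^^ j) y)) + c" using c(2) by simp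
  also have "\<dots> \<le> ?d * (?d ^ j * (lnp (nv y) + c) - c) + c" using Suc by (intro add_right_mono mult_left_mono) auto
  also have "\<dots> = ?d ^ Suc j * (lnp (nv y) + c) - (?d - 1) * c" by (simp add: algebra_simps)
  also have "\<dots> \<le> ?d ^ Suc j * (lnp (nv y) + c) - 1 * c" using d c(1) by (intro diff_left_mono mult_right_mono) auto
  finally show ?case by simp
qed simp

text \<open>The leading coefficient of the iterate is that of \<open>P\<close> to the power
  \<open>1 + d + ... + d ^ (k - 1)\<close>; hence \<open>lam\<close> is the same for all
  \<open>k\<close>.\<close>

lemma ln_nv_lead_iter_poly:
  assumes d: "degree P \<ge> 2"
  defines "lam \<equiv> - ln (nv (lead_coeff P)) / (real (degree P) - 1)"
  shows "ln (nv (lead_coeff (iter_poly P k))) = - (real (degree P) ^ k - 1) * lam"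
proof (induction k)
  case (Suc k)
  have P0: "lead_coeff P \<noteq> 0" using d by auto
  have Q0: "lead_coeff (iter_poly P k) \<noteq> 0" using d degree_iter_poly[of P k]
    by (metis leading_coeff_0_iff degree_0 power_eq_0_iff not_numeral_le_zero iter_poly.simps(1) one_neq_zero pCons_eq_0_iff power_0 neq0_conv)
  have l: "ln (nv (lead_coeff P)) = - (real (degree P) - 1) * lam" using d by (simp add: lam_def field_simps)
  have "ln (nv (lead_coeff (iter_poly P (Suc k)))) = ln (nv (lead_coeff P)) + real (degree P) * ln (nv (lead_coeff (iter_poly P k)))"
  proof -
    have "lead_coeff (iter_poly P (Suc k)) = lead_coeff P * lead_coeff (iter_poly P k) ^ degree P"
      by (rule lead_coeff_iter_poly) (use d in simp)
    hence "nv (lead_coeff (iter_poly P (Suc k))) = nv (lead_coeff P) * nv (lead_coeff (iter_poly P k)) ^ degree P"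
      by (simp only: nv_mult nv_power)
    moreover have "nv (lead_coeff P) > 0" "nv (lead_coeff (iter_poly P k)) ^ degree P > 0"
      using nv_pos[OF P0] nv_pos[OF Q0] by auto
    ultimately show ?thesis by (simp only: ln_mult_pos ln_realpow)
  qed
  thus ?case unfolding Suc l by (simp add: algebra_simps)
qed simp

end

text \<open>Two points of \<open>A\<close>, the part of \<open>S\<close> well inside the circle
  through \<alpha>, are closer by a factor \<open>exp (- \<gamma>)\<close> than points at radius
  \<open>nv \<alpha>\<close> need be. Points outside the circle are paid for by the excess
  \<open>l\<close>. The hypothesis \<open>few\<close> makes this excess small and so forces
  \<open>A\<close> to contain most of \<open>S\<close>.\<close>

lemma (in padic_absval) close_saving:
  fixes \<alpha> :: 'a and S :: "'a set"
  assumes a0: "\<alpha> \<noteq> 0" and S: "finite S" "card S = N" and g: "\<gamma> > 0"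
    and avoid: "\<And>x. x \<in> S \<Longrightarrow> x = 0 \<or> \<bar>ln (nv x) - ln (nv \<alpha>)\<bar> \<ge> \<gamma>"
    and few: "(\<Sum>x\<in>S. ln (max (nv \<alpha>) (nv x)) - ln (nv \<alpha>)) \<le> \<gamma> / 16 * N"
  shows "ln (nv (dsc S)) \<le> ln (nv \<alpha>) * (real N)\<^sup>2 - \<gamma> / 8 * (real N)\<^sup>2 + real N * (\<bar>ln (nv \<alpha>)\<bar> + \<gamma>)"
proof -
  define mu where "mu = ln (nv \<alpha>)"
  define l where "l x = ln (max (nv \<alpha>) (nv x)) - mu" for x
  have na: "nv \<alpha> > 0" by (rule nv_pos[OF a0])
  have l0: "l x \<ge> 0" for x unfolding l_def mu_def using na by simp
  define A where "A = {x \<in> S. x = 0 \<or> ln (nv x) \<le> mu - \<gamma>}"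
  have A: "A \<subseteq> S" "finite A" using S by (auto simp: A_def)
  define i where "i x = (if x \<in> A then 1 else (0::real))" for x
  have pair: "ln (nv (x - y)) \<le> mu + l x + l y - \<gamma> * i x * i y" if xy: "x \<in> S" "y \<in> S" "x \<noteq> y" for x y
  proof -
    have xy0: "nv (x - y) > 0" using xy by (intro nv_pos) simp
    show ?thesis
    proof (cases "x \<in> A \<and> y \<in> A")
      case True
      have le: "nv z \<le> exp (mu - \<gamma>)" if "z \<in> A" for z
      proof (cases "z = 0")
        case False
        hence "ln (nv z) \<le> mu - \<gamma>" using that by (simp add: A_def)
        thus ?thesis using nv_pos[OF False] by (metis exp_le_cancel_iff exp_ln)
      qed simp
      have "nv (x - y) \<le> exp (mu - \<gamma>)" using nv_ultra_diff[of x y] le True by (meson max.bounded_iff order_trans)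
      hence "ln (nv (x - y)) \<le> mu - \<gamma>" using xy0 by (metis ln_exp ln_le_cancel_iff exp_gt_zero)
      thus ?thesis using True l0[of x] l0[of y] by (simp add: i_def)
    next
      case False
      have "nv (x - y) \<le> max (max (nv \<alpha>) (nv x)) (max (nv \<alpha>) (nv y))" using nv_ultra_diff[of x y] by auto
      hence "ln (nv (x - y)) \<le> ln (max (max (nv \<alpha>) (nv x)) (max (nv \<alpha>) (nv y)))"
        using xy0 na by (subst ln_le_cancel_iff) auto
      also have "\<dots> \<le> mu + l x + l y"
      proof (cases "max (nv \<alpha>) (nv x) \<le> max (nv \<alpha>) (nv y)")
        case True
        hence "max (max (nv \<alpha>) (nv x)) (max (nv \<alpha>) (nv y)) = max (nv \<alpha>) (nv y)" by (rule max_absorb2)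
        thus ?thesis using l0[of x] by (simp only: l_def)
      next
        case False
        hence "max (max (nv \<alpha>) (nv x)) (max (nv \<alpha>) (nv y)) = max (nv \<alpha>) (nv x)" by simp
        thus ?thesis using l0[of y] by (simp only: l_def)
      qed
      finally show ?thesis using False by (auto simp: i_def)
    qed
  qed
  have "ln (nv (dsc S)) = (\<Sum>x\<in>S. \<Sum>y\<in>S - {x}. ln (nv (x - y)))"
  proof -
    have pos: "(\<Prod>y\<in>S - {x}. nv (x - y)) > 0" for x by (intro prod_pos) (auto intro!: nv_pos)
    have "ln (nv (dsc S)) = (\<Sum>x\<in>S. ln (\<Prod>y\<in>S - {x}. nv (x - y)))"
      unfolding dsc_def nv_prod using S(1) pos by (subst ln_prod) (auto simp: order_less_imp_not_eq2)
    also have "\<dots> = (\<Sum>x\<in>S. \<Sum>y\<in>S - {x}. ln (nv (x - y)))"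
      using S(1) by (intro sum.cong ln_prod) (auto intro!: nv_pos simp: nv_eq_0_iff)
    finally show ?thesis .
  qed
  also have "\<dots> \<le> (\<Sum>x\<in>S. \<Sum>y\<in>S - {x}. mu + l x + l y - \<gamma> * i x * i y)" using pair by (intro sum_mono) auto
  also have "\<dots> = (\<Sum>x\<in>S. (\<Sum>y\<in>S. mu + l x + l y - \<gamma> * i x * i y) - (mu + l x + l x - \<gamma> * i x * i x))"
    using S(1) by (intro sum.cong) (auto simp: sum_diff1)
  also have "\<dots> = real N * real N * mu + 2 * real N * sum l S - \<gamma> * (sum i S)\<^sup>2 - (real N * mu + 2 * sum l S - \<gamma> * (\<Sum>x\<in>S. i x * i x))"
    by (simp add: sum.distrib sum_subtractf sum_distrib_left[symmetric] sum_distrib_right[symmetric] S(2) power2_eq_square algebra_simps)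
  also have "sum i S = card A" using A S(1) by (simp add: i_def sum.If_cases Int_absorb1)
  also have "(\<Sum>x\<in>S. i x * i x) = card A"
  proof -
    have "(\<Sum>x\<in>S. i x * i x) = sum i S" by (intro sum.cong) (auto simp: i_def)
    thus ?thesis using A S(1) by (simp add: i_def sum.If_cases Int_absorb1)
  qed
  finally have main: "ln (nv (dsc S)) \<le> real N * real N * mu + 2 * real N * sum l S - \<gamma> * (real (card A))\<^sup>2 - (real N * mu + 2 * sum l S - \<gamma> * real (card A))" .
  have few': "sum l S \<le> \<gamma> / 16 * real N" using few by (simp add: l_def mu_def)
  have "\<gamma> * real (card (S - A)) \<le> sum l S"
  proof -
    have "\<gamma> * real (card (S - A)) = (\<Sum>x\<in>S - A. \<gamma>)" by simp
    also have "\<dots> \<le> sum l (S - A)"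
    proof (rule sum_mono)
      fix x assume x: "x \<in> S - A"
      hence "x \<noteq> 0" "ln (nv x) - mu \<ge> \<gamma>" using avoid[of x] by (auto simp: A_def mu_def)
      moreover have "ln (nv x) \<le> ln (max (nv \<alpha>) (nv x))" using nv_pos[OF \<open>x \<noteq> 0\<close>] by (subst ln_le_cancel_iff) auto
      ultimately show "\<gamma> \<le> l x" by (simp add: l_def)
    qed
    also have "\<dots> \<le> sum l S" using S(1) l0 by (intro sum_mono2) auto
    finally show ?thesis .
  qed
  hence "\<gamma> * real (card (S - A)) \<le> \<gamma> * (real N / 16)" using few' by simp
  hence "real (card (S - A)) \<le> real N / 16" using g by simp
  moreover have "card (S - A) = N - card A" "card A \<le> N" using A S card_mono[OF S(1) A(1)] by (auto simp: card_Diff_subset)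
  \<comment> \<open>Each point outside \<open>A\<close> contributes at least \<gamma> to the excess,
    so there are at most \<open>N / 16\<close> of them. With half of all points in \<open>A\<close>,
    the gain \<open>\<gamma> * N^2 / 4\<close> exceeds the cost \<open>\<gamma> * N^2 / 8\<close> of
    the excess and leaves \<open>\<gamma> * N^2 / 8\<close>.\<close>
  ultimately have cA: "real (card A) \<ge> real N / 2" "real (card A) \<le> real N" by (auto simp: of_nat_diff)
  have "(real N / 2)\<^sup>2 \<le> (real (card A))\<^sup>2" using cA by (intro power_mono) auto
  hence 1: "\<gamma> * ((real N)\<^sup>2 / 4) \<le> \<gamma> * (real (card A))\<^sup>2" using g by (intro mult_left_mono) (auto simp: power_divide)
  have 2: "2 * real N * sum l S \<le> 2 * real N * (\<gamma> / 16 * real N)" using few' by (intro mult_left_mono) auto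
  have 3: "sum l S \<ge> 0" using l0 by (intro sum_nonneg) auto
  have 4: "\<gamma> * real (card A) \<le> \<gamma> * real N" using cA g by (intro mult_left_mono) auto
  have 5: "- (real N * mu) \<le> real N * \<bar>mu\<bar>" using mult_left_mono[of "- mu" "\<bar>mu\<bar>" "real N"] by simp
  have "ln (nv (dsc S)) \<le> real N * real N * mu + 2 * real N * (\<gamma> / 16 * real N) - \<gamma> * ((real N)\<^sup>2 / 4) + real N * \<bar>mu\<bar> + \<gamma> * real N"
    using main 1 2 3 4 5 by linarith
  also have "\<dots> = mu * (real N)\<^sup>2 - \<gamma> / 8 * (real N)\<^sup>2 + real N * (\<bar>mu\<bar> + \<gamma>)"
    by (simp add: power2_eq_square algebra_simps)
  finally show ?thesis by (simp add: mu_def)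
qed

text \<open>The leading coefficient contributes \<open>- lam * N^2\<close>, so it suffices to push
  the discriminant below \<open>lam * N^2\<close> by a multiple of \<open>N^2\<close>. The dichotomy
  is governed by \<open>ll\<close>, the sum of \<open>ln (max (nv \<alpha>) (nv x)) - lam\<close>
  over \<open>S\<close>: if it is large, adjoining the progression \<open>T\<close> gains in the
  cross terms; if it is small, \<open>close_saving\<close> applies. The gain \<open>c\<close> is
  fixed before \<open>k\<close>, while \<open>C\<close> may depend on \<open>k\<close>.\<close>

theorem (in padic_absval) local_saving:
  fixes P :: "'a poly" and \<alpha> :: 'a
  assumes d: "degree P \<ge> 2" and fp: "poly P \<alpha> = \<alpha>" and a0: "\<alpha> \<noteq> 0" and g: "\<gamma> > 0"
    and mu: "ln (nv \<alpha>) \<ge> - ln (nv (lead_coeff P)) / (real (degree P) - 1)"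
  shows "\<exists>c>0. \<exists>k1. \<forall>k\<ge>k1. \<exists>C. \<forall>S. finite S \<longrightarrow> (\<forall>x\<in>S. x = 0 \<or> \<bar>ln (nv x) - ln (nv \<alpha>)\<bar> \<ge> \<gamma>) \<longrightarrow>
    2 * real (floor_sum (degree P ^ k) (card S)) * ln (nv (lead_coeff (iter_poly P k))) + ln (nv (dsc S)) \<le>
    4 * real (degree P ^ k) * (\<Sum>x\<in>S. lnp (nv x)) +
    4 * (real (card S) / real (degree P ^ k)) * (\<Sum>x\<in>S. lnp (nv (poly (iter_poly P k) x))) +
    C * real (card S) - c * (real (card S))\<^sup>2"
proof -
  define lam where "lam = - ln (nv (lead_coeff P)) / (real (degree P) - 1)"
  define la where "la = lnp (nv \<alpha>)"
  have na: "nv \<alpha> > 0" by (rule nv_pos[OF a0])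
  have la0: "la \<ge> 0" unfolding la_def by (rule lnp_nonneg)
  have ml: "ln (nv \<alpha>) \<ge> lam" using mu by (simp add: lam_def)
  \<comment> \<open>Threshold for \<open>ll / N\<close>. If \<open>ln (nv \<alpha>)\<close> exceeds
    \<open>lam\<close>, each summand of \<open>ll\<close> is at least \<open>eta\<close>, so the
    second case never occurs; if they are equal, \<open>\<gamma> / 16\<close> is what
    \<open>close_saving\<close> tolerates.\<close>
  define eta where "eta = (if ln (nv \<alpha>) > lam then min (\<gamma> / 16) (ln (nv \<alpha>) - lam) else \<gamma> / 16)"
  have eta: "eta > 0" "eta \<le> \<gamma> / 16" "ln (nv \<alpha>) > lam \<Longrightarrow> eta \<le> ln (nv \<alpha>) - lam" using g by (auto simp: eta_def min_def)
  obtain c1 where c1: "c1 \<ge> 0" "\<And>x. lnp (nv (poly P x)) \<le> real (degree P) * lnp (nv x) + c1"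
    using poly_lnp_upper[of P] by blast
  have d2: "real (degree P) \<ge> 2" using d by simp
  \<comment> \<open>After \<open>k0\<close> iterations a point of the progression still lies within
    1 of \<alpha>, where \<open>lnp\<close> is at most \<open>la\<close>. The remaining
    \<open>k - k0\<close> iterations multiply \<open>la + c1\<close> by \<open>d ^ (k - k0)\<close>,
    which by this choice is at most \<open>D * eta / 4\<close>.\<close>
  obtain k0 where k0: "4 * (la + c1) / eta < real (degree P) ^ k0" using real_arch_pow[of "real (degree P)"] d2 by auto
  obtain dl where dl: "dl > 0" "\<And>t. nv (t - \<alpha>) \<le> dl \<Longrightarrow> nv ((poly P ^^ k0) t - \<alpha>) \<le> 1"
    using iterate_continuous_at_fixed_point[OF fp, of 1 k0] by auto
  \<comment> \<open>A step \<open>p ^ s\<close> small enough to keep the progression within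
    \<open>dl\<close> of \<alpha> and on the circle through \<alpha>.\<close>
  obtain s where s: "max (1 / dl) (1 / nv \<alpha>) < real p ^ s" using real_arch_pow[OF p_gt_1] by blast
  have ps: "real p ^ s > 0" using p_gt_1 by simp
  have s1: "1 / real p ^ s \<le> dl" "1 / real p ^ s < nv \<alpha>"
    using s dl(1) na ps by (auto simp: field_simps)
  define CT where "CT = (real s + 1) * ln (real p)"
  have CT: "CT \<ge> 0" using p_gt_1 by (simp add: CT_def)
  \<comment> \<open>The density of the progression: the quadratic costs, from its own discriminant
    and from \<open>lam\<close>, become at most half of the linear gain \<open>eta\<close>.\<close>
  define tau where "tau = min 1 (eta / (2 * (\<bar>lam\<bar> + CT + 1)))"
  have tau: "tau > 0" "tau \<le> 1" using eta(1) CT by (auto simp: tau_def)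
  have tau2: "(\<bar>lam\<bar> + CT) * tau \<le> eta / 2"
  proof -
    have "(\<bar>lam\<bar> + CT) * tau \<le> (\<bar>lam\<bar> + CT + 1) * (eta / (2 * (\<bar>lam\<bar> + CT + 1)))"
      using CT eta(1) by (intro mult_mono) (auto simp: tau_def)
    also have "\<dots> = eta / 2" using CT by (simp add: field_simps)
    finally show ?thesis .
  qed
  define c0 where "c0 = min (tau * eta / 2) (\<gamma> / 8)"
  have c0: "c0 > 0" "c0 \<le> tau * eta / 2" "c0 \<le> \<gamma> / 8" using tau eta g by (auto simp: c0_def)
  \<comment> \<open>The rounding error of \<open>floor_sum\<close> is of order
    \<open>\<bar>lam\<bar> * n^2 / D\<close>; for \<open>k\<close> beyond \<open>k1\<close> it uses
    up at most half of the gain \<open>c0\<close>.\<close>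
  obtain k1 where k1: "10 * \<bar>lam\<bar> / c0 < real (degree P) ^ k1" using real_arch_pow[of "real (degree P)"] d2 by auto
  have concl: "2 * real (floor_sum (degree P ^ k) (card S)) * ln (nv (lead_coeff (iter_poly P k))) + ln (nv (dsc S)) \<le>
    4 * real (degree P ^ k) * (\<Sum>x\<in>S. lnp (nv x)) +
    4 * (real (card S) / real (degree P ^ k)) * (\<Sum>x\<in>S. lnp (nv (poly (iter_poly P k) x))) +
    (9 * real (degree P ^ k) * \<bar>lam\<bar> + eta + 2 * real (degree P ^ k) * la + \<bar>ln (nv \<alpha>)\<bar> + \<gamma>) * real (card S) - (c0 / 2) * (real (card S))\<^sup>2"
    if k: "k \<ge> max k0 k1" and fS: "finite S" and av: "\<forall>x\<in>S. x = 0 \<or> \<bar>ln (nv x) - ln (nv \<alpha>)\<bar> \<ge> \<gamma>" for k S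
  proof -
    define N where "N = card S"
    define D where "D = degree P ^ k"
    define n where "n = real N"
    have n0: "n \<ge> 0" by (simp add: n_def)
    have D1: "D \<ge> 1" using d by (simp add: D_def)
    have Dr: "real D \<ge> 1" using D1 by simp
    have dPsi: "degree (iter_poly P k) = D" by (simp add: degree_iter_poly D_def)
    have lead: "ln (nv (lead_coeff (iter_poly P k))) = - (real D - 1) * lam"
      using ln_nv_lead_iter_poly[OF d, of k] by (simp add: lam_def D_def)
    define SX where "SX = (\<Sum>x\<in>S. lnp (nv x))"
    define SY where "SY = (\<Sum>x\<in>S. lnp (nv (poly (iter_poly P k) x)))"
    have SX0: "SX \<ge> 0" and SY0: "SY \<ge> 0" unfolding SX_def SY_def by (intro sum_nonneg lnp_nonneg)+
    have k1D: "5 * \<bar>lam\<bar> * (n\<^sup>2 / D) \<le> c0 / 2 * n\<^sup>2"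
    proof -
      have "real (degree P) ^ k1 \<le> real D" unfolding D_def of_nat_power using k d2 by (intro power_increasing) auto
      hence "10 * \<bar>lam\<bar> / c0 \<le> real D" using k1 by linarith
      hence "5 * \<bar>lam\<bar> / D \<le> c0 / 2" using c0(1) Dr by (simp add: field_simps)
      hence "5 * \<bar>lam\<bar> / D * n\<^sup>2 \<le> c0 / 2 * n\<^sup>2" by (intro mult_right_mono) auto
      thus ?thesis by simp
    qed
    define q where "q = n\<^sup>2 / D"
    have q0: "q \<ge> 0" by (simp add: q_def)
    have LS: "2 * real (floor_sum D N) * ln (nv (lead_coeff (iter_poly P k))) \<le> - (lam * n\<^sup>2) + \<bar>lam\<bar> * (3 * real D * n + q)"
      using floor_sum_scaled[OF D1, of lam N] unfolding lead n_def[symmetric] q_def[symmetric]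
      by (simp add: abs_le_iff algebra_simps)
    define ll where "ll = (\<Sum>x\<in>S. ln (max (nv \<alpha>) (nv x)) - lam)"
    have lterm: "ln (max (nv \<alpha>) (nv x)) \<ge> ln (nv \<alpha>)" for x using na by (subst ln_le_cancel_iff) auto
    have "2 * real (floor_sum D N) * ln (nv (lead_coeff (iter_poly P k))) + ln (nv (dsc S)) \<le>
      4 * real D * SX + 4 * (n / real D) * SY + (9 * real D * \<bar>lam\<bar> + eta + 2 * real D * la + \<bar>ln (nv \<alpha>)\<bar> + \<gamma>) * n - (c0 / 2) * n\<^sup>2"
    proof (cases "ll < eta * n")
      case True
      have "\<not> ln (nv \<alpha>) > lam"
      proof
        assume gt: "ln (nv \<alpha>) > lam"
        have "(\<Sum>x\<in>S. eta) \<le> ll" unfolding ll_def using eta(3)[OF gt] lterm by (intro sum_mono) (smt (verit))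
        thus False using True by (simp add: N_def n_def mult.commute)
      qed
      hence ml': "ln (nv \<alpha>) = lam" using ml by simp
      have "eta * n \<le> \<gamma> / 16 * n" using eta(2) n0 by (rule mult_right_mono)
      hence "(\<Sum>x\<in>S. ln (max (nv \<alpha>) (nv x)) - ln (nv \<alpha>)) \<le> \<gamma> / 16 * real N"
        using True unfolding ll_def ml' n_def by linarith
      hence "ln (nv (dsc S)) \<le> ln (nv \<alpha>) * (real N)\<^sup>2 - \<gamma> / 8 * (real N)\<^sup>2 + real N * (\<bar>ln (nv \<alpha>)\<bar> + \<gamma>)"
        using av by (intro close_saving[OF a0 fS N_def[symmetric] g]) auto
      hence 1: "ln (nv (dsc S)) \<le> lam * n\<^sup>2 - \<gamma> / 8 * n\<^sup>2 + (\<bar>ln (nv \<alpha>)\<bar> + \<gamma>) * n"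
        by (simp add: ml' n_def mult.commute)
      have 2: "c0 * n\<^sup>2 \<le> \<gamma> / 8 * n\<^sup>2" using c0(3) by (intro mult_right_mono) auto
      have 3: "\<bar>lam\<bar> * q \<le> c0 / 2 * n\<^sup>2" using k1D q0 mult_nonneg_nonneg[of "\<bar>lam\<bar>" q] unfolding q_def[symmetric] by linarith
      have 4: "0 \<le> 4 * real D * SX" "0 \<le> 4 * (n / real D) * SY" "0 \<le> 2 * real D * la * n" "0 \<le> eta * n" "0 \<le> 6 * real D * \<bar>lam\<bar> * n"
        using SX0 SY0 n0 la0 eta(1) by auto
      have "2 * real (floor_sum D N) * ln (nv (lead_coeff (iter_poly P k))) + ln (nv (dsc S)) \<le>
        3 * real D * \<bar>lam\<bar> * n + \<bar>lam\<bar> * q - \<gamma> / 8 * n\<^sup>2 + (\<bar>ln (nv \<alpha>)\<bar> + \<gamma>) * n"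
        using LS 1 by (simp add: algebra_simps)
      also have "\<dots> \<le> 3 * real D * \<bar>lam\<bar> * n - c0 / 2 * n\<^sup>2 + (\<bar>ln (nv \<alpha>)\<bar> + \<gamma>) * n" using 2 3 by linarith
      also have "\<dots> \<le> 4 * real D * SX + 4 * (n / real D) * SY + (9 * real D * \<bar>lam\<bar> + eta + 2 * real D * la + \<bar>ln (nv \<alpha>)\<bar> + \<gamma>) * n - (c0 / 2) * n\<^sup>2"
        using 4 by (simp only: distrib_right)
      finally show ?thesis .
    next
      case False
      hence far: "ll \<ge> eta * n" by simp
      \<comment> \<open>The size of the progression is \<open>tau * n\<close> rounded down; the loss
        of less than one point is linear in \<open>n\<close> and goes into \<open>C\<close>.\<close>
      define M where "M = nat \<lfloor>tau * n\<rfloor>"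
      define m where "m = real M"
      have tn: "tau * n \<ge> 0" using tau n0 by simp
      have m: "m \<le> tau * n" "m \<ge> tau * n - 1" "m \<ge> 0" using tn unfolding m_def M_def by (auto simp: of_nat_nat)
      have mn: "m \<le> n" using m(1) mult_right_mono[OF tau(2) n0] by simp
      define T where "T = (\<lambda>j. \<alpha> + of_nat p ^ s * of_nat j) ` {..<M}"
      have T: "finite T" "card T = M" "ln (nv (dsc T)) \<ge> - CT * m\<^sup>2"
        using arithmetic_progression[where a = \<alpha> and s = s and M = M] by (auto simp: T_def CT_def m_def)
      have Tn: "nv (t - \<alpha>) \<le> dl \<and> nv t = nv \<alpha>" if t: "t \<in> T" for t
      proof -
        from t obtain j where j: "t = \<alpha> + of_nat p ^ s * of_nat j" by (auto simp: T_def)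
        have "nv (of_nat p ^ s * of_nat j) \<le> 1 / real p ^ s * 1"
          unfolding nv_mult nv_p_power by (intro mult_left_mono nv_of_nat_le_1) simp
        hence b: "nv (of_nat p ^ s * of_nat j) \<le> 1 / real p ^ s" by simp
        have "nv (of_nat p ^ s * of_nat j + \<alpha>) = nv \<alpha>" using b s1(2) by (intro nv_add_eq) linarith
        thus ?thesis using b s1(1) by (simp add: j add.commute)
      qed
      have ne: "nv x \<noteq> nv \<alpha>" if "x \<in> S" for x using av that g na by force
      have disj: "S \<inter> T = {}" using ne Tn by fastforce
      define U where "U = S \<union> T"
      have U: "finite U" "card U = N + M" using fS T disj by (auto simp: U_def card_Un_disjoint N_def)
      have TY: "lnp (nv (poly (iter_poly P k) t)) \<le> real D * (eta / 4)" if t: "t \<in> T" for t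
      proof -
        define y where "y = (poly P ^^ k0) t"
        have "nv (y - \<alpha>) \<le> 1" using dl(2) Tn[OF t] by (simp add: y_def)
        hence "nv y \<le> max 1 (nv \<alpha>)" using nv_ultra[of "y - \<alpha>" \<alpha>] by auto
        hence ly: "lnp (nv y) \<le> la" unfolding la_def lnp_def by (subst ln_le_cancel_iff) (auto simp: less_max_iff_disj)
        have "(poly P ^^ k) t = (poly P ^^ (k - k0)) y"
          unfolding y_def using k by (metis funpow_add comp_apply le_add_diff_inverse2 max.bounded_iff)
        hence "lnp (nv (poly (iter_poly P k) t)) \<le> real (degree P) ^ (k - k0) * (lnp (nv y) + c1) - c1"
          using lnp_iterate_le[OF d c1, of "k - k0" y] by (simp add: poly_iter_poly)
        also have "\<dots> \<le> real (degree P) ^ (k - k0) * (la + c1)"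
          using ly c1(1) mult_left_mono[of "lnp (nv y) + c1" "la + c1" "real (degree P) ^ (k - k0)"] by simp
        also have "\<dots> \<le> real (degree P) ^ (k - k0) * (real (degree P) ^ k0 * (eta / 4))"
          using k0 eta(1) by (intro mult_left_mono) (auto simp: field_simps)
        also have "\<dots> = real D * (eta / 4)"
          unfolding D_def of_nat_power using k by (simp add: power_add[symmetric] mult.assoc[symmetric])
        finally show ?thesis .
      qed
      have SU: "(\<Sum>x\<in>U. lnp (nv x)) = SX + m * la"
        unfolding U_def SX_def using fS T(1) disj Tn
        by (subst sum.union_disjoint) (auto simp: la_def m_def T(2)[symmetric])
      have YU: "(\<Sum>x\<in>U. lnp (nv (poly (iter_poly P k) x))) \<le> SY + m * (real D * (eta / 4))"
      proof -
        have "(\<Sum>x\<in>T. lnp (nv (poly (iter_poly P k) x))) \<le> (\<Sum>x\<in>T. real D * (eta / 4))" by (intro sum_mono TY)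
        thus ?thesis unfolding U_def SY_def using fS T disj by (subst sum.union_disjoint) (auto simp: m_def)
      qed
      \<comment> \<open>No point of \<open>S\<close> has the absolute value of \<alpha>, whereas all
        of \<open>T\<close> has it. So each distance between the two sets equals the larger absolute
        value, and the cross terms are known exactly through \<open>ll\<close>.\<close>
      have lU: "ln (nv (dsc U)) = ln (nv (dsc S)) + ln (nv (dsc T)) + 2 * m * (ll + n * lam)"
      proof -
        define L where "L = (\<Sum>x\<in>S. ln (max (nv \<alpha>) (nv x)))"
        have mx: "max (nv \<alpha>) (nv x) > 0" for x using na by (simp add: less_max_iff_disj)
        have tx: "nv ((t - x) * (x - t)) = (max (nv \<alpha>) (nv x))\<^sup>2" if "t \<in> T" "x \<in> S" for t x
          using nv_diff_eq_max[of t x] nv_diff_commute[of x t] ne[OF that(2)] Tn[OF that(1)]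
          by (simp add: nv_mult power2_eq_square)
        have "nv (\<Prod>t\<in>T. \<Prod>x\<in>S. (t - x) * (x - t)) = (\<Prod>t\<in>T. \<Prod>x\<in>S. (max (nv \<alpha>) (nv x))\<^sup>2)"
          unfolding nv_prod using tx by (intro prod.cong) auto
        also have "\<dots> = ((\<Prod>x\<in>S. max (nv \<alpha>) (nv x))\<^sup>2) ^ M" by (simp add: T(2) prod_power_distrib)
        finally have "nv (\<Prod>t\<in>T. \<Prod>x\<in>S. (t - x) * (x - t)) = ((\<Prod>x\<in>S. max (nv \<alpha>) (nv x))\<^sup>2) ^ M" .
        moreover have "ln (((\<Prod>x\<in>S. max (nv \<alpha>) (nv x))\<^sup>2) ^ M) = m * (2 * L)"
        proof -
          have "ln (\<Prod>x\<in>S. max (nv \<alpha>) (nv x)) = L" unfolding L_def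
            using fS mx by (subst ln_prod) (auto simp: order_less_imp_not_eq2)
          thus ?thesis by (simp add: ln_realpow m_def)
        qed
        moreover have "nv (\<Prod>t\<in>T. \<Prod>x\<in>S. (t - x) * (x - t)) > 0"
          using fS T(1) disj by (intro nv_pos) (auto simp: prod_zero_iff)
        moreover have "nv (dsc S) > 0" "nv (dsc T) > 0" using ln_dsc_pos fS T(1) by auto
        ultimately have "ln (nv (dsc U)) = ln (nv (dsc S)) + ln (nv (dsc T)) + m * (2 * L)"
          unfolding U_def dsc_union[OF T(1) fS disj] nv_mult by (simp add: ln_mult_pos)
        moreover have "ll = L - n * lam" by (simp add: ll_def L_def sum_subtractf n_def N_def)
        ultimately show ?thesis by simp
      qed
      have gb: "2 * real (floor_sum D (N + M)) * ln (nv (lead_coeff (iter_poly P k))) + ln (nv (dsc U)) \<le>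
        2 * real D * (SX + m * la) + 2 * ((n + m) / real D) * (SY + m * (real D * (eta / 4)))"
      proof -
        have "2 * real (floor_sum D (N + M)) * ln (nv (lead_coeff (iter_poly P k))) + ln (nv (dsc U)) \<le>
          2 * real D * (\<Sum>x\<in>U. lnp (nv x)) + 2 * (real (N + M) / real D) * (\<Sum>x\<in>U. lnp (nv (poly (iter_poly P k) x)))"
          by (rule ln_dsc_bound_ultra[OF dPsi D1 U])
        also have "\<dots> \<le> 2 * real D * (SX + m * la) + 2 * (real (N + M) / real D) * (SY + m * (real D * (eta / 4)))"
          unfolding SU by (intro add_left_mono mult_left_mono YU) auto
        finally show ?thesis by (simp add: n_def m_def)
      qed
      have EM: "2 * real (floor_sum D (N + M)) * ln (nv (lead_coeff (iter_poly P k))) \<ge>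
        - (lam * (n + m)\<^sup>2) - \<bar>lam\<bar> * (3 * real D * (n + m) + (n + m)\<^sup>2 / real D)"
        using floor_sum_scaled[OF D1, of lam "N + M"] unfolding lead
        by (simp add: abs_le_iff algebra_simps n_def m_def)
      have i1: "\<bar>lam\<bar> * (3 * real D * (n + m) + (n + m)\<^sup>2 / real D) \<le> \<bar>lam\<bar> * (6 * real D * n + 4 * q)"
      proof (intro mult_left_mono add_mono)
        have "3 * real D * (n + m) \<le> 3 * real D * (n + n)" using mn Dr by (intro mult_left_mono) auto
        thus "3 * real D * (n + m) \<le> 6 * real D * n" by simp
        have "(n + m)\<^sup>2 \<le> (n + n)\<^sup>2" using mn n0 m(3) by (intro power_mono) auto
        hence "(n + m)\<^sup>2 / real D \<le> (n + n)\<^sup>2 / real D" by (intro divide_right_mono) auto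
        thus "(n + m)\<^sup>2 / real D \<le> 4 * q" by (simp add: q_def power2_eq_square algebra_simps)
      qed simp
      have i2: "2 * ((n + m) / real D) * (SY + m * (real D * (eta / 4))) \<le> 4 * (n / real D) * SY + m * n * eta"
      proof -
        have "2 * ((n + m) / real D) * SY \<le> 2 * ((n + n) / real D) * SY"
          using mn SY0 Dr by (intro mult_right_mono mult_left_mono divide_right_mono) auto
        moreover have "2 * ((n + m) / real D) * (m * (real D * (eta / 4))) = (n + m) * (m * eta) / 2"
          using Dr by (simp add: field_simps)
        moreover have "(n + m) * (m * eta) \<le> (n + n) * (m * eta)" using mn m(3) eta(1) by (intro mult_right_mono) auto
        moreover have "2 * ((n + n) / real D) * SY = 4 * (n / real D) * SY" "(n + n) * (m * eta) = 2 * (m * n * eta)" by (simp_all add: field_simps)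
        ultimately show ?thesis by (simp only: distrib_left; linarith)
      qed
      have i3: "(\<bar>lam\<bar> + CT) * m\<^sup>2 \<le> m * n * eta / 2"
      proof -
        have "(\<bar>lam\<bar> + CT) * m \<le> (\<bar>lam\<bar> + CT) * (tau * n)" using m(1) CT by (intro mult_left_mono) auto
        also have "\<dots> = (\<bar>lam\<bar> + CT) * tau * n" by simp
        also have "\<dots> \<le> eta / 2 * n" using tau2 n0 by (rule mult_right_mono)
        finally have "(\<bar>lam\<bar> + CT) * m * m \<le> eta / 2 * n * m" using m(3) by (rule mult_right_mono)
        thus ?thesis by (simp add: power2_eq_square algebra_simps)
      qed
      have i4: "lam * m\<^sup>2 \<le> \<bar>lam\<bar> * m\<^sup>2" by (intro mult_right_mono) auto
      have i5: "2 * m * (eta * n) \<le> 2 * m * ll" using far m(3) by (intro mult_left_mono) auto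
      have i6: "m * n * eta / 2 \<ge> tau * eta / 2 * n\<^sup>2 - eta / 2 * n"
      proof -
        have "(tau * n - 1) * (n * eta / 2) \<le> m * (n * eta / 2)" using m(2) n0 eta(1) by (intro mult_right_mono) auto
        thus ?thesis by (simp add: power2_eq_square algebra_simps)
      qed
      have i7: "2 * real D * (m * la) \<le> 2 * real D * la * n"
      proof -
        have "2 * real D * la * m \<le> 2 * real D * la * n" using mn la0 by (intro mult_left_mono) auto
        thus ?thesis by (simp add: mult_ac)
      qed
      have i8: "c0 * n\<^sup>2 \<le> tau * eta / 2 * n\<^sup>2" using c0(2) by (intro mult_right_mono) auto
      have sq: "lam * (n + m)\<^sup>2 = lam * n\<^sup>2 + 2 * m * (n * lam) + lam * m\<^sup>2" by (simp add: power2_eq_square algebra_simps)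
      have e5: "2 * m * (eta * n) = 2 * (m * n * eta)" by simp
      have eT: "(\<bar>lam\<bar> + CT) * m\<^sup>2 = \<bar>lam\<bar> * m\<^sup>2 + CT * m\<^sup>2" by (simp add: distrib_right)
      have eD: "2 * real D * (SX + m * la) = 2 * real D * SX + 2 * real D * (m * la)" by (simp add: distrib_left)
      have eL: "2 * m * (ll + n * lam) = 2 * m * ll + 2 * m * (n * lam)" by (simp add: distrib_left)
      have T3: "ln (nv (dsc T)) \<ge> - (CT * m\<^sup>2)" using T(3) by simp
      \<comment> \<open>The cross terms gain \<open>2 * m * n * eta\<close>; the images of
        \<open>T\<close> under the iterate cost at most \<open>m * n * eta\<close> and the terms
        quadratic in \<open>m\<close> half of that, so half of \<open>m * n * eta\<close>
        remains.\<close>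
      have dS: "ln (nv (dsc S)) \<le> lam * n\<^sup>2 - m * n * eta / 2 + \<bar>lam\<bar> * (6 * real D * n + 4 * q) + 2 * real D * SX + 2 * real D * la * n + 4 * (n / real D) * SY"
        using gb EM i1 i2 i3 i4 i5 i7 T3 unfolding lU sq e5 eT eD eL by linarith
      have "2 * real (floor_sum D N) * ln (nv (lead_coeff (iter_poly P k))) + ln (nv (dsc S)) \<le>
        - (m * n * eta / 2) + \<bar>lam\<bar> * (9 * real D * n) + 5 * \<bar>lam\<bar> * q + 2 * real D * SX + 2 * real D * la * n + 4 * (n / real D) * SY"
        using LS dS by (simp add: algebra_simps)
      also have "\<dots> \<le> eta / 2 * n - c0 / 2 * n\<^sup>2 + \<bar>lam\<bar> * (9 * real D * n) + 2 * real D * SX + 2 * real D * la * n + 4 * (n / real D) * SY"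
        using i6 i8 k1D[folded q_def] by linarith
      also have "\<dots> \<le> 4 * real D * SX + 4 * (n / real D) * SY + (9 * real D * \<bar>lam\<bar> + eta + 2 * real D * la + \<bar>ln (nv \<alpha>)\<bar> + \<gamma>) * n - (c0 / 2) * n\<^sup>2"
      proof -
        have "eta / 2 * n \<le> eta * n" using eta(1) n0 by simp
        moreover have "0 \<le> \<bar>ln (nv \<alpha>)\<bar> * n" "0 \<le> \<gamma> * n" using g n0 by auto
        moreover have "2 * real D * SX \<le> 4 * real D * SX" using SX0 by simp
        moreover have "\<bar>lam\<bar> * (9 * real D * n) = 9 * real D * \<bar>lam\<bar> * n" by simp
        ultimately show ?thesis by (simp only: distrib_right; linarith)
      qed
      finally show ?thesis .
    qed
    thus ?thesis by (simp only: SX_def SY_def D_def N_def n_def)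
  qed
  show ?thesis
  proof (rule exI[of _ "c0 / 2"], rule conjI, use c0 in simp, rule exI[of _ "max k0 k1"], rule allI, rule impI)
    fix k assume "max k0 k1 \<le> k"
    thus "\<exists>C. \<forall>S. finite S \<longrightarrow> (\<forall>x\<in>S. x = 0 \<or> \<bar>ln (nv x) - ln (nv \<alpha>)\<bar> \<ge> \<gamma>) \<longrightarrow>
      2 * real (floor_sum (degree P ^ k) (card S)) * ln (nv (lead_coeff (iter_poly P k))) + ln (nv (dsc S)) \<le>
      4 * real (degree P ^ k) * (\<Sum>x\<in>S. lnp (nv x)) +
      4 * (real (card S) / real (degree P ^ k)) * (\<Sum>x\<in>S. lnp (nv (poly (iter_poly P k) x))) +
      C * real (card S) - c0 / 2 * (real (card S))\<^sup>2"
      using concl by blast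
  qed
qed

section \<open>Extending places, Newton slopes and ramification\<close>

lemma padic_abs_frac:
  assumes p: "prime p" and ab: "a \<noteq> 0" "b \<noteq> 0"
  shows "padic_abs p (of_int a / of_int b) = real p powi (int (multiplicity (int p) b) - int (multiplicity (int p) a))"
proof -
  let ?q = "of_int a / of_int b :: rat"
  obtain c d where cd: "quotient_of ?q = (c, d)" by fastforce
  have d: "d > 0" using quotient_of_denom_pos[OF cd] .
  have q0: "?q \<noteq> 0" using ab by simp
  have qd: "?q = of_int c / of_int d" by (rule quotient_of_div[OF cd])
  hence c: "c \<noteq> 0" using q0 by auto
  have "of_int (a * d) = (of_int (c * b) :: rat)" using qd d ab by (simp add: field_simps)
  hence "a * d = c * b" by (simp only: of_int_eq_iff)
  hence "multiplicity (int p) (a * d) = multiplicity (int p) (c * b)" by simp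
  hence "multiplicity (int p) a + multiplicity (int p) d = multiplicity (int p) c + multiplicity (int p) b"
    using p ab c d by (simp add: prime_elem_multiplicity_mult_distrib)
  hence "int (multiplicity (int p) d) - int (multiplicity (int p) c) = int (multiplicity (int p) b) - int (multiplicity (int p) a)"
    by linarith
  thus ?thesis using q0 by (simp add: padic_abs_def cd)
qed

lemma rat_fracE: obtains a b where "(x::rat) = of_int a / of_int b" "b \<noteq> (0::int)"
proof -
  obtain a b where "quotient_of x = (a, b)" by fastforce
  thus ?thesis using that[of a b] quotient_of_div[of x a b] quotient_of_denom_pos[of x a b] by auto
qed

text \<open>Provides, after extension to the closure, absolute values at the primes other than the
  one below \<open>v\<close>.\<close>

lemma finite_place_rat:
  assumes p: "prime p" shows "finite_place p UNIV (padic_abs p)"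
proof -
  have p1: "real p > 1" using prime_gt_1_nat[OF p] by simp
  have nn: "padic_abs p x \<ge> 0" for x by (auto simp: padic_abs_def split: prod.splits)
  have z: "padic_abs p x = 0 \<longleftrightarrow> x = 0" for x
    using p1 by (auto simp: padic_abs_def split: prod.splits)
  have z0: "padic_abs p 0 = 0" using z by simp
  have m: "padic_abs p (x * y) = padic_abs p x * padic_abs p y" for x y
  proof (cases "x = 0 \<or> y = 0")
    case False
    obtain a b where x: "x = of_int a / of_int b" "b \<noteq> 0" by (rule rat_fracE)
    obtain c d where y: "y = of_int c / of_int d" "d \<noteq> 0" by (rule rat_fracE)
    have ac: "a \<noteq> 0" "c \<noteq> 0" using False x y by auto
    have "x * y = of_int (a * c) / of_int (b * d)" using x y by simp
    hence "padic_abs p (x * y) = real p powi (int (multiplicity (int p) (b * d)) - int (multiplicity (int p) (a * c)))"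
      using padic_abs_frac[OF p, of "a * c" "b * d"] ac x y by simp
    also have "\<dots> = padic_abs p x * padic_abs p y"
      unfolding x(1) y(1) padic_abs_frac[OF p ac(1) x(2)] padic_abs_frac[OF p ac(2) y(2)]
      using p ac x y p1
      by (simp add: prime_elem_multiplicity_mult_distrib power_int_add[symmetric] algebra_simps)
    finally show ?thesis .
  qed (auto simp: z)
  have u: "padic_abs p (x + y) \<le> max (padic_abs p x) (padic_abs p y)" for x y
  proof (cases "x = 0 \<or> y = 0 \<or> x + y = 0")
    case False
    obtain a b where x: "x = of_int a / of_int b" "b \<noteq> 0" by (rule rat_fracE)
    obtain c d where y: "y = of_int c / of_int d" "d \<noteq> 0" by (rule rat_fracE)
    let ?s = "a * d + c * b"
    let ?m = "\<lambda>z. multiplicity (int p) z"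
    have ac: "a \<noteq> 0" "c \<noteq> 0" using False x y by auto
    have xe: "x = of_int (a * d) / of_int (b * d)" and ye: "y = of_int (c * b) / of_int (b * d)"
      and se: "x + y = of_int ?s / of_int (b * d)" using x y by (simp_all add: field_simps)
    have s0: "?s \<noteq> 0" using False se by (metis div_0 of_int_0)
    have bd: "b * d \<noteq> 0" "a * d \<noteq> 0" "c * b \<noteq> 0" using x y ac by auto
    have "int p ^ min (?m (a * d)) (?m (c * b)) dvd ?s"
      by (intro dvd_add multiplicity_dvd') auto
    hence "?m ?s \<ge> min (?m (a * d)) (?m (c * b))"
      using p s0 by (intro multiplicity_geI) auto
    hence "?m ?s \<ge> ?m (a * d) \<or> ?m ?s \<ge> ?m (c * b)" by auto
    moreover have "real p powi (int (?m (b * d)) - int (?m ?s)) \<le> real p powi (int (?m (b * d)) - int k)" if "?m ?s \<ge> k" for k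
      using that p1 by (intro power_int_increasing) auto
    ultimately show ?thesis
      unfolding se by (subst xe, subst ye) (auto simp only: padic_abs_frac[OF p] s0 bd le_max_iff_disj not_False_eq_True)
  qed (auto simp: z0 nn max_def)
  show ?thesis using p nn z m u by (simp add: finite_place_def nonarch_abs_on_def)
qed

lemma is_subfield_range: assumes f: "field_hom f" shows "is_subfield (range f)"
  unfolding is_subfield_def ball_simps
proof (intro conjI allI)
  show "0 \<in> range f" "1 \<in> range f" using field_hom_0[OF f] field_hom_1[OF f] by (metis rangeI)+
qed (simp_all add: field_hom_diff[OF f, symmetric] field_hom_mult[OF f, symmetric] field_hom_inverse[OF f, symmetric])

lemma place_extension:
  fixes f :: "'b::field_char_0 \<Rightarrow> 'a::qbar"
  assumes f: "field_hom f" and v: "finite_place p UNIV v"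
  obtains W where "padic_absval W p" "\<And>c. W (f c) = v c"
proof -
  define w where "w = restrict (v \<circ> inv_into UNIV f) (range f)"
  have wf: "w (f c) = v c" for c using field_hom_inj[OF f] by (simp add: w_def)
  have "finite_place p (range f) w"
    unfolding finite_place_def
  proof (intro conjI allI)
    show "prime p" using v by (simp add: finite_place_def)
    show "w \<in> extensional (range f)" by (simp add: w_def)
    show "nonarch_abs_on (range f) w" using v
      by (auto simp: finite_place_def nonarch_abs_on_def wf field_hom_eq_0_iff[OF f]
          field_hom_mult[OF f, symmetric] field_hom_add[OF f, symmetric])
    fix q
    show "w (of_rat q) = padic_abs p q"
      using wf[of "of_rat q"] v by (simp add: finite_place_def field_hom_of_rat[OF f])
  qed
  from finite_place_extension[OF is_subfield_range[OF f] this] obtain W where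
    "padic_absval W p" "\<And>u. u \<in> range f \<Longrightarrow> W u = w u" by blast
  thus ?thesis using wf that by simp
qed

lemma exists_complex_embedding: obtains \<iota> :: "'a::qbar \<Rightarrow> complex" where "field_hom \<iota>"
proof -
  have "ring_graph {(of_int n :: 'a, of_int n :: complex) |n. True}"
    unfolding ring_graph_def
  proof (intro conjI allI impI)
    show "(1::'a, 1::complex) \<in> {(of_int n, of_int n) |n. True}" by (auto intro: exI[of _ 1])
  next
    fix a c :: 'a and b d :: complex
    assume "(a, b) \<in> {(of_int n, of_int n) |n. True}" "(c, d) \<in> {(of_int n, of_int n) |n. True}"
    then obtain m n where "a = of_int m" "b = of_int m" "c = of_int n" "d = of_int n" by auto
    thus "(a - c, b - d) \<in> {(of_int n, of_int n) |n. True}" "(a * c, b * d) \<in> {(of_int n, of_int n) |n. True}"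
      by (auto intro: exI[of _ "m - n"] exI[of _ "m * n"])
  qed auto
  from field_hom_extending_graph[OF this] show ?thesis using that by blast
qed

text \<open>If no root had absolute value \<open>exp \<mu>\<close>, a single point of the Newton diagram would minimise
  \<open>y - \<mu> x\<close> over the convex hull, which is incompatible with an edge of slope \<open>\<mu>\<close>.\<close>

lemma (in ultra_absval) newton_slope_root:
  fixes f :: "'b::Fields.field \<Rightarrow> 'a" and \<psi> :: "'b poly"
  assumes fac: "\<And>q::'a poly. q \<noteq> 0 \<Longrightarrow> \<exists>A. q = smult (lead_coeff q) (\<Prod>x\<in>#A. [:- x, 1:])"
    and f: "field_hom f" and v: "\<And>c. v c = nv (f c)" and mu: "\<mu> \<in> newton_slopes v \<psi>" and p0: "\<psi> \<noteq> 0"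
  shows "\<exists>\<alpha>. poly (map_poly f \<psi>) \<alpha> = 0 \<and> nv \<alpha> = exp \<mu>"
proof (rule ccontr)
  assume no: "\<not> ?thesis"
  define Q where "Q = map_poly f \<psi>"
  have cQ: "coeff Q i = f (coeff \<psi> i)" for i by (simp add: Q_def coeff_map_poly field_hom_0[OF f])
  have Q0: "Q \<noteq> 0"
  proof
    assume "Q = 0"
    hence "f (coeff \<psi> i) = 0" for i using cQ[of i] by simp
    hence "coeff \<psi> i = 0" for i using field_hom_eq_0_iff[OF f] by blast
    thus False using p0 by (simp add: poly_eq_iff)
  qed
  obtain A where A: "Q = smult (lead_coeff Q) (\<Prod>x\<in>#A. [:- x, 1:])" using fac[OF Q0] by blast
  define R where "R = (\<Prod>x\<in>#A. [:- x, 1:])"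
  have root: "poly Q a = 0" if "a \<in># A" for a
    using that by (subst A) (auto simp: poly_prod_mset prod_mset_zero_iff)
  have nA: "nv a \<noteq> exp \<mu>" if "a \<in># A" for a using root[OF that] no by (auto simp: Q_def)
  from dominating_term[of "exp \<mu>" A, folded R_def] nA obtain i0 where i0: "coeff R i0 \<noteq> 0"
    "\<And>i. i \<noteq> i0 \<Longrightarrow> nv (coeff R i) * exp \<mu> ^ i < nv (coeff R i0) * exp \<mu> ^ i0" by auto
  have l0: "lead_coeff Q \<noteq> 0" using Q0 by simp
  have cR: "f (coeff \<psi> i) = lead_coeff Q * coeff R i" for i
    unfolding cQ[symmetric] by (subst A) (simp add: R_def)
  define pt where "pt i = (real i, - ln (v (coeff \<psi> i)))" for i
  \<comment> \<open>The height above a line of slope \<mu>; an edge of slope \<mu> is a set on which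
    \<open>F\<close> is constant.\<close>
  define F where "F z = snd z - \<mu> * fst z" for z :: "real \<times> real"
  have b0: "coeff \<psi> i0 \<noteq> 0" using cR[of i0] i0(1) l0 field_hom_eq_0_iff[OF f, of "coeff \<psi> i0"] by simp
  have dom: "F (pt i) > F (pt i0)" if i: "i \<noteq> i0" "coeff \<psi> i \<noteq> 0" for i
  proof -
    have vp: "v (coeff \<psi> j) > 0" if "coeff \<psi> j \<noteq> 0" for j
      unfolding v using that field_hom_eq_0_iff[OF f] by (intro nv_pos) simp
    have "nv (lead_coeff Q) * (nv (coeff R i) * exp \<mu> ^ i) < nv (lead_coeff Q) * (nv (coeff R i0) * exp \<mu> ^ i0)"
      using i0(2)[OF i(1)] nv_pos[OF l0] by (intro mult_strict_left_mono)
    hence "v (coeff \<psi> i) * exp (\<mu> * real i) < v (coeff \<psi> i0) * exp (\<mu> * real i0)"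
      by (simp add: v cR nv_mult exp_of_nat2_mult)
    hence "ln (v (coeff \<psi> i) * exp (\<mu> * real i)) < ln (v (coeff \<psi> i0) * exp (\<mu> * real i0))"
      using vp[OF i(2)] vp[OF b0] by (subst ln_less_cancel_iff) auto
    thus ?thesis using vp[OF i(2)] vp[OF b0] by (simp add: F_def pt_def ln_mult_pos)
  qed
  define H where "H = convex hull {(real i, - ln (v (coeff \<psi> i))) |i. coeff \<psi> i \<noteq> 0}"
  define V where "V = pt i0"
  have VH: "V \<in> H" unfolding H_def V_def pt_def using b0 by (intro hull_inc) blast
  have H: "z = V \<or> F z > F V" if "z \<in> H" for z
  proof -
    \<comment> \<open>An open half-plane stays convex when a single boundary point is added, so the
      hull has \<open>V\<close> as its unique minimum of \<open>F\<close>.\<close>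
    have "convex ({V} \<union> {z. F z > F V})"
    proof (rule convexI)
      fix x y :: "real \<times> real" and a b :: real
      assume xy: "x \<in> {V} \<union> {z. F z > F V}" "y \<in> {V} \<union> {z. F z > F V}" and ab: "0 \<le> a" "0 \<le> b" "a + b = 1"
      have Fl: "F (a *\<^sub>R x + b *\<^sub>R y) = a * F x + b * F y" by (simp add: F_def algebra_simps)
      have FV: "F V = a * F V + b * F V" using ab by (metis distrib_right mult_1)
      consider "a = 0" | "b = 0" | "x = V" "y = V" | "a > 0" "b > 0" "F x > F V \<or> F y > F V" "F x \<ge> F V" "F y \<ge> F V"
        using xy ab by fastforce
      thus "a *\<^sub>R x + b *\<^sub>R y \<in> {V} \<union> {z. F z > F V}"
      proof cases
        case 3
        thus ?thesis using ab by (metis UnCI insertI1 scaleR_add_left scaleR_one)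
      next
        case 4
        have "a * F V \<le> a * F x" "b * F V \<le> b * F y" using 4 by (auto intro: mult_left_mono)
        moreover have "a * F V < a * F x \<or> b * F V < b * F y" using 4 by auto
        ultimately have "F (a *\<^sub>R x + b *\<^sub>R y) > F V" using Fl FV by linarith
        thus ?thesis by simp
      qed (use xy ab in auto)
    qed
    moreover have "{(real i, - ln (v (coeff \<psi> i))) |i. coeff \<psi> i \<noteq> 0} \<subseteq> {V} \<union> {z. F z > F V}"
    proof
      fix z assume "z \<in> {(real i, - ln (v (coeff \<psi> i))) |i. coeff \<psi> i \<noteq> 0}"
      then obtain i where "z = pt i" "coeff \<psi> i \<noteq> 0" by (auto simp: pt_def)
      thus "z \<in> {V} \<union> {z. F z > F V}" using dom[of i] by (cases "i = i0") (auto simp: V_def)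
    qed
    ultimately have "H \<subseteq> {V} \<union> {z. F z > F V}" unfolding H_def by (intro hull_minimal)
    thus ?thesis using that by auto
  qed
  from mu obtain x1 y1 x2 y2 where s: "\<mu> = (y2 - y1) / (x2 - x1)" "x1 < x2"
    "closed_segment (x1, y1) (x2, y2) \<subseteq> newton_polygon v \<psi>" by (auto simp: newton_slopes_def)
  have NP: "newton_polygon v \<psi> = {(x, y) \<in> H. \<forall>y'. (x, y') \<in> H \<longrightarrow> y \<le> y'}"
    by (simp add: newton_polygon_def H_def Let_def)
  have y2: "y2 = y1 + \<mu> * (x2 - x1)" using s by (simp add: field_simps)
  define c where "c = F (x1, y1)"
  have c2: "F (x2, y2) = c" by (simp add: c_def F_def y2 algebra_simps)
  have e: "(x1, y1) \<in> H" "(x2, y2) \<in> H" using s(3) by (auto simp: NP)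
  have cV: "c > F V" using H[OF e(1)] H[OF e(2)] c2 s(2) by (auto simp: c_def)
  have low: "F (x, y) \<ge> c" if x: "x1 \<le> x" "x \<le> x2" "(x, y) \<in> H" for x y
  proof -
    define t where "t = (x - x1) / (x2 - x1)"
    have t: "0 \<le> t" "t \<le> 1" using x s(2) by (auto simp: t_def)
    have tx: "t * (x2 - x1) = x - x1" using s(2) by (simp add: t_def)
    have "(x, y1 + \<mu> * (x - x1)) = (1 - t) *\<^sub>R (x1, y1) + t *\<^sub>R (x2, y2)"
      using tx by (simp add: y2 algebra_simps) (metis add_diff_cancel_left' add_diff_eq mult.left_commute right_diff_distrib')
    hence "(x, y1 + \<mu> * (x - x1)) \<in> closed_segment (x1, y1) (x2, y2)" using t by (auto simp: closed_segment_def)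
    hence "y1 + \<mu> * (x - x1) \<le> y" using s(3) x(3) by (auto simp: NP)
    thus ?thesis by (simp add: c_def F_def algebra_simps)
  qed
  obtain a b where ab: "V = (a, b)" by fastforce
  have cvx: "convex H" unfolding H_def by (rule convex_convex_hull)
  have comb: "((1 - t) * x + t * a, (1 - t) * y + t * b) \<in> H" if "(x, y) \<in> H" "0 \<le> t" "t \<le> 1" for x y t
    using convexD[OF cvx that(1) VH, of "1 - t" t] that ab by simp
  \<comment> \<open>Moving from a point of the edge towards \<open>V\<close> lowers \<open>F\<close>
    strictly. If the abscissa is still between \<open>x1\<close> and \<open>x2\<close>, the point
    reached lies in the hull below the edge.\<close>
  have bad: False if xy: "(x, y) \<in> H" "F (x, y) = c" and t: "0 < t" "t \<le> 1"
    and r: "x1 \<le> (1 - t) * x + t * a" "(1 - t) * x + t * a \<le> x2" for x y t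
  proof -
    have "c \<le> F ((1 - t) * x + t * a, (1 - t) * y + t * b)" using low[OF r comb[OF xy(1)]] t by auto
    also have "\<dots> = (1 - t) * F (x, y) + t * F V" by (simp add: F_def ab algebra_simps)
    also have "\<dots> = c - t * (c - F V)" using xy by (simp add: algebra_simps)
    also have "\<dots> < c" using t cV by simp
    finally show False by simp
  qed
  consider "a \<le> x1" | "x1 < a" "a < x2" | "a \<ge> x2" by linarith
  thus False
  proof cases
    case 1
    \<comment> \<open>The parameter at which the segment from the right end point to
      \<open>V\<close> lies above \<open>x1\<close>; the third case is symmetric.\<close>
    define t where "t = (x2 - x1) / (x2 - a)"
    have t: "0 < t" "t \<le> 1" using 1 s(2) by (auto simp: t_def)
    have "t * (x2 - a) = x2 - x1" using 1 s(2) by (simp add: t_def)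
    hence "(1 - t) * x2 + t * a = x1" by (simp add: algebra_simps)
    thus False using bad[OF e(2) c2 t] s(2) by simp
  next
    case 2
    thus False using bad[OF e(1) c_def[symmetric], of 1] by simp
  next
    case 3
    define t where "t = (x2 - x1) / (a - x1)"
    have t: "0 < t" "t \<le> 1" using 3 s(2) by (auto simp: t_def)
    have "t * (a - x1) = x2 - x1" using 3 s(2) by (simp add: t_def)
    hence "(1 - t) * x1 + t * a = x2" by (simp add: algebra_simps)
    thus False using bad[OF e(1) c_def[symmetric] t] s(2) by simp
  qed
qed

text \<open>Elements whose values lie in different cosets are linearly independent over the
  rationals: the terms of a relation would have pairwise distinct values, so that their sum could
  not vanish.\<close>

lemma finite_cosets:
  fixes v :: "'k::number_field \<Rightarrow> real"
  assumes "padic_absval v p"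
  shows "finite (padic_absval.coset p ` value_group UNIV v)"
proof (rule ccontr)
  interpret padic_absval v p by fact
  interpret VS: vector_space "\<lambda>(q::rat) (x::'k). of_rat q * x" by (rule rat_vector_space)
  obtain B :: "'k set" where B: "finite B" "\<And>x. \<exists>c::'k \<Rightarrow> rat. x = (\<Sum>b\<in>B. of_rat (c b) * b)"
    using finite_dim_over_rat by blast
  have sp: "x \<in> VS.span B" for x
  proof -
    obtain c :: "'k \<Rightarrow> rat" where "x = (\<Sum>b\<in>B. of_rat (c b) * b)" using B(2) by blast
    thus ?thesis by (simp only:) (intro VS.span_sum VS.span_scale VS.span_base)
  qed
  assume "infinite (coset ` value_group UNIV v)"
  then obtain C where C: "finite C" "card C = Suc (card B)" "C \<subseteq> coset ` value_group UNIV v"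
    using infinite_arbitrarily_large by blast
  have "\<forall>c\<in>C. \<exists>t. t \<noteq> 0 \<and> coset (v t) = c" using C(3) by (auto simp: value_group_def)
  from bchoice[OF this] obtain r where r: "\<And>c. c \<in> C \<Longrightarrow> r c \<noteq> 0 \<and> coset (v (r c)) = c" by blast
  have inj: "inj_on r C" by (rule inj_onI) (metis r)
  have ind: "VS.independent (r ` C)"
  proof (rule VS.independent_if_scalars_zero)
    show "finite (r ` C)" using C by simp
    fix u :: "'k \<Rightarrow> rat" and x assume s: "(\<Sum>x\<in>r ` C. of_rat (u x) * x) = 0" and x: "x \<in> r ` C"
    show "u x = 0"
    proof (rule ccontr)
      assume ux: "u x \<noteq> 0"
      let ?I = "{y \<in> r ` C. u y \<noteq> 0}"
      have "(\<Sum>x\<in>?I. of_rat (u x) * x) = (\<Sum>x\<in>r ` C. of_rat (u x) * x)"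
        using C(1) by (intro sum.mono_neutral_left) auto
      hence s0: "(\<Sum>x\<in>?I. of_rat (u x) * x) = 0" using s by simp
      have cs: "coset (v (of_rat (u y) * y)) = coset (v y)" if "u y \<noteq> 0" for y
      proof -
        from nv_of_rat_value[OF that] obtain k :: int where "v (of_rat (u y)) = real p powi k" by auto
        thus ?thesis using coset_scale[of "v y" k] by (simp add: nv_mult mult.commute)
      qed
      have "inj_on (\<lambda>y. v (of_rat (u y) * y)) ?I"
      proof (rule inj_onI)
        fix y z assume yz: "y \<in> ?I" "z \<in> ?I" "v (of_rat (u y) * y) = v (of_rat (u z) * z)"
        hence "coset (v y) = coset (v z)" using cs[of y] cs[of z] by simp
        thus "y = z" using yz r by auto
      qed
      moreover have "x \<in> ?I" using x ux by simp
      ultimately obtain i where "i \<in> ?I" "v (\<Sum>x\<in>?I. of_rat (u x) * x) = v (of_rat (u i) * i)"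
        using nv_sum_distinct[of ?I "\<lambda>x. of_rat (u x) * x"] C(1) by auto
      moreover from this r have "of_rat (u i) * i \<noteq> 0" by auto
      ultimately show False using s0 by (simp add: nv_eq_0_iff)
    qed
  qed
  have "card (r ` C) \<le> card B"
    using VS.independent_span_bound[OF B(1) ind] sp by auto
  thus False using C(2) card_image[OF inj] by simp
qed

text \<open>Multiplication by \<open>v c\<close> permutes the cosets of the value group of the rationals; comparing the products of
  coset representatives shows that \<open>v c ^ e\<close> is an integral power of \<open>p\<close>.\<close>

lemma ln_value_multiple:
  fixes v :: "'k::number_field \<Rightarrow> real"
  assumes "padic_absval v p" and c: "c \<noteq> 0"
  shows "ram_index_over_rat p UNIV v > 0 \<and>
    (\<exists>k::int. ln (v c) = ln (real p) / real (ram_index_over_rat p UNIV v) * of_int k)"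
proof -
  interpret padic_absval v p by fact
  define G where "G = value_group UNIV v"
  define K where "K = coset ` G"
  define e where "e = ram_index_over_rat p UNIV v"
  have eK: "e = card K" by (simp add: e_def ram_index_eq K_def G_def)
  have fK: "finite K" unfolding K_def G_def by (rule finite_cosets[OF assms(1)])
  define g where "g = v c"
  have gG: "g \<in> G" using c by (simp add: G_def g_def value_group_def)
  have e0: "e > 0" unfolding eK using fK gG by (auto simp: card_gt_0_iff K_def)
  have pos: "x > 0" if "x \<in> G" for x using that nv_pos by (auto simp: G_def value_group_def)
  have mult: "x * y \<in> G" if "x \<in> G" "y \<in> G" for x y
    using that by (auto simp: G_def value_group_def nv_mult[symmetric])
  have "\<forall>x\<in>K. \<exists>s. s \<in> G \<and> coset s = x" by (auto simp: K_def)
  from bchoice[OF this] obtain s where s: "\<And>x. x \<in> K \<Longrightarrow> s x \<in> G \<and> coset (s x) = x" by blast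
  \<comment> \<open>The permutation of cosets induced by multiplication with \<open>g\<close>. When
    logarithms are summed over all cosets the representatives cancel, leaving
    \<open>e * ln g\<close> as an integral multiple of \<open>ln p\<close>.\<close>
  define f where "f x = coset (g * s x)" for x
  have fin: "f ` K \<subseteq> K" using s gG mult by (auto simp: f_def K_def)
  have "inj_on f K"
  proof (rule inj_onI)
    fix x y assume xy: "x \<in> K" "y \<in> K" "f x = f y"
    from coset_eqD[OF this(3)[unfolded f_def]] obtain k :: int where "g * s y = g * s x * real p powi k" by auto
    hence "s y = s x * real p powi k" using pos[OF gG] by simp
    hence "coset (s y) = coset (s x)" by (simp add: coset_scale)
    thus "x = y" using s xy by simp
  qed
  hence bij: "bij_betw f K K" using fin fK by (simp add: bij_betw_def endo_inj_surj)
  have "\<forall>x\<in>K. \<exists>k::int. g * s x = s (f x) * real p powi k"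
  proof
    fix x assume x: "x \<in> K"
    hence "f x \<in> K" using fin by auto
    hence "coset (s (f x)) = coset (g * s x)" using s by (simp add: f_def)
    from coset_eqD[OF this] show "\<exists>k::int. g * s x = s (f x) * real p powi k" .
  qed
  from bchoice[OF this] obtain k where k: "\<And>x. x \<in> K \<Longrightarrow> g * s x = s (f x) * real p powi (k x)" by blast
  have pp: "real p > 0" using p_gt_1 by simp
  have lk: "ln g + ln (s x) = ln (s (f x)) + of_int (k x) * ln (real p)" if x: "x \<in> K" for x
  proof -
    have fx: "f x \<in> K" using fin x by auto
    have 1: "s x > 0" "s (f x) > 0" "g > 0" using s[OF x] s[OF fx] pos gG by auto
    have "ln (g * s x) = ln (s (f x) * real p powi (k x))" using k[OF x] by simp
    thus ?thesis using 1 pp by (simp add: ln_mult_pos powr_real_of_int'[symmetric] ln_powr)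
  qed
  have "(\<Sum>x\<in>K. ln g + ln (s x)) = (\<Sum>x\<in>K. ln (s (f x)) + of_int (k x) * ln (real p))"
    by (intro sum.cong refl lk)
  moreover have "(\<Sum>x\<in>K. ln (s (f x))) = (\<Sum>x\<in>K. ln (s x))" by (rule sum.reindex_bij_betw[OF bij])
  ultimately have "real e * ln g = of_int (\<Sum>x\<in>K. k x) * ln (real p)"
    by (simp add: sum.distrib eK sum_distrib_right)
  hence "ln g = ln (real p) / real e * of_int (\<Sum>x\<in>K. k x)" using e0 by (simp add: field_simps)
  thus ?thesis using e0 unfolding g_def e_def by blast
qed

lemma slope_gap:
  fixes v :: "'k::number_field \<Rightarrow> real"
  assumes v: "padic_absval v p"
    and mu: "\<mu> \<notin> range (\<lambda>k::int. ln (real p) / real (ram_index_over_rat p UNIV v) * of_int k)"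
  obtains \<gamma> where "\<gamma> > 0" "\<And>c. c \<noteq> 0 \<Longrightarrow> \<bar>ln (v c) - \<mu>\<bar> \<ge> \<gamma>"
proof -
  interpret padic_absval v p by fact
  define u where "u = ln (real p) / real (ram_index_over_rat p UNIV v)"
  have u: "u > 0" using ln_value_multiple[OF v, of 1] p_gt_1 by (simp add: u_def)
  define x where "x = \<mu> / u"
  have xm: "\<mu> = u * x" using u by (simp add: x_def)
  have xi: "x \<noteq> of_int k" for k using mu xm unfolding u_def[symmetric] by blast
  define \<delta> where "\<delta> = min (x - of_int \<lfloor>x\<rfloor>) (of_int \<lfloor>x\<rfloor> + 1 - x)"
  have d: "\<delta> > 0" using xi[of "\<lfloor>x\<rfloor>"] floor_correct[of x] by (auto simp: \<delta>_def less_le)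
  have dk: "\<bar>of_int k - x\<bar> \<ge> \<delta>" for k
  proof (cases "k \<le> \<lfloor>x\<rfloor>")
    case True
    hence "real_of_int k \<le> of_int \<lfloor>x\<rfloor>" by simp
    thus ?thesis by (simp add: \<delta>_def)
  next
    case False
    hence "real_of_int k \<ge> of_int \<lfloor>x\<rfloor> + 1" by linarith
    thus ?thesis by (simp add: \<delta>_def)
  qed
  show ?thesis
  proof (rule that[of "u * \<delta>"])
    show "u * \<delta> > 0" using u d by simp
    fix c :: 'k assume "c \<noteq> 0"
    then obtain k :: int where "ln (v c) = u * of_int k" using ln_value_multiple[OF v] unfolding u_def by blast
    hence "\<bar>ln (v c) - \<mu>\<bar> = u * \<bar>of_int k - x\<bar>" using u by (simp add: xm abs_mult right_diff_distrib[symmetric])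
    thus "\<bar>ln (v c) - \<mu>\<bar> \<ge> u * \<delta>" using dk[of k] u by simp
  qed
qed

text \<open>Pulled back along \<open>g\<close>, the absolute value \<open>W\<close> extends
  \<open>v\<close> to the member \<open>L\<close> of the family that contains \<beta>. Index 1 means
  that the values on \<open>L\<close> are values of \<open>v\<close>.\<close>

lemma max_unramified_value:
  fixes v :: "'k::number_field \<Rightarrow> real"
  assumes W: "padic_absval W p" and g: "g \<in> auts" and wv: "\<And>c. W (g (to_ac c)) = v c"
    and b: "\<beta> \<in> max_unramified v" "\<beta> \<noteq> 0"
  obtains c where "c \<noteq> 0" "W (g \<beta>) = v c"
proof -
  interpret padic_absval W p by fact
  have h: "field_hom g" using g by (simp add: auts_def)
  from b obtain L where L: "is_subfield L" "\<beta> \<in> L" "unramified_in v L" by (auto simp: max_unramified_def)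
  define w where "w = (\<lambda>x. W (g x))"
  have "nonarch_abs_on L w" unfolding nonarch_abs_on_def w_def
    using nv_nonneg nv_eq_0_iff nv_mult nv_ultra by (simp add: field_hom_eq_0_iff[OF h] field_hom_mult[OF h] field_hom_add[OF h])
  moreover have "\<forall>x. w (to_ac x) = v x" by (simp add: w_def wv)
  ultimately have gi: "group_index (value_group L w) (value_group UNIV v) = 1"
    using L(3) unfolding unramified_in_def by blast
  define H where "H = value_group UNIV v"
  have v1: "v 1 = 1" using wv[of 1] by (simp add: field_hom_1[OF h])
  have w1: "w 1 = 1" by (simp add: w_def field_hom_1[OF h])
  have m1: "w 1 \<in> value_group L w" and mb: "w \<beta> \<in> value_group L w"
    using L(2) b(2) is_subfield_closed(2)[OF L(1)] unfolding value_group_def by auto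
  note mem = m1[unfolded w1] mb
  have "(\<lambda>h. w \<beta> * h) ` H = (\<lambda>h. 1 * h) ` H"
  proof -
    from gi obtain Z where Z: "(\<lambda>g. (\<lambda>h. g * h) ` H) ` value_group L w = {Z}"
      unfolding group_index_def H_def by (metis card_1_singletonE)
    have "(\<lambda>h. w \<beta> * h) ` H \<in> {Z}" "(\<lambda>h. 1 * h) ` H \<in> {Z}" unfolding Z[symmetric] using mem by blast+
    thus ?thesis by simp
  qed
  moreover have "1 \<in> H" unfolding H_def value_group_def using v1 by (auto simp: image_iff intro!: exI[of _ 1])
  ultimately have "w \<beta> \<in> H" by force
  thus ?thesis using that by (auto simp: H_def value_group_def w_def)
qed

text \<open>The image stays in the same member \<open>L\<close> of the union. Orbits thus remain in
  the field, as is needed to recognise points of height zero as preperiodic.\<close>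

lemma max_unramified_poly:
  fixes v :: "'k::number_field \<Rightarrow> real"
  assumes "x \<in> max_unramified v"
  shows "poly (map_poly to_ac \<phi>) x \<in> max_unramified v"
proof -
  from assms obtain L where L: "is_subfield L" "range to_ac \<subseteq> L" "unramified_in v L" "x \<in> L"
    by (auto simp: max_unramified_def)
  note cl = is_subfield_closed[OF L(1)]
  have "poly (map_poly to_ac \<phi>) x \<in> L"
    by (induction \<phi>) (use L(2,4) in \<open>auto simp: map_poly_pCons intro!: cl\<close>)
  thus ?thesis using L by (auto simp: max_unramified_def)
qed

section \<open>The global inequality\<close>

context poly_dynamics
begin

text \<open>Conjugates over \<open>K\<close> instead of the rationals: automorphisms fixing
  \<open>K\<close> fix \<phi> and respect the gap at the chosen place.\<close>

definition K_orbit :: "'k alg_closure \<Rightarrow> 'k alg_closure set" where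
  "K_orbit \<beta> = (\<lambda>g. g \<beta>) ` {g \<in> auts. map g basis = basis}"

lemma K_orbit_subset: "K_orbit \<beta> \<subseteq> conjs \<beta>" by (auto simp: K_orbit_def conjs_def)

lemma finite_K_orbit: "finite (K_orbit \<beta>)"
  using K_orbit_subset finite_conjs by (rule finite_subset)

lemma K_orbit_self: "\<beta> \<in> K_orbit \<beta>"
  unfolding K_orbit_def using auts_id(1) by (auto simp: image_iff intro!: bexI[of _ id])

lemma K_orbit_image:
  assumes g: "g \<in> auts" "map g basis = basis" shows "g ` K_orbit \<beta> = K_orbit \<beta>"
proof (rule card_subset_eq[OF finite_K_orbit])
  show "g ` K_orbit \<beta> \<subseteq> K_orbit \<beta>"
  proof
    fix y assume "y \<in> g ` K_orbit \<beta>"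
    then obtain h where h: "h \<in> auts" "map h basis = basis" "y = (g \<circ> h) \<beta>" by (auto simp: K_orbit_def)
    have "map (g \<circ> h) basis = basis" using h(2) g(2) by (metis map_map)
    thus "y \<in> K_orbit \<beta>" using h auts_comp[OF g(1) h(1)] unfolding K_orbit_def by blast
  qed
  have "inj g" using auts_bij[OF g(1)] by (rule bij_is_inj)
  thus "card (g ` K_orbit \<beta>) = card (K_orbit \<beta>)" by (metis card_image inj_on_subset subset_UNIV)
qed

text \<open>Coset decomposition: two automorphisms with the same effect on \<open>basis\<close>
  differ by one that fixes \<open>K\<close>.\<close>

lemma card_conjs_le: "card (conjs \<beta>) \<le> card (list_orbit basis) * card (K_orbit \<beta>)"
proof -
  have "\<forall>bs\<in>list_orbit basis. \<exists>g. g \<in> auts \<and> map g basis = bs" by (auto simp: list_orbit_def)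
  from bchoice[OF this] obtain h where h: "\<And>bs. bs \<in> list_orbit basis \<Longrightarrow> h bs \<in> auts \<and> map (h bs) basis = bs" by blast
  have "conjs \<beta> \<subseteq> (\<Union>bs\<in>list_orbit basis. h bs ` K_orbit \<beta>)"
  proof
    fix y assume "y \<in> conjs \<beta>"
    then obtain g where g: "g \<in> auts" "y = g \<beta>" by (auto simp: conjs_def)
    define bs where "bs = map g basis"
    have bs: "bs \<in> list_orbit basis" using g by (auto simp: bs_def list_orbit_def)
    define u where "u = inv_into UNIV (h bs) \<circ> g"
    have b: "bij (h bs)" using h[OF bs] auts_bij by blast
    have u: "u \<in> auts" unfolding u_def using h[OF bs] g(1) by (intro auts_comp auts_inv) auto
    have "map u basis = map (inv_into UNIV (h bs)) (map (h bs) basis)"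
      using h[OF bs] by (simp add: u_def bs_def)
    also have "\<dots> = basis" using b by (simp add: bij_is_inj)
    finally have "u \<beta> \<in> K_orbit \<beta>" using u unfolding K_orbit_def by blast
    moreover have "h bs (u \<beta>) = y" using b by (simp add: u_def g(2) bij_is_surj surj_f_inv_f)
    ultimately show "y \<in> (\<Union>bs\<in>list_orbit basis. h bs ` K_orbit \<beta>)" using bs by blast
  qed
  hence "card (conjs \<beta>) \<le> card (\<Union>bs\<in>list_orbit basis. h bs ` K_orbit \<beta>)"
    by (intro card_mono finite_UN_I finite_list_orbit finite_imageI finite_K_orbit)
  also have "\<dots> \<le> (\<Sum>bs\<in>list_orbit basis. card (h bs ` K_orbit \<beta>))"
    by (rule card_UN_le[OF finite_list_orbit])
  also have "\<dots> \<le> (\<Sum>bs\<in>list_orbit basis. card (K_orbit \<beta>))"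
    by (intro sum_mono card_image_le finite_K_orbit)
  finally show ?thesis by simp
qed

lemma map_poly_P_fixed: "g \<in> auts \<Longrightarrow> map g basis = basis \<Longrightarrow> map_poly g P = P"
  by (intro poly_eqI) (simp add: P_def coeff_map_poly field_hom_0 auts_def aut_fixes_K)

text \<open>The local discriminant bounds are summed over places and averaged over automorphisms. On
  the left the product formula gives 0, on the right the local terms add up to heights.
  \<open>E\<close> enters only where \<open>g\<close> fixes \<open>K\<close>, that is with frequency
  \<open>1 / card (list_orbit basis)\<close>.\<close>

theorem global_inequality:
  fixes \<beta> k
  defines "D \<equiv> d ^ k" and "\<Psi> \<equiv> iter_poly P k" and "S \<equiv> K_orbit \<beta>"
  defines "N \<equiv> card S"
  assumes p: "prime p"
    and sav: "2 * real (floor_sum D N) * ln (av p (lead_coeff \<Psi>)) + ln (av p (dsc S)) \<le>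
      4 * real D * (\<Sum>x\<in>S. lnp (av p x)) + 4 * (real N / real D) * (\<Sum>x\<in>S. lnp (av p (poly \<Psi> x))) + E"
  shows "0 \<le> 2 * ln (fact N) + 4 * real D * (real N * hgt \<beta>) +
    4 * (real N / real D) * (real N * hgt (poly \<Psi> \<beta>)) + E / real (card (list_orbit basis))"
proof -
  have fS: "finite S" unfolding S_def by (rule finite_K_orbit)
  have D1: "D \<ge> 1" using deg by (simp add: D_def)
  have dPsi: "degree \<Psi> = D" by (simp add: \<Psi>_def D_def degree_iter_poly degree_P)
  define l where "l = lead_coeff \<Psi>"
  have l0: "l \<noteq> 0" unfolding l_def using dPsi D1 by auto
  define \<delta> where "\<delta> = dsc S"
  have d0: "\<delta> \<noteq> 0" unfolding \<delta>_def by (rule dsc_nonzero[OF fS])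
  define Y where "Y = poly \<Psi> ` S"
  have fY: "finite Y" using fS by (simp add: Y_def)
  \<comment> \<open>Everything whose images are averaged, together with \<open>basis\<close>, which
    is needed to measure how often an automorphism fixes \<open>K\<close>.\<close>
  define A where "A = {l, \<delta>} \<union> S \<union> Y \<union> set basis"
  have fA: "finite A" using fS fY by (simp add: A_def)
  obtain \<Gamma> where G: "finite \<Gamma>" "\<Gamma> \<noteq> {}" "\<Gamma> \<subseteq> auts"
    "\<And>x (f :: 'k alg_closure \<Rightarrow> real). x \<in> A \<Longrightarrow> (\<Sum>g\<in>\<Gamma>. f (g x)) / card \<Gamma> = (\<Sum>y\<in>conjs x. f y) / card (conjs x)"
    "\<And>ks. set ks \<subseteq> A \<Longrightarrow> real (card {g \<in> \<Gamma>. map g ks = ks}) / card \<Gamma> = 1 / card (list_orbit ks)"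
    by (rule galois_average_single[OF fA]) blast
  define c where "c = real (card \<Gamma>)"
  have c: "c > 0" using G(1,2) by (simp add: c_def card_gt_0_iff)
  have gh: "field_hom g" if "g \<in> \<Gamma>" for g using that G(3) by (auto simp: auts_def)
  \<comment> \<open>A finite set of rational places outside which all logarithms and all local
    heights in question vanish.\<close>
  define V where "V = {0, p} \<union> (\<Union>y\<in>conjs l \<union> conjs \<delta>. {v \<in> Pl. av v y \<noteq> 1}) \<union>
    (\<Union>x\<in>S \<union> Y. \<Union>y\<in>conjs x. {v \<in> Pl. av v y > 1})"
  have nz: "y \<noteq> 0" if "y \<in> conjs l \<union> conjs \<delta>" for y
    using that l0 d0 by (auto simp: conjs_def auts_def field_hom_eq_0_iff)
  have fV: "finite V" unfolding V_def
    using nz finite_nontrivial finite_large fS fY by (intro finite_UnI finite_UN_I finite_conjs) auto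
  have VP: "V \<subseteq> Pl" using p by (auto simp: V_def Pl_def)
  have V0: "0 \<in> V" "p \<in> V" "p \<noteq> 0" using p by (auto simp: V_def)
  define stab where "stab g \<longleftrightarrow> map g basis = basis" for g :: "'k alg_closure \<Rightarrow> 'k alg_closure"
  let ?L = "\<lambda>g v. 2 * real (floor_sum D N) * ln (av v (g l)) + ln (av v (g \<delta>))"
  let ?R = "\<lambda>g v. (if v = 0 then 2 * ln (fact N) else 0) + 4 * real D * (\<Sum>x\<in>S. lnp (av v (g x))) +
      4 * (real N / real D) * (\<Sum>x\<in>S. lnp (av v (g (poly \<Psi> x)))) + (if v = p then if stab g then E else 0 else 0)"
  have loc: "?L g v \<le> ?R g v" if g: "g \<in> \<Gamma>" and v: "v \<in> V" for g v
  proof -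
    have ga: "g \<in> auts" using g G(3) by auto
    have h: "field_hom g" by (rule gh[OF g])
    have inj: "inj_on g S" using field_hom_inj[OF h] by (rule inj_on_subset) simp
    define Q where "Q = map_poly g \<Psi>"
    have Q: "degree Q = D" "lead_coeff Q = g l" "\<And>x. poly Q (g x) = g (poly \<Psi> x)"
      using h by (simp_all add: Q_def field_hom_map_poly_degree dPsi l_def coeff_map_poly field_hom_0 field_hom_poly)
    have T: "finite (g ` S)" "card (g ` S) = N" using fS card_image[OF inj] by (auto simp: N_def)
    have ds: "g \<delta> = dsc (g ` S)" unfolding \<delta>_def by (rule dsc_hom[OF h])
    have s1: "(\<Sum>x\<in>g ` S. lnp (av v x)) = (\<Sum>x\<in>S. lnp (av v (g x)))" by (simp add: sum.reindex[OF inj])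
    have s2: "(\<Sum>x\<in>g ` S. lnp (av v (poly Q x))) = (\<Sum>x\<in>S. lnp (av v (g (poly \<Psi> x))))" by (simp add: sum.reindex[OF inj] Q(3))
    have n1: "(\<Sum>x\<in>S. lnp (av v (g x))) \<ge> 0" "(\<Sum>x\<in>S. lnp (av v (g (poly \<Psi> x)))) \<ge> 0"
      by (intro sum_nonneg lnp_nonneg)+
    \<comment> \<open>The bound at \<open>p\<close> carries the factor 4 to leave room for the
      enlarged set \<open>S\<close> with progression; elsewhere the factor 2 is weakened so that all
      places have the same shape.\<close>
    have n2: "2 * real D * (\<Sum>x\<in>S. lnp (av v (g x))) \<le> 4 * real D * (\<Sum>x\<in>S. lnp (av v (g x)))"
      "2 * (real N / real D) * (\<Sum>x\<in>S. lnp (av v (g (poly \<Psi> x)))) \<le> 4 * (real N / real D) * (\<Sum>x\<in>S. lnp (av v (g (poly \<Psi> x))))"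
      using n1 by (intro mult_right_mono; simp add: divide_right_mono)+
    consider "v = 0" | "v = p" "stab g" | "prime v" "\<not> (v = p \<and> stab g)" using v VP by (auto simp: Pl_def)
    thus ?thesis
    proof cases
      case 1
      interpret absval "av v" using av_absval v VP by blast
      show ?thesis using ln_dsc_bound[OF Q(1) D1 T] n2 V0(3) 1 unfolding Q(2) ds[symmetric] s1 s2 by simp
    next
      case 2
      have "g ` S = S" unfolding S_def using K_orbit_image[OF ga] 2 by (simp add: stab_def)
      moreover have "Q = \<Psi>" unfolding Q_def \<Psi>_def map_iter_poly[OF h]
        using map_poly_P_fixed[OF ga] 2 by (simp add: stab_def)
      ultimately have "2 * real (floor_sum D N) * ln (av p (lead_coeff Q)) + ln (av p (dsc (g ` S))) \<le>
        4 * real D * (\<Sum>x\<in>g ` S. lnp (av p x)) + 4 * (real N / real D) * (\<Sum>x\<in>g ` S. lnp (av p (poly Q x))) + E"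
        using sav by simp
      thus ?thesis using 2 V0(3) unfolding Q(2) ds[symmetric] 2(1)[symmetric] s1 s2 by simp
    next
      case 3
      interpret padic_absval "av v" v by (rule av_prime[OF 3(1)])
      have "?L g v \<le> 2 * real D * (\<Sum>x\<in>S. lnp (av v (g x))) + 2 * (real N / real D) * (\<Sum>x\<in>S. lnp (av v (g (poly \<Psi> x))))"
        using ln_dsc_bound_ultra[OF Q(1) D1 T] unfolding Q(2) ds[symmetric] s1 s2 .
      moreover have "v \<noteq> 0" using 3(1) by auto
      ultimately show ?thesis using n2 3(2) by auto
    qed
  qed
  have pf: "(\<Sum>g\<in>\<Gamma>. \<Sum>v\<in>V. ln (av v (g z))) = 0" if z: "z = l \<or> z = \<delta>" for z
  proof -
    have zA: "z \<in> A" "z \<noteq> 0" using z l0 d0 by (auto simp: A_def)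
    have "(\<Sum>g\<in>\<Gamma>. \<Sum>v\<in>V. ln (av v (g z))) / card \<Gamma> = (\<Sum>y\<in>conjs z. \<Sum>v\<in>V. ln (av v y)) / card (conjs z)"
      by (rule G(4)[OF zA(1), of "\<lambda>y. \<Sum>v\<in>V. ln (av v y)"])
    also have "(\<Sum>y\<in>conjs z. \<Sum>v\<in>V. ln (av v y)) = (\<Sum>v\<in>V. \<Sum>y\<in>conjs z. ln (av v y))" by (rule sum.swap)
    also have "\<dots> = 0" by (rule product_formula[OF zA(2) fV VP]) (use z in \<open>auto simp: V_def\<close>)
    finally show ?thesis using c by (simp add: c_def)
  qed
  have lh: "(\<Sum>g\<in>\<Gamma>. \<Sum>v\<in>V. lnp (av v (g x))) = c * hgt x" if x: "x \<in> S \<union> Y" for x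
  proof -
    have xA: "x \<in> A" using x by (auto simp: A_def)
    have "(\<Sum>g\<in>\<Gamma>. \<Sum>v\<in>V. lnp (av v (g x))) = (\<Sum>g\<in>\<Gamma>. tot (g x))"
    proof (rule sum.cong)
      fix g assume "g \<in> \<Gamma>"
      hence "g x \<in> conjs x" using G(3) conjsI by auto
      hence "{v \<in> Pl. av v (g x) > 1} \<subseteq> V" using x by (auto simp: V_def)
      from tot_eq[OF fV VP this] show "(\<Sum>v\<in>V. lnp (av v (g x))) = tot (g x)" by simp
    qed simp
    moreover have "(\<Sum>g\<in>\<Gamma>. tot (g x)) / c = hgt x" unfolding hgt_def c_def by (rule G(4)[OF xA])
    ultimately show ?thesis using c by (simp add: field_simps)
  qed
  have hS: "hgt x = hgt \<beta>" "hgt (poly \<Psi> x) = hgt (poly \<Psi> \<beta>)" if "x \<in> S" for x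
  proof -
    from that obtain g where g: "g \<in> auts" "map g basis = basis" "x = g \<beta>" by (auto simp: S_def K_orbit_def)
    show "hgt x = hgt \<beta>" using g hgt_aut by simp
    have h: "field_hom g" using g by (simp add: auts_def)
    have "poly \<Psi> x = g (poly \<Psi> \<beta>)" unfolding field_hom_poly[OF h] \<Psi>_def map_iter_poly[OF h] map_poly_P_fixed[OF g(1,2)] g(3) ..
    thus "hgt (poly \<Psi> x) = hgt (poly \<Psi> \<beta>)" using hgt_aut[OF g(1)] by simp
  qed
  have t1: "(\<Sum>g\<in>\<Gamma>. \<Sum>v\<in>V. \<Sum>x\<in>S. lnp (av v (g x))) = c * (real N * hgt \<beta>)"
  proof -
    have "(\<Sum>g\<in>\<Gamma>. \<Sum>v\<in>V. \<Sum>x\<in>S. lnp (av v (g x))) = (\<Sum>x\<in>S. \<Sum>g\<in>\<Gamma>. \<Sum>v\<in>V. lnp (av v (g x)))"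
      by (simp only: sum.swap[of _ S V] sum.swap[of _ S \<Gamma>])
    also have "\<dots> = (\<Sum>x\<in>S. c * hgt \<beta>)" by (intro sum.cong refl) (simp add: lh hS)
    finally show ?thesis by (simp add: N_def)
  qed
  have t2: "(\<Sum>g\<in>\<Gamma>. \<Sum>v\<in>V. \<Sum>x\<in>S. lnp (av v (g (poly \<Psi> x)))) = c * (real N * hgt (poly \<Psi> \<beta>))"
  proof -
    have "(\<Sum>g\<in>\<Gamma>. \<Sum>v\<in>V. \<Sum>x\<in>S. lnp (av v (g (poly \<Psi> x)))) = (\<Sum>x\<in>S. \<Sum>g\<in>\<Gamma>. \<Sum>v\<in>V. lnp (av v (g (poly \<Psi> x))))"
      by (simp only: sum.swap[of _ S V] sum.swap[of _ S \<Gamma>])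
    also have "\<dots> = (\<Sum>x\<in>S. c * hgt (poly \<Psi> \<beta>))" by (intro sum.cong refl) (simp add: lh hS Y_def)
    finally show ?thesis by (simp add: N_def)
  qed
  have t3: "(\<Sum>g\<in>\<Gamma>. \<Sum>v\<in>V. if v = 0 then 2 * ln (fact N) else (0::real)) = c * (2 * ln (fact N))"
    using fV V0 by (simp add: sum.delta' c_def)
  have t4: "(\<Sum>g\<in>\<Gamma>. \<Sum>v\<in>V. if v = p then if stab g then E else 0 else 0) = c * (E / real (card (list_orbit basis)))"
  proof -
    have "(\<Sum>g\<in>\<Gamma>. \<Sum>v\<in>V. if v = p then if stab g then E else 0 else 0) = (\<Sum>g\<in>\<Gamma>. if stab g then E else 0)"
      using fV V0 by (simp add: sum.delta')
    also have "\<dots> = real (card {g \<in> \<Gamma>. stab g}) * E" using G(1) by (simp add: sum.If_cases Int_def)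
    also have "real (card {g \<in> \<Gamma>. stab g}) = c * (1 / real (card (list_orbit basis)))"
    proof -
      have "set basis \<subseteq> A" by (auto simp: A_def)
      from G(5)[OF this] show ?thesis using c unfolding stab_def c_def by (simp add: field_simps)
    qed
    finally show ?thesis by simp
  qed
  have "(\<Sum>g\<in>\<Gamma>. \<Sum>v\<in>V. ?L g v) \<le> (\<Sum>g\<in>\<Gamma>. \<Sum>v\<in>V. ?R g v)" by (intro sum_mono loc)
  also have "(\<Sum>g\<in>\<Gamma>. \<Sum>v\<in>V. ?L g v) = 0"
    by (simp only: sum.distrib sum_distrib_left[symmetric] pf simp_thms mult_zero_right add_0)
  also have "(\<Sum>g\<in>\<Gamma>. \<Sum>v\<in>V. ?R g v) = c * (2 * ln (fact N)) + 4 * real D * (c * (real N * hgt \<beta>)) +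
    4 * (real N / real D) * (c * (real N * hgt (poly \<Psi> \<beta>))) + c * (E / real (card (list_orbit basis)))"
    by (simp only: sum.distrib sum_distrib_left[symmetric] t1 t2 t3 t4)
  also have "\<dots> = c * (2 * ln (fact N) + 4 * real D * (real N * hgt \<beta>) +
    4 * (real N / real D) * (real N * hgt (poly \<Psi> \<beta>)) + E / real (card (list_orbit basis)))"
    by (simp add: algebra_simps)
  finally show ?thesis using c by (simp add: zero_le_mult_iff)
qed

text \<open>The order of choices is what makes it work: \<open>c\<close> is independent of
  \<open>k\<close>, so \<open>k\<close> can be taken so large that the bounded height defect
  \<open>B\<close>, divided by the degree of the iterate, is small against \<open>c\<close>. The
  constant \<open>C\<close>, which depends on \<open>k\<close>, only multiplies terms linear in the
  number of conjugates.\<close>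

theorem strong_bogomolov_of_gap:
  assumes p: "prime p" and fp: "poly P \<alpha> = \<alpha>" and a0: "\<alpha> \<noteq> 0" and \<gamma>: "\<gamma> > 0"
    and mu: "ln (av p \<alpha>) \<ge> - ln (av p (lead_coeff P)) / (real d - 1)"
    and cl: "\<And>\<beta>. \<beta> \<in> L \<Longrightarrow> poly P \<beta> \<in> L"
    and gap: "\<And>\<beta> g. \<beta> \<in> L \<Longrightarrow> g \<in> auts \<Longrightarrow> map g basis = basis \<Longrightarrow>
      g \<beta> = 0 \<or> \<bar>ln (av p (g \<beta>)) - ln (av p \<alpha>)\<bar> \<ge> \<gamma>"
  shows "strong_bogomolov \<phi> L"
proof -
  interpret padic_absval "av p" p by (rule av_prime[OF p])
  have d2: "degree P \<ge> 2" using deg by (simp add: degree_P)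
  from local_saving[OF d2 fp a0 \<gamma> mu[folded degree_P], unfolded degree_P] obtain c k1 where c: "c > 0"
    and sv: "\<forall>k\<ge>k1. \<exists>C. \<forall>S. finite S \<longrightarrow> (\<forall>x\<in>S. x = 0 \<or> \<bar>ln (av p x) - ln (av p \<alpha>)\<bar> \<ge> \<gamma>) \<longrightarrow>
    2 * real (floor_sum (d ^ k) (card S)) * ln (av p (lead_coeff (iter_poly P k))) + ln (av p (dsc S)) \<le>
    4 * real (d ^ k) * (\<Sum>x\<in>S. lnp (av p x)) +
    4 * (real (card S) / real (d ^ k)) * (\<Sum>x\<in>S. lnp (av p (poly (iter_poly P k) x))) +
    C * real (card S) - c * (real (card S))\<^sup>2" by blast
  obtain B where B: "B \<ge> 0" "\<And>x. \<bar>hh (Aff x) - hgt x\<bar> \<le> B"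
    "\<And>Q. hh (poly_proj_map \<phi> Q) = real d * hh Q" "\<And>Q. hh Q \<ge> 0"
    by (rule hh_props) blast
  have hit: "hh ((poly_proj_map \<phi> ^^ m) Q) = real d ^ m * hh Q" for m Q
    by (induction m) (simp_all add: B(3))
  have ait: "(poly_proj_map \<phi> ^^ m) (Aff x) = Aff ((poly P ^^ m) x)" for m x
    by (induction m) (simp_all add: P_def)
  define n where "n = real (card (list_orbit basis))"
  have n: "n > 0" unfolding n_def using card_list_orbit_pos[of basis] by simp
  have dr: "real d > 1" using deg by simp
  \<comment> \<open>Chosen to give \<open>4 * B / D \<le> c / (4 * n)\<close>, a quarter of the
    averaged gain.\<close>
  obtain k2 where k2: "16 * n * B / c < real d ^ k2" using real_arch_pow[OF dr] by blast
  define k where "k = max k1 k2"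
  define D where "D = real d ^ k"
  have D: "D \<ge> 1" unfolding D_def using dr by (intro one_le_power) simp
  have "real d ^ k2 \<le> D" unfolding D_def k_def using dr by (intro power_increasing) auto
  hence "16 * n * B / c \<le> D" using k2 by linarith
  hence BD: "4 * B / D \<le> c / (4 * n)" using c n D by (simp add: field_simps)
  from sv[rule_format, of k] obtain C where C: "\<And>S. finite S \<Longrightarrow> (\<forall>x\<in>S. x = 0 \<or> \<bar>ln (av p x) - ln (av p \<alpha>)\<bar> \<ge> \<gamma>) \<Longrightarrow>
    2 * real (floor_sum (d ^ k) (card S)) * ln (av p (lead_coeff (iter_poly P k))) + ln (av p (dsc S)) \<le>
    4 * real (d ^ k) * (\<Sum>x\<in>S. lnp (av p x)) +
    4 * (real (card S) / real (d ^ k)) * (\<Sum>x\<in>S. lnp (av p (poly (iter_poly P k) x))) +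
    C * real (card S) - c * (real (card S))\<^sup>2" unfolding k_def by auto
  \<comment> \<open>With \<open>c / n = 16 * \<epsilon>\<close>, the height and the defect
    \<open>B / D\<close> use up at most \<open>4 * \<epsilon>\<close> each, and
    \<open>8 * \<epsilon>\<close> of the gain survives.\<close>
  define \<epsilon> where "\<epsilon> = c / (16 * n)"
  have e: "\<epsilon> > 0" using c n by (simp add: \<epsilon>_def)
  define M where "M = (4 * D * (\<epsilon> + B) + \<bar>C\<bar> / n + 2 * \<bar>ln (2 * \<epsilon>)\<bar>) / (4 * \<epsilon>)"
  have bound: "real (card (K_orbit \<beta>)) \<le> M" if b: "\<beta> \<in> L" and hb: "hh (Aff \<beta>) < \<epsilon>" for \<beta>
  proof -
    define N where "N = real (card (K_orbit \<beta>))"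
    define h where "h = hh (Aff \<beta>)"
    have N: "N \<ge> 1" unfolding N_def using K_orbit_self[of \<beta>] finite_K_orbit[of \<beta>]
      by (metis One_nat_def Suc_leI card_gt_0_iff empty_iff of_nat_1 of_nat_le_iff)
    have gp: "\<forall>x\<in>K_orbit \<beta>. x = 0 \<or> \<bar>ln (av p x) - ln (av p \<alpha>)\<bar> \<ge> \<gamma>" using gap[OF b] by (auto simp: K_orbit_def)
    from C[OF finite_K_orbit gp]
    have "2 * real (floor_sum (d ^ k) (card (K_orbit \<beta>))) * ln (av p (lead_coeff (iter_poly P k))) + ln (av p (dsc (K_orbit \<beta>))) \<le>
      4 * real (d ^ k) * (\<Sum>x\<in>K_orbit \<beta>. lnp (av p x)) +
      4 * (real (card (K_orbit \<beta>)) / real (d ^ k)) * (\<Sum>x\<in>K_orbit \<beta>. lnp (av p (poly (iter_poly P k) x))) + (C * N - c * N\<^sup>2)"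
      by (simp add: N_def)
    from global_inequality[OF p this]
    have gi: "0 \<le> 2 * ln (fact (card (K_orbit \<beta>))) + 4 * D * (N * hgt \<beta>) +
      4 * (N / D) * (N * hgt ((poly P ^^ k) \<beta>)) + (C * N - c * N\<^sup>2) / n"
      by (simp add: N_def D_def n_def poly_iter_poly)
    have lf: "ln (fact (card (K_orbit \<beta>))) \<le> N * ln N"
    proof -
      have "(fact (card (K_orbit \<beta>)) :: real) \<le> real (card (K_orbit \<beta>) ^ card (K_orbit \<beta>))"
        using fact_le_power[of "card (K_orbit \<beta>)"] by (metis fact_le_power le_refl of_nat_fact of_nat_le_iff)
      hence "ln (fact (card (K_orbit \<beta>))) \<le> ln (N ^ card (K_orbit \<beta>))"
        using N unfolding N_def of_nat_power by (subst ln_le_cancel_iff) auto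
      thus ?thesis using N by (simp add: ln_realpow N_def)
    qed
    have h1: "hgt \<beta> \<le> \<epsilon> + B" using B(2)[of \<beta>] hb by linarith
    have h2: "hgt ((poly P ^^ k) \<beta>) \<le> D * h + B"
      using B(2)[of "(poly P ^^ k) \<beta>"] hit[of k "Aff \<beta>"] unfolding ait D_def h_def by linarith
    have "4 * D * (N * hgt \<beta>) \<le> 4 * D * (N * (\<epsilon> + B))" using h1 N D by (intro mult_left_mono) auto
    moreover have "4 * (N / D) * (N * hgt ((poly P ^^ k) \<beta>)) \<le> 4 * (N / D) * (N * (D * h + B))"
      using h2 N D by (intro mult_left_mono) auto
    ultimately have "0 \<le> 2 * (N * ln N) + 4 * D * (N * (\<epsilon> + B)) + 4 * (N / D) * (N * (D * h + B)) + (C * N - c * N\<^sup>2) / n"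
      using gi lf by linarith
    also have "\<dots> = N * (2 * ln N + 4 * D * (\<epsilon> + B) + C / n + N * (4 * h + 4 * B / D - c / n))"
    proof -
      have "(D * h + B) / D = h + B / D" using D by (simp add: add_divide_distrib)
      note q = this
      have "4 * (N / D) * (N * (D * h + B)) = N * (N * (4 * ((D * h + B) / D)))"
        by (simp only: divide_inverse mult_ac)
      also have "\<dots> = N * (N * (4 * h + 4 * B / D))" unfolding q by (simp only: distrib_left times_divide_eq_right)
      finally have E1: "4 * (N / D) * (N * (D * h + B)) = N * (N * (4 * h + 4 * B / D))" .
      have E2: "(C * N - c * N\<^sup>2) / n = N * (C / n) - N * (N * (c / n))"
        by (simp add: diff_divide_distrib power2_eq_square mult_ac)
      have E3: "N * (2 * ln N + 4 * D * (\<epsilon> + B) + C / n + N * (4 * h + 4 * B / D - c / n)) =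
        2 * (N * ln N) + 4 * D * (N * (\<epsilon> + B)) + N * (C / n) + N * (N * (4 * h + 4 * B / D)) - N * (N * (c / n))"
        by (simp only: distrib_left right_diff_distrib) (simp only: mult_ac add_ac diff_conv_add_uminus)
      show ?thesis unfolding E1 E2 E3 by (simp only: diff_conv_add_uminus add_ac)
    qed
    finally have main: "0 \<le> 2 * ln N + 4 * D * (\<epsilon> + B) + C / n + N * (4 * h + 4 * B / D - c / n)"
      using N by (simp add: zero_le_mult_iff)
    have "4 * h + 4 * B / D - c / n \<le> - (8 * \<epsilon>)"
    proof -
      have "c / n = 16 * \<epsilon>" "c / (4 * n) = 4 * \<epsilon>" using n by (simp_all add: \<epsilon>_def field_simps)
      thus ?thesis using BD hb unfolding h_def by linarith
    qed
    hence 1: "N * (4 * h + 4 * B / D - c / n) \<le> N * (- (8 * \<epsilon>))" using N by (intro mult_left_mono) auto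
    \<comment> \<open>The factorial leaves \<open>2 * ln N\<close>; this estimate charges it against
      half of the surviving \<open>8 * \<epsilon> * N\<close>.\<close>
    have "ln (2 * \<epsilon> * N) \<le> 2 * \<epsilon> * N - 1" using e N by (intro ln_le_minus_one) auto
    hence 2: "ln N \<le> 2 * (\<epsilon> * N) + \<bar>ln (2 * \<epsilon>)\<bar>" using e N by (simp add: ln_mult_pos)
    have 3: "C / n \<le> \<bar>C\<bar> / n" using n by (intro divide_right_mono) auto
    have "N * (4 * \<epsilon>) \<le> 4 * D * (\<epsilon> + B) + \<bar>C\<bar> / n + 2 * \<bar>ln (2 * \<epsilon>)\<bar>"
    proof -
      have "N * (- (8 * \<epsilon>)) = - 8 * (\<epsilon> * N)" "N * (4 * \<epsilon>) = 4 * (\<epsilon> * N)" by simp_all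
      thus ?thesis using main 1 2 3 by linarith
    qed
    thus ?thesis using e unfolding M_def N_def[symmetric] by (simp add: pos_le_divide_eq)
  qed
  define Z where "Z = {\<beta> \<in> L. hh (Aff \<beta>) < \<epsilon>}"
  have fZ: "finite Z"
  proof (rule finite_subset)
    show "Z \<subseteq> {x. card (conjs x) \<le> nat \<lfloor>n * M\<rfloor> \<and> hgt x \<le> \<epsilon> + B}"
    proof
      fix x assume x: "x \<in> Z"
      have "real (card (conjs x)) \<le> n * real (card (K_orbit x))"
        using card_conjs_le[of x] unfolding n_def by (metis of_nat_le_iff of_nat_mult)
      also have "\<dots> \<le> n * M" using bound[of x] x n by (intro mult_left_mono) (auto simp: Z_def)
      finally have "card (conjs x) \<le> nat \<lfloor>n * M\<rfloor>" by (simp add: le_nat_floor)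
      moreover have "hgt x \<le> \<epsilon> + B" using B(2)[of x] x by (simp add: Z_def abs_le_iff)
      ultimately show "x \<in> {x. card (conjs x) \<le> nat \<lfloor>n * M\<rfloor> \<and> hgt x \<le> \<epsilon> + B}" by simp
    qed
  qed (rule northcott)
  have pre0: "hh Q = 0" if pre: "preperiodic (poly_proj_map \<phi>) Q" for Q
  proof (rule ccontr)
    assume h: "hh Q \<noteq> 0"
    have "inj (\<lambda>m. (poly_proj_map \<phi> ^^ m) Q)"
    proof (rule injI)
      fix i j assume "(poly_proj_map \<phi> ^^ i) Q = (poly_proj_map \<phi> ^^ j) Q"
      hence "real d ^ i * hh Q = real d ^ j * hh Q" by (metis hit)
      thus "i = j" using h dr by (simp add: power_inject_exp)
    qed
    thus False using pre unfolding preperiodic_def using finite_imageD infinite_UNIV_nat by blast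
  qed
  have cit: "(poly P ^^ m) \<beta> \<in> L" if "\<beta> \<in> L" for m \<beta> using that by (induction m) (auto simp: cl)
  \<comment> \<open>The orbit of a point of height zero consists of points of \<open>L\<close> of
    height zero, all of which belong to the finite set \<open>Z\<close>.\<close>
  have pos: "hh (Aff \<beta>) > 0" if b: "\<beta> \<in> L" "\<not> preperiodic (poly_proj_map \<phi>) (Aff \<beta>)" for \<beta>
  proof (rule ccontr)
    assume "\<not> hh (Aff \<beta>) > 0"
    hence h0: "hh (Aff \<beta>) = 0" using B(4)[of "Aff \<beta>"] by simp
    have "(poly_proj_map \<phi> ^^ m) (Aff \<beta>) \<in> Aff ` Z" for m
      using hit[of m "Aff \<beta>"] e cit[OF b(1), of m] unfolding ait h0 by (auto simp: Z_def)
    hence "range (\<lambda>m. (poly_proj_map \<phi> ^^ m) (Aff \<beta>)) \<subseteq> Aff ` Z" by blast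
    hence "preperiodic (poly_proj_map \<phi>) (Aff \<beta>)" unfolding preperiodic_def using fZ finite_subset by blast
    thus False using b(2) by simp
  qed
  have infty: "preperiodic (poly_proj_map \<phi>) Infty"
  proof -
    have "(poly_proj_map \<phi> ^^ m) Infty = Infty" for m by (induction m) auto
    hence "range (\<lambda>m. (poly_proj_map \<phi> ^^ m) Infty) \<subseteq> {Infty}" by auto
    thus ?thesis unfolding preperiodic_def using finite_subset by blast
  qed
  \<comment> \<open>Including \<epsilon> keeps the set nonempty and bounds the heights of the points
    outside \<open>Z\<close> as well.\<close>
  define T where "T = insert \<epsilon> ((\<lambda>\<beta>. hh (Aff \<beta>)) ` {\<beta> \<in> Z. \<not> preperiodic (poly_proj_map \<phi>) (Aff \<beta>)})"
  have fT: "finite T" "T \<noteq> {}" using fZ by (auto simp: T_def)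
  have Tp: "Min T > 0" using fT e pos by (subst Min_gr_iff) (auto simp: T_def Z_def)
  have low: "hh Q \<ge> Min T" if Q: "Q \<in> proj_points L" "\<not> preperiodic (poly_proj_map \<phi>) Q" for Q
  proof -
    from Q infty obtain \<beta> where b: "\<beta> \<in> L" "Q = Aff \<beta>" by (auto simp: proj_points_def)
    show ?thesis
    proof (cases "\<beta> \<in> Z")
      case True
      hence "hh Q \<in> T" using b Q by (auto simp: T_def)
      thus ?thesis using fT by simp
    next
      case False
      hence "hh Q \<ge> \<epsilon>" using b by (simp add: Z_def)
      moreover have "Min T \<le> \<epsilon>" using fT by (simp add: T_def)
      ultimately show ?thesis by simp
    qed
  qed
  have "{Q \<in> proj_points L. preperiodic (poly_proj_map \<phi>) Q} \<subseteq> insert Infty (Aff ` Z)"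
    using pre0 e by (auto simp: proj_points_def Z_def)
  hence fin: "finite {Q \<in> proj_points L. preperiodic (poly_proj_map \<phi>) Q}" using fZ finite_subset by blast
  show ?thesis unfolding strong_bogomolov_def canonical_height_eq using Tp low fin by blast
qed

end

theorem theorem1p11:
  fixes v :: "'k::number_field \<Rightarrow> real" and p :: nat and \<phi> :: "'k poly"
  assumes "finite_place p UNIV v"
    and "Polynomial.degree \<phi> \<ge> 2"
    and "poly \<phi> 0 \<noteq> 0"
    and "\<exists>\<mu>\<in>newton_slopes v (\<phi> - [:0, 1:]).
           \<mu> \<notin> range (\<lambda>k::int. ln (real p) / real (ram_index_over_rat p UNIV v) * of_int k) \<and>
           \<mu> \<ge> - ln (v (Polynomial.lead_coeff \<phi>)) / (real (Polynomial.degree \<phi>) - 1)"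
  shows "strong_bogomolov \<phi> (max_unramified v)"
proof -
  have pr: "prime p" using assms(1) by (simp add: finite_place_def)
  obtain W where W: "padic_absval W p" "\<And>c. W (to_ac c) = v c"
    by (rule place_extension[OF field_hom_to_ac assms(1)]) blast
  have "\<forall>q\<in>{q::nat. prime q}. \<exists>w::'k alg_closure \<Rightarrow> real. padic_absval w q"
    using place_extension[OF field_hom_of_rat_hom finite_place_rat] by (metis mem_Collect_eq)
  from bchoice[OF this] obtain w where w: "\<And>q. prime q \<Longrightarrow> padic_absval (w q :: 'k alg_closure \<Rightarrow> real) q" by blast
  obtain \<iota> :: "'k alg_closure \<Rightarrow> complex" where iota: "field_hom \<iota>" by (rule exists_complex_embedding)
  \<comment> \<open>At \<open>p\<close> the extension of \<open>v\<close> is prescribed; at other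
    primes any extension may be taken, since by \<open>std_height_eq\<close> the height is
    independent of the choice.\<close>
  define av where "av q = (if q = 0 then (\<lambda>x. cmod (\<iota> x)) else if q = p then W else w q)" for q :: nat
  have p0: "p \<noteq> 0" using pr by auto
  have avp: "av p = W" using p0 by (simp add: av_def)
  interpret poly_dynamics av \<iota> \<phi>
  proof (intro poly_dynamics.intro global_places.intro poly_dynamics_axioms.intro)
    show "field_hom \<iota>" by (rule iota)
    show "av 0 x = cmod (\<iota> x)" for x by (simp add: av_def)
    show "padic_absval (av q) q" if "prime q" for q using that W(1) w by (auto simp: av_def)
    show "degree \<phi> \<ge> 2" by (rule assms(2))
  qed
  interpret WV: padic_absval W p by (rule W(1))
  have vp: "padic_absval v p"
  proof -
    interpret ultra_absval v using assms(1) by (intro nonarch_abs_on_UNIV) (simp add: finite_place_def)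
    show ?thesis by unfold_locales (use pr assms(1) in \<open>auto simp: finite_place_def\<close>)
  qed
  from assms(4) obtain \<mu> where mu: "\<mu> \<in> newton_slopes v (\<phi> - [:0, 1:])"
    "\<mu> \<notin> range (\<lambda>k::int. ln (real p) / real (ram_index_over_rat p UNIV v) * of_int k)"
    "\<mu> \<ge> - ln (v (lead_coeff \<phi>)) / (real (degree \<phi>) - 1)" by blast
  obtain \<gamma> where g: "\<gamma> > 0" "\<And>c. c \<noteq> 0 \<Longrightarrow> \<bar>ln (v c) - \<mu>\<bar> \<ge> \<gamma>"
    by (rule slope_gap[OF vp mu(2)]) blast
  have "\<phi> - [:0, 1:] \<noteq> 0"
  proof
    assume "\<phi> - [:0, 1:] = 0"
    hence "\<phi> = [:0, 1:]" by simp
    thus False using assms(2) by simp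
  qed
  moreover have "\<exists>A. q = smult (lead_coeff q) (\<Prod>x\<in>#A. [:- x, 1:])" if "q \<noteq> 0" for q :: "'k alg_closure poly"
    using alg_closed_imp_factorization[OF that] by metis
  ultimately obtain \<alpha> where \<alpha>: "poly (map_poly to_ac (\<phi> - [:0, 1:])) \<alpha> = 0" "W \<alpha> = exp \<mu>"
    using WV.newton_slope_root[OF _ field_hom_to_ac W(2)[symmetric] mu(1)] by blast
  have "map_poly to_ac (\<phi> - [:0, 1:]) = P - [:0, 1:]"
    by (intro poly_eqI) (simp add: coeff_map_poly P_def coeff_pCons split: nat.splits)
  hence fp: "poly P \<alpha> = \<alpha>" using \<alpha>(1) by simp
  have a0: "\<alpha> \<noteq> 0" using \<alpha>(2) by (metis WV.nv_0 exp_not_eq_zero)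
  have la: "ln (av p \<alpha>) = \<mu>" by (simp add: avp \<alpha>(2))
  show ?thesis
  proof (rule strong_bogomolov_of_gap[OF pr fp a0 g(1)])
    have "lead_coeff P = to_ac (lead_coeff \<phi>)" unfolding degree_P by (simp add: P_def coeff_map_poly)
    thus "ln (av p \<alpha>) \<ge> - ln (av p (lead_coeff P)) / (real d - 1)" using mu(3) la by (simp add: avp W(2))
    show "poly P \<beta> \<in> max_unramified v" if "\<beta> \<in> max_unramified v" for \<beta>
      unfolding P_def by (rule max_unramified_poly[OF that])
    \<comment> \<open>Since \<open>h\<close> fixes \<open>K\<close>, \<open>W\<close> composed with
      \<open>h\<close> again extends \<open>v\<close>, so a nonzero conjugate of \<beta> has a value
      of \<open>v\<close> as absolute value, and the gap around \<mu> applies.\<close>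
    show "h \<beta> = 0 \<or> \<bar>ln (av p (h \<beta>)) - ln (av p \<alpha>)\<bar> \<ge> \<gamma>"
      if b: "\<beta> \<in> max_unramified v" and h: "h \<in> auts" "map h basis = basis" for \<beta> h
    proof (cases "\<beta> = 0")
      case True
      thus ?thesis using h(1) by (simp add: auts_def field_hom_0)
    next
      case False
      have wv: "W (h (to_ac c)) = v c" for c using aut_fixes_K[OF h] W(2) by simp
      obtain c where "c \<noteq> 0" "W (h \<beta>) = v c" by (rule max_unramified_value[OF W(1) h(1) wv b False]) blast
      thus ?thesis using g(2)[of c] la by (simp add: avp)
    qed
  qed
qed

end
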